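(* Let $q$ be a prime, $q^*=2$ if $q=2$, $q^*=(-1)^{(q-1)/2}q$ if $q$ odd, $K=\mathbb Q(\zeta_{4q})$, $\widetilde K=K(\sqrt[4]{q^*})$, $\widetilde G=\mathrm{Gal}(\widetilde K/\mathbb Q)$, $\varepsilon$ the nontrivial element of $\mathrm{Gal}(\widetilde K/K)$. Let $P_0$ be the set of primes of the form $A^2+64B^2$, $A,B\in\mathbb Z$. All products below run over primes $\ell$. (i) If $q=2$, $\widetilde G$ has, up to isomorphism, a unique irreducible representation $\widetilde\rho_0$ of dimension $>1$, it has dimension 2, and $$L(\widetilde\rho_0,s)=\prod_{\ell\equiv3,7\ (8)}(1-\ell^{-2s})^{-1}\prod_{\ell\equiv5\ (8)}(1+\ell^{-2s})^{-1}\prod_{\ell\in P_0}(1-\ell^{-s})^{-2}\prod_{\ell\equiv1\ (8),\ \ell\notin P_0}(1+\ell^{-s})^{-2}.$$ (ii) If $q$ is odd, let $g$ be a primitive root mod $q$, $\sigma_{-1},\sigma_q\in\mathrm{Gal}(K/\mathbb Q)$ with $\sigma_{-1}(\zeta_4)=\zeta_4^{-1},\sigma_{-1}(\zeta_q)=\zeta_q$, $\sigma_q(\zeta_4)=\zeta_4,\sigma_q(\zeta_q)=\zeta_q^g$, and $\widetilde\sigma_{-1},\widetilde\sigma_q\in\widetilde G$ lifts of them. Let $J=\{0\le j<q-1: j \text{ even}\}$ if $q\equiv1\ (4)$ and $J=\{0\le j<q-1: j\text{ odd}\}$ if $q\equiv 3\ (4)$. For $j\in J$ let $\widetilde\rho_j$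 be the representation with $\widetilde\rho_j(\widetilde\sigma_{-1})=\begin{pmatrix}1&0\\0&-1\end{pmatrix}$, $\widetilde\rho_j(\widetilde\sigma_q)=\begin{pmatrix}0&\zeta_{q-1}^j\\1&0\end{pmatrix}$, $\widetilde\rho_j(\varepsilon)=-I$. Then every irreducible representation of $\widetilde G$ of dimension $>1$ is isomorphic to some $\widetilde\rho_j$, $j\in J$, and $$L(\widetilde\rho_j,s)=E_2(s)\,E_q(s)\prod_{\substack{\ell\equiv1\ (4),\,2\nmid b_\ell\\ \text{or }\ell\equiv3\ (4),\,2\mid b_\ell}}(1-\zeta_{q-1}^{jb_\ell}\ell^{-2s})^{-1}\prod_{\ell\equiv3\ (4),\,2\nmid b_\ell}(1+\zeta_{q-1}^{jb_\ell}\ell^{-2s})^{-1}\prod_{\ell\equiv1\ (4),\,2\mid b_\ell}(1-u_\ell\zeta_{2(q-1)}^{jb_\ell}\ell^{-s})^{-2},$$ where the products run over odd primes $\ell\ne q$; $b_\ell$ is an integer with $\ell\equiv g^{b_\ell}\pmod q$; $u_\ell=(\frac{\alpha_\ell}{\ell})(-1)^{b_\ell/2}$ with $\alpha_\ell\in\mathbb Z$, $\alpha_\ell^2\equiv q^*\pmod\ell$; $E_q(s)=(1-(-1)^{(q-1)/4}q^{-s})^{-1}$ if $q\equiv1\ (4)$ and $j=0$, and $E_q(s)=1$ otherwise; $E_2(s)=1$ if $(\frac2q)=-1$, while if $(\frac 2q)=1$, $E_2(s)=(1-u_q\zeta_{2(q-1)}^{jb_2}2^{-s})^{-1}$, where $b_2$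 is an (even) integer with $2\equiv g^{b_2}\pmod q$, chosen with $b_2\equiv2\pmod4$ when $q\equiv3\pmod4$, and $u_q=1$ if ($q\notin P_0$ and $16\nmid q^*-1$) or ($q\in P_0$ and $16\mid q^*-1$), $u_q=-1$ otherwise.
   Context: For a finite-dimensional complex representation $\varphi:\widetilde G\to \mathrm{GL}(V)$ the Artin $L$-function is $L(\varphi,s)=\prod_\ell\det(1-\varphi(\widetilde{\mathrm{Fr}}_\ell)\ell^{-s}\mid V^{\widetilde I_\ell})^{-1}$, where $\widetilde I_\ell$ is the inertia group and $\widetilde{\mathrm{Fr}}_\ell$ the Frobenius of a prime of $\widetilde K$ above $\ell$. The one-dimensional representations of $\widetilde G$ give Dirichlet $L$-functions. $(\frac a\ell)$ is the Legendre symbol; $\zeta_n=e^{2\pi i/n}$. *)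

theory Defs
  imports
    "HOL-Algebra.Generated_Fields"
    "HOL-Algebra.Bij"
    "HOL-Algebra.Ideal"
    "HOL-Number_Theory.Number_Theory"
    "HOL-Analysis.Infinite_Products"
    "HOL-Analysis.Complex_Transcendental"
    "Jordan_Normal_Form.VS_Connect"
begin

section \<open>Subfields of the complex numbers and their Galois groups\<close>

definition zeta :: "nat \<Rightarrow> complex" where
  "zeta n = exp (2 * of_real pi * \<i> / of_nat n)"

definition field_of :: "complex set \<Rightarrow> complex ring" where
  "field_of L = class_ring\<lparr>carrier := L\<rparr>"

definition Gal :: "complex set \<Rightarrow> complex set \<Rightarrow> (complex \<Rightarrow> complex) monoid" where
  "Gal L F = (BijGroup L)\<lparr>carrier :=
     {\<sigma> \<in> Bij L. \<sigma> \<in> Ring.ring_hom (field_of L) (field_of L) \<and> (\<forall>x\<in>F. \<sigma> x = x)}\<rparr>"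

section \<open>Finite-dimensional complex representations\<close>

abbreviation cvec :: "nat \<Rightarrow> (complex, complex vec) module" where
  "cvec n \<equiv> module_vec TYPE(complex) n"

definition GL :: "nat \<Rightarrow> complex mat monoid" where
  "GL n = units_of (ring_mat TYPE(complex) n ())"

text \<open>A representation is given in coordinates, as a homomorphism to invertible matrices; only
  its values on the carrier of the group matter.\<close>

definition representation :: "('g, 'b) monoid_scheme \<Rightarrow> nat \<Rightarrow> ('g \<Rightarrow> complex mat) \<Rightarrow> bool" where
  "representation G n \<phi> \<longleftrightarrow> \<phi> \<in> hom G (GL n)"

definition irreducible_rep :: "('g, 'b) monoid_scheme \<Rightarrow> nat \<Rightarrow> ('g \<Rightarrow> complex mat) \<Rightarrow> bool" where
  "irreducible_rep G n \<phi> \<longleftrightarrow> representation G n \<phi> \<and> n > 0 \<and>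
     (\<forall>W. VectorSpace.subspace class_ring W (cvec n) \<and>
          (\<forall>g\<in>carrier G. \<forall>v\<in>W. \<phi> g *\<^sub>v v \<in> W) \<longrightarrow> W = {0\<^sub>v n} \<or> W = carrier_vec n)"

definition rep_iso ::
  "('g, 'b) monoid_scheme \<Rightarrow> nat \<Rightarrow> ('g \<Rightarrow> complex mat) \<Rightarrow> nat \<Rightarrow> ('g \<Rightarrow> complex mat) \<Rightarrow> bool" where
  "rep_iso G m \<phi> n \<psi> \<longleftrightarrow>
     m = n \<and> (\<exists>T\<in>carrier (GL n). \<forall>g\<in>carrier G. T * \<phi> g = \<psi> g * T)"

text \<open>\<open>det_on n W A\<close> is the determinant of the restriction of \<open>A\<close> to an \<open>A\<close>-stable subspace \<open>W\<close>
  of the space of \<open>n\<close>-vectors: the determinant of the matrix \<open>M\<close> of the restriction in a basis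
  \<open>bs\<close> of \<open>W\<close>. It does not depend on the basis, and is 1 if \<open>W = 0\<close>.\<close>

definition det_on :: "nat \<Rightarrow> complex vec set \<Rightarrow> complex mat \<Rightarrow> complex" where
  "det_on n W A = (THE d. \<exists>bs M.
      distinct bs \<and> vectorspace.basis class_ring ((cvec n)\<lparr>carrier := W\<rparr>) (set bs) \<and>
      M \<in> carrier_mat (length bs) (length bs) \<and>
      A * mat_of_cols n bs = mat_of_cols n bs * M \<and> d = det M)"

definition fixed_space ::
  "nat \<Rightarrow> ('g \<Rightarrow> complex mat) \<Rightarrow> 'g set \<Rightarrow> complex vec set" where
  "fixed_space n \<phi> H = {v \<in> carrier_vec n. \<forall>h\<in>H. \<phi> h *\<^sub>v v = v}"

section \<open>Artin L-functions of finite Galois extensions of the rationals inside the complex numbers\<close>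

definition integer_ring :: "complex set \<Rightarrow> complex ring" where
  "integer_ring L = field_of {x \<in> L. algebraic_int x}"

definition primes_above :: "complex set \<Rightarrow> nat \<Rightarrow> complex set set" where
  "primes_above L l = {P. primeideal P (integer_ring L) \<and> of_nat l \<in> P}"

definition inertia_group :: "complex set \<Rightarrow> complex set \<Rightarrow> (complex \<Rightarrow> complex) set" where
  "inertia_group L P =
     {\<sigma> \<in> carrier (Gal L \<rat>). \<forall>x\<in>carrier (integer_ring L). \<sigma> x - x \<in> P}"

text \<open>Arithmetic Frobenius elements; they form one coset of the inertia group and automatically
  stabilise \<open>P\<close>.\<close>

definition frobenius_elements ::
  "complex set \<Rightarrow> complex set \<Rightarrow> nat \<Rightarrow> (complex \<Rightarrow> complex) set" where
  "frobenius_elements L P l =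
     {\<sigma> \<in> carrier (Gal L \<rat>). \<forall>x\<in>carrier (integer_ring L). \<sigma> x - x ^ l \<in> P}"

text \<open>The local factor depends neither on the prime above \<open>l\<close> nor on the Frobenius element.\<close>

definition artin_factor ::
  "complex set \<Rightarrow> nat \<Rightarrow> ((complex \<Rightarrow> complex) \<Rightarrow> complex mat) \<Rightarrow> nat \<Rightarrow> complex \<Rightarrow> complex" where
  "artin_factor L n \<phi> l s =
     (let P = (SOME P. P \<in> primes_above L l);
          Fr = (SOME \<sigma>. \<sigma> \<in> frobenius_elements L P l)
      in inverse (det_on n (fixed_space n \<phi> (inertia_group L P))
           (1\<^sub>m n - (of_nat l powr (-s)) \<cdot>\<^sub>m \<phi> Fr)))"

text \<open>Infinite products over a set \<open>A\<close> of primes, taken in increasing order.\<close>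

definition prime_prod :: "nat set \<Rightarrow> (nat \<Rightarrow> complex) \<Rightarrow> complex" where
  "prime_prod A f = (\<Prod>l. if l \<in> A then f l else 1)"

definition prime_prod_converges :: "nat set \<Rightarrow> (nat \<Rightarrow> complex) \<Rightarrow> bool" where
  "prime_prod_converges A f \<longleftrightarrow> abs_convergent_prod (\<lambda>l. if l \<in> A then f l else 1)"

definition artin_L ::
  "complex set \<Rightarrow> nat \<Rightarrow> ((complex \<Rightarrow> complex) \<Rightarrow> complex mat) \<Rightarrow> complex \<Rightarrow> complex" where
  "artin_L L n \<phi> s = prime_prod {l. prime l} (\<lambda>l. artin_factor L n \<phi> l s)"

definition artin_L_converges ::
  "complex set \<Rightarrow> nat \<Rightarrow> ((complex \<Rightarrow> complex) \<Rightarrow> complex mat) \<Rightarrow> complex \<Rightarrow> bool" where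
  "artin_L_converges L n \<phi> s \<longleftrightarrow>
     prime_prod_converges {l. prime l} (\<lambda>l. artin_factor L n \<phi> l s)"

section \<open>The fields and representations at hand\<close>

definition qstar :: "nat \<Rightarrow> int" where
  "qstar q = (if q = 2 then 2 else (-1) ^ ((q - 1) div 2) * int q)"

definition K_field :: "nat \<Rightarrow> complex set" where
  "K_field q = generate_field (class_ring :: complex ring) {zeta (4 * q)}"

text \<open>Here \<open>r\<close> is to be a fourth root of \<open>qstar q\<close>. As \<open>K_field q\<close> contains the fourth roots of
  unity, the field does not depend on which one.\<close>

definition Kt_field :: "nat \<Rightarrow> complex \<Rightarrow> complex set" where
  "Kt_field q r = generate_field (class_ring :: complex ring) (insert r (K_field q))"

abbreviation Gt :: "nat \<Rightarrow> complex \<Rightarrow> (complex \<Rightarrow> complex) monoid" where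
  "Gt q r \<equiv> Gal (Kt_field q r) \<rat>"

definition P0 :: "nat set" where
  "P0 = {p. prime p \<and> (\<exists>A B :: int. int p = A^2 + 64 * B^2)}"

definition J_set :: "nat \<Rightarrow> nat set" where
  "J_set q = {j. j < q - 1 \<and> (if q mod 4 = 1 then even j else odd j)}"

text \<open>\<open>a \<equiv> g ^ b (mod q)\<close> for an integer exponent \<open>b\<close>, which may be negative.\<close>

definition is_index :: "nat \<Rightarrow> nat \<Rightarrow> nat \<Rightarrow> int \<Rightarrow> bool" where
  "is_index q g a b \<longleftrightarrow> [a * g ^ nat (- b) = g ^ nat b] (mod q)"

definition is_rho ::
  "('g, 'b) monoid_scheme \<Rightarrow> nat \<Rightarrow> 'g \<Rightarrow> 'g \<Rightarrow> 'g \<Rightarrow> nat \<Rightarrow> ('g \<Rightarrow> complex mat) \<Rightarrow> bool" where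
  "is_rho G q t\<^sub>1 t\<^sub>2 \<epsilon> j \<rho> \<longleftrightarrow> representation G 2 \<rho> \<and>
     \<rho> t\<^sub>1 = mat_of_rows_list 2 [[1, 0], [0, -1]] \<and>
     \<rho> t\<^sub>2 = mat_of_rows_list 2 [[0, zeta (q - 1) ^ j], [1, 0]] \<and>
     \<rho> \<epsilon> = - 1\<^sub>m 2"

definition u_sign :: "(nat \<Rightarrow> int) \<Rightarrow> (nat \<Rightarrow> int) \<Rightarrow> nat \<Rightarrow> complex" where
  "u_sign \<alpha> b l = of_int (Legendre (\<alpha> l) (int l)) * (-1) powi (b l div 2)"

definition u_q :: "nat \<Rightarrow> complex" where
  "u_q q = (if (q \<notin> P0 \<and> \<not> 16 dvd qstar q - 1) \<or> (q \<in> P0 \<and> 16 dvd qstar q - 1) then 1 else -1)"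

definition E_2 :: "nat \<Rightarrow> nat \<Rightarrow> (nat \<Rightarrow> int) \<Rightarrow> complex \<Rightarrow> complex" where
  "E_2 q j b s = (if Legendre 2 (int q) = 1
     then inverse (1 - u_q q * zeta (2 * (q - 1)) powi (int j * b 2) * 2 powr (-s)) else 1)"

definition E_q :: "nat \<Rightarrow> nat \<Rightarrow> complex \<Rightarrow> complex" where
  "E_q q j s = (if q mod 4 = 1 \<and> j = 0
     then inverse (1 - (-1) ^ ((q - 1) div 4) * of_nat q powr (-s)) else 1)"

end

theory Submission
  imports Defs "Jordan_Normal_Form.Char_Poly"
begin

text \<open>The group \<open>G\<close> is generated by lifts \<open>t\<close>, \<open>s\<close> of \<open>\<sigma>\<^sub>1\<close>, \<open>\<sigma>\<^sub>q\<close> and the central involution \<open>e = \<epsilon>\<close>,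
  and \<open>t s = e s t\<close> because \<open>s r = \<plusminus>\<i> r\<close> while \<open>t \<i> = - \<i>\<close>. If \<open>e\<close> acts trivially on an irreducible
  representation, then the image is abelian and the dimension is 1; otherwise \<open>e = -1\<close>, \<open>s\<^sup>2\<close> is central and
  acts as a scalar \<open>c\<close>, and an eigenvector of \<open>t\<close> gives the normal form with parameter \<open>c\<close>.

  At a prime \<open>P\<close> above \<open>\<ell>\<close>, congruences modulo \<open>P\<close> are lifted along the tower \<open>\<rat>(z) \<subseteq> K \<subseteq> L\<close> of quadratic
  steps. For \<open>\<ell>\<close> prime to \<open>2q\<close> inertia is trivial, the Frobenius element is read off from its values at \<open>z\<close> and
  \<open>\<i>\<close>, and, where these leave a sign open, from its value at \<open>r\<close>; for \<open>q = 2\<close> that sign is the biquadratic character of 2,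
  which decides whether \<open>\<ell> = A\<^sup>2 + 64 B\<^sup>2\<close>. At \<open>\<ell> = q\<close> inertia contains a lift of \<open>s\<close>, whose square is the scalar \<open>c\<close>, and
  at \<open>\<ell> = 2\<close> a lift of \<open>t\<close>, so that only a line or nothing is fixed.\<close>

subsection \<open>Algebraic integers\<close>

text \<open>The delicate point is a sign. The action of a Frobenius element on \<open>K\<close>
  leaves a factor \<open>e\<close> open, hence a sign of \<rho>, and where it matters it must be
  read from an element negated by \<open>e\<close> that is a unit at P. For l prime to 2q this
  element is \<open>r\<close>. At l = q, \<open>r\<close> lies in P, and (z-1)^((q-1)/4) / r
  replaces it. At l = 2 opposite signs coincide modulo P, so a half-integral combination
  \<open>y\<close> of 1 and a multiple of \<open>r\<close> is used: modulo P it satisfies y^2 = y +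
  m, where q* = 1 + 8m. This Artin-Schreier equation splits over the field with two elements exactly
  for even m, whence the 16 in \<open>u_q\<close>. The 64 in \<open>P0\<close> comes from the
  criterion that 2 is a fourth power modulo a prime l = a^2 + b^2, l = 1 mod 8, a odd, exactly when
  8 divides b. For q = 3 mod 4 the index of 2 is determined modulo q - 1 = 2 mod 4 only, which
  leaves (-1)^(b/2) open; \<open>u_q\<close> does not contain b, so b has to be fixed modulo 4.
  Integers are computed explicitly only in Q(z); the quadratic steps above it get by with traces and
  norms.\<close>

lemma algebraic_int_eigenvalue:
  fixes A :: "int mat" and z :: complex
  assumes A: "A \<in> carrier_mat n n" and ev: "eigenvalue (map_mat of_int A) z"
  shows "algebraic_int z"
proof -
  have A': "(map_mat of_int A :: complex mat) \<in> carrier_mat n n" using A by simp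
  have "poly (char_poly (map_mat of_int A)) z = 0"
    using eigenvalue_root_char_poly[OF A'] ev by simp
  then have "poly (map_poly of_int (char_poly A)) z = 0"
    by (simp add: of_int_hom.char_poly_hom[OF A])
  moreover have "lead_coeff (char_poly A) = 1" using degree_monic_char_poly[OF A] by simp
  ultimately show ?thesis unfolding algebraic_int_altdef_ipoly by blast
qed

definition zspan :: "complex set \<Rightarrow> complex set" where
  "zspan S = {(\<Sum>s\<in>S. of_int (a s) * s) | a. True}"

lemma zspan_add: "x \<in> zspan S \<Longrightarrow> y \<in> zspan S \<Longrightarrow> x + y \<in> zspan S"
proof -
  assume "x \<in> zspan S" "y \<in> zspan S"
  then obtain a b where "x = (\<Sum>s\<in>S. of_int (a s) * s)" "y = (\<Sum>s\<in>S. of_int (b s) * s)"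
    unfolding zspan_def by blast
  then have "x + y = (\<Sum>s\<in>S. of_int (a s + b s) * s)"
    by (simp add: sum.distrib algebra_simps)
  then show ?thesis unfolding zspan_def by (intro CollectI exI[of _ "\<lambda>s. a s + b s"]) simp
qed

lemma zspan_int: "x \<in> zspan S \<Longrightarrow> of_int k * x \<in> zspan S"
proof -
  assume "x \<in> zspan S"
  then obtain a where "x = (\<Sum>s\<in>S. of_int (a s) * s)"
    unfolding zspan_def by blast
  then have "of_int k * x = (\<Sum>s\<in>S. of_int (k * a s) * s)"
    by (simp add: sum_distrib_left mult.assoc)
  then show ?thesis unfolding zspan_def by (intro CollectI exI[of _ "\<lambda>s. k * a s"]) simp
qed

lemma zspan_0: "0 \<in> zspan S"
  unfolding zspan_def by (intro CollectI exI[of _ "\<lambda>_. 0"]) simp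

lemma zspan_incl: "finite S \<Longrightarrow> x \<in> S \<Longrightarrow> x \<in> zspan S"
  unfolding zspan_def
  by (intro CollectI exI[of _ "\<lambda>s. if s = x then 1 else 0"])
     (simp add: if_distrib[of of_int] if_distrib[of "\<lambda>c. c * _"] cong: if_cong)

lemma zspan_sum: "(\<And>i. i \<in> I \<Longrightarrow> f i \<in> zspan S) \<Longrightarrow> (\<Sum>i\<in>I. f i) \<in> zspan S"
  by (induction I rule: infinite_finite_induct) (auto simp: zspan_0 intro: zspan_add)

lemma zspan_mult:
  assumes "\<And>s. s \<in> S \<Longrightarrow> z * s \<in> zspan S" and "x \<in> zspan S"
  shows "z * x \<in> zspan S"
proof -
  obtain a where x: "x = (\<Sum>s\<in>S. of_int (a s) * s)"
    using assms(2) unfolding zspan_def by blast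
  have "z * x = (\<Sum>s\<in>S. of_int (a s) * (z * s))"
    unfolding x by (simp add: sum_distrib_left mult_ac)
  then show ?thesis using assms(1) by (simp add: zspan_sum zspan_int)
qed

text \<open>The determinant trick: multiplication by \<open>z\<close> on the generators is given by
  an integer matrix, and the vector of generators is an eigenvector of it with eigenvalue
  \<open>z\<close>. The generators may be dependent; they only must not all vanish.\<close>

lemma algebraic_int_stable_zspan:
  assumes fin: "finite S" and z: "\<And>s. s \<in> S \<Longrightarrow> z * s \<in> zspan S" and ne: "\<exists>s\<in>S. s \<noteq> 0"
  shows "algebraic_int z"
proof -
  obtain vs where vs: "set vs = S" "distinct vs" using finite_distinct_list[OF fin] by blast
  define n where "n = length vs"
  have "\<forall>s\<in>S. \<exists>a. z * s = (\<Sum>s'\<in>S. of_int (a s') * s')" using z unfolding zspan_def by blast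
  then obtain a where a: "\<And>s. s \<in> S \<Longrightarrow> z * s = (\<Sum>s'\<in>S. of_int (a s s') * s')" by metis
  define A where "A = mat n n (\<lambda>(i,j). a (vs ! i) (vs ! j))"
  have A: "A \<in> carrier_mat n n" unfolding A_def by simp
  define v where "v = vec_of_list vs"
  have v: "v \<in> carrier_vec n" unfolding v_def n_def carrier_vec_def by simp
  have vi: "v $ i = vs ! i" for i unfolding v_def by (simp add: vec_of_list_index)
  have "map_mat of_int A *\<^sub>v v = z \<cdot>\<^sub>v v"
  proof (rule eq_vecI)
    fix i assume "i < dim_vec (z \<cdot>\<^sub>v v)"
    then have i: "i < n" using v by simp
    have "(map_mat of_int A *\<^sub>v v) $ i = (\<Sum>j<n. of_int (a (vs ! i) (vs ! j)) * (vs ! j))"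
      using i v A by (simp add: scalar_prod_def A_def vi lessThan_atLeast0)
    also have "\<dots> = (\<Sum>s'\<in>S. of_int (a (vs ! i) s') * s')"
      by (rule sum.reindex_bij_betw[of "(!) vs" "{..<n}" S])
         (metis bij_betw_nth lessThan_iff n_def vs)
    also have "\<dots> = z * (vs ! i)" using a i vs n_def by (metis nth_mem)
    finally show "(map_mat of_int A *\<^sub>v v) $ i = (z \<cdot>\<^sub>v v) $ i" using i v by (simp add: vi)
  qed (use A v in simp)
  moreover have "v \<noteq> 0\<^sub>v n"
  proof
    assume "v = 0\<^sub>v n"
    then have "\<And>i. i < n \<Longrightarrow> vs ! i = 0" by (metis vi index_zero_vec(1))
    then show False using ne vs n_def by (metis in_set_conv_nth)
  qed
  ultimately have "eigenvector (map_mat of_int A) v z"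
    unfolding eigenvector_def using A v by simp
  then show ?thesis using algebraic_int_eigenvalue[OF A] eigenvalue_def by blast
qed

text \<open>The version with a factor \<open>w\<close> serves for monomials in two numbers, where
  \<open>w\<close> is a power of the other one.\<close>

lemma algebraic_int_power_zspan:
  assumes "algebraic_int x"
  obtains m where "m > 0" "x ^ m \<in> zspan ((\<lambda>i. x ^ i) ` {..<m})"
    "\<And>w. w * x ^ m \<in> zspan ((\<lambda>i. w * x ^ i) ` {..<m})"
proof -
  obtain p where p: "poly (map_poly of_int p) x = 0" "lead_coeff p = 1"
    using assms unfolding algebraic_int_altdef_ipoly by blast
  define m where "m = degree p"
  have deg: "degree (map_poly (of_int :: int \<Rightarrow> complex) p) = m" unfolding m_def by simp
  have m0: "m > 0"
  proof (rule ccontr)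
    assume "\<not> m > 0"
    then have "degree p = 0" using m_def by simp
    then have "p = [:1:]" using p(2) by (metis degree_0_id)
    then show False using p(1) by simp
  qed
  have cm: "coeff p m = 1" using p(2) m_def by simp
  have "(\<Sum>i\<le>m. of_int (coeff p i) * x ^ i) = 0"
    using p(1) by (simp add: poly_altdef m_def)
  then have xm: "x ^ m = (\<Sum>i<m. of_int (- coeff p i) * x ^ i)"
    using cm by (simp add: lessThan_Suc_atMost[symmetric] sum_negf add_eq_0_iff)
  have w: "w * x ^ m \<in> zspan ((\<lambda>i. w * x ^ i) ` {..<m})" for w
  proof -
    have "w * x ^ m = (\<Sum>i<m. of_int (- coeff p i) * (w * x ^ i))"
      unfolding xm by (simp add: sum_distrib_left mult_ac)
    also have "\<dots> \<in> zspan ((\<lambda>i. w * x ^ i) ` {..<m})"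
      by (intro zspan_sum zspan_int zspan_incl) auto
    finally show ?thesis .
  qed
  from w[of 1] have "x ^ m \<in> zspan ((\<lambda>i. x ^ i) ` {..<m})" by simp
  with that m0 w show ?thesis by blast
qed

lemma zspan_mono: "finite T \<Longrightarrow> S \<subseteq> T \<Longrightarrow> zspan S \<subseteq> zspan T"
proof
  fix x assume T: "finite T" "S \<subseteq> T" and "x \<in> zspan S"
  then obtain a where x: "x = (\<Sum>s\<in>S. of_int (a s) * s)"
    unfolding zspan_def by blast
  show "x \<in> zspan T" unfolding x
    by (intro zspan_sum zspan_int zspan_incl) (use T in auto)
qed

text \<open>The monomials x^i y^j below the degrees of two monic equations span a group stable under
  \<open>x\<close> and under \<open>y\<close>, hence under their sum and product.\<close>

lemma algebraic_int_common_zspan: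
  assumes x: "algebraic_int x" and y: "algebraic_int y"
  obtains S where "finite S" "\<exists>s\<in>S. s \<noteq> 0"
    "\<And>s. s \<in> S \<Longrightarrow> x * s \<in> zspan S" "\<And>s. s \<in> S \<Longrightarrow> y * s \<in> zspan S"
proof -
  from algebraic_int_power_zspan[OF x] obtain m where m: "m > 0"
    "\<And>w. w * x ^ m \<in> zspan ((\<lambda>i. w * x ^ i) ` {..<m})" by metis
  from algebraic_int_power_zspan[OF y] obtain n where n: "n > 0"
    "\<And>w. w * y ^ n \<in> zspan ((\<lambda>i. w * y ^ i) ` {..<n})" by metis
  define S where "S = (\<lambda>(i,j). x ^ i * y ^ j) ` ({..<m} \<times> {..<n})"
  have fin: "finite S" unfolding S_def by simp
  have ne: "\<exists>s\<in>S. s \<noteq> 0"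
    by (rule bexI[of _ "x ^ 0 * y ^ 0"]) (use m(1) n(1) in \<open>auto simp: S_def intro!: image_eqI[of _ _ "(0,0)"]\<close>)
  have mem: "x ^ i * y ^ j \<in> S" if "i < m" "j < n" for i j using that unfolding S_def by auto
  have xS: "x * s \<in> zspan S" if sS: "s \<in> S" for s
  proof -
    obtain i j where ij: "s = x ^ i * y ^ j" "i < m" "j < n" using sS unfolding S_def by auto
    show ?thesis
    proof (cases "Suc i < m")
      case True
      then have "x * s \<in> S" using mem[OF True ij(3)] ij(1) by (simp add: mult_ac)
      then show ?thesis using zspan_incl fin by blast
    next
      case False
      then have "Suc i = m" using ij by simp
      then have "x * s = y ^ j * x ^ m" using ij(1) by (auto simp: mult_ac)
      moreover have "(\<lambda>i. y ^ j * x ^ i) ` {..<m} \<subseteq> S" using mem ij(3) by (auto simp: mult.commute)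
      ultimately show ?thesis using m(2)[of "y ^ j"] zspan_mono[OF fin] by auto
    qed
  qed
  have yS: "y * s \<in> zspan S" if sS: "s \<in> S" for s
  proof -
    obtain i j where ij: "s = x ^ i * y ^ j" "i < m" "j < n" using sS unfolding S_def by auto
    show ?thesis
    proof (cases "Suc j < n")
      case True
      then have "y * s \<in> S" using mem[OF ij(2) True] ij(1) by (simp add: mult_ac)
      then show ?thesis using zspan_incl fin by blast
    next
      case False
      then have "Suc j = n" using ij by simp
      then have "y * s = x ^ i * y ^ n" using ij(1) by (auto simp: mult_ac)
      moreover have "(\<lambda>j. x ^ i * y ^ j) ` {..<n} \<subseteq> S" using mem ij(2) by auto
      ultimately show ?thesis using n(2)[of "x ^ i"] zspan_mono[OF fin] by auto
    qed
  qed
  show ?thesis using that fin ne xS yS by blast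
qed

lemma algebraic_int_add: "algebraic_int (x + y)"
  and algebraic_int_mult: "algebraic_int (x * y)"
  if "algebraic_int x" "algebraic_int y" for x y :: complex
proof -
  from algebraic_int_common_zspan[OF that] obtain S where S: "finite S" "\<exists>s\<in>S. s \<noteq> 0"
    "\<And>s. s \<in> S \<Longrightarrow> x * s \<in> zspan S" "\<And>s. s \<in> S \<Longrightarrow> y * s \<in> zspan S" by metis
  show "algebraic_int (x + y)"
    by (rule algebraic_int_stable_zspan[OF S(1) _ S(2)]) (auto simp: distrib_right S intro: zspan_add)
  show "algebraic_int (x * y)"
    by (rule algebraic_int_stable_zspan[OF S(1) _ S(2)]) (auto simp: mult.assoc S intro: zspan_mult)
qed

lemma algebraic_int_diff: "algebraic_int x \<Longrightarrow> algebraic_int y \<Longrightarrow> algebraic_int (x - y :: complex)"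
  using algebraic_int_add[of x "- y"] by simp

lemma algebraic_int_power: "algebraic_int x \<Longrightarrow> algebraic_int (x ^ n :: complex)"
  by (induction n) (auto intro: algebraic_int_mult int_imp_algebraic_int)

lemma algebraic_int_of_int: "algebraic_int (of_int n :: complex)"
  by (simp add: int_imp_algebraic_int)

lemma algebraic_int_of_nat: "algebraic_int (of_nat n :: complex)"
  by (simp add: int_imp_algebraic_int)

lemma algebraic_int_power_root:
  assumes "algebraic_int (x ^ n :: complex)" "n > 0"
  shows "algebraic_int x"
  by (rule algebraic_int_root[of "x ^ n" "monom 1 n"]) (use assms in \<open>auto simp: poly_monom degree_monom_eq\<close>)

lemma algebraic_int_rat: "algebraic_int (x :: complex) \<Longrightarrow> x \<in> \<rat> \<Longrightarrow> x \<in> \<int>"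
  by (rule rational_algebraic_int_is_int)

subsection \<open>Two-dimensional representations of twisted groups\<close>

definition m2 :: "complex \<Rightarrow> complex \<Rightarrow> complex \<Rightarrow> complex \<Rightarrow> complex mat" where
  "m2 a b c d = mat_of_rows_list 2 [[a, b], [c, d]]"

lemma m2_carrier [simp]: "m2 a b c d \<in> carrier_mat 2 2"
  unfolding m2_def mat_of_rows_list_def by (rule carrier_matI) simp_all

lemma m2_dim [simp]: "dim_row (m2 a b c d) = 2" "dim_col (m2 a b c d) = 2"
  using m2_carrier[of a b c d] by (simp_all only: carrier_matD)

lemma m2_index [simp]:
  "m2 a b c d $$ (0, 0) = a" "m2 a b c d $$ (0, Suc 0) = b"
  "m2 a b c d $$ (Suc 0, 0) = c" "m2 a b c d $$ (Suc 0, Suc 0) = d"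
  unfolding m2_def mat_of_rows_list_def by simp_all

lemma mat2_eqI:
  assumes "A \<in> carrier_mat 2 2" "B \<in> carrier_mat 2 2"
    "A $$ (0, 0) = B $$ (0, 0)" "A $$ (0, Suc 0) = B $$ (0, Suc 0)"
    "A $$ (Suc 0, 0) = B $$ (Suc 0, 0)" "A $$ (Suc 0, Suc 0) = B $$ (Suc 0, Suc 0)"
  shows "A = B"
  by (rule eq_matI) (use assms in \<open>auto simp: less_2_cases_iff numeral_2_eq_2 less_Suc_eq\<close>)

lemma atLeast0_lessThan_two: "{0..<2::nat} = {0, Suc 0}"
  by auto

lemma m2_mult: "m2 a b c d * m2 a' b' c' d' = m2 (a*a' + b*c') (a*b' + b*d') (c*a' + d*c') (c*b' + d*d')"
  by (rule mat2_eqI) (auto simp: scalar_prod_def atLeast0_lessThan_two)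

lemma m2_smult: "k \<cdot>\<^sub>m m2 a b c d = m2 (k * a) (k * b) (k * c) (k * d)"
  by (rule mat2_eqI) auto

lemma m2_minus: "m2 a b c d - m2 a' b' c' d' = m2 (a - a') (b - b') (c - c') (d - d')"
  by (rule mat2_eqI) auto

lemma m2_one: "1\<^sub>m 2 = m2 1 0 0 1"
  by (rule mat2_eqI) auto

lemma m2_uminus_one: "- 1\<^sub>m 2 = m2 (-1) 0 0 (-1)"
  by (rule mat2_eqI) auto

lemma m2_eq_iff: "m2 a b c d = m2 a' b' c' d' \<longleftrightarrow> a = a' \<and> b = b' \<and> c = c' \<and> d = d'"
  by (metis m2_index)

lemma m2_det: "det (m2 a b c d) = a * d - b * c"
proof -
  have "mat_delete (m2 a b c d) 0 0 = mat 1 1 (\<lambda>_. d)" "mat_delete (m2 a b c d) (Suc 0) 0 = mat 1 1 (\<lambda>_. b)"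
    by (auto simp: mat_delete_def)
  then show ?thesis
    by (subst laplace_expansion_column[of _ 2 0])
       (auto simp: cofactor_def det_single numeral_2_eq_2 m2_index)
qed

definition v2 :: "complex \<Rightarrow> complex \<Rightarrow> complex vec" where
  "v2 x y = vec_of_list [x, y]"

lemma v2_carrier [simp]: "v2 x y \<in> carrier_vec 2"
  unfolding v2_def carrier_vec_def by simp

lemma v2_index [simp]: "v2 x y $ 0 = x" "v2 x y $ Suc 0 = y" "dim_vec (v2 x y) = 2"
  unfolding v2_def by (simp_all add: vec_of_list_index)

lemma vec2_eqI: "v \<in> carrier_vec 2 \<Longrightarrow> w \<in> carrier_vec 2 \<Longrightarrow> v $ 0 = w $ 0 \<Longrightarrow>
    v $ Suc 0 = w $ Suc 0 \<Longrightarrow> v = w"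
  by (rule eq_vecI) (auto simp: less_2_cases_iff)

lemma m2_mult_vec: "m2 a b c d *\<^sub>v v2 x y = v2 (a * x + b * y) (c * x + d * y)"
  by (rule vec2_eqI[OF mult_mat_vec_carrier[OF m2_carrier v2_carrier] v2_carrier])
    (auto simp: scalar_prod_def atLeast0_lessThan_two)

lemma v2_add: "v2 x y + v2 x' y' = v2 (x + x') (y + y')"
  by (rule vec2_eqI) auto

lemma v2_smult: "k \<cdot>\<^sub>v v2 x y = v2 (k * x) (k * y)"
  by (rule vec2_eqI) auto

lemma v2_zero: "0\<^sub>v 2 = v2 0 0"
  by (rule vec2_eqI) auto

lemma v2_eq_iff: "v2 x y = v2 x' y' \<longleftrightarrow> x = x' \<and> y = y'"
  by (metis v2_index(1,2))

lemma v2_exhaust: "v \<in> carrier_vec 2 \<Longrightarrow> \<exists>x y. v = v2 x y"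
  by (rule exI, rule exI, rule vec2_eqI) auto

lemma GL_carrier: "A \<in> carrier (GL n) \<longleftrightarrow>
    A \<in> carrier_mat n n \<and> (\<exists>B\<in>carrier_mat n n. A * B = 1\<^sub>m n \<and> B * A = 1\<^sub>m n)"
  unfolding GL_def units_of_def Units_def by (auto simp: ring_mat_simps)

lemma GL_mult [simp]: "(\<otimes>\<^bsub>GL n\<^esub>) = (*)"
  unfolding GL_def units_of_def by (simp add: ring_mat_simps)

lemma GL_one [simp]: "\<one>\<^bsub>GL n\<^esub> = 1\<^sub>m n"
  unfolding GL_def units_of_def by (simp add: ring_mat_simps)

lemma GL_group: "group (GL n)"
  unfolding GL_def by (rule monoid.units_group) (rule ring.is_monoid, rule ring_mat)

lemma subspace_cvecI:
  assumes "W \<subseteq> carrier_vec n" "0\<^sub>v n \<in> W" "\<And>v w. v \<in> W \<Longrightarrow> w \<in> W \<Longrightarrow> v + w \<in> W"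
    "\<And>k v. v \<in> W \<Longrightarrow> k \<cdot>\<^sub>v v \<in> W"
  shows "VectorSpace.subspace class_ring W (cvec n)"
  unfolding VectorSpace.subspace_def submodule_def
  using assms by (auto simp: vec_vs vec_module module_vec_simps)

lemma subspace_cvecD:
  assumes "VectorSpace.subspace class_ring W (cvec n)"
  shows "W \<subseteq> carrier_vec n" "0\<^sub>v n \<in> W" "\<And>v w. v \<in> W \<Longrightarrow> w \<in> W \<Longrightarrow> v + w \<in> W"
    "\<And>k v. v \<in> W \<Longrightarrow> k \<cdot>\<^sub>v v \<in> W"
  using assms unfolding VectorSpace.subspace_def submodule_def
  by (auto simp: module_vec_simps)

lemma mat_eq_if_mult_vec_eq:
  fixes A B :: "'a :: comm_ring_1 mat"
  assumes A: "A \<in> carrier_mat m n" and B: "B \<in> carrier_mat m n"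
    and "\<And>v. v \<in> carrier_vec n \<Longrightarrow> A *\<^sub>v v = B *\<^sub>v v"
  shows "A = B"
proof (rule eq_matI)
  fix i j assume ij: "i < dim_row B" "j < dim_col B"
  have "(A *\<^sub>v unit_vec n j) $ i = (B *\<^sub>v unit_vec n j) $ i" using assms(3) by simp
  then show "A $$ (i, j) = B $$ (i, j)" using A B ij by simp
qed (use A B in auto)

lemma rep_closed:
  "representation G n \<phi> \<Longrightarrow> x \<in> carrier G \<Longrightarrow> \<phi> x \<in> carrier_mat n n"
  unfolding representation_def hom_def using GL_carrier by blast

lemma rep_mult:
  "representation G n \<phi> \<Longrightarrow> x \<in> carrier G \<Longrightarrow> y \<in> carrier G \<Longrightarrow> \<phi> (x \<otimes>\<^bsub>G\<^esub> y) = \<phi> x * \<phi> y"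
  unfolding representation_def using hom_mult by fastforce

lemma rep_one: "group G \<Longrightarrow> representation G n \<phi> \<Longrightarrow> \<phi> \<one>\<^bsub>G\<^esub> = 1\<^sub>m n"
  unfolding representation_def using hom_one[of \<phi> G "GL n"] GL_group by simp

lemma representationI:
  assumes G: "group G" and cl: "\<And>x. x \<in> carrier G \<Longrightarrow> \<phi> x \<in> carrier_mat n n"
    and mult: "\<And>x y. x \<in> carrier G \<Longrightarrow> y \<in> carrier G \<Longrightarrow> \<phi> (x \<otimes>\<^bsub>G\<^esub> y) = \<phi> x * \<phi> y"
    and one: "\<phi> \<one>\<^bsub>G\<^esub> = 1\<^sub>m n"
  shows "representation G n \<phi>"
  unfolding representation_def
proof (rule homI)
  interpret group G by fact
  fix x assume x: "x \<in> carrier G"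
  let ?y = "inv\<^bsub>G\<^esub> x"
  have "\<phi> x * \<phi> ?y = 1\<^sub>m n" "\<phi> ?y * \<phi> x = 1\<^sub>m n"
    using x mult[of x ?y] mult[of ?y x] one by auto
  then show "\<phi> x \<in> carrier (GL n)" using GL_carrier cl x inv_closed by blast
qed (use mult in simp)

lemma complex_eigenvalue_exists:
  assumes A: "(A :: complex mat) \<in> carrier_mat n n" and n: "n > 0"
  obtains \<mu> where "eigenvalue A \<mu>"
proof -
  have "degree (char_poly A) \<noteq> 0" using degree_monic_char_poly[OF A] n by simp
  then have "\<not> constant (poly (char_poly A))" by (simp add: constant_degree)
  then obtain \<mu> where "poly (char_poly A) \<mu> = 0" using fundamental_theorem_of_algebra by blast
  then show ?thesis using that eigenvalue_root_char_poly[OF A] by blast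
qed

text \<open>An eigenspace of \<open>Z\<close> is nonzero and stable under the group, so
  irreducibility makes it the whole space.\<close>

lemma schur_scalar:
  assumes irr: "irreducible_rep G n \<phi>" and Z: "Z \<in> carrier_mat n n"
    and comm: "\<And>g. g \<in> carrier G \<Longrightarrow> \<phi> g * Z = Z * \<phi> g"
  obtains \<mu> where "Z = \<mu> \<cdot>\<^sub>m 1\<^sub>m n"
proof -
  have rep: "representation G n \<phi>" and n: "n > 0" using irr unfolding irreducible_rep_def by auto
  obtain \<mu> where "eigenvalue Z \<mu>" using complex_eigenvalue_exists[OF Z n] by blast
  then obtain v where v: "v \<in> carrier_vec n" "v \<noteq> 0\<^sub>v n" "Z *\<^sub>v v = \<mu> \<cdot>\<^sub>v v"
    unfolding eigenvalue_def eigenvector_def using Z by auto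
  define W where "W = {v \<in> carrier_vec n. Z *\<^sub>v v = \<mu> \<cdot>\<^sub>v v}"
  have "VectorSpace.subspace class_ring W (cvec n)"
  proof (rule subspace_cvecI)
    fix v w assume "v \<in> W" "w \<in> W"
    then show "v + w \<in> W" using Z unfolding W_def
      by (simp add: mult_add_distrib_mat_vec smult_add_distrib_vec[of v n w])
  next
    fix k v assume v: "v \<in> W"
    then have "Z *\<^sub>v (k \<cdot>\<^sub>v v) = k \<cdot>\<^sub>v (\<mu> \<cdot>\<^sub>v v)" using Z unfolding W_def by (simp add: mult_mat_vec)
    also have "\<dots> = \<mu> \<cdot>\<^sub>v (k \<cdot>\<^sub>v v)" by (simp add: smult_smult_assoc mult.commute)
    finally show "k \<cdot>\<^sub>v v \<in> W" using v unfolding W_def by simp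
  next
    show "0\<^sub>v n \<in> W" using Z unfolding W_def by auto
  qed (auto simp: W_def)
  moreover have "\<phi> g *\<^sub>v w \<in> W" if g: "g \<in> carrier G" and w: "w \<in> W" for g w
  proof -
    have c: "\<phi> g \<in> carrier_mat n n" by (rule rep_closed[OF rep g])
    have wc: "w \<in> carrier_vec n" "Z *\<^sub>v w = \<mu> \<cdot>\<^sub>v w" using w unfolding W_def by simp_all
    have "Z *\<^sub>v (\<phi> g *\<^sub>v w) = \<phi> g *\<^sub>v (Z *\<^sub>v w)"
      using assoc_mult_mat_vec[OF Z c wc(1)] assoc_mult_mat_vec[OF c Z wc(1)] comm[OF g] by simp
    also have "\<dots> = \<mu> \<cdot>\<^sub>v (\<phi> g *\<^sub>v w)" using wc c by (simp add: mult_mat_vec)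
    finally show ?thesis using c wc(1) unfolding W_def by simp
  qed
  ultimately have "W = {0\<^sub>v n} \<or> W = carrier_vec n"
    using irr unfolding irreducible_rep_def by blast
  moreover have "v \<in> W" using v unfolding W_def by simp
  ultimately have W: "W = carrier_vec n" using v(2) by blast
  have "Z = \<mu> \<cdot>\<^sub>m 1\<^sub>m n"
  proof (rule mat_eq_if_mult_vec_eq[OF Z])
    fix w :: "complex vec" assume w: "w \<in> carrier_vec n"
    then have "Z *\<^sub>v w = \<mu> \<cdot>\<^sub>v w" using W unfolding W_def by blast
    also have "\<dots> = (\<mu> \<cdot>\<^sub>m 1\<^sub>m n) *\<^sub>v w" using w by (intro eq_vecI) (auto simp: row_one)
    finally show "Z *\<^sub>v w = (\<mu> \<cdot>\<^sub>m 1\<^sub>m n) *\<^sub>v w" .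
  qed simp
  then show ?thesis using that by blast
qed

text \<open>Modulo the central involution \<open>e\<close> the group is a product of cyclic groups
  of orders \<open>N\<close> and 2, and \<open>e\<close> is the commutator of \<open>t\<close> and
  \<open>s\<close>. The abstraction covers q = 2 (with \<open>N = 2\<close>) and odd q (with
  \<open>N = q - 1\<close>) at once; in both cases \<open>h\<close> is \<open>N div 2\<close>.
  Exponents are natural numbers, so inverses have to be written as positive words.\<close>

locale twisted_group = group G for G (structure) +
  fixes t s e :: 'a and N h :: nat
  assumes t_closed [simp]: "t \<in> carrier G" and s_closed [simp]: "s \<in> carrier G"
    and e_closed [simp]: "e \<in> carrier G"
    and ee: "e \<otimes> e = \<one>" and e_ne: "e \<noteq> \<one>" and tt: "t \<otimes> t = \<one>"
    and te: "t \<otimes> e = e \<otimes> t" and se: "s \<otimes> e = e \<otimes> s" and ts: "t \<otimes> s = e \<otimes> (s \<otimes> t)"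
    and sN: "s [^] N = e [^] h" and N_even: "even N" and N_pos: "N > 0"
    and gen: "x \<in> carrier G \<Longrightarrow> \<exists>(b::nat) (a::nat) (k::nat). x = s [^] b \<otimes> (t [^] a \<otimes> e [^] k)"
    and free: "s [^] (b :: nat) \<otimes> (t [^] (a :: nat) \<otimes> e [^] (k :: nat)) = \<one> \<Longrightarrow> N dvd b \<and> even a"
begin

definition word :: "nat \<Rightarrow> nat \<Rightarrow> nat \<Rightarrow> 'a" where
  "word b a k = s [^] b \<otimes> (t [^] a \<otimes> e [^] k)"

lemma word_closed [simp]: "word b a k \<in> carrier G"
  unfolding word_def by simp

lemma e_comm_pow: "s [^] (b :: nat) \<otimes> e [^] (k :: nat) = e [^] k \<otimes> s [^] b"
  "t [^] (b :: nat) \<otimes> e [^] (k :: nat) = e [^] k \<otimes> t [^] b"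
  by (metis se te group_commutes_pow nat_pow_closed s_closed t_closed e_closed)+

lemma t_s_pow: "t \<otimes> s [^] (b :: nat) = e [^] b \<otimes> (s [^] b \<otimes> t)"
proof (induction b)
  case (Suc b)
  have "t \<otimes> s [^] Suc b = (e [^] b \<otimes> (s [^] b \<otimes> t)) \<otimes> s"
    using Suc by (simp add: m_assoc[symmetric])
  also have "\<dots> = e [^] b \<otimes> (s [^] b \<otimes> (e \<otimes> (s \<otimes> t)))" by (simp add: m_assoc ts)
  also have "\<dots> = e [^] b \<otimes> ((s [^] b \<otimes> e) \<otimes> (s \<otimes> t))" by (simp add: m_assoc)
  also have "s [^] b \<otimes> e = e \<otimes> s [^] b" using e_comm_pow(1)[of b 1] by simp
  finally show ?case by (simp add: m_assoc)
qed simp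

lemma t_pow_s_pow: "t [^] (a :: nat) \<otimes> s [^] (b :: nat) = e [^] (a * b) \<otimes> (s [^] b \<otimes> t [^] a)"
proof (induction a)
  case (Suc a)
  have "t [^] Suc a \<otimes> s [^] b = t [^] a \<otimes> (e [^] b \<otimes> (s [^] b \<otimes> t))"
    by (simp add: m_assoc t_s_pow)
  also have "\<dots> = (t [^] a \<otimes> e [^] b) \<otimes> (s [^] b \<otimes> t)" by (simp add: m_assoc)
  also have "\<dots> = e [^] b \<otimes> ((t [^] a \<otimes> s [^] b) \<otimes> t)" by (simp add: m_assoc e_comm_pow)
  also have "\<dots> = (e [^] b \<otimes> e [^] (a * b)) \<otimes> (s [^] b \<otimes> (t [^] a \<otimes> t))"
    unfolding Suc by (simp add: m_assoc)
  finally show ?case by (simp add: nat_pow_mult add.commute)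
qed simp

text \<open>The extra exponent \<open>a * b'\<close> counts the copies of \<open>e\<close> that
  appear when t^a is moved past s^b'.\<close>

lemma word_mult: "word b a k \<otimes> word b' a' k' = word (b + b') (a + a') (k + k' + a * b')"
proof -
  have "word b a k \<otimes> word b' a' k'
      = s [^] b \<otimes> (t [^] a \<otimes> ((e [^] k \<otimes> s [^] b') \<otimes> (t [^] a' \<otimes> e [^] k')))"
    unfolding word_def by (simp add: m_assoc)
  also have "\<dots> = s [^] b \<otimes> ((t [^] a \<otimes> s [^] b') \<otimes> ((e [^] k \<otimes> t [^] a') \<otimes> e [^] k'))"
    unfolding e_comm_pow(1)[symmetric] by (simp add: m_assoc)
  also have "\<dots> = s [^] b \<otimes> ((e [^] (a * b') \<otimes> s [^] b') \<otimes> (t [^] a \<otimes> (t [^] a' \<otimes> (e [^] k \<otimes> e [^] k'))))"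
    unfolding e_comm_pow(2)[symmetric] t_pow_s_pow by (simp add: m_assoc)
  also have "\<dots> = (s [^] b \<otimes> s [^] b') \<otimes> ((e [^] (a * b') \<otimes> (t [^] a \<otimes> t [^] a')) \<otimes> (e [^] k \<otimes> e [^] k'))"
    unfolding e_comm_pow(1)[symmetric] by (simp add: m_assoc)
  also have "\<dots> = (s [^] (b + b')) \<otimes> ((e [^] (a * b') \<otimes> t [^] (a + a')) \<otimes> e [^] (k + k'))"
    by (simp add: nat_pow_mult)
  also have "\<dots> = word (b + b') (a + a') (k + k' + a * b')"
    unfolding e_comm_pow(2)[symmetric] word_def by (simp add: m_assoc nat_pow_mult add.commute)
  finally show ?thesis .
qed

lemma word_exhaust: "x \<in> carrier G \<Longrightarrow> \<exists>b a k. x = word b a k"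
  using gen unfolding word_def .

lemma e_word: "e = word 0 0 1" and s_word: "s = word 1 0 0" and t_word: "t = word 0 1 0"
  and one_word: "\<one> = word 0 0 0"
  unfolding word_def by simp_all

lemma e_pow_even: "even k \<Longrightarrow> e [^] (k :: nat) = \<one>"
proof -
  assume "even k"
  then obtain j where k: "k = 2 * j" by blast
  have "e [^] (2 :: nat) = \<one>" by (simp add: numeral_2_eq_2 ee)
  then show ?thesis unfolding k using nat_pow_pow[OF e_closed, of 2 j] by simp
qed

lemma t_pow_even: "even k \<Longrightarrow> t [^] (k :: nat) = \<one>"
proof -
  assume "even k"
  then obtain j where k: "k = 2 * j" by blast
  have "t [^] (2 :: nat) = \<one>" by (simp add: numeral_2_eq_2 tt)
  then show ?thesis unfolding k using nat_pow_pow[OF t_closed, of 2 j] by simp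
qed

lemma e_pow_odd: "odd k \<Longrightarrow> e [^] (k :: nat) = e"
  by (auto elim!: oddE simp: e_pow_even)

lemma word_N: "word (N * m) a k = word 0 a (k + h * m)"
proof -
  have "s [^] (N * m) = e [^] (h * m)" by (simp add: nat_pow_pow[symmetric] sN)
  moreover have "e [^] (h * m) \<otimes> (t [^] a \<otimes> e [^] k) = (t [^] a \<otimes> e [^] (h * m)) \<otimes> e [^] k"
    unfolding e_comm_pow(2)[of a "h * m"] by (simp add: m_assoc)
  ultimately show ?thesis unfolding word_def by (simp add: m_assoc nat_pow_mult add.commute)
qed

lemma word_eq_one:
  assumes "word b a k = \<one>"
  obtains m where "b = N * m" "even a" "even (k + h * m)"
proof -
  from free assms have "N dvd b" and a: "even a" unfolding word_def by auto
  then obtain m where m: "b = N * m" by blast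
  have "word 0 a (k + h * m) = \<one>" using assms unfolding m word_N .
  then have "e [^] (k + h * m) = \<one>" using a by (simp add: word_def t_pow_even)
  then have "even (k + h * m)" using e_pow_odd e_ne by metis
  then show ?thesis using that m a by blast
qed

lemma word_inverse:
  obtains \<beta> \<alpha> \<kappa> where "word b a k \<otimes> word \<beta> \<alpha> \<kappa> = \<one>"
    "N dvd b + \<beta>" "even (a + \<alpha>)"
proof -
  \<comment> \<open>The sum of the exponents of \<open>s\<close> becomes \<open>N * (2 * b)\<close>:
    a multiple of \<open>N\<close>, and an even one, so that the power of \<open>e\<close> coming
    from \<open>sN\<close> is trivial for every \<open>h\<close>.\<close>
  define \<beta> where "\<beta> = 2 * N * b - b"
  have b: "b + \<beta> = N * (2 * b)" unfolding \<beta>_def using N_pos by simp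
  have "word b a k \<otimes> word \<beta> a (k + a * \<beta>) = word (N * (2 * b)) (a + a) (k + (k + a * \<beta>) + a * \<beta>)"
    by (simp only: word_mult b)
  also have "\<dots> = word 0 (a + a) (k + (k + a * \<beta>) + a * \<beta> + h * (2 * b))" by (rule word_N)
  also have "\<dots> = \<one>" unfolding word_def by (subst t_pow_even, simp, subst e_pow_even, auto)
  finally show ?thesis using that b by (metis dvd_triv_left even_add)
qed

text \<open>The matrix of \<open>s\<^sup>b t\<^sup>a e\<^sup>k\<close>, where \<open>s\<^sup>2\<close> acts as the scalar \<open>c\<close>.\<close>

definition word_mat :: "complex \<Rightarrow> nat \<Rightarrow> nat \<Rightarrow> nat \<Rightarrow> complex mat" where
  "word_mat c b a k = ((-1) ^ k * c ^ (b div 2)) \<cdot>\<^sub>m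
     (if even b then m2 1 0 0 ((-1) ^ a) else m2 0 (c * (-1) ^ a) 1 0)"

lemma word_mat_carrier [simp]: "word_mat c b a k \<in> carrier_mat 2 2"
  unfolding word_mat_def by auto

lemma word_mat_mult:
  "word_mat c b a k * word_mat c b' a' k' = word_mat c (b + b') (a + a') (k + k' + a * b')"
proof -
  have "word_mat c b a k * word_mat c b' a' k' = word_mat c (b + b') (a + a') (k + k' + a * b')"
    if "b = 2 * m + x" "b' = 2 * m' + x'" "x \<in> {0, 1}" "x' \<in> {0, 1}" for m m' x x'
    using that by (cases "even a"; cases "even a'"; cases "even k"; cases "even k'")
      (auto simp: word_mat_def minus_one_power_iff m2_smult m2_mult m2_eq_iff power_add)
  from this[of "b div 2" "b mod 2" "b' div 2" "b' mod 2"] show ?thesis by force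
qed

text \<open>With s^2 acting as \<open>c\<close> and \<open>e\<close> as -1, the relation
  \<open>sN\<close> turns into the condition on \<open>c\<close>. It is the only obstruction to the
  matrices being well defined on the group.\<close>

lemma word_mat_one:
  assumes c: "c ^ (N div 2) = (-1) ^ h" and "word b a k = \<one>"
  shows "word_mat c b a k = 1\<^sub>m 2"
proof -
  obtain m where m: "b = N * m" "even a" "even (k + h * m)" using word_eq_one assms(2) by blast
  have "b div 2 = (N div 2) * m" using m(1) N_even by (auto elim!: evenE)
  then have "c ^ (b div 2) = (-1) ^ (h * m)" by (simp add: power_mult c)
  then have "(-1) ^ k * c ^ (b div 2) = 1" using m(3) by (simp flip: power_add)
  moreover have "even b" using m(1) N_even by simp
  ultimately show ?thesis unfolding word_mat_def using m(2) by (simp add: m2_smult m2_one)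
qed

text \<open>A group element has many exponent triples. Multiplying two of them by a common inverse
  word reduces the comparison to words that represent the identity.\<close>

lemma word_mat_cong:
  assumes c: "c ^ (N div 2) = (-1) ^ h" and eq: "word b a k = word b' a' k'"
  shows "word_mat c b a k = word_mat c b' a' k'"
proof -
  obtain \<beta> \<alpha> \<kappa> where inv: "word b a k \<otimes> word \<beta> \<alpha> \<kappa> = \<one>" using word_inverse by blast
  have 1: "word_mat c b a k * word_mat c \<beta> \<alpha> \<kappa> = 1\<^sub>m 2"
    using inv by (simp only: word_mult word_mat_mult word_mat_one[OF c])
  have 2: "word_mat c b' a' k' * word_mat c \<beta> \<alpha> \<kappa> = 1\<^sub>m 2"
    using inv unfolding eq by (simp only: word_mult word_mat_mult word_mat_one[OF c])
  have "word_mat c \<beta> \<alpha> \<kappa> * word_mat c b a k = 1\<^sub>m 2"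
    using mat_mult_left_right_inverse[OF _ _ 1] by simp
  then show ?thesis
    using assoc_mult_mat[of "word_mat c b' a' k'" 2 2 "word_mat c \<beta> \<alpha> \<kappa>" 2 "word_mat c b a k" 2] 2
      left_mult_one_mat[of "word_mat c b a k" 2 2] right_mult_one_mat[of "word_mat c b' a' k'" 2 2]
    by simp
qed

lemma rep_exists:
  assumes c: "c ^ (N div 2) = (-1) ^ h"
  obtains \<rho> where "representation G 2 \<rho>" "\<And>b a k. \<rho> (word b a k) = word_mat c b a k"
proof -
  define \<rho> where "\<rho> x = (let (b,a,k) = (SOME (b,a,k). x = word b a k) in word_mat c b a k)" for x
  have \<rho>: "\<rho> (word b a k) = word_mat c b a k" for b a k
  proof -
    obtain b' a' k' where eq: "(SOME (b',a',k'). word b a k = word b' a' k') = (b', a', k')"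
      using prod_cases3 by blast
    have "word b a k = word b' a' k'"
      using someI[of "\<lambda>(b',a',k'). word b a k = word b' a' k'" "(b,a,k)"] eq by simp
    then have "word_mat c b' a' k' = word_mat c b a k"
      by (rule word_mat_cong[OF c, symmetric])
    then show ?thesis unfolding \<rho>_def eq by simp
  qed
  have "representation G 2 \<rho>"
  proof (rule representationI)
    show "\<rho> x \<in> carrier_mat 2 2" if "x \<in> carrier G" for x
      using word_exhaust[OF that] \<rho> by auto
    show "\<rho> (x \<otimes> y) = \<rho> x * \<rho> y" if "x \<in> carrier G" "y \<in> carrier G" for x y
      using word_exhaust[OF that(1)] word_exhaust[OF that(2)] \<rho> by (auto simp: word_mult word_mat_mult)
    show "\<rho> \<one> = 1\<^sub>m 2" unfolding one_word \<rho> by (simp add: word_mat_def m2_one m2_smult)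
  qed (rule is_group)
  then show ?thesis using that \<rho> by blast
qed

text \<open>For odd q and c = \<open>zeta (q - 1) ^ j\<close> this is the representation \<rho>_j of
  the theorem; for q = 2 the relevant parameter is c = -1.\<close>

definition standard_rep :: "complex \<Rightarrow> ('a \<Rightarrow> complex mat) \<Rightarrow> bool" where
  "standard_rep c \<rho> \<longleftrightarrow> representation G 2 \<rho> \<and> \<rho> t = m2 1 0 0 (-1) \<and> \<rho> s = m2 0 c 1 0 \<and> \<rho> e = - 1\<^sub>m 2"

lemma standard_rep_word:
  assumes "standard_rep c \<rho>"
  shows "\<rho> (word b a k) = word_mat c b a k"
proof -
  from assms have rep: "representation G 2 \<rho>" and \<rho>: "\<rho> t = m2 1 0 0 (-1)" "\<rho> s = m2 0 c 1 0"
    "\<rho> e = - 1\<^sub>m 2" unfolding standard_rep_def by auto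
  have one: "\<rho> \<one> = 1\<^sub>m 2" using rep_one rep is_group by blast
  have 1: "\<rho> (s [^] b) = word_mat c b 0 0" for b :: nat
  proof (induction b)
    case 0 show ?case using one by (simp add: word_mat_def m2_one m2_smult)
  next
    case (Suc b)
    have "\<rho> (s [^] Suc b) = word_mat c b 0 0 * word_mat c 1 0 0"
      using rep_mult[OF rep] Suc by (simp add: \<rho> word_mat_def m2_smult)
    then show ?case by (simp add: word_mat_mult)
  qed
  have 2: "\<rho> (t [^] a) = word_mat c 0 a 0" for a :: nat
  proof (induction a)
    case 0 show ?case using one by (simp add: word_mat_def m2_one m2_smult)
  next
    case (Suc a)
    have "\<rho> (t [^] Suc a) = word_mat c 0 a 0 * word_mat c 0 1 0"
      using rep_mult[OF rep] Suc by (simp add: \<rho> word_mat_def m2_smult)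
    then show ?case by (simp add: word_mat_mult)
  qed
  have 3: "\<rho> (e [^] k) = word_mat c 0 0 k" for k :: nat
  proof (induction k)
    case 0 show ?case using one by (simp add: word_mat_def m2_one m2_smult)
  next
    case (Suc k)
    have "\<rho> (e [^] Suc k) = word_mat c 0 0 k * word_mat c 0 0 1"
      using rep_mult[OF rep] Suc by (simp add: \<rho> word_mat_def m2_smult m2_uminus_one)
    then show ?case by (simp add: word_mat_mult)
  qed
  show ?thesis unfolding word_def
    using rep_mult[OF rep] by (simp add: 1 2 3 word_mat_mult)
qed

lemma standard_rep_exists:
  assumes "c ^ (N div 2) = (-1) ^ h"
  obtains \<rho> where "standard_rep c \<rho>"
proof -
  obtain \<rho> where \<rho>: "representation G 2 \<rho>" "\<And>b a k. \<rho> (word b a k) = word_mat c b a k"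
    using rep_exists[OF assms] by blast
  have "\<rho> t = m2 1 0 0 (-1)" "\<rho> s = m2 0 c 1 0" "\<rho> e = - 1\<^sub>m 2"
    using \<rho>(2)[of 0 1 0] \<rho>(2)[of 1 0 0] \<rho>(2)[of 0 0 1]
    unfolding e_word[symmetric] s_word[symmetric] t_word[symmetric]
    by (simp_all add: word_mat_def m2_smult m2_uminus_one)
  then have "standard_rep c \<rho>" unfolding standard_rep_def using \<rho>(1) by simp
  then show ?thesis using that by blast
qed

lemma standard_rep_unique:
  assumes "standard_rep c \<rho>" "standard_rep c \<rho>'"
  shows "\<forall>x\<in>carrier G. \<rho> x = \<rho>' x"
proof
  fix x assume "x \<in> carrier G"
  then obtain b a k where "x = word b a k" using word_exhaust by blast
  then show "\<rho> x = \<rho>' x" using standard_rep_word[OF assms(1)] standard_rep_word[OF assms(2)] by simp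
qed

text \<open>The matrix of \<open>t\<close> separates the two coordinates of a vector of
  \<open>W\<close>, and that of \<open>s\<close> interchanges the axes, so a nonzero
  \<open>W\<close> contains both axes.\<close>

lemma standard_rep_irreducible:
  assumes "standard_rep c \<rho>" and c: "c \<noteq> 0"
  shows "irreducible_rep G 2 \<rho>"
  unfolding irreducible_rep_def
proof (intro conjI allI impI)
  from assms have rep: "representation G 2 \<rho>" and \<rho>: "\<rho> t = m2 1 0 0 (-1)" "\<rho> s = m2 0 c 1 0"
    unfolding standard_rep_def by auto
  show "representation G 2 \<rho>" by fact
  fix W assume "VectorSpace.subspace class_ring W (cvec 2) \<and> (\<forall>g\<in>carrier G. \<forall>v\<in>W. \<rho> g *\<^sub>v v \<in> W)"
  then have W: "VectorSpace.subspace class_ring W (cvec 2)"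
    and st: "\<And>g v. g \<in> carrier G \<Longrightarrow> v \<in> W \<Longrightarrow> \<rho> g *\<^sub>v v \<in> W" by auto
  note W = subspace_cvecD[OF W]
  have st1: "v2 x (- y) \<in> W" if "v2 x y \<in> W" for x y
    using st[OF t_closed that] unfolding \<rho> m2_mult_vec by simp
  have st2: "v2 (c * y) x \<in> W" if "v2 x y \<in> W" for x y
    using st[OF s_closed that] unfolding \<rho> m2_mult_vec by simp
  have sc: "v2 (k * x) (k * y) \<in> W" if "v2 x y \<in> W" for k x y
    using W(4)[OF that] unfolding v2_smult .
  have ad: "v2 (x + x') (y + y') \<in> W" if "v2 x y \<in> W" "v2 x' y' \<in> W" for x y x' y'
    using W(3)[OF that] unfolding v2_add .
  have x0: "v2 x 0 \<in> W" if "v2 x y \<in> W" for x y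
    using sc[OF ad[OF that st1[OF that]], of "1/2"] by simp
  have y0: "v2 0 y \<in> W" if "v2 x y \<in> W" for x y
    using ad[OF that sc[OF x0[OF that], of "-1"]] by simp
  show "W = {0\<^sub>v 2} \<or> W = carrier_vec 2"
  proof (cases "W = {0\<^sub>v 2}")
    case False
    then obtain w where w: "w \<in> W" "w \<noteq> 0\<^sub>v 2" using W(2) by blast
    then obtain x y where xy: "w = v2 x y" using v2_exhaust W(1) by blast
    have e0: "v2 1 0 \<in> W"
    proof (cases "x = 0")
      case True
      then have "y \<noteq> 0" using w xy v2_zero by auto
      moreover have "v2 (c * y) 0 \<in> W" using st2[OF w(1)[unfolded xy]] True by simp
      ultimately show ?thesis using sc[of "c * y" 0 "1 / (c * y)"] c by simp
    next
      case False
      then show ?thesis using sc[OF x0[OF w(1)[unfolded xy]], of "1 / x"] by simp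
    qed
    have e1: "v2 0 1 \<in> W" using st2[OF e0] by simp
    have "v \<in> W" if v: "v \<in> carrier_vec 2" for v
    proof -
      obtain x y where "v = v2 x y" using v2_exhaust v by blast
      then show ?thesis using ad[OF sc[OF e0, of x] sc[OF e1, of y]] by simp
    qed
    then show ?thesis using W(1) by blast
  qed simp
qed simp

end

subsection \<open>Products over primes\<close>

lemma prime_prod_converges_iff:
  "prime_prod_converges A f \<longleftrightarrow> summable (\<lambda>l. norm ((if l \<in> A then f l else 1) - 1))"
  unfolding prime_prod_converges_def by (rule abs_convergent_prod_conv_summable)

lemma prime_prod_converges_cong:
  "(\<And>l. l \<in> A \<Longrightarrow> f l = g l) \<Longrightarrow> prime_prod_converges A f = prime_prod_converges A g"
  unfolding prime_prod_converges_def by (intro arg_cong[of _ _ abs_convergent_prod]) auto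

lemma prime_prod_cong:
  "(\<And>l. l \<in> A \<Longrightarrow> f l = g l) \<Longrightarrow> prime_prod A f = prime_prod A g"
  unfolding prime_prod_def by (intro arg_cong[of _ _ prodinf]) auto

text \<open>Write \<open>f g - 1 = (f - 1) g + (g - 1)\<close>; since \<open>g\<close> tends to 1,
  its norm is eventually at most 2.\<close>

lemma abs_convergent_prod_mult:
  fixes f g :: "nat \<Rightarrow> complex"
  assumes f: "abs_convergent_prod f" and g: "abs_convergent_prod g"
  shows "abs_convergent_prod (\<lambda>n. f n * g n)"
proof -
  have sf: "summable (\<lambda>n. norm (f n - 1))" and sg: "summable (\<lambda>n. norm (g n - 1))"
    using f g by (simp_all add: abs_convergent_prod_conv_summable)
  then have "(\<lambda>n. norm (g n - 1)) \<longlonglongrightarrow> 0" by (intro summable_LIMSEQ_zero)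
  then have ev: "eventually (\<lambda>n. norm (g n - 1) < 1) sequentially"
    by (rule order_tendstoD(2)) simp
  have "summable (\<lambda>n. norm (f n * g n - 1))"
  proof (rule summable_comparison_test_ev)
    show "summable (\<lambda>n. 2 * norm (f n - 1) + norm (g n - 1))"
      by (intro summable_add summable_mult sf sg)
    show "eventually (\<lambda>n. norm (norm (f n * g n - 1)) \<le> 2 * norm (f n - 1) + norm (g n - 1)) sequentially"
      using ev
    proof eventually_elim
      case (elim n)
      have "norm (g n) \<le> norm (g n - 1) + 1"
        using norm_triangle_ineq[of "g n - 1" 1] by simp
      then have "norm (g n) \<le> 2" using elim by simp
      have "f n * g n - 1 = (f n - 1) * g n + (g n - 1)" by (simp add: algebra_simps)
      then have "norm (f n * g n - 1) \<le> norm (f n - 1) * norm (g n) + norm (g n - 1)"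
        by (metis norm_mult norm_triangle_ineq)
      also have "\<dots> \<le> norm (f n - 1) * 2 + norm (g n - 1)"
        using \<open>norm (g n) \<le> 2\<close> by (intro add_right_mono mult_left_mono) auto
      finally show ?case by simp
    qed
  qed
  then show ?thesis by (simp add: abs_convergent_prod_conv_summable)
qed

lemma prime_prod_converges_mult:
  assumes "prime_prod_converges A f" "prime_prod_converges A g"
  shows "prime_prod_converges A (\<lambda>l. f l * g l)"
proof -
  have "(\<lambda>l. if l \<in> A then f l * g l else 1) = (\<lambda>l. (if l \<in> A then f l else 1) * (if l \<in> A then g l else 1))"
    by auto
  then show ?thesis
    using abs_convergent_prod_mult assms unfolding prime_prod_converges_def by presburger
qed

lemma prime_prod_converges_finite: "finite A \<Longrightarrow> prime_prod_converges A f"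
  unfolding prime_prod_converges_iff by (rule summable_finite[of A]) auto

text \<open>This splits an Euler product according to the type of the prime. By disjointness each
  index contributes to one of the two factors only, and absolute convergence allows the limits to be
  multiplied.\<close>

lemma prime_prod_converges_union:
  assumes "A \<inter> B = {}" "prime_prod_converges A f" "prime_prod_converges B f"
  shows "prime_prod_converges (A \<union> B) f"
    and "prime_prod (A \<union> B) f = prime_prod A f * prime_prod B f"
proof -
  have eq: "(\<lambda>l. if l \<in> A \<union> B then f l else 1) = (\<lambda>l. (if l \<in> A then f l else 1) * (if l \<in> B then f l else 1))"
    using assms(1) by (auto simp: fun_eq_iff)
  show "prime_prod_converges (A \<union> B) f"
    unfolding prime_prod_converges_def eq
    using assms(2,3) unfolding prime_prod_converges_def by (rule abs_convergent_prod_mult)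
  show "prime_prod (A \<union> B) f = prime_prod A f * prime_prod B f"
    unfolding prime_prod_def eq
    by (rule prodinf_mult[symmetric])
      (use assms(2,3) abs_convergent_prod_imp_convergent_prod in \<open>auto simp: prime_prod_converges_def\<close>)
qed

lemma prime_prod_singleton: "prime_prod {a} f = f a"
  unfolding prime_prod_def by (subst prodinf_finite[of "{a}"]) auto

lemma norm_nat_powr: "l > 0 \<Longrightarrow> norm (of_nat l powr (- s) :: complex) = real l powr (- Re s)"
  by (subst norm_powr_real_powr) auto

text \<open>For l >= 2 and Re s > 1 the number x = u l^(-s) has norm at most 1/2, so 1/(1 - x) - 1
  has norm at most 2 |x|, which is dominated by a convergent series.\<close>

lemma prime_prod_converges_euler:
  assumes A: "\<And>l. l \<in> A \<Longrightarrow> l \<ge> 2" and u: "\<And>l. l \<in> A \<Longrightarrow> norm (u l) \<le> 1" and s: "Re s > 1"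
  shows "prime_prod_converges A (\<lambda>l. inverse (1 - u l * of_nat l powr (- s)))"
  unfolding prime_prod_converges_iff
proof (rule summable_comparison_test')
  show "summable (\<lambda>l. 2 * real l powr (- Re s))"
    using s by (intro summable_mult) (simp add: summable_real_powr_iff)
  fix l :: nat
  show "norm (norm ((if l \<in> A then inverse (1 - u l * of_nat l powr (- s)) else 1) - 1)) \<le> 2 * real l powr (- Re s)"
  proof (cases "l \<in> A")
    case True
    define x where "x = u l * of_nat l powr (- s)"
    have l2: "l \<ge> 2" using A True by blast
    have nx: "norm x \<le> real l powr (- Re s)"
      using u[OF True] l2 mult_right_mono[OF u[OF True], of "real l powr (- Re s)"]
      by (simp add: x_def norm_mult norm_nat_powr)
    have "real l powr (- Re s) \<le> 2 powr (- Re s)"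
      using l2 s by (intro powr_mono2') auto
    also have "\<dots> \<le> 2 powr (- 1)" using s by (intro powr_mono) auto
    finally have "real l powr (- Re s) \<le> 1/2" by (simp add: powr_minus field_simps)
    then have nx2: "norm x \<le> 1/2" using nx by simp
    have n1: "norm (1 - x) \<ge> 1/2" using norm_triangle_ineq2[of 1 x] nx2 by simp
    then have "1 - x \<noteq> 0" by auto
    then have "inverse (1 - x) - 1 = x / (1 - x)" by (simp add: field_simps)
    then have "norm (inverse (1 - x) - 1) = norm x / norm (1 - x)" by (simp add: norm_divide)
    also have "\<dots> \<le> norm x / (1/2)" using n1 by (intro divide_left_mono) auto
    also have "\<dots> \<le> 2 * real l powr (- Re s)" using nx by simp
    finally show ?thesis using True x_def by simp
  qed simp
qed

subsection \<open>The biquadratic character of 2\<close>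

lemma cong_pm_one_eq:
  assumes "prime p" "2 < p" "[x = y] (mod int p)" "x \<in> {-1,1}" "y \<in> {-1,1::int}"
  shows "x = y"
proof (rule ccontr)
  assume "x \<noteq> y"
  then have "x - y \<in> {2, -2}" using assms by auto
  then have "int p dvd 2" using assms(3) by (auto simp: cong_iff_dvd_diff)
  then have "int p \<le> 2" by (intro zdvd_imp_le) auto
  then show False using assms(2) by simp
qed

lemma Legendre_cases: "\<not> [a = 0] (mod p) \<Longrightarrow> Legendre a p \<in> {-1, 1}"
  unfolding Legendre_def by auto

lemma Legendre_mult:
  assumes p: "prime p" "2 < p" and ab: "\<not> [a = 0] (mod int p)" "\<not> [b = 0] (mod int p)"
  shows "Legendre (a * b) (int p) = Legendre a (int p) * Legendre b (int p)"
proof (rule cong_pm_one_eq[OF p])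
  have "[Legendre (a * b) (int p) = (a * b) ^ ((p - 1) div 2)] (mod int p)"
    by (rule euler_criterion[OF p])
  also have "(a * b) ^ ((p - 1) div 2) = a ^ ((p - 1) div 2) * b ^ ((p - 1) div 2)"
    by (rule power_mult_distrib)
  also have "[\<dots> = Legendre a (int p) * Legendre b (int p)] (mod int p)"
    by (intro cong_mult cong_sym[OF euler_criterion[OF p]])
  finally show "[Legendre (a * b) (int p) = Legendre a (int p) * Legendre b (int p)] (mod int p)" .
  have "\<not> [a * b = 0] (mod int p)"
    using ab p(1) by (simp add: cong_0_iff prime_dvd_mult_iff)
  then show "Legendre (a * b) (int p) \<in> {-1, 1}" by (rule Legendre_cases)
  show "Legendre a (int p) * Legendre b (int p) \<in> {-1, 1}"
    using Legendre_cases[OF ab(1)] Legendre_cases[OF ab(2)] by auto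
qed

definition chi8 :: "nat \<Rightarrow> int" where
  "chi8 n = (if n mod 8 \<in> {1, 7} then 1 else -1)"

lemma chi8_mult:
  assumes "odd m" "odd n"
  shows "chi8 (m * n) = chi8 m * chi8 n"
proof -
  have "m mod 8 = 1 \<or> m mod 8 = 3 \<or> m mod 8 = 5 \<or> m mod 8 = 7" using assms(1) by presburger
  moreover have "n mod 8 = 1 \<or> n mod 8 = 3 \<or> n mod 8 = 5 \<or> n mod 8 = 7" using assms(2) by presburger
  moreover have "(m * n) mod 8 = (m mod 8) * (n mod 8) mod 8" by (simp add: mod_mult_eq)
  ultimately show ?thesis unfolding chi8_def by auto
qed

lemma Legendre_two:
  assumes p: "prime p" "2 < p"
  shows "Legendre 2 (int p) = chi8 p"
proof -
  have oddp: "odd p" using p prime_odd_nat by blast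
  interpret GAUSS p 2
  proof
    show "[2 \<noteq> 0] (mod int p)"
      using p by (auto simp: cong_0_iff dest!: zdvd_imp_le)
  qed (use p in auto)
  define m where "m = (int p - 1) div 2"
  have pm: "int p = 2 * m + 1" using p_eq2 m_def by simp
  \<comment> \<open>In Gauss's lemma with multiplier 2 the doubles of 1, ..., m stay below p, so
    nothing is reduced, and those exceeding m are the doubles of x > m div 2.\<close>
  have E: "E = (\<lambda>x. 2 * x) ` {m div 2 <.. m}"
  proof (intro equalityI subsetI)
    fix y assume "y \<in> E"
    then obtain x where x: "0 < x" "x \<le> m" "y = (x * 2) mod int p" "m < y"
      unfolding E_def C_def B_def A_def m_def by auto
    have "x * 2 < int p" using x pm by linarith
    then have "y = 2 * x" using x by simp
    moreover have "m div 2 < x" using x \<open>y = 2 * x\<close> by linarith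
    ultimately show "y \<in> (\<lambda>x. 2 * x) ` {m div 2 <.. m}" using x by auto
  next
    fix y assume "y \<in> (\<lambda>x. 2 * x) ` {m div 2 <.. m}"
    then obtain x where x: "m div 2 < x" "x \<le> m" "y = 2 * x" by auto
    have "0 < x" using x p(2) pm by linarith
    have "(x * 2) mod int p = y" using x pm \<open>0 < x\<close> by simp
    moreover have "m < y" using x by linarith
    ultimately show "y \<in> E"
      unfolding E_def C_def B_def A_def m_def[symmetric] using x \<open>0 < x\<close> by force
  qed
  have "card E = nat (m - m div 2)"
    unfolding E by (subst card_image) (auto simp: inj_on_def)
  then have L: "Legendre 2 (int p) = (-1) ^ nat (m - m div 2)" using gauss_lemma by simp
  have "even (nat (m - m div 2)) \<longleftrightarrow> p mod 8 \<in> {1, 7}"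
  proof -
    have "m - m div 2 \<ge> 0" using p(2) pm by linarith
    then have "even (nat (m - m div 2)) \<longleftrightarrow> even (m - m div 2)" by (simp add: even_nat_iff)
    also have "\<dots> \<longleftrightarrow> int p mod 8 = 1 \<or> int p mod 8 = 7"
    proof -
      define k where "k = m div 4"
      have "m = 4 * k \<or> m = 4 * k + 1 \<or> m = 4 * k + 2 \<or> m = 4 * k + 3" unfolding k_def by presburger
      then consider "m - m div 2 = 2 * k \<and> int p = 8 * k + 1" | "m - m div 2 = 2 * k + 1 \<and> int p = 8 * k + 3"
        | "m - m div 2 = 2 * k + 1 \<and> int p = 8 * k + 5" | "m - m div 2 = 2 * (k + 1) \<and> int p = 8 * k + 7"
        unfolding pm by force
      then show ?thesis
      proof cases
        case 1
        have "int p mod 8 = 1" unfolding conjunct2[OF 1] by simp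
        then show ?thesis using 1 by simp
      next
        case 2
        have "int p mod 8 = 3" unfolding conjunct2[OF 2] by simp
        then show ?thesis using 2 by simp
      next
        case 3
        have "int p mod 8 = 5" unfolding conjunct2[OF 3] by simp
        then show ?thesis using 3 by simp
      next
        case 4
        have "int p mod 8 = 7" unfolding conjunct2[OF 4] by simp
        then show ?thesis using 4 by simp
      qed
    qed
    also have "int p mod 8 = int (p mod 8)" by (simp add: zmod_int)
    also have "(int (p mod 8) = 1 \<or> int (p mod 8) = 7) \<longleftrightarrow> p mod 8 = 1 \<or> p mod 8 = 7" by linarith
    also have "\<dots> \<longleftrightarrow> p mod 8 \<in> {1, 7}" by simp
    finally show ?thesis .
  qed
  then show ?thesis unfolding L chi8_def by auto
qed

text \<open>Takes the place of the Jacobi symbol: Euler's criterion at the prime factors of an odd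
  number passes to the number itself.\<close>

lemma multiplicative_power_cong:
  fixes f :: "nat \<Rightarrow> int"
  assumes f1: "f 1 = 1" and fm: "\<And>m n. odd m \<Longrightarrow> odd n \<Longrightarrow> f (m * n) = f m * f n"
    and n: "odd n" and pr: "\<And>\<pi>. prime \<pi> \<Longrightarrow> \<pi> dvd n \<Longrightarrow> [int \<pi> ^ k = f \<pi>] (mod M)"
  shows "[int n ^ k = f n] (mod M)"
  using n pr
proof (induction n rule: less_induct)
  case (less n)
  show ?case
  proof (cases "n = 1")
    case True
    then show ?thesis using f1 by simp
  next
    case False
    then obtain \<pi> where \<pi>: "prime \<pi>" "\<pi> dvd n" using prime_factor_nat by blast
    then obtain m where m: "n = \<pi> * m" by blast
    have odd: "odd \<pi>" "odd m" using less.prems(1) m by auto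
    have "m < n" using m \<pi>(1) less.prems(1) prime_gt_1_nat by (cases "m = 0") auto
    then have "[int m ^ k = f m] (mod M)" using less.IH odd less.prems(2) m by auto
    then have "[int \<pi> ^ k * int m ^ k = f \<pi> * f m] (mod M)"
      using less.prems(2)[OF \<pi>] by (intro cong_mult) auto
    then show ?thesis using m fm odd by (simp add: power_mult_distrib)
  qed
qed

lemma Legendre_reciprocal:
  assumes "prime p" "p mod 4 = 1" "prime \<pi>" "2 < \<pi>" "\<pi> \<noteq> p"
  shows "Legendre (int \<pi>) (int p) = Legendre (int p) (int \<pi>)"
proof -
  have p2: "2 < p" using assms(1,2) prime_ge_2_nat[of p] by (cases "p = 2") auto
  have "Legendre (int p) (int \<pi>) * Legendre (int \<pi>) (int p) = (-1) ^ ((p - 1) div 2 * ((\<pi> - 1) div 2))"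
    using Quadratic_Reciprocity[of p \<pi>] assms p2 by auto
  also have "even ((p - 1) div 2)" using assms(2) by presburger
  then have "(-1::int) ^ ((p - 1) div 2 * ((\<pi> - 1) div 2)) = 1" by simp
  finally show ?thesis by (metis zmult_eq_1_iff)
qed

lemma coprime_sum_of_squares:
  fixes p a b \<pi> :: nat
  assumes "prime p" "p = a ^ 2 + b ^ 2" "prime \<pi>" "\<pi> dvd a" "\<pi> dvd b"
  shows False
proof -
  have "\<pi> ^ 2 dvd p" using assms by (auto intro!: dvd_add dvd_power_same)
  then have "\<pi> ^ 2 = 1 \<or> \<pi> ^ 2 = p" using assms(1) unfolding prime_nat_iff by blast
  then show False using assms(1,3) by (auto simp: prime_power_iff dest: prime_gt_1_nat)
qed

lemma mod_8_eq_1: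
  assumes "n mod 8 = (1::nat)"
  shows "n mod 4 = 1" and "odd n"
proof -
  show 4: "n mod 4 = 1" using mod_mod_cancel[of 4 8 n] assms by simp
  show "odd n" using mod_mod_cancel[of 2 8 n] assms by (simp add: odd_iff_mod_2_eq_one)
qed

text \<open>A prime \<pi> dividing a sees p as the square b^2. A prime \<pi> dividing a + b sees 2p
  as a square, because 2p = (a + b)^2 + (a - b)^2, so there p has the same quadratic character as 2.
  Reciprocity for p = 1 mod 4 turns both into the character of \<pi> modulo p.\<close>

lemma sum_of_squares_Legendre:
  fixes p a b :: nat
  assumes p: "prime p" "p mod 8 = 1" and ab: "p = a ^ 2 + b ^ 2" and a: "odd a"
  shows "[int a ^ ((p - 1) div 2) = 1] (mod int p)"
    and "[int (a + b) ^ ((p - 1) div 2) = chi8 (a + b)] (mod int p)"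
proof -
  have p4: "p mod 4 = 1" by (rule mod_8_eq_1[OF p(2)])
  have p2: "2 < p" using p by (cases "p = 2") (auto dest: prime_ge_2_nat)
  have "odd p" by (rule mod_8_eq_1[OF p(2)])
  then have b: "even b" using ab a by simp
  have b0: "b > 0" using ab p(1) by (cases "b = 0") (auto simp: prime_power_iff)
  have ap: "a < p" using ab b0 a by (cases "a = 0") (auto simp: power2_eq_square intro!: le_less_trans[of a "a*a"])
  show "[int a ^ ((p - 1) div 2) = 1] (mod int p)"
  proof (rule multiplicative_power_cong[where f = "\<lambda>_. 1"])
    fix \<pi> assume \<pi>: "prime \<pi>" "\<pi> dvd a"
    have "odd \<pi>" using \<pi>(2) a dvd_trans[of 2 \<pi> a] by auto
    then have \<pi>2: "2 < \<pi>" using \<pi>(1) prime_ge_2_nat[of \<pi>] by (cases "\<pi> = 2") auto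
    have "\<pi> \<le> a" using \<pi>(2) a by (intro dvd_imp_le) (auto intro: Nat.gr0I)
    then have ne: "\<pi> \<noteq> p" using ap by simp
    have nd: "\<not> \<pi> dvd b" using coprime_sum_of_squares[OF p(1) ab] \<pi> by blast
    have "[int b ^ 2 = int p] (mod int \<pi>)"
      using \<pi>(2) ab by (auto simp: cong_iff_dvd_diff power2_eq_square)
    moreover have "\<not> [int p = 0] (mod int \<pi>)"
      using ne \<pi>(1) p(1) by (auto simp: cong_0_iff dest: primes_dvd_imp_eq)
    ultimately have "Legendre (int p) (int \<pi>) = 1" unfolding Legendre_def QuadRes_def by auto
    then have "Legendre (int \<pi>) (int p) = 1" using Legendre_reciprocal[OF p(1) p4 \<pi>(1) \<pi>2 ne] by simp
    then show "[int \<pi> ^ ((p - 1) div 2) = 1] (mod int p)"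
      using cong_sym[OF euler_criterion[OF p(1) p2, of "int \<pi>"]] by simp
  qed (use a in auto)
  show "[int (a + b) ^ ((p - 1) div 2) = chi8 (a + b)] (mod int p)"
  proof (rule multiplicative_power_cong[where f = chi8])
    show "odd (a + b)" using a b by simp
    fix \<pi> assume \<pi>: "prime \<pi>" "\<pi> dvd a + b"
    have "odd \<pi>" using \<pi>(2) a b dvd_trans[of 2 \<pi> "a + b"] by auto
    then have \<pi>2: "2 < \<pi>" using \<pi>(1) prime_ge_2_nat[of \<pi>] by (cases "\<pi> = 2") auto
    have nda: "\<not> \<pi> dvd a"
      using coprime_sum_of_squares[OF p(1) ab \<pi>(1)] \<pi> by (auto simp: dvd_add_right_iff)
    have id: "2 * int p = (int a + int b) ^ 2 + (int a - int b) ^ 2"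
      unfolding ab by (simp add: power2_eq_square algebra_simps)
    have d: "int \<pi> dvd (int a + int b) ^ 2" using \<pi>(2) by (simp add: power2_eq_square flip: of_nat_add)
    have c: "[(int a - int b) ^ 2 = 2 * int p] (mod int \<pi>)"
      using d id by (simp add: cong_iff_dvd_diff)
    have nd: "\<not> [2 * int p = 0] (mod int \<pi>)"
    proof
      assume "[2 * int p = 0] (mod int \<pi>)"
      then have "[(int a - int b) ^ 2 = 0] (mod int \<pi>)" using c cong_trans by blast
      then have "int \<pi> dvd int a - int b" using \<pi>(1) by (auto simp: cong_0_iff prime_dvd_power_iff)
      moreover have "int \<pi> dvd int a + int b" using \<pi>(2) by (simp flip: of_nat_add)
      ultimately have "int \<pi> dvd (int a - int b) + (int a + int b)" by (rule dvd_add)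
      then have "int \<pi> dvd 2 * int a" by simp
      then have "int \<pi> dvd int (2 * a)" by simp
      then have "\<pi> dvd 2 * a" by (simp only: int_dvd_int_iff)
      then have "\<pi> dvd 2" using nda \<pi>(1) by (simp add: prime_dvd_mult_iff)
      then have "\<pi> \<le> 2" by (rule dvd_imp_le) simp
      then show False using \<pi>2 by simp
    qed
    have nd2: "\<not> [2 = 0] (mod int \<pi>)" "\<not> [int p = 0] (mod int \<pi>)" using nd by (auto simp: cong_0_iff)
    then have ne: "\<pi> \<noteq> p" by (auto simp: cong_0_iff)
    have "Legendre (2 * int p) (int \<pi>) = 1"
      using c nd unfolding Legendre_def QuadRes_def by auto
    then have "Legendre 2 (int \<pi>) * Legendre (int p) (int \<pi>) = 1"
      using Legendre_mult[OF \<pi>(1) \<pi>2 nd2] by simp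
    then have "Legendre (int p) (int \<pi>) = Legendre 2 (int \<pi>)" by (metis zmult_eq_1_iff)
    then have "Legendre (int \<pi>) (int p) = chi8 \<pi>"
      using Legendre_reciprocal[OF p(1) p4 \<pi>(1) \<pi>2 ne] Legendre_two[OF \<pi>(1) \<pi>2] by simp
    then show "[int \<pi> ^ ((p - 1) div 2) = chi8 \<pi>] (mod int p)"
      using cong_sym[OF euler_criterion[OF p(1) p2, of "int \<pi>"]] by simp
  qed (auto simp: chi8_mult, simp add: chi8_def)
qed

text \<open>Dirichlet's argument. Raise (a + b)^2 = 2ab modulo p to the power (p - 1)/4 and use b^2
  = -a^2 together with the quadratic characters of a and a + b. This gives 2^((p-1)/4) = chi8(a + b)
  (-1)^((p-1)/8) modulo p, and the rest is a comparison of residues.\<close>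

lemma biquadratic_two_sum_of_squares:
  fixes p a b :: nat
  assumes p: "prime p" "p mod 8 = 1" and ab: "p = a ^ 2 + b ^ 2" and a: "odd a"
  shows "[2 ^ ((p - 1) div 4) = 1] (mod int p) \<longleftrightarrow> 8 dvd b"
proof -
  have p2: "2 < p" using p by (cases "p = 2") (auto dest: prime_ge_2_nat)
  define m where "m = p div 8"
  have pm: "p = 8 * m + 1" unfolding m_def using p(2) div_mult_mod_eq[of p 8] by linarith
  obtain c where c: "a = 2 * c + 1" using a oddE by blast
  obtain f where f: "c * (c + 1) = 2 * f" by (metis evenE even_mult_iff even_plus_one_iff)
  have a2: "a ^ 2 = 8 * f + 1"
  proof -
    have "a ^ 2 = 4 * (c * (c + 1)) + 1" unfolding c by (simp add: power2_eq_square algebra_simps)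
    then show ?thesis using f by simp
  qed
  have "4 dvd b"
  proof -
    have b8: "b ^ 2 + 8 * f = 8 * m" using ab pm a2 by simp
    then have "8 dvd b ^ 2" by (metis dvd_add_left_iff dvd_triv_left)
    then have "even b" by (metis dvd_trans even_numeral even_power)
    then obtain d where d: "b = 2 * d" by blast
    have "4 * d ^ 2 + 8 * f = 8 * m" using b8 unfolding d by (simp add: power_mult_distrib)
    then have "d ^ 2 = 2 * (m - f)" by simp
    then have "even (d ^ 2)" by simp
    then have "even d" by simp
    then show ?thesis unfolding d by auto
  qed
  then obtain b' where b': "b = 4 * b'" by blast
  let ?P = "\<lambda>x y. [x = y] (mod int p)"
  have L: "?P (int a ^ (4 * m)) 1" "?P (int (a + b) ^ (4 * m)) (chi8 (a + b))"
    using sum_of_squares_Legendre[OF p ab a] by (simp_all add: pm)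
  have "int (a + b) ^ 2 = 2 * int a * int b + int p"
    unfolding ab by (simp add: power2_eq_square algebra_simps)
  then have "?P (int (a + b) ^ 2) (2 * int a * int b)" by (simp add: cong_iff_dvd_diff)
  then have "?P ((int (a + b) ^ 2) ^ (2 * m)) ((2 * int a * int b) ^ (2 * m))" by (rule cong_pow)
  then have 1: "?P (int (a + b) ^ (4 * m)) ((2 * int a * int b) ^ (2 * m))"
    by (simp flip: power_mult)
  have 2: "(2 * int a * int b) ^ (2 * m) = 2 ^ (2 * m) * ((int a ^ 2 * int b ^ 2) ^ m)"
    by (simp add: power_mult power_mult_distrib)
  have "?P (int b ^ 2) (- (int a ^ 2))" unfolding ab by (simp add: cong_iff_dvd_diff add.commute)
  then have "?P ((int a ^ 2 * int b ^ 2) ^ m) ((int a ^ 2 * - (int a ^ 2)) ^ m)"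
    by (intro cong_pow cong_mult) auto
  also have "(int a ^ 2 * - (int a ^ 2)) ^ m = (-1) ^ m * int a ^ (4 * m)"
    by (simp add: power_minus[of "int a ^ 4"] power_mult flip: power_add)
  also have "?P \<dots> ((-1) ^ m * 1)" by (intro cong_mult L) simp
  finally have 3: "?P ((int a ^ 2 * int b ^ 2) ^ m) ((-1) ^ m)" by simp
  have "?P (chi8 (a + b)) (2 ^ (2 * m) * (-1) ^ m)"
    using cong_trans[OF cong_trans[OF cong_sym[OF L(2)] 1[unfolded 2]] cong_mult[OF cong_refl 3]] .
  then have "?P (chi8 (a + b) * (-1) ^ m) (2 ^ (2 * m) * (-1) ^ m * (-1) ^ m)"
    by (rule cong_mult) simp
  then have 4: "?P (2 ^ (2 * m)) (chi8 (a + b) * (-1) ^ m)"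
    by (simp add: mult.assoc cong_sym_eq flip: power_add)
  have e1: "chi8 (a + b) * (-1) ^ m \<in> {-1, 1}" unfolding chi8_def by (simp add: minus_one_power_iff)
  have "?P (2 ^ (2 * m)) 1 \<longleftrightarrow> chi8 (a + b) * (-1) ^ m = 1"
    using 4 e1 cong_pm_one_eq[OF p(1) p2, of "chi8 (a + b) * (-1) ^ m" 1]
    by (auto dest: cong_sym cong_trans)
  \<comment> \<open>With a = 2c + 1, b = 4b' and c(c + 1) = 2f one has m = f + 2b'^2, so m and f
    have the same parity, which depends on c modulo 4. The sign chi8(a + b) depends in the same way
    on c + 2b'. Adding 2 to c interchanges the two cases, so the signs agree exactly for even
    b'.\<close>
  also have "\<dots> \<longleftrightarrow> even b'"
  proof -
    have "8 * m = 8 * f + 16 * b' ^ 2"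
      using pm ab a2 unfolding b' by (simp add: power_mult_distrib)
    then have mf: "m = f + 2 * b' ^ 2" by simp
    have em: "even m \<longleftrightarrow> even f" unfolding mf by simp
    have ef: "even f \<longleftrightarrow> c mod 4 = 0 \<or> c mod 4 = 3"
    proof -
      define d where "d = c div 4"
      have "c = 4 * d \<or> c = 4 * d + 1 \<or> c = 4 * d + 2 \<or> c = 4 * d + 3"
        unfolding d_def by presburger
      then consider "c = 4 * d" | "c = 4 * d + 1" | "c = 4 * d + 2" | "c = 4 * d + 3" by blast
      then show ?thesis
      proof cases
        case 1
        then have "f = 2 * (4 * (d * d) + d)" using f by (simp add: algebra_simps)
        then show ?thesis using 1 by presburger
      next
        case 2
        then have "f = 2 * (4 * (d * d) + 3 * d) + 1" using f by (simp add: algebra_simps)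
        then show ?thesis using 2 by presburger
      next
        case 3
        then have "f = 2 * (4 * (d * d) + 5 * d + 1) + 1" using f by (simp add: algebra_simps)
        then show ?thesis using 3 by presburger
      next
        case 4
        then have "f = 2 * (4 * (d * d) + 7 * d + 3)" using f by (simp add: algebra_simps)
        then show ?thesis using 4 by presburger
      qed
    qed
    have ch: "chi8 (a + b) = 1 \<longleftrightarrow> (c + 2 * b') mod 4 = 0 \<or> (c + 2 * b') mod 4 = 3"
    proof -
      have "chi8 (a + b) = 1 \<longleftrightarrow> (a + b) mod 8 = 1 \<or> (a + b) mod 8 = 7" unfolding chi8_def by simp
      moreover have ab': "a + b = 2 * (c + 2 * b') + 1" unfolding c b' by simp
      moreover have "(a + b) mod 8 = 2 * ((c + 2 * b') mod 4) + 1"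
      proof -
        define n where "n = c + 2 * b'"
        have "2 * n + 1 = 2 * (n mod 4) + 1 + 8 * (n div 4)" using div_mult_mod_eq[of n 4] by linarith
        then have "(2 * n + 1) mod 8 = (2 * (n mod 4) + 1) mod 8" by (metis mod_mult_self2)
        moreover have "n mod 4 < 4" by simp
        ultimately show ?thesis unfolding ab' n_def by simp
      qed
      ultimately show ?thesis by auto
    qed
    have "chi8 (a + b) * (-1) ^ m = 1 \<longleftrightarrow> (chi8 (a + b) = 1 \<longleftrightarrow> even m)"
      by (cases "even m") (auto simp: chi8_def)
    also have "\<dots> \<longleftrightarrow> even b'"
    proof (cases "even b'")
      case True
      then obtain d where "b' = 2 * d" by blast
      then have "c + 2 * b' = c + 4 * d" by simp
      then have "(c + 2 * b') mod 4 = c mod 4" by (metis mod_mult_self2)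
      then show ?thesis unfolding ch em ef using True by simp
    next
      case False
      then obtain d where "b' = 2 * d + 1" using oddE by blast
      then have "c + 2 * b' = c + 2 + 4 * d" by simp
      then have "(c + 2 * b') mod 4 = (c + 2) mod 4" by (metis mod_mult_self2)
      moreover have "((c + 2) mod 4 = 0 \<or> (c + 2) mod 4 = 3) \<longleftrightarrow> \<not> (c mod 4 = 0 \<or> c mod 4 = 3)"
      proof -
        have "c mod 4 < 4" by simp
        then have "c mod 4 \<in> {0, 1, 2, 3}" by auto
        then show ?thesis using mod_add_left_eq[of c 4 2] by auto
      qed
      ultimately show ?thesis unfolding ch em ef using False by simp
    qed
    finally show ?thesis .
  qed
  also have "\<dots> \<longleftrightarrow> 8 dvd b" unfolding b' by presburger
  finally show ?thesis using pm by simp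
qed

text \<open>Thue's argument. With x^2 = -1 modulo p and k the integer part of the square root of p,
  there are (k + 1)^2 > p pairs (u, v), so two of them have the same u - x v modulo p. Their
  difference (a, b) satisfies p | a^2 + b^2 and 0 < a^2 + b^2 < 2p.\<close>

lemma prime_sum_of_squares:
  assumes p: "prime p" "p mod 4 = 1"
  obtains a b :: nat where "p = a ^ 2 + b ^ 2"
proof -
  have p2: "2 < p" using p by (cases "p = 2") (auto dest: prime_ge_2_nat)
  have "[Legendre (-1) (int p) = (-1) ^ ((p - 1) div 2)] (mod int p)"
    by (rule euler_criterion[OF p(1) p2])
  also have "even ((p - 1) div 2)" using p(2) by presburger
  then have "(-1::int) ^ ((p - 1) div 2) = 1" by simp
  finally have L: "[Legendre (-1) (int p) = 1] (mod int p)" .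
  have "Legendre (-1) (int p) = 1"
    by (rule cong_pm_one_eq[OF p(1) p2 L]) (use p2 in \<open>auto simp: Legendre_def cong_0_iff\<close>)
  then obtain x :: int where x: "[x ^ 2 = -1] (mod int p)"
    unfolding Legendre_def QuadRes_def by (auto split: if_splits)
  define k where "k = nat \<lfloor>sqrt (real p)\<rfloor>"
  have k1: "k ^ 2 \<le> p"
  proof -
    have "real k \<le> sqrt (real p)" unfolding k_def by (simp add: of_nat_nat)
    then have "real k ^ 2 \<le> sqrt (real p) ^ 2" by (intro power_mono) auto
    then have "real (k ^ 2) \<le> real p" by simp
    then show ?thesis by (simp only: of_nat_le_iff)
  qed
  have k2: "p < (k + 1) ^ 2"
  proof -
    have "sqrt (real p) < real (k + 1)" unfolding k_def by simp linarith
    then have "sqrt (real p) ^ 2 < real (k + 1) ^ 2" by (intro power_strict_mono) auto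
    then have "real p < real ((k + 1) ^ 2)" by simp
    then show ?thesis by (simp only: of_nat_less_iff)
  qed
  define f where "f = (\<lambda>(u, v). (int u - x * int v) mod int p)"
  let ?S = "{0..k} \<times> {0..k}"
  have "\<not> inj_on f ?S"
  proof
    assume "inj_on f ?S"
    then have "card ?S \<le> card {0..<int p}"
      using p2 by (intro card_inj_on_le[of f]) (auto simp: f_def)
    then have "(k + 1) ^ 2 \<le> p" by (simp add: power2_eq_square)
    then show False using k2 by simp
  qed
  then obtain u v u' v' where uv: "u \<le> k" "v \<le> k" "u' \<le> k" "v' \<le> k" "(u, v) \<noteq> (u', v')"
    "f (u, v) = f (u', v')" unfolding inj_on_def by auto
  define a where "a = int u - int u'"
  define b where "b = int v - int v'"
  have "[int u - x * int v = int u' - x * int v'] (mod int p)"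
    using uv(6) unfolding f_def cong_def by simp
  then have "[a = x * b] (mod int p)"
    unfolding a_def b_def by (simp add: cong_iff_dvd_diff algebra_simps)
  then have "[a ^ 2 = (x * b) ^ 2] (mod int p)" by (rule cong_pow)
  also have "(x * b) ^ 2 = x ^ 2 * b ^ 2" by (rule power_mult_distrib)
  also have "[\<dots> = -1 * b ^ 2] (mod int p)" by (intro cong_mult x cong_refl)
  finally have "int p dvd a ^ 2 + b ^ 2" by (simp add: cong_iff_dvd_diff)
  then obtain d where d: "a ^ 2 + b ^ 2 = int p * d" by blast
  have pos: "a ^ 2 + b ^ 2 > 0"
    using uv(5) unfolding a_def b_def by (auto simp: sum_power2_gt_zero_iff)
  have sq: "k ^ 2 \<noteq> p" using p(1) by (auto simp: prime_power_iff)
  then have "int k ^ 2 < int p" using k1 by (metis le_neq_implies_less of_nat_less_iff of_nat_power)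
  moreover have "a ^ 2 \<le> int k ^ 2" "b ^ 2 \<le> int k ^ 2"
    using uv(1-4) unfolding a_def b_def by (auto intro!: power2_le_iff_abs_le[THEN iffD2])
  ultimately have "a ^ 2 + b ^ 2 < 2 * int p" by linarith
  then have "int p * d < int p * 2" "int p * 0 < int p * d" using d pos by linarith+
  moreover have p0: "0 < int p" using p2 by simp
  ultimately have "d < 2" "0 < d"
    using mult_less_cancel_left_pos[OF p0, of d 2] mult_less_cancel_left_pos[OF p0, of 0 d] by blast+
  then have "d = 1" by simp
  then have "int p = a ^ 2 + b ^ 2" using d by simp
  then have "int p = int (nat \<bar>a\<bar> ^ 2 + nat \<bar>b\<bar> ^ 2)" by simp
  then have "p = nat \<bar>a\<bar> ^ 2 + nat \<bar>b\<bar> ^ 2" by (simp only: of_nat_eq_iff)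
  then show ?thesis using that by blast
qed

lemma P0_mod_8: "p \<in> P0 \<Longrightarrow> p mod 8 = 1"
proof -
  assume "p \<in> P0"
  then obtain A B :: int where p: "prime p" "int p = A ^ 2 + 64 * B ^ 2" unfolding P0_def by blast
  have "odd A"
  proof
    assume "even A"
    then obtain c where "A = 2 * c" by blast
    then have "int p = 4 * (c ^ 2 + 16 * B ^ 2)" using p(2) by (simp add: power_mult_distrib)
    then have "int 4 dvd int p" by simp
    then have 4: "4 dvd p" by (simp only: int_dvd_int_iff)
    then have "2 dvd p" by presburger
    then have "p = 2" using p(1) primes_dvd_imp_eq two_is_prime_nat by metis
    then show False using 4 by simp
  qed
  then obtain c where "A = 2 * c + 1" by (rule oddE)
  then have "A ^ 2 = 4 * (c * (c + 1)) + 1" by (simp add: power2_eq_square algebra_simps)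
  moreover obtain d where "c * (c + 1) = 2 * d" by (metis evenE even_mult_iff even_plus_one_iff)
  ultimately have "int p = 8 * (d + 8 * B ^ 2) + 1" using p(2) by simp
  moreover have "(8 * x + 1) mod 8 = (1 :: int)" for x by presburger
  ultimately have "int p mod 8 = 1" by metis
  then have "int (p mod 8) = 1" by (simp add: zmod_int)
  then show "p mod 8 = 1" by simp
qed

text \<open>In the converse direction any representation as a sum of two squares will do, once its
  odd term is put first: the criterion makes the other term divisible by 8.\<close>

lemma P0_iff_biquadratic:
  assumes p: "prime p" "p mod 8 = 1"
  shows "p \<in> P0 \<longleftrightarrow> [2 ^ ((p - 1) div 4) = 1] (mod int p)"
proof
  assume "p \<in> P0"
  then obtain A B :: int where AB: "int p = A ^ 2 + 64 * B ^ 2" unfolding P0_def by blast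
  then have "int p = int (nat \<bar>A\<bar> ^ 2 + (8 * nat \<bar>B\<bar>) ^ 2)" by (simp add: power_mult_distrib)
  then have pe: "p = nat \<bar>A\<bar> ^ 2 + (8 * nat \<bar>B\<bar>) ^ 2" by (simp only: of_nat_eq_iff)
  have "odd (nat \<bar>A\<bar>)"
  proof
    assume "even (nat \<bar>A\<bar>)"
    then have "even p" using pe by simp
    then show False using p(2) by presburger
  qed
  then show "[2 ^ ((p - 1) div 4) = 1] (mod int p)"
    using biquadratic_two_sum_of_squares[OF p pe] by simp
next
  assume R: "[2 ^ ((p - 1) div 4) = 1] (mod int p)"
  have "p mod 4 = 1" by (rule mod_8_eq_1[OF p(2)])
  then obtain a b where ab: "p = a ^ 2 + b ^ 2" using prime_sum_of_squares p(1) by blast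
  have "\<exists>a b. p = a ^ 2 + b ^ 2 \<and> odd a"
  proof (cases "odd a")
    case False
    moreover have "odd p" by (rule mod_8_eq_1[OF p(2)])
    ultimately have "odd b" using ab by simp
    then show ?thesis using ab by (metis add.commute)
  qed (use ab in blast)
  then obtain a b where ab: "p = a ^ 2 + b ^ 2" "odd a" by blast
  then have "8 dvd b" using biquadratic_two_sum_of_squares[OF p ab] R by simp
  then obtain B where "b = 8 * B" by blast
  then have "int p = int a ^ 2 + 64 * int B ^ 2" using ab(1) by (simp add: power_mult_distrib)
  then show "p \<in> P0" unfolding P0_def using p(1) by blast
qed

subsection \<open>Classification of the irreducible representations\<close>

lemma mat_mult_vec_v2:
  assumes "v \<in> carrier_vec n" "v' \<in> carrier_vec n"
  shows "mat n 2 (\<lambda>(i, j). if j = 0 then v $ i else v' $ i) *\<^sub>v v2 x y = x \<cdot>\<^sub>v v + y \<cdot>\<^sub>v v'"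
  by (rule eq_vecI) (use assms in \<open>auto simp: scalar_prod_def atLeast0_lessThan_two mult.commute\<close>)

text \<open>The traces of \<open>B * C\<close> and \<open>C * B\<close> agree. The classification
  uses this to find the dimension after the change of basis has been inverted.\<close>

lemma mat_mult_inverse_dim:
  fixes B C :: "complex mat"
  assumes B: "B \<in> carrier_mat n m" and C: "C \<in> carrier_mat m n"
    and BC: "B * C = 1\<^sub>m n" and CB: "C * B = 1\<^sub>m m"
  shows "n = m"
proof -
  have "of_nat n = (\<Sum>i<n. (B * C) $$ (i, i))" unfolding BC by simp
  also have "\<dots> = (\<Sum>i<n. \<Sum>k<m. B $$ (i, k) * C $$ (k, i))"
    by (rule sum.cong) (use B C in \<open>auto simp: scalar_prod_def lessThan_atLeast0\<close>)
  also have "\<dots> = (\<Sum>k<m. \<Sum>i<n. C $$ (k, i) * B $$ (i, k))"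
    by (subst sum.swap) (simp add: mult.commute)
  also have "\<dots> = (\<Sum>k<m. (C * B) $$ (k, k))"
    by (rule sum.cong) (use B C in \<open>auto simp: scalar_prod_def lessThan_atLeast0\<close>)
  also have "\<dots> = of_nat m" unfolding CB by simp
  finally have "(of_nat n :: complex) = of_nat m" .
  then show ?thesis by simp
qed

lemma smult_one_mult_vec: "(v :: complex vec) \<in> carrier_vec n \<Longrightarrow> (k \<cdot>\<^sub>m 1\<^sub>m n) *\<^sub>v v = k \<cdot>\<^sub>v v"
  by (intro eq_vecI) (auto simp: row_one)

lemma mat_mult_zero_vec:
  "(A :: complex mat) \<in> carrier_mat m n \<Longrightarrow> A *\<^sub>v 0\<^sub>v n = 0\<^sub>v m"
  by (rule eq_vecI) (auto simp: scalar_prod_def)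

lemma smult_mat_mult_vec:
  "(A :: complex mat) \<in> carrier_mat m n \<Longrightarrow> v \<in> carrier_vec n \<Longrightarrow> (k \<cdot>\<^sub>m A) *\<^sub>v v = k \<cdot>\<^sub>v (A *\<^sub>v v)"
  by (rule eq_vecI) (auto simp: scalar_prod_def sum_distrib_left mult.assoc)

lemma smult_one_mult_mat: "(A :: complex mat) \<in> carrier_mat n m \<Longrightarrow> (k \<cdot>\<^sub>m 1\<^sub>m n) * A = k \<cdot>\<^sub>m A"
  by (subst mult_smult_assoc_mat[of _ n n _ m]) auto

lemma smult_one_eq: "0 < n \<Longrightarrow> k \<cdot>\<^sub>m 1\<^sub>m n = (l :: complex) \<cdot>\<^sub>m 1\<^sub>m n \<Longrightarrow> k = l"
  by (drule arg_cong[of _ _ "\<lambda>M. M $$ (0, 0)"]) simp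

context twisted_group
begin

lemma word_shift_even: "word b a (k + 2 * j) = word b a k"
proof -
  have "e [^] (k + 2 * j) = e [^] k"
    using nat_pow_mult[of e k "2 * j"] e_pow_even[of "2 * j"] by simp
  then show ?thesis unfolding word_def by simp
qed

lemma irreducible_classification:
  assumes irr: "irreducible_rep G n \<phi>" and n: "n > 1"
  obtains c \<rho> where "n = 2" "c ^ (N div 2) = (-1) ^ h" "standard_rep c \<rho>" "rep_iso G n \<phi> 2 \<rho>"
proof -
  have rep: "representation G n \<phi>" using irr unfolding irreducible_rep_def by simp
  note m = rep_mult[OF rep] and cl [simp] = rep_closed[OF rep]
  have n0: "0 < n" using n by simp
  have one: "\<phi> \<one> = 1\<^sub>m n" by (rule rep_one[OF is_group rep])
  have pow: "\<phi> (x [^] (k :: nat)) = \<mu> ^ k \<cdot>\<^sub>m 1\<^sub>m n" if "x \<in> carrier G" "\<phi> x = \<mu> \<cdot>\<^sub>m 1\<^sub>m n" for x \<mu> k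
  proof (induction k)
    case 0 show ?case using one by (auto intro!: eq_matI)
  next
    case (Suc k)
    have "\<phi> (x [^] Suc k) = (\<mu> ^ k \<cdot>\<^sub>m 1\<^sub>m n) * (\<mu> \<cdot>\<^sub>m 1\<^sub>m n)" using that m Suc by simp
    also have "\<dots> = \<mu> ^ k \<cdot>\<^sub>m (\<mu> \<cdot>\<^sub>m 1\<^sub>m n)" by (rule smult_one_mult_mat[of _ n n]) simp
    finally show ?case by (auto intro!: eq_matI)
  qed
  obtain \<mu> where \<mu>: "\<phi> e = \<mu> \<cdot>\<^sub>m 1\<^sub>m n"
  proof (rule schur_scalar[OF irr, of "\<phi> e"])
    fix g assume g: "g \<in> carrier G"
    then obtain b a k where gw: "g = word b a k" using word_exhaust by blast
    have "g \<otimes> e = e \<otimes> g" unfolding gw using word_mult[of b a k 0 0 1] word_mult[of 0 0 1 b a k]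
      unfolding e_word[symmetric] by simp
    then show "\<phi> g * \<phi> e = \<phi> e * \<phi> g" using m[OF g e_closed] m[OF e_closed g] by simp
  qed auto
  have "\<mu> ^ 2 \<cdot>\<^sub>m 1\<^sub>m n = 1 \<cdot>\<^sub>m 1\<^sub>m n"
    using pow[OF e_closed \<mu>, of 2] e_pow_even[of 2] one by (auto intro!: eq_matI)
  then have "\<mu> ^ 2 = 1" by (rule smult_one_eq[OF n0])
  moreover have "\<mu> \<noteq> 1"
  proof
    assume "\<mu> = 1"
    then have e1: "\<phi> (e [^] (k :: nat)) = 1\<^sub>m n" for k
      using pow[OF e_closed \<mu>, of k] by (auto intro!: eq_matI)
    have drop: "\<phi> (word b a k) = \<phi> (word b a 0)" for b a k
    proof -
      have "word b a k = word b a 0 \<otimes> word 0 0 k" unfolding word_mult by simp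
      then have "\<phi> (word b a k) = \<phi> (word b a 0) * \<phi> (word 0 0 k)" using m by simp
      moreover have "word 0 0 k = e [^] k" unfolding word_def by simp
      ultimately show ?thesis using e1[of k] right_mult_one_mat[OF cl[OF word_closed]] by simp
    qed
    have comm: "\<phi> x * \<phi> y = \<phi> y * \<phi> x" if xy: "x \<in> carrier G" "y \<in> carrier G" for x y
    proof -
      obtain b a k b' a' k' where w: "x = word b a k" "y = word b' a' k'"
        using word_exhaust xy by meson
      have "\<phi> (x \<otimes> y) = \<phi> (word (b + b') (a + a') 0)" "\<phi> (y \<otimes> x) = \<phi> (word (b' + b) (a' + a) 0)"
        unfolding w word_mult by (rule drop)+
      then show ?thesis using m xy by (simp add: add.commute)
    qed
    have scal: "\<exists>\<nu>. \<phi> g = \<nu> \<cdot>\<^sub>m 1\<^sub>m n" if g: "g \<in> carrier G" for g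
      by (rule schur_scalar[OF irr cl[OF g]]) (use comm g in auto)
    \<comment> \<open>All group elements act as scalars now, so a single line is already stable, and
      for n > 1 it is a proper subspace.\<close>
    define W where "W = {k \<cdot>\<^sub>v unit_vec n 0 | k :: complex. True}"
    have W: "k \<cdot>\<^sub>v unit_vec n 0 \<in> W" for k unfolding W_def by blast
    have "VectorSpace.subspace class_ring W (cvec n)"
    proof (rule subspace_cvecI)
      show "W \<subseteq> carrier_vec n" unfolding W_def by auto
      have "0 \<cdot>\<^sub>v unit_vec n 0 = (0\<^sub>v n :: complex vec)" by (intro eq_vecI) auto
      then show "0\<^sub>v n \<in> W" using W[of 0] by simp
      fix v k assume "v \<in> W"
      then obtain l where "v = l \<cdot>\<^sub>v unit_vec n 0" unfolding W_def by blast
      then show "k \<cdot>\<^sub>v v \<in> W" using W[of "k * l"] by (simp add: smult_smult_assoc)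
    next
      fix v w assume "v \<in> W" "w \<in> W"
      then obtain l l' where "v = l \<cdot>\<^sub>v unit_vec n 0" "w = l' \<cdot>\<^sub>v unit_vec n 0" unfolding W_def by blast
      then have "v + w = (l + l') \<cdot>\<^sub>v unit_vec n 0" by (intro eq_vecI) (auto simp: algebra_simps)
      then show "v + w \<in> W" using W by simp
    qed
    moreover have "\<phi> g *\<^sub>v w \<in> W" if g: "g \<in> carrier G" and w: "w \<in> W" for g w
    proof -
      obtain \<nu> where \<nu>: "\<phi> g = \<nu> \<cdot>\<^sub>m 1\<^sub>m n" using scal[OF g] by blast
      obtain l where l: "w = l \<cdot>\<^sub>v unit_vec n 0" using w unfolding W_def by blast
      have "\<phi> g *\<^sub>v w = (\<nu> * l) \<cdot>\<^sub>v unit_vec n 0"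
        unfolding \<nu> l by (subst smult_one_mult_vec) (auto simp: smult_smult_assoc)
      then show ?thesis using W by simp
    qed
    ultimately have "W = {0\<^sub>v n} \<or> W = carrier_vec n"
      using irr unfolding irreducible_rep_def by blast
    moreover have "unit_vec n 0 \<in> W" using W[of 1] by simp
    moreover have "(unit_vec n 0 :: complex vec) \<noteq> 0\<^sub>v n"
      using n0 by (metis index_unit_vec(1) index_zero_vec(1) zero_neq_one)
    ultimately have "W = carrier_vec n" by blast
    then have "unit_vec n 1 \<in> W" by simp
    then obtain k where "unit_vec n 1 = k \<cdot>\<^sub>v (unit_vec n 0 :: complex vec)" unfolding W_def by blast
    then have "unit_vec n 1 $ 1 = (k \<cdot>\<^sub>v (unit_vec n 0 :: complex vec)) $ 1" by simp
    then show False using n by simp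
  qed
  ultimately have \<mu>1: "\<mu> = -1" by (metis power2_eq_1_iff)
  define A where "A = \<phi> t"
  define S where "S = \<phi> s"
  have A [simp]: "A \<in> carrier_mat n n" and S [simp]: "S \<in> carrier_mat n n"
    unfolding A_def S_def by auto
  note [simp] = carrier_matD[OF A] carrier_matD[OF S]
    mult_mat_vec_carrier[OF A] mult_mat_vec_carrier[OF S]
  have AA: "A * A = 1\<^sub>m n" unfolding A_def using m[OF t_closed t_closed] tt one by simp
  have AS: "A * S = (-1) \<cdot>\<^sub>m (S * A)"
  proof -
    have "A * S = \<phi> (e \<otimes> (s \<otimes> t))" unfolding A_def S_def using m[OF t_closed s_closed] ts by simp
    also have "\<dots> = \<phi> e * (S * A)" unfolding A_def S_def using m by simp
    also have "\<dots> = (-1) \<cdot>\<^sub>m (S * A)" unfolding \<mu> \<mu>1 by (rule smult_one_mult_mat[OF mult_carrier_mat[OF S A]])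
    finally show ?thesis .
  qed
  obtain c where c: "\<phi> (s \<otimes> s) = c \<cdot>\<^sub>m 1\<^sub>m n"
  proof (rule schur_scalar[OF irr, of "\<phi> (s \<otimes> s)"])
    have ss: "s \<otimes> s = word 2 0 0" unfolding word_def by (simp add: numeral_2_eq_2)
    fix g assume g: "g \<in> carrier G"
    then obtain b a k where gw: "g = word b a k" using word_exhaust by blast
    \<comment> \<open>Moving s^2 past t^a costs e^(2a), which is trivial.\<close>
    have "g \<otimes> (s \<otimes> s) = (s \<otimes> s) \<otimes> g"
      unfolding gw ss word_mult using word_shift_even[of "b + 2" a k a] by (simp add: mult.commute)
    then show "\<phi> g * \<phi> (s \<otimes> s) = \<phi> (s \<otimes> s) * \<phi> g"
      using m[of g "s \<otimes> s"] m[of "s \<otimes> s" g] g by simp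
  qed auto
  then have SS: "S * S = c \<cdot>\<^sub>m 1\<^sub>m n" unfolding S_def using m by simp
  have cN: "c ^ (N div 2) = (-1) ^ h"
  proof (rule smult_one_eq[OF n0])
    have "(s \<otimes> s) [^] (N div 2) = s [^] N"
    proof -
      have "s \<otimes> s = s [^] (2 :: nat)" by (simp add: numeral_2_eq_2)
      then show ?thesis using nat_pow_pow[OF s_closed, of 2 "N div 2"] N_even by simp
    qed
    then have "\<phi> ((s \<otimes> s) [^] (N div 2)) = \<phi> (e [^] h)" using sN by simp
    then show "c ^ (N div 2) \<cdot>\<^sub>m 1\<^sub>m n = (-1) ^ h \<cdot>\<^sub>m 1\<^sub>m n"
      using pow[OF _ c, of "N div 2"] pow[OF e_closed \<mu>, of h] \<mu>1 by simp
  qed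
  have c0: "c \<noteq> 0"
  proof
    assume "c = 0"
    moreover have "N div 2 > 0" using N_pos N_even by (auto elim!: evenE)
    ultimately show False using cN by (simp add: power_0_left)
  qed
  have Sv: "S *\<^sub>v (S *\<^sub>v w) = c \<cdot>\<^sub>v w" if "w \<in> carrier_vec n" for w
    using assoc_mult_mat_vec[OF S S that] SS smult_one_mult_vec[OF that] by simp
  have Av: "A *\<^sub>v (A *\<^sub>v w) = w" if "w \<in> carrier_vec n" for w
    using assoc_mult_mat_vec[OF A A that] AA that by simp
  have ASv: "A *\<^sub>v (S *\<^sub>v w) = - (S *\<^sub>v (A *\<^sub>v w))" if w: "w \<in> carrier_vec n" for w
  proof -
    have "A *\<^sub>v (S *\<^sub>v w) = ((-1) \<cdot>\<^sub>m (S * A)) *\<^sub>v w"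
      using assoc_mult_mat_vec[OF A S w] AS by simp
    also have "\<dots> = (-1) \<cdot>\<^sub>v ((S * A) *\<^sub>v w)" by (rule smult_mat_mult_vec[OF mult_carrier_mat[OF S A] w])
    also have "(S * A) *\<^sub>v w = S *\<^sub>v (A *\<^sub>v w)" by (rule assoc_mult_mat_vec[OF S A w])
    finally show ?thesis by (simp add: uminus_vec_def) (auto intro!: eq_vecI)
  qed
  have S_ne: "S *\<^sub>v w \<noteq> 0\<^sub>v n" if w: "w \<in> carrier_vec n" "w \<noteq> 0\<^sub>v n" for w
  proof
    assume "S *\<^sub>v w = 0\<^sub>v n"
    moreover have "S *\<^sub>v 0\<^sub>v n = 0\<^sub>v n" by (rule mat_mult_zero_vec[OF S])
    ultimately have "c \<cdot>\<^sub>v w = 0\<^sub>v n" using Sv[OF w(1)] by simp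
    then have "\<And>i. i < n \<Longrightarrow> c * w $ i = 0"
      using w(1) by (metis carrier_vecD index_smult_vec(1) index_zero_vec(1))
    then have "w = 0\<^sub>v n" using c0 w(1) by (intro eq_vecI) auto
    then show False using w by simp
  qed
  \<comment> \<open>Start from a unit vector w. Either w + Aw is a nonzero vector fixed by
    \<open>A\<close>, or Aw = -w, and then Sw is fixed because \<open>A\<close> and \<open>S\<close>
    anticommute.\<close>
  obtain v where v: "v \<in> carrier_vec n" "v \<noteq> 0\<^sub>v n" "A *\<^sub>v v = v"
  proof -
    let ?w = "unit_vec n 0 :: complex vec"
    have w: "?w \<in> carrier_vec n" "?w \<noteq> 0\<^sub>v n"
      using n0 by simp (metis index_unit_vec(1) index_zero_vec(1) zero_neq_one n0)
    have Aw: "A *\<^sub>v ?w \<in> carrier_vec n" using A w by simp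
    show thesis
    proof (cases "?w + A *\<^sub>v ?w = 0\<^sub>v n")
      case False
      have "A *\<^sub>v (?w + A *\<^sub>v ?w) = A *\<^sub>v ?w + A *\<^sub>v (A *\<^sub>v ?w)"
        by (rule mult_add_distrib_mat_vec[OF A w(1) Aw])
      also have "\<dots> = ?w + A *\<^sub>v ?w" using Av[OF w(1)] comm_add_vec[OF w(1) Aw] by simp
      finally show ?thesis using that[of "?w + A *\<^sub>v ?w"] False w Aw by simp
    next
      case True
      then have "\<And>i. i < n \<Longrightarrow> ?w $ i + (A *\<^sub>v ?w) $ i = 0"
        using Aw by (metis carrier_vecD index_add_vec(1) index_zero_vec(1))
      then have "A *\<^sub>v ?w = - ?w"
        using Aw A by (intro eq_vecI) (auto simp: add_eq_0_iff)
      then have "A *\<^sub>v (S *\<^sub>v ?w) = - (S *\<^sub>v (- ?w))" using ASv[OF w(1)] by simp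
      also have "\<dots> = S *\<^sub>v ?w" using S by (intro eq_vecI) auto
      finally show ?thesis using that[of "S *\<^sub>v ?w"] S_ne[OF w] S w by simp
    qed
  qed
  define v' where "v' = S *\<^sub>v v"
  have v': "v' \<in> carrier_vec n" "v' \<noteq> 0\<^sub>v n" unfolding v'_def using S v S_ne by auto
  have Av': "A *\<^sub>v v' = - v'" unfolding v'_def using ASv[OF v(1)] v(3) by simp
  have Sv': "S *\<^sub>v v' = c \<cdot>\<^sub>v v" unfolding v'_def by (rule Sv[OF v(1)])
  \<comment> \<open>The columns are v and Sv. In these coordinates \<open>t\<close>,
    \<open>s\<close> and \<open>e\<close> have the matrices of the standard representation, so the
    column space is stable and hence everything.\<close>
  define B where "B = mat n 2 (\<lambda>(i, j). if j = 0 then v $ i else v' $ i)"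
  have B [simp]: "B \<in> carrier_mat n 2" unfolding B_def by simp
  note [simp] = carrier_matD[OF B] mult_mat_vec_carrier[OF B]
  have Bv: "B *\<^sub>v v2 x y = x \<cdot>\<^sub>v v + y \<cdot>\<^sub>v v'" for x y
    unfolding B_def by (rule mat_mult_vec_v2[OF v(1) v'(1)])
  have lin: "X *\<^sub>v (x \<cdot>\<^sub>v v + y \<cdot>\<^sub>v v') = x \<cdot>\<^sub>v (X *\<^sub>v v) + y \<cdot>\<^sub>v (X *\<^sub>v v')" if "X \<in> carrier_mat n n" for X x y
    using that v(1) v'(1) by (simp add: mult_add_distrib_mat_vec[of _ n n] mult_mat_vec[of _ n n])
  have AB: "A *\<^sub>v (B *\<^sub>v v2 x y) = B *\<^sub>v v2 x (- y)" for x y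
    unfolding Bv lin[OF A] v(3) Av' using v(1) v'(1) by (intro eq_vecI) auto
  have SB: "S *\<^sub>v (B *\<^sub>v v2 x y) = B *\<^sub>v v2 (c * y) x" for x y
    unfolding Bv lin[OF S] v'_def[symmetric] Sv' using v(1) v'(1)
    by (intro eq_vecI) auto
  have EB: "\<phi> e *\<^sub>v (B *\<^sub>v v2 x y) = B *\<^sub>v v2 (- x) (- y)" for x y
    unfolding \<mu> \<mu>1 Bv using v(1) v'(1) by (subst smult_one_mult_vec) (auto intro!: eq_vecI)
  define W where "W = {B *\<^sub>v v2 x y | x y. True}"
  have W: "B *\<^sub>v v2 x y \<in> W" for x y unfolding W_def by blast
  have sub: "VectorSpace.subspace class_ring W (cvec n)"
  proof (rule subspace_cvecI)
    show "W \<subseteq> carrier_vec n" unfolding W_def using B by auto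
    have "B *\<^sub>v v2 0 0 = 0\<^sub>v n" unfolding Bv using v(1) v'(1) by (intro eq_vecI) auto
    then show "0\<^sub>v n \<in> W" using W[of 0 0] by simp
    fix w k assume "w \<in> W"
    then obtain x y where w: "w = B *\<^sub>v v2 x y" unfolding W_def by blast
    have "k \<cdot>\<^sub>v w = B *\<^sub>v v2 (k * x) (k * y)"
      unfolding w v2_smult[symmetric] by (rule mult_mat_vec[OF B, symmetric]) simp
    then show "k \<cdot>\<^sub>v w \<in> W" using W by simp
  next
    fix w w' assume "w \<in> W" "w' \<in> W"
    then obtain x y x' y' where w: "w = B *\<^sub>v v2 x y" "w' = B *\<^sub>v v2 x' y'" unfolding W_def by blast
    have "w + w' = B *\<^sub>v v2 (x + x') (y + y')"
      unfolding w v2_add[symmetric] by (rule mult_add_distrib_mat_vec[OF B, symmetric]) simp_all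
    then show "w + w' \<in> W" using W by simp
  qed
  have st: "\<phi> g *\<^sub>v w \<in> W" if g: "g \<in> carrier G" and w: "w \<in> W" for g w
  proof -
    have comp: "\<phi> (x \<otimes> y) *\<^sub>v w = \<phi> x *\<^sub>v (\<phi> y *\<^sub>v w)"
      if "x \<in> carrier G" "y \<in> carrier G" "w \<in> W" for x y w
    proof -
      have "w \<in> carrier_vec n" using that(3) subspace_cvecD(1)[OF sub] by blast
      then show ?thesis unfolding m[OF that(1,2)]
        by (rule assoc_mult_mat_vec[OF cl[OF that(1)] cl[OF that(2)]])
    qed
    have pw: "\<phi> (x [^] (k :: nat)) *\<^sub>v w \<in> W"
      if x: "x \<in> carrier G" and st: "\<And>w. w \<in> W \<Longrightarrow> \<phi> x *\<^sub>v w \<in> W" and w: "w \<in> W" for x k w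
      using w
    proof (induction k arbitrary: w)
      case 0
      then have "w \<in> carrier_vec n" using subspace_cvecD(1)[OF sub] by blast
      then show ?case using one 0 by simp
    next
      case (Suc k)
      then show ?case using comp[OF nat_pow_closed[OF x] x] st x by simp
    qed
    obtain b a k :: nat where gw: "g = s [^] b \<otimes> (t [^] a \<otimes> e [^] k)"
      using g word_exhaust unfolding word_def by blast
    have Wcl: "X *\<^sub>v w \<in> W" if XW: "\<And>x y. X *\<^sub>v (B *\<^sub>v v2 x y) \<in> W" and w: "w \<in> W" for X w
    proof -
      obtain x y where "w = B *\<^sub>v v2 x y" using w unfolding W_def by blast
      then show ?thesis using XW by simp
    qed
    have 1: "\<phi> (e [^] k) *\<^sub>v w \<in> W"
      using e_closed _ w
    proof (rule pw)
      show "\<phi> e *\<^sub>v w \<in> W" if "w \<in> W" for w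
        by (rule Wcl[OF _ that]) (simp only: EB W)
    qed
    have 2: "\<phi> (t [^] a) *\<^sub>v (\<phi> (e [^] k) *\<^sub>v w) \<in> W"
      using t_closed _ 1
    proof (rule pw)
      show "\<phi> t *\<^sub>v w \<in> W" if "w \<in> W" for w
        unfolding A_def[symmetric] by (rule Wcl[OF _ that]) (simp only: AB W)
    qed
    have 3: "\<phi> (s [^] b) *\<^sub>v (\<phi> (t [^] a) *\<^sub>v (\<phi> (e [^] k) *\<^sub>v w)) \<in> W"
      using s_closed _ 2
    proof (rule pw)
      show "\<phi> s *\<^sub>v w \<in> W" if "w \<in> W" for w
        unfolding S_def[symmetric] by (rule Wcl[OF _ that]) (simp only: SB W)
    qed
    have "\<phi> g *\<^sub>v w = \<phi> (s [^] b) *\<^sub>v (\<phi> (t [^] a) *\<^sub>v (\<phi> (e [^] k) *\<^sub>v w))"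
      unfolding gw using comp w by simp
    then show ?thesis using 3 by simp
  qed
  have "v = B *\<^sub>v v2 1 0" unfolding Bv using v(1) v'(1) by (intro eq_vecI) auto
  then have "v \<in> W" using W by simp
  moreover have "W = {0\<^sub>v n} \<or> W = carrier_vec n"
    using irr sub st unfolding irreducible_rep_def by blast
  ultimately have Wall: "W = carrier_vec n" using v(2) by blast
  \<comment> \<open>The two columns belong to the eigenvalues 1 and -1 of \<open>A\<close>, so
    adding and subtracting a relation and its image under \<open>A\<close> kills both
    coefficients.\<close>
  have inj: "x = 0 \<and> y = 0" if z: "B *\<^sub>v v2 x y = 0\<^sub>v n" for x y
  proof -
    have "B *\<^sub>v v2 x (- y) = 0\<^sub>v n" using AB[of x y] z mat_mult_zero_vec[OF A] by simp
    then have eq: "x \<cdot>\<^sub>v v + (- y) \<cdot>\<^sub>v v' = 0\<^sub>v n" "x \<cdot>\<^sub>v v + y \<cdot>\<^sub>v v' = 0\<^sub>v n" using z Bv by auto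
    have "x * v $ i + - y * v' $ i = 0" "x * v $ i + y * v' $ i = 0" if "i < n" for i
      using arg_cong[OF eq(1), of "\<lambda>u. u $ i"] arg_cong[OF eq(2), of "\<lambda>u. u $ i"] v(1) v'(1) that by auto
    then have *: "x * v $ i = 0" "y * v' $ i = 0" if "i < n" for i using that by (force simp: add_eq_0_iff)+
    have "x = 0"
    proof (rule ccontr)
      assume "x \<noteq> 0"
      then have "v = 0\<^sub>v n" using * v(1) by (intro eq_vecI) auto
      then show False using v by simp
    qed
    moreover have "y = 0"
    proof (rule ccontr)
      assume "y \<noteq> 0"
      then have "v' = 0\<^sub>v n" using * v'(1) by (intro eq_vecI) auto
      then show False using v' by simp
    qed
    ultimately show ?thesis by simp
  qed
  have "\<exists>x y. unit_vec n j = B *\<^sub>v v2 x y" for j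
  proof -
    have "unit_vec n j \<in> W" unfolding Wall by simp
    then show ?thesis unfolding W_def by blast
  qed
  \<comment> \<open>Coordinates of the unit vectors with respect to the columns of \<open>B\<close>
    are the columns of the inverse matrix \<open>C\<close>.\<close>
  then obtain X Y where XY: "\<And>j. unit_vec n j = B *\<^sub>v v2 (X j) (Y j)" by metis
  define C where "C = mat 2 n (\<lambda>(i, j). if i = 0 then X j else Y j)"
  have C [simp]: "C \<in> carrier_mat 2 n" unfolding C_def by simp
  note [simp] = carrier_matD[OF C] mult_mat_vec_carrier[OF C]
  have BC: "B * C = 1\<^sub>m n"
  proof (rule mat_col_eqI)
    fix j assume "j < dim_col (1\<^sub>m n :: complex mat)"
    then have j: "j < n" by simp
    have "col C j = v2 (X j) (Y j)" unfolding C_def using j by (intro vec2_eqI) auto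
    then show "col (B * C) j = col (1\<^sub>m n) j" using j XY[of j] by (simp add: col_mult2[OF B C])
  qed auto
  have CB: "C * B = 1\<^sub>m 2"
  proof (rule mat_eq_if_mult_vec_eq[OF mult_carrier_mat[OF C B] one_carrier_mat])
    fix w :: "complex vec" assume w: "w \<in> carrier_vec 2"
    obtain x y where xy: "w = v2 x y" using v2_exhaust[OF w] by blast
    obtain x' y' where xy': "C *\<^sub>v (B *\<^sub>v w) = v2 x' y'"
      using v2_exhaust[of "C *\<^sub>v (B *\<^sub>v w)"] w by auto
    have "B *\<^sub>v v2 x' y' = (B * C) *\<^sub>v (B *\<^sub>v w)"
      unfolding xy'[symmetric] using assoc_mult_mat_vec[OF B C, of "B *\<^sub>v w"] w by simp
    also have "\<dots> = B *\<^sub>v v2 x y" unfolding BC xy by simp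
    finally have "B *\<^sub>v (v2 x' y' - v2 x y) = 0\<^sub>v n"
      using mult_minus_distrib_mat_vec[OF B, of "v2 x' y'" "v2 x y"] by auto
    moreover have "v2 x' y' - v2 x y = v2 (x' - x) (y' - y)" by (rule vec2_eqI) auto
    ultimately have "x' = x" "y' = y" using inj[of "x' - x" "y' - y"] by auto
    then show "(C * B) *\<^sub>v w = 1\<^sub>m 2 *\<^sub>v w"
      using assoc_mult_mat_vec[OF C B w] xy' xy by simp
  qed
  have n2: "n = 2" using mat_mult_inverse_dim[OF B C BC CB] .
  define \<rho> where "\<rho> g = C * (\<phi> g * B)" for g
  have \<rho>c: "\<rho> g \<in> carrier_mat 2 2" if "g \<in> carrier G" for g unfolding \<rho>_def using that by auto
  have key: "\<rho> g = R" if R: "R \<in> carrier_mat 2 2" "\<And>x y. \<phi> g *\<^sub>v (B *\<^sub>v v2 x y) = B *\<^sub>v (R *\<^sub>v v2 x y)"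
    and g: "g \<in> carrier G" for R g
  proof -
    have "\<phi> g * B = B * R"
    proof (rule mat_eq_if_mult_vec_eq[OF mult_carrier_mat[OF cl[OF g] B] mult_carrier_mat[OF B R(1)]])
      fix w :: "complex vec" assume w: "w \<in> carrier_vec 2"
      then obtain x y where "w = v2 x y" using v2_exhaust by blast
      then show "(\<phi> g * B) *\<^sub>v w = (B * R) *\<^sub>v w"
        using assoc_mult_mat_vec[OF cl[OF g] B w] assoc_mult_mat_vec[OF B R(1) w] R(2) by simp
    qed
    then have "\<rho> g = C * (B * R)" unfolding \<rho>_def by simp
    also have "\<dots> = (C * B) * R" by (rule assoc_mult_mat[OF C B R(1), symmetric])
    finally show ?thesis unfolding CB using R(1) by simp
  qed
  have BCX: "B * (C * X) = X" if X: "X \<in> carrier_mat n k" for X k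
    using assoc_mult_mat[OF B C X] BC X by simp
  have rep\<rho>: "representation G 2 \<rho>"
  proof (rule representationI[OF is_group \<rho>c])
    fix x y assume x: "x \<in> carrier G" and y: "y \<in> carrier G"
    have xB: "\<phi> x * B \<in> carrier_mat n 2" and yB: "\<phi> y * B \<in> carrier_mat n 2"
      using mult_carrier_mat[OF cl B] x y by blast+
    have "\<rho> x * \<rho> y = C * ((\<phi> x * B) * (C * (\<phi> y * B)))"
      unfolding \<rho>_def by (rule assoc_mult_mat[OF C xB mult_carrier_mat[OF C yB]])
    also have "(\<phi> x * B) * (C * (\<phi> y * B)) = \<phi> x * (B * (C * (\<phi> y * B)))"
      by (rule assoc_mult_mat[OF cl[OF x] B mult_carrier_mat[OF C yB]])
    also have "\<dots> = \<phi> x * (\<phi> y * B)" unfolding BCX[OF yB] ..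
    also have "\<dots> = \<phi> (x \<otimes> y) * B"
      unfolding m[OF x y] by (rule assoc_mult_mat[OF cl[OF x] cl[OF y] B, symmetric])
    finally show "\<rho> (x \<otimes> y) = \<rho> x * \<rho> y" unfolding \<rho>_def by simp
  next
    show "\<rho> \<one> = 1\<^sub>m 2" unfolding \<rho>_def one using CB by simp
  qed
  have "standard_rep c \<rho>"
    unfolding standard_rep_def m2_uminus_one
    using rep\<rho> AB SB EB by (intro conjI key) (auto simp: m2_mult_vec A_def S_def)
  moreover have "rep_iso G n \<phi> 2 \<rho>"
    unfolding rep_iso_def
  proof (intro conjI n2 bexI[of _ C] ballI)
    show "C \<in> carrier (GL 2)" unfolding GL_carrier using B C BC CB unfolding n2 by blast
    fix g assume g: "g \<in> carrier G"
    have "\<rho> g * C = C * ((\<phi> g * B) * C)" unfolding \<rho>_def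
      by (rule assoc_mult_mat[OF C mult_carrier_mat[OF cl[OF g] B] C])
    also have "(\<phi> g * B) * C = \<phi> g * (B * C)" by (rule assoc_mult_mat[OF cl[OF g] B C])
    also have "\<dots> = \<phi> g" unfolding BC by (rule right_mult_one_mat[OF cl[OF g]])
    finally show "C * \<phi> g = \<rho> g * C" by simp
  qed
  ultimately show ?thesis using that n2 cN by blast
qed

end

subsection \<open>Determinants on subspaces\<close>

abbreviation cbasis :: "nat \<Rightarrow> complex vec set \<Rightarrow> complex vec set \<Rightarrow> bool" where
  "cbasis n W A \<equiv> vectorspace.basis class_ring ((cvec n)\<lparr>carrier := W\<rparr>) A"

text \<open>\<open>det_on\<close> is a definite description, so its value has to be found for every
  basis. Independence of the basis is established separately for the fixed spaces that occur: a
  line, zero and the full space.\<close>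

lemma det_on_eqI:
  assumes ex: "distinct bs0" "cbasis n W (set bs0)" "M0 \<in> carrier_mat (length bs0) (length bs0)"
      "A * mat_of_cols n bs0 = mat_of_cols n bs0 * M0" "det M0 = d"
    and un: "\<And>bs M. distinct bs \<Longrightarrow> cbasis n W (set bs) \<Longrightarrow> M \<in> carrier_mat (length bs) (length bs) \<Longrightarrow>
      A * mat_of_cols n bs = mat_of_cols n bs * M \<Longrightarrow> det M = d"
  shows "det_on n W A = d"
  unfolding det_on_def using ex un by (intro the_equality) blast+

lemma subspace_vectorspace:
  "VectorSpace.subspace class_ring W (cvec n) \<Longrightarrow> vectorspace class_ring ((cvec n)\<lparr>carrier := W\<rparr>)"
  by (rule vectorspace.subspace_is_vs[OF vec_vs])

lemma cbasis_card:
  assumes "VectorSpace.subspace class_ring W (cvec n)" "cbasis n W A" "finite A" "cbasis n W A'" "finite A'"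
  shows "card A = card A'"
proof -
  interpret W: vectorspace class_ring "(cvec n)\<lparr>carrier := W\<rparr>"
    using assms(1) by (rule subspace_vectorspace)
  show ?thesis using W.dim_basis assms by metis
qed

lemma line_subspace:
  assumes w: "w \<in> carrier_vec n"
  shows "VectorSpace.subspace class_ring {k \<cdot>\<^sub>v w | k :: complex. True} (cvec n)"
proof (rule subspace_cvecI)
  have "0 \<cdot>\<^sub>v w = 0\<^sub>v n" using w by (intro eq_vecI) auto
  then show "0\<^sub>v n \<in> {k \<cdot>\<^sub>v w | k :: complex. True}" by (metis (mono_tags, lifting) mem_Collect_eq)
  fix u v assume "u \<in> {k \<cdot>\<^sub>v w | k :: complex. True}" "v \<in> {k \<cdot>\<^sub>v w | k :: complex. True}"
  then obtain k l where "u = k \<cdot>\<^sub>v w" "v = l \<cdot>\<^sub>v w" by blast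
  then have "u + v = (k + l) \<cdot>\<^sub>v w" by (intro eq_vecI) (auto simp: algebra_simps)
  then show "u + v \<in> {k \<cdot>\<^sub>v w | k :: complex. True}" by blast
next
  fix k v assume "v \<in> {k \<cdot>\<^sub>v w | k :: complex. True}"
  then obtain l where "v = l \<cdot>\<^sub>v w" by blast
  then have "k \<cdot>\<^sub>v v = (k * l) \<cdot>\<^sub>v w" by (simp add: smult_smult_assoc)
  then show "k \<cdot>\<^sub>v v \<in> {k \<cdot>\<^sub>v w | k :: complex. True}" by blast
qed (use w in auto)

lemma line_basis:
  assumes w: "w \<in> carrier_vec n" "w \<noteq> 0\<^sub>v n" and W: "W = {k \<cdot>\<^sub>v w | k :: complex. True}"
  shows "cbasis n W {w}"
proof -
  interpret W: vectorspace class_ring "(cvec n)\<lparr>carrier := W\<rparr>"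
    using line_subspace[OF w(1)] unfolding W[symmetric] by (rule subspace_vectorspace)
  have kW: "k \<cdot>\<^sub>v w \<in> W" for k unfolding W by blast
  have wW: "w \<in> W" using kW[of 1] by simp
  have lc: "W.lincomb a {w} = a w \<cdot>\<^sub>v w" for a :: "complex vec \<Rightarrow> complex"
  proof -
    have "a w \<cdot>\<^sub>v w + 0\<^sub>v n = a w \<cdot>\<^sub>v w" using w(1) by simp
    then show ?thesis unfolding W.lincomb_def
      using kW by (subst W.finsum_insert) (auto simp: module_vec_simps)
  qed
  have nz: "k = 0" if "k \<cdot>\<^sub>v w = 0\<^sub>v n" for k :: complex
  proof (rule ccontr)
    assume "k \<noteq> 0"
    have "k * w $ i = 0" if "i < n" for i
      using arg_cong[OF \<open>k \<cdot>\<^sub>v w = 0\<^sub>v n\<close>, of "\<lambda>u. u $ i"] that w(1) by simp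
    then have "w = 0\<^sub>v n" using \<open>k \<noteq> 0\<close> w(1) by (intro eq_vecI) auto
    then show False using w by simp
  qed
  have "W.lin_indpt {w}"
  proof
    assume "W.lin_dep {w}"
    then obtain A a v where A: "finite A" "A \<subseteq> {w}" "W.lincomb a A = 0\<^sub>v n" "v \<in> A" "a v \<noteq> 0"
      unfolding W.lin_dep_def by (auto simp: module_vec_simps)
    then have "A = {w}" "v = w" by auto
    then show False using A lc[of a] nz by auto
  qed
  moreover have "W.span {w} = W"
  proof
    show "W.span {w} \<subseteq> W" using W.span_is_subset2[of "{w}"] wW by auto
    show "W \<subseteq> W.span {w}"
    proof
      fix v assume "v \<in> W"
      then obtain k where "v = W.lincomb (\<lambda>_. k) {w}" using lc W by auto
      then show "v \<in> W.span {w}" unfolding W.span_def by auto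
    qed
  qed
  ultimately show ?thesis unfolding W.basis_def using wW by simp
qed

lemma mat_of_cols_singleton_mult:
  "v \<in> carrier_vec n \<Longrightarrow> mat_of_cols n [v] * mat 1 1 (\<lambda>_. c) = mat_of_cols n [c \<cdot>\<^sub>v (v :: complex vec)]"
  by (rule eq_matI) (auto simp: scalar_prod_def mat_of_cols_def mult.commute)

lemma mult_mat_of_cols_singleton:
  "A \<in> carrier_mat n n \<Longrightarrow> v \<in> carrier_vec n \<Longrightarrow> A * mat_of_cols n [v] = mat_of_cols n [A *\<^sub>v (v :: complex vec)]"
  by (rule eq_matI) (auto simp: scalar_prod_def mat_of_cols_def)

lemma det_on_line:
  assumes w: "w \<in> carrier_vec n" "w \<noteq> 0\<^sub>v n" and A: "A \<in> carrier_mat n n"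
    and ev: "A *\<^sub>v w = d \<cdot>\<^sub>v w" and W: "W = {k \<cdot>\<^sub>v w | k :: complex. True}"
  shows "det_on n W A = d"
proof (rule det_on_eqI[of "[w]" _ _ "mat 1 1 (\<lambda>_. d)"])
  show "cbasis n W (set [w])" using line_basis[OF w W] by simp
  show "A * mat_of_cols n [w] = mat_of_cols n [w] * mat 1 1 (\<lambda>_. d)"
    using mat_of_cols_singleton_mult[OF w(1)] mult_mat_of_cols_singleton[OF A w(1)] ev by simp
  show "det (mat 1 1 (\<lambda>_. d)) = d" by (subst det_single) auto
next
  note sub = line_subspace[OF w(1), folded W]
  fix bs M assume bs: "distinct bs" "cbasis n W (set bs)" and M: "M \<in> carrier_mat (length bs) (length bs)"
    and eq: "A * mat_of_cols n bs = mat_of_cols n bs * M"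
  interpret W: vectorspace class_ring "(cvec n)\<lparr>carrier := W\<rparr>"
    using sub by (rule subspace_vectorspace)
  have nonzero: "carrier (class_ring :: complex ring) \<noteq> {\<zero>\<^bsub>class_ring\<^esub>}"
    by simp (metis UNIV_I singletonD zero_neq_one)
  have "card (set bs) = 1"
    using cbasis_card[OF sub bs(2) _ line_basis[OF w W]] by simp
  then have "length bs = 1" using distinct_card[OF bs(1)] by simp
  then obtain b where b: "bs = [b]" by (cases bs) auto
  have bW: "b \<in> W" and li: "W.lin_indpt {b}" using bs(2) unfolding W.basis_def b by auto
  have b0: "b \<noteq> 0\<^sub>v n" using W.zero_nin_lin_indpt[OF _ li nonzero] bW by (auto simp: module_vec_simps)
  obtain k where k: "b = k \<cdot>\<^sub>v w" using bW W by blast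
  have bc: "b \<in> carrier_vec n" unfolding k using w by simp
  have M1: "M = mat 1 1 (\<lambda>_. M $$ (0, 0))" using M b by (intro eq_matI) auto
  have Ab: "A *\<^sub>v b = d \<cdot>\<^sub>v b"
    unfolding k using mult_mat_vec[OF A w(1)] ev by (simp add: smult_smult_assoc mult.commute)
  have "mat_of_cols n [d \<cdot>\<^sub>v b] = mat_of_cols n [M $$ (0, 0) \<cdot>\<^sub>v b]"
    using eq mat_of_cols_singleton_mult[OF bc, of "M $$ (0, 0)"] M1
    unfolding b mult_mat_of_cols_singleton[OF A bc] Ab by metis
  then have "col (mat_of_cols n [d \<cdot>\<^sub>v b]) 0 = col (mat_of_cols n [M $$ (0, 0) \<cdot>\<^sub>v b]) 0" by simp
  then have eq': "d \<cdot>\<^sub>v b = M $$ (0, 0) \<cdot>\<^sub>v b" using bc by simp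
  obtain i where i: "i < n" "b $ i \<noteq> 0" using b0 bc by (metis carrier_vecD eq_vecI index_zero_vec)
  have "d * b $ i = M $$ (0, 0) * b $ i"
    using arg_cong[OF eq', of "\<lambda>v. v $ i"] i bc by simp
  then have "M $$ (0, 0) = d" using i by simp
  then show "det M = d" using M b by (subst det_single) auto
qed auto

lemma det_on_zero:
  assumes A: "A \<in> carrier_mat n n"
  shows "det_on n {0\<^sub>v n} A = 1"
proof -
  have sub: "VectorSpace.subspace class_ring {0\<^sub>v n} (cvec n)"
    by (rule subspace_cvecI) (auto intro: eq_vecI)
  interpret W: vectorspace class_ring "(cvec n)\<lparr>carrier := {0\<^sub>v n}\<rparr>"
    using sub by (rule subspace_vectorspace)
  have nonzero: "carrier (class_ring :: complex ring) \<noteq> {\<zero>\<^bsub>class_ring\<^esub>}"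
    by simp (metis UNIV_I singletonD zero_neq_one)
  have e: "bs = []" if "cbasis n {0\<^sub>v n} (set bs)" for bs
  proof -
    have "set bs \<subseteq> {0\<^sub>v n}" "W.lin_indpt (set bs)" using that unfolding W.basis_def by auto
    then have "0\<^sub>v n \<notin> set bs" using W.zero_nin_lin_indpt[of "set bs"] nonzero by (auto simp: module_vec_simps)
    then show ?thesis using \<open>set bs \<subseteq> {0\<^sub>v n}\<close> by (cases bs) auto
  qed
  show ?thesis
  proof (rule det_on_eqI[of "[]" _ _ "1\<^sub>m 0"])
    have "W.lin_indpt {}" unfolding W.lin_dep_def by auto
    moreover have "W.span {} = {0\<^sub>v n}"
      unfolding W.span_def by (auto simp: W.lincomb_def module_vec_simps)
    ultimately show "cbasis n {0\<^sub>v n} (set [])" unfolding W.basis_def by simp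
    show "A * mat_of_cols n [] = mat_of_cols n [] * 1\<^sub>m 0" using A by (intro eq_matI) auto
    show "det (1\<^sub>m 0 :: complex mat) = 1" by simp
    fix bs and M :: "complex mat" assume "cbasis n {0\<^sub>v n} (set bs)" "M \<in> carrier_mat (length bs) (length bs)"
    then show "det M = 1" using e[of bs] by (auto simp: det_dim_zero)
  qed auto
qed

lemma mat_of_cols_unit_vecs: "mat_of_cols n (unit_vecs n) = (1\<^sub>m n :: complex mat)"
  by (rule eq_matI) (auto simp: mat_of_cols_def unit_vecs_def)

lemma det_on_full:
  assumes A: "A \<in> carrier_mat n n"
  shows "det_on n (carrier_vec n) A = det A"
proof -
  interpret V: vec_space "TYPE(complex)" n .
  have c: "(cvec n)\<lparr>carrier := carrier_vec n\<rparr> = cvec n" by (simp add: module_vec_def)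
  show ?thesis
  proof (rule det_on_eqI[of "unit_vecs n" _ _ A])
    show "cbasis n (carrier_vec n) (set (unit_vecs n))" unfolding c by (rule V.unit_vecs_basis)
    show "A \<in> carrier_mat (length (unit_vecs n)) (length (unit_vecs n))" using A by simp
    show "A * mat_of_cols n (unit_vecs n) = mat_of_cols n (unit_vecs n) * A"
      unfolding mat_of_cols_unit_vecs using A by simp
    fix bs M assume bs: "distinct bs" "cbasis n (carrier_vec n) (set bs)"
      and M: "M \<in> carrier_mat (length bs) (length bs)"
      and eq: "A * mat_of_cols n bs = mat_of_cols n bs * M"
    note basis = bs(2)[unfolded c V.basis_def]
    have "card (set bs) = n" using V.dim_basis[OF _ bs(2)[unfolded c]] V.dim_is_n by simp
    then have len: "length bs = n" using distinct_card[OF bs(1)] by simp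
    \<comment> \<open>The basis vectors form a matrix with A Q = Q M, and cancelling det Q leaves
      det M = det A. That \<open>Q\<close> is invertible comes from spanning: preimages of the unit
      vectors are the columns of an inverse.\<close>
    define Q where "Q = mat_of_cols n bs"
    have Q: "Q \<in> carrier_mat n n" unfolding Q_def using len mat_of_cols_carrier(1)[of n bs] by simp
    have bsc: "set bs \<subseteq> carrier_vec n" using basis by auto
    have "\<exists>x\<in>carrier_vec n. Q *\<^sub>v x = unit_vec n j" for j
    proof -
      have "unit_vec n j \<in> V.span_list bs" unfolding V.span_list_as_span[OF bsc] using basis by auto
      then obtain f where "unit_vec n j = V.lincomb_list f bs" unfolding V.span_list_def by blast
      also have "\<dots> = Q *\<^sub>v vec (length bs) f" unfolding Q_def
        by (rule V.lincomb_list_as_mat_mult) (use bsc in auto)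
      finally show ?thesis using len by (metis vec_carrier)
    qed
    then obtain f where f: "\<And>j. f j \<in> carrier_vec n" "\<And>j. Q *\<^sub>v f j = unit_vec n j" by metis
    define C where "C = mat n n (\<lambda>(i, j). f j $ i)"
    have C: "C \<in> carrier_mat n n" unfolding C_def by simp
    have "Q * C = 1\<^sub>m n"
    proof (rule mat_col_eqI)
      fix j assume "j < dim_col (1\<^sub>m n :: complex mat)"
      then have j: "j < n" by simp
      have "col C j = f j" unfolding C_def using j f(1)[of j] by (intro eq_vecI) auto
      then show "col (Q * C) j = col (1\<^sub>m n) j" using j f(2)[of j] by (simp add: col_mult2[OF Q C])
    qed (use Q C in auto)
    then have "det Q * det C = 1" using det_mult[OF Q C] by simp
    then have "det Q \<noteq> 0" by auto
    moreover have "det A * det Q = det Q * det M"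
      using arg_cong[OF eq, of det] det_mult[OF A Q] det_mult[OF Q, of M] M
      unfolding Q_def[symmetric] len by simp
    ultimately show "det M = det A" by (simp add: mult.commute)
  qed (simp_all add: V.unit_vecs_distinct)
qed



subsection \<open>Number fields and their automorphisms\<close>

text \<open>Closure conditions on the bare set. With the convention \<open>inverse 0 = 0\<close> the
  last clause can range over all elements.\<close>

definition csubfield :: "complex set \<Rightarrow> bool" where
  "csubfield F \<longleftrightarrow> 1 \<in> F \<and> (\<forall>x\<in>F. \<forall>y\<in>F. x + y \<in> F \<and> x * y \<in> F) \<and> (\<forall>x\<in>F. - x \<in> F \<and> inverse x \<in> F)"

abbreviation gen :: "complex set \<Rightarrow> complex set" where
  "gen H \<equiv> generate_field (class_ring :: complex ring) H"

lemma csubfieldD: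
  assumes "csubfield F"
  shows csubfield_one: "1 \<in> F" and csubfield_zero: "0 \<in> F"
    and csubfield_add: "x \<in> F \<Longrightarrow> y \<in> F \<Longrightarrow> x + y \<in> F"
    and csubfield_mult: "x \<in> F \<Longrightarrow> y \<in> F \<Longrightarrow> x * y \<in> F"
    and csubfield_uminus: "x \<in> F \<Longrightarrow> - x \<in> F"
    and csubfield_inverse: "x \<in> F \<Longrightarrow> inverse x \<in> F"
    and csubfield_diff: "x \<in> F \<Longrightarrow> y \<in> F \<Longrightarrow> x - y \<in> F"
    and csubfield_divide: "x \<in> F \<Longrightarrow> y \<in> F \<Longrightarrow> x / y \<in> F"
    and csubfield_power: "x \<in> F \<Longrightarrow> x ^ n \<in> F"
proof -
  note a = assms[unfolded csubfield_def]
  show one: "1 \<in> F" using a by blast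
  have "1 + (- 1) \<in> F" using a by blast
  then show "0 \<in> F" by simp
  show "x + y \<in> F" "x * y \<in> F" if "x \<in> F" "y \<in> F" using a that by blast+
  show "- x \<in> F" "inverse x \<in> F" if "x \<in> F" using a that by blast+
  show "x - y \<in> F" if "x \<in> F" "y \<in> F" using a that by (metis uminus_add_conv_diff add.commute)
  show "x / y \<in> F" if "x \<in> F" "y \<in> F" using a that by (metis divide_inverse)
  show "x ^ n \<in> F" if "x \<in> F" using a that one by (induction n) auto
qed

lemma csubfield_of_nat: "csubfield F \<Longrightarrow> of_nat n \<in> F"
  by (induction n) (auto simp: csubfield_zero csubfield_one csubfield_add)

lemma csubfield_of_int: "csubfield F \<Longrightarrow> of_int n \<in> F"
  by (cases n rule: int_cases2) (auto simp: csubfield_of_nat csubfield_uminus)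

lemma csubfield_Rats: "csubfield F \<Longrightarrow> \<rat> \<subseteq> F"
  by (auto elim!: Rats_cases' simp: csubfield_of_int csubfield_divide)

lemma csubfield_sum: "csubfield F \<Longrightarrow> (\<And>i. i \<in> I \<Longrightarrow> f i \<in> F) \<Longrightarrow> (\<Sum>i\<in>I. f i) \<in> F"
  by (induction I rule: infinite_finite_induct) (auto simp: csubfield_zero csubfield_add)

lemma csubfield_prod: "csubfield F \<Longrightarrow> (\<And>i. i \<in> I \<Longrightarrow> f i \<in> F) \<Longrightarrow> (\<Prod>i\<in>I. f i) \<in> F"
  by (induction I rule: infinite_finite_induct) (auto simp: csubfield_one csubfield_mult)

lemma csubfield_gen: "csubfield (gen H)"
proof -
  have "inverse x \<in> gen H" if "x \<in> gen H" for x
  proof (cases "x = 0")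
    case False
    then show ?thesis using generate_field.m_inv[OF that] by (simp add: class_ring_simps)
  next
    case True
    then show ?thesis using that by simp
  qed
  then show ?thesis unfolding csubfield_def
    using generate_field.one[of "class_ring :: complex ring" H]
      generate_field.eng_add[of _ "class_ring :: complex ring" H]
      generate_field.eng_mult[of _ "class_ring :: complex ring" H]
      generate_field.a_inv[of _ "class_ring :: complex ring" H]
    by (auto simp: class_ring_simps)
qed

lemma gen_incl: "x \<in> H \<Longrightarrow> x \<in> gen H"
  by (rule generate_field.incl)

lemma gen_least:
  assumes M: "csubfield M" and H: "H \<subseteq> M"
  shows "gen H \<subseteq> M"
proof
  fix x assume "x \<in> gen H"
  then show "x \<in> M"
    by induction (use M H in \<open>auto simp: class_ring_simps csubfieldD split: if_splits\<close>)
qed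

lemma gen_eqI: "H \<subseteq> gen H' \<Longrightarrow> H' \<subseteq> gen H \<Longrightarrow> gen H = gen H'"
  by (intro equalityI gen_least csubfield_gen)

lemma gen_mono: "H \<subseteq> gen H' \<Longrightarrow> gen H \<subseteq> gen H'"
  by (intro gen_least csubfield_gen)

lemma mem_Gal_iff:
  "\<sigma> \<in> carrier (Gal L F) \<longleftrightarrow> \<sigma> \<in> extensional L \<and> bij_betw \<sigma> L L \<and>
     (\<forall>x\<in>L. \<forall>y\<in>L. \<sigma> (x + y) = \<sigma> x + \<sigma> y \<and> \<sigma> (x * y) = \<sigma> x * \<sigma> y) \<and> \<sigma> 1 = 1 \<and> (\<forall>x\<in>F. \<sigma> x = x)"
  unfolding Gal_def Bij_def Ring.ring_hom_def field_of_def by (auto simp: bij_betw_def Pi_iff)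

lemma Gal_mult: "\<sigma> \<in> carrier (Gal L F) \<Longrightarrow> \<tau> \<in> carrier (Gal L F) \<Longrightarrow> \<sigma> \<otimes>\<^bsub>Gal L F\<^esub> \<tau> = compose L \<sigma> \<tau>"
  unfolding Gal_def BijGroup_def by auto

lemma Gal_one: "\<one>\<^bsub>Gal L F\<^esub> = (\<lambda>x\<in>L. x)"
  unfolding Gal_def BijGroup_def by auto

lemma Gal_group:
  assumes L: "csubfield L" and F: "F \<subseteq> L"
  shows "group (Gal L F)"
proof -
  interpret B: group "BijGroup L" by (rule group_BijGroup)
  have sub: "carrier (Gal L F) \<subseteq> carrier (BijGroup L)"
    unfolding Gal_def BijGroup_def by auto
  have "subgroup (carrier (Gal L F)) (BijGroup L)"
  proof (rule B.subgroupI)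
    show "carrier (Gal L F) \<subseteq> carrier (BijGroup L)" by fact
    have "(\<lambda>x\<in>L. x) \<in> carrier (Gal L F)"
      using id_Bij[of L] F csubfieldD[OF L] unfolding mem_Gal_iff Bij_def by auto
    then show "carrier (Gal L F) \<noteq> {}" by blast
  next
    fix \<sigma> assume \<sigma>: "\<sigma> \<in> carrier (Gal L F)"
    then have \<sigma>B: "\<sigma> \<in> Bij L" unfolding Gal_def by simp
    have inv: "inv\<^bsub>BijGroup L\<^esub> \<sigma> = (\<lambda>x\<in>L. inv_into L \<sigma> x)" by (rule inv_BijGroup[OF \<sigma>B])
    let ?\<tau> = "\<lambda>x\<in>L. inv_into L \<sigma> x"
    note s = \<sigma>[unfolded mem_Gal_iff]
    have bij: "bij_betw \<sigma> L L" using s by blast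
    have cl: "inv_into L \<sigma> x \<in> L" "\<sigma> (inv_into L \<sigma> x) = x" if "x \<in> L" for x
      using bij that by (auto simp: bij_betw_def inv_into_into f_inv_into_f)
    have eq: "inv_into L \<sigma> y = x" if "x \<in> L" "\<sigma> x = y" for x y
      using bij that by (auto simp: bij_betw_def)
    have "?\<tau> \<in> carrier (Gal L F)"
      unfolding mem_Gal_iff
    proof (intro conjI ballI)
      show "bij_betw ?\<tau> L L" using restrict_inv_into_Bij[OF \<sigma>B] unfolding Bij_def by blast
      show "?\<tau> 1 = 1" using s eq[of 1 1] csubfield_one[OF L] by simp
      show "?\<tau> x = x" if "x \<in> F" for x using s eq[of x x] F that by auto
      fix x y assume xy: "x \<in> L" "y \<in> L"
      show "?\<tau> (x + y) = ?\<tau> x + ?\<tau> y" using xy csubfieldD[OF L] cl s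
        by simp (intro eq, auto)
      show "?\<tau> (x * y) = ?\<tau> x * ?\<tau> y" using xy csubfieldD[OF L] cl s
        by simp (intro eq, auto)
    qed auto
    then show "inv\<^bsub>BijGroup L\<^esub> \<sigma> \<in> carrier (Gal L F)" unfolding inv .
  next
    fix \<sigma> \<tau> assume \<sigma>: "\<sigma> \<in> carrier (Gal L F)" and \<tau>: "\<tau> \<in> carrier (Gal L F)"
    then have "\<sigma> \<otimes>\<^bsub>BijGroup L\<^esub> \<tau> = compose L \<sigma> \<tau>" unfolding Gal_def BijGroup_def by auto
    moreover have "compose L \<sigma> \<tau> \<in> carrier (Gal L F)"
      using \<sigma> \<tau> F csubfieldD[OF L] unfolding mem_Gal_iff
      by (auto simp: compose_eq bij_betw_compose bij_betwE)
    ultimately show "\<sigma> \<otimes>\<^bsub>BijGroup L\<^esub> \<tau> \<in> carrier (Gal L F)" by simp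
  qed
  then have "group ((BijGroup L)\<lparr>carrier := carrier (Gal L F)\<rparr>)"
    by (rule B.subgroup_imp_group)
  moreover have "(BijGroup L)\<lparr>carrier := carrier (Gal L F)\<rparr> = Gal L F" unfolding Gal_def by simp
  ultimately show ?thesis by simp
qed

lemma Gal_mono: "\<sigma> \<in> carrier (Gal L F) \<Longrightarrow> F' \<subseteq> F \<Longrightarrow> \<sigma> \<in> carrier (Gal L F')"
  unfolding mem_Gal_iff by blast

locale number_field =
  fixes L :: "complex set"
  assumes subfield: "csubfield L"
begin

abbreviation "G \<equiv> Gal L \<rat>"

definition "OL = {x \<in> L. algebraic_int x}"

sublocale G: group G
  by (rule Gal_group[OF subfield csubfield_Rats[OF subfield]])

lemmas L_closed = csubfieldD[OF subfield]

context
  fixes \<sigma> assumes \<sigma>: "\<sigma> \<in> carrier G"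
begin

lemma Gal_closed: "x \<in> L \<Longrightarrow> \<sigma> x \<in> L"
  using \<sigma> unfolding mem_Gal_iff by (auto dest: bij_betwE)

lemma Gal_add: "x \<in> L \<Longrightarrow> y \<in> L \<Longrightarrow> \<sigma> (x + y) = \<sigma> x + \<sigma> y"
  and Gal_mul: "x \<in> L \<Longrightarrow> y \<in> L \<Longrightarrow> \<sigma> (x * y) = \<sigma> x * \<sigma> y"
  and Gal_1: "\<sigma> 1 = 1" and Gal_rat: "x \<in> \<rat> \<Longrightarrow> \<sigma> x = x"
  using \<sigma> unfolding mem_Gal_iff by blast+

lemma Gal_0: "\<sigma> 0 = 0"
  by (rule Gal_rat) simp

lemma Gal_uminus: "x \<in> L \<Longrightarrow> \<sigma> (- x) = - \<sigma> x"
  using Gal_add[of x "- x"] L_closed Gal_0 by (simp add: add_eq_0_iff)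

lemma Gal_diff: "x \<in> L \<Longrightarrow> y \<in> L \<Longrightarrow> \<sigma> (x - y) = \<sigma> x - \<sigma> y"
  using Gal_add[of x "- y"] Gal_uminus[of y] L_closed by simp

lemma Gal_pow: "x \<in> L \<Longrightarrow> \<sigma> (x ^ n) = \<sigma> x ^ n"
  by (induction n) (auto simp: Gal_1 Gal_mul L_closed)

lemma Gal_of_int: "\<sigma> (of_int k) = of_int k"
  by (rule Gal_rat) simp

lemma Gal_of_nat: "\<sigma> (of_nat k) = of_nat k"
  by (rule Gal_rat) simp

lemma Gal_inj: "x \<in> L \<Longrightarrow> y \<in> L \<Longrightarrow> \<sigma> x = \<sigma> y \<longleftrightarrow> x = y"
  using \<sigma> unfolding mem_Gal_iff bij_betw_def by (auto dest: inj_onD)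

lemma Gal_eq_0: "x \<in> L \<Longrightarrow> \<sigma> x = 0 \<longleftrightarrow> x = 0"
  using Gal_inj[of x 0] Gal_0 L_closed by simp

lemma Gal_inverse: "x \<in> L \<Longrightarrow> \<sigma> (inverse x) = inverse (\<sigma> x)"
proof (cases "x = 0")
  case False
  assume x: "x \<in> L"
  have "\<sigma> (inverse x) * \<sigma> x = 1" using Gal_mul[of "inverse x" x] x False L_closed Gal_1 by simp
  then show ?thesis by (metis inverse_unique mult.commute)
qed (simp add: Gal_0)

lemma Gal_divide: "x \<in> L \<Longrightarrow> y \<in> L \<Longrightarrow> \<sigma> (x / y) = \<sigma> x / \<sigma> y"
  by (simp add: divide_inverse Gal_mul Gal_inverse L_closed)

lemma Gal_sum: "(\<And>i. i \<in> I \<Longrightarrow> f i \<in> L) \<Longrightarrow> \<sigma> (\<Sum>i\<in>I. f i) = (\<Sum>i\<in>I. \<sigma> (f i))"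
  by (induction I rule: infinite_finite_induct) (auto simp: Gal_0 Gal_add csubfield_sum[OF subfield])

lemma Gal_prod: "(\<And>i. i \<in> I \<Longrightarrow> f i \<in> L) \<Longrightarrow> \<sigma> (\<Prod>i\<in>I. f i) = (\<Prod>i\<in>I. \<sigma> (f i))"
  by (induction I rule: infinite_finite_induct) (auto simp: Gal_1 Gal_mul csubfield_prod[OF subfield])

lemma Gal_algebraic_int: "x \<in> L \<Longrightarrow> algebraic_int x \<Longrightarrow> algebraic_int (\<sigma> x)"
proof -
  assume x: "x \<in> L" and "algebraic_int x"
  then obtain p where p: "poly (map_poly of_int p) x = 0" "lead_coeff p = 1"
    unfolding algebraic_int_altdef_ipoly by blast
  have ev: "poly (map_poly of_int p) y = (\<Sum>i\<le>degree p. of_int (coeff p i) * y ^ i)" for y :: complex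
    by (simp add: poly_altdef)
  have "\<sigma> (\<Sum>i\<le>degree p. of_int (coeff p i) * x ^ i) = (\<Sum>i\<le>degree p. of_int (coeff p i) * \<sigma> x ^ i)"
    using x by (subst Gal_sum) (auto simp: Gal_mul Gal_of_int Gal_pow L_closed csubfield_of_int[OF subfield])
  then have "poly (map_poly of_int p) (\<sigma> x) = \<sigma> (poly (map_poly of_int p) x)" unfolding ev by simp
  then have "poly (map_poly of_int p) (\<sigma> x) = 0" using p(1) Gal_0 by simp
  then show ?thesis unfolding algebraic_int_altdef_ipoly using p(2) by blast
qed

lemma Gal_OL: "x \<in> OL \<Longrightarrow> \<sigma> x \<in> OL"
  unfolding OL_def using Gal_closed Gal_algebraic_int by blast

end

lemma Gal_comp: "\<sigma> \<in> carrier G \<Longrightarrow> \<tau> \<in> carrier G \<Longrightarrow> x \<in> L \<Longrightarrow> (\<sigma> \<otimes>\<^bsub>G\<^esub> \<tau>) x = \<sigma> (\<tau> x)"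
  by (simp add: Gal_mult compose_eq)

lemma Gal_one_apply: "x \<in> L \<Longrightarrow> \<one>\<^bsub>G\<^esub> x = x"
  by (simp add: Gal_one)

lemma Gal_surj:
  assumes "\<sigma> \<in> carrier G" "x \<in> OL"
  obtains y where "y \<in> OL" "\<sigma> y = x"
proof -
  have i: "inv\<^bsub>G\<^esub> \<sigma> \<in> carrier G" using assms by simp
  have x: "x \<in> L" using assms(2) OL_def by simp
  have "\<sigma> ((inv\<^bsub>G\<^esub> \<sigma>) x) = x"
    using Gal_comp[OF assms(1) i x] Gal_one_apply[OF x] assms(1) by simp
  then show ?thesis using that[of "(inv\<^bsub>G\<^esub> \<sigma>) x"] Gal_OL[OF i assms(2)] by simp
qed

text \<open>The elements on which two automorphisms agree form a subfield, so generators suffice;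
  outside \<open>L\<close> both functions are \<open>undefined\<close>.\<close>

lemma Gal_eqI:
  assumes L: "L = gen H" and \<sigma>: "\<sigma> \<in> carrier G" and \<tau>: "\<tau> \<in> carrier G"
    and eq: "\<And>x. x \<in> H \<Longrightarrow> \<sigma> x = \<tau> x"
  shows "\<sigma> = \<tau>"
proof -
  have "csubfield {x \<in> L. \<sigma> x = \<tau> x}"
    unfolding csubfield_def using L_closed
    by (auto simp: Gal_add[OF \<sigma>] Gal_add[OF \<tau>] Gal_mul[OF \<sigma>] Gal_mul[OF \<tau>] Gal_1[OF \<sigma>] Gal_1[OF \<tau>]
      Gal_uminus[OF \<sigma>] Gal_uminus[OF \<tau>] Gal_inverse[OF \<sigma>] Gal_inverse[OF \<tau>])
  moreover have "H \<subseteq> {x \<in> L. \<sigma> x = \<tau> x}" using eq L gen_incl by blast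
  ultimately have "L \<subseteq> {x \<in> L. \<sigma> x = \<tau> x}" using gen_least L by blast
  moreover have "\<sigma> \<in> extensional L" "\<tau> \<in> extensional L" using \<sigma> \<tau> unfolding mem_Gal_iff by auto
  ultimately show ?thesis by (intro extensionalityI[of _ L]) auto
qed

lemma Gal_gen_fixed:
  assumes \<sigma>: "\<sigma> \<in> carrier G" and \<tau>: "\<tau> \<in> carrier G" and H: "H \<subseteq> L"
    and eq: "\<And>x. x \<in> H \<Longrightarrow> \<sigma> x = \<tau> x" and x: "x \<in> gen H"
  shows "\<sigma> x = \<tau> x"
proof -
  have "csubfield {x \<in> L. \<sigma> x = \<tau> x}"
    unfolding csubfield_def using L_closed
    by (auto simp: Gal_add[OF \<sigma>] Gal_add[OF \<tau>] Gal_mul[OF \<sigma>] Gal_mul[OF \<tau>] Gal_1[OF \<sigma>] Gal_1[OF \<tau>]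
      Gal_uminus[OF \<sigma>] Gal_uminus[OF \<tau>] Gal_inverse[OF \<sigma>] Gal_inverse[OF \<tau>])
  then have "gen H \<subseteq> {x \<in> L. \<sigma> x = \<tau> x}" by (rule gen_least) (use eq H in auto)
  then show ?thesis using x by blast
qed

lemma OL_closed:
  shows OL_one: "1 \<in> OL" and OL_zero: "0 \<in> OL"
    and OL_add: "x \<in> OL \<Longrightarrow> y \<in> OL \<Longrightarrow> x + y \<in> OL"
    and OL_mult: "x \<in> OL \<Longrightarrow> y \<in> OL \<Longrightarrow> x * y \<in> OL"
    and OL_diff: "x \<in> OL \<Longrightarrow> y \<in> OL \<Longrightarrow> x - y \<in> OL"
    and OL_uminus: "x \<in> OL \<Longrightarrow> - x \<in> OL"
    and OL_power: "x \<in> OL \<Longrightarrow> x ^ n \<in> OL"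
    and OL_of_int: "of_int k \<in> OL" and OL_of_nat: "of_nat m \<in> OL"
  unfolding OL_def using L_closed csubfield_of_int[OF subfield] csubfield_of_nat[OF subfield]
  by (auto intro: algebraic_int_add algebraic_int_mult algebraic_int_diff algebraic_int_power
      algebraic_int_of_int algebraic_int_of_nat int_imp_algebraic_int)

lemma OL_sum: "(\<And>i. i \<in> I \<Longrightarrow> f i \<in> OL) \<Longrightarrow> (\<Sum>i\<in>I. f i) \<in> OL"
  by (induction I rule: infinite_finite_induct) (auto simp: OL_closed)

lemma OL_L: "x \<in> OL \<Longrightarrow> x \<in> L"
  unfolding OL_def by simp

lemma integer_ring_eq: "integer_ring L = class_ring\<lparr>carrier := OL\<rparr>"
  unfolding integer_ring_def field_of_def OL_def by simp

lemma integer_ring_cring: "cring (integer_ring L)"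
proof (rule cringI)
  show "abelian_group (integer_ring L)"
    unfolding integer_ring_eq
    by (rule abelian_groupI) (auto simp: OL_closed intro!: bexI[of _ "- _"])
  show "comm_monoid (integer_ring L)"
    unfolding integer_ring_eq by (rule comm_monoidI) (auto simp: OL_closed)
qed (auto simp: integer_ring_eq distrib_right)

end

subsection \<open>Primes above a rational prime\<close>

context number_field
begin

lemma integer_ring_simps:
  "carrier (integer_ring L) = OL" "\<one>\<^bsub>integer_ring L\<^esub> = 1" "\<zero>\<^bsub>integer_ring L\<^esub> = 0"
  "x \<otimes>\<^bsub>integer_ring L\<^esub> y = x * y" "x \<oplus>\<^bsub>integer_ring L\<^esub> y = x + y"
  unfolding integer_ring_eq by simp_all

lemma integer_ring_uminus: "x \<in> OL \<Longrightarrow> \<ominus>\<^bsub>integer_ring L\<^esub> x = - x"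
proof -
  interpret R: cring "integer_ring L" by (rule integer_ring_cring)
  assume x: "x \<in> OL"
  show ?thesis
    by (rule R.minus_equality) (use x OL_uminus in \<open>auto simp: integer_ring_simps\<close>)
qed

lemma ideal_OL_iff: "ideal I (integer_ring L) \<longleftrightarrow>
    I \<subseteq> OL \<and> 0 \<in> I \<and> (\<forall>x\<in>I. \<forall>y\<in>I. x + y \<in> I) \<and> (\<forall>x\<in>OL. \<forall>y\<in>I. x * y \<in> I)"
proof
  interpret R: cring "integer_ring L" by (rule integer_ring_cring)
  {
    assume "ideal I (integer_ring L)"
    then interpret I: ideal I "integer_ring L" .
    show "I \<subseteq> OL \<and> 0 \<in> I \<and> (\<forall>x\<in>I. \<forall>y\<in>I. x + y \<in> I) \<and> (\<forall>x\<in>OL. \<forall>y\<in>I. x * y \<in> I)"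
      using I.a_subset I.I_l_closed I.a_closed additive_subgroup.zero_closed[OF I.is_additive_subgroup]
      by (auto simp: integer_ring_simps)
  next
    assume I: "I \<subseteq> OL \<and> 0 \<in> I \<and> (\<forall>x\<in>I. \<forall>y\<in>I. x + y \<in> I) \<and> (\<forall>x\<in>OL. \<forall>y\<in>I. x * y \<in> I)"
    then have comm: "\<forall>x\<in>OL. \<forall>y\<in>I. y * x \<in> I" by (simp add: mult.commute)
    have neg: "- x \<in> I" if "x \<in> I" for x
      using I that OL_uminus[OF OL_one] by (metis mult_minus1)
    show "ideal I (integer_ring L)"
    proof (rule idealI)
      show "subgroup I (add_monoid (integer_ring L))"
        by (rule R.add.subgroupI) (use I neg integer_ring_uminus in
          \<open>auto simp: integer_ring_simps a_inv_def[symmetric]\<close>)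
    qed (use I comm R.ring_axioms in \<open>auto simp: integer_ring_simps\<close>)
  }
qed

text \<open>Zorn's lemma for the ideals that contain l but not 1. The principal ideal of l is one of
  them: if 1 = x l, then x = 1/l would be a rational algebraic integer and hence an integer.\<close>

lemma primes_above_nonempty:
  assumes l: "prime (l :: nat)"
  shows "primes_above L l \<noteq> {}"
proof -
  let ?R = "integer_ring L"
  interpret R: cring ?R by (rule integer_ring_cring)
  define \<A> where "\<A> = {I. ideal I ?R \<and> of_nat l \<in> I \<and> 1 \<notin> I}"
  have "PIdl\<^bsub>?R\<^esub> (of_nat l) \<in> \<A>"
    unfolding \<A>_def
  proof (intro CollectI conjI)
    show "ideal (PIdl\<^bsub>?R\<^esub> (of_nat l)) ?R"
      by (rule R.cgenideal_ideal) (simp add: integer_ring_simps OL_of_nat)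
    show "of_nat l \<in> PIdl\<^bsub>?R\<^esub> (of_nat l)"
      by (rule R.cgenideal_self) (simp add: integer_ring_simps OL_of_nat)
    show "1 \<notin> PIdl\<^bsub>?R\<^esub> (of_nat l)"
    proof
      assume "1 \<in> PIdl\<^bsub>?R\<^esub> (of_nat l)"
      then obtain x where x: "x \<in> OL" "1 = x * of_nat l"
        unfolding cgenideal_def by (auto simp: integer_ring_simps)
      then have xl: "x = 1 / of_nat l" using l prime_gt_0_nat[OF l] by (simp add: field_simps)
      then have "x \<in> \<rat>" by simp
      then have "x \<in> \<int>" using x(1) algebraic_int_rat unfolding OL_def by blast
      then obtain k where "x = of_int k" by (rule Ints_cases)
      then have "of_int (k * int l) = (1 :: complex)" using x(2) by simp
      then have "k * int l = 1" by (metis of_int_eq_1_iff)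
      then show False using prime_gt_1_nat[OF l] by (auto simp: zmult_eq_1_iff)
    qed
  qed
  moreover have "\<Union>C \<in> \<A>" if C: "C \<noteq> {}" "subset.chain \<A> C" for C
  proof -
    have I: "\<And>I. I \<in> C \<Longrightarrow> ideal I ?R" and tot: "\<And>I J. I \<in> C \<Longrightarrow> J \<in> C \<Longrightarrow> I \<subseteq> J \<or> J \<subseteq> I"
      using C(2) unfolding \<A>_def subset.chain_def by auto
    have "x + y \<in> \<Union>C" if xy: "x \<in> \<Union>C" "y \<in> \<Union>C" for x y
    proof -
      obtain I J where IJ: "I \<in> C" "J \<in> C" "x \<in> I" "y \<in> J" using xy by blast
      then obtain K where "K \<in> C" "x \<in> K" "y \<in> K" using tot[OF IJ(1,2)] by blast
      then show ?thesis using I[of K] unfolding ideal_OL_iff by blast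
    qed
    moreover have "\<Union>C \<subseteq> OL" "0 \<in> \<Union>C" "\<And>x y. x \<in> OL \<Longrightarrow> y \<in> \<Union>C \<Longrightarrow> x * y \<in> \<Union>C"
      using I C(1) unfolding ideal_OL_iff by blast+
    ultimately have "ideal (\<Union>C) ?R" unfolding ideal_OL_iff by blast
    then show ?thesis using C unfolding \<A>_def subset.chain_def by auto
  qed
  ultimately obtain M where M: "M \<in> \<A>" "\<And>X. X \<in> \<A> \<Longrightarrow> M \<subseteq> X \<Longrightarrow> X = M"
    using subset_Zorn_nonempty[of \<A>] by blast
  have "maximalideal M ?R"
  proof (rule maximalidealI)
    show "ideal M ?R" using M(1) \<A>_def by simp
    show "carrier ?R \<noteq> M" using M(1) OL_one unfolding \<A>_def by (auto simp: integer_ring_simps)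
    fix J assume J: "ideal J ?R" "M \<subseteq> J" "J \<subseteq> carrier ?R"
    show "J = M \<or> J = carrier ?R"
    proof (cases "1 \<in> J")
      case True
      then have "J = carrier ?R" using ideal.one_imp_carrier[OF J(1)] by (simp add: integer_ring_simps)
      then show ?thesis by simp
    next
      case False
      then have "J \<in> \<A>" using J M(1) unfolding \<A>_def by auto
      then show ?thesis using M(2) J(2) by blast
    qed
  qed
  then have "primeideal M ?R" by (rule R.maximalideal_prime)
  then show ?thesis using M(1) unfolding primes_above_def \<A>_def by blast
qed

end

locale prime_above = number_field +
  fixes P :: "complex set" and l :: nat
  assumes P: "P \<in> primes_above L l" and prime_l: "prime l"
begin

lemma P_primeideal: "primeideal P (integer_ring L)"
  using P unfolding primes_above_def by simp

lemma P_OL: "x \<in> P \<Longrightarrow> x \<in> OL"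
proof -
  interpret p: primeideal P "integer_ring L" by (rule P_primeideal)
  show "x \<in> P \<Longrightarrow> x \<in> OL" using p.Icarr by (simp add: integer_ring_simps)
qed

lemma P_closed:
  shows P_0: "0 \<in> P" and P_add: "x \<in> P \<Longrightarrow> y \<in> P \<Longrightarrow> x + y \<in> P"
    and P_uminus: "x \<in> P \<Longrightarrow> - x \<in> P" and P_mult: "x \<in> OL \<Longrightarrow> y \<in> P \<Longrightarrow> x * y \<in> P"
    and P_diff: "x \<in> P \<Longrightarrow> y \<in> P \<Longrightarrow> x - y \<in> P"
    and P_l: "of_nat l \<in> P" and P_1: "1 \<notin> P"
proof -
  interpret p: primeideal P "integer_ring L" by (rule P_primeideal)
  note i = p.is_ideal[unfolded ideal_OL_iff]
  show "0 \<in> P" using i by blast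
  show add: "x + y \<in> P" if "x \<in> P" "y \<in> P" for x y
    using i that by blast
  show neg: "- x \<in> P" if "x \<in> P" for x
    using i that OL_uminus[OF OL_one] by (metis mult_minus1)
  show "x * y \<in> P" if "x \<in> OL" "y \<in> P" using p.I_l_closed[of y x] that by (simp add: integer_ring_simps)
  show "x - y \<in> P" if "x \<in> P" "y \<in> P" using add[OF that(1) neg[OF that(2)]] by simp
  show "of_nat l \<in> P" using P unfolding primes_above_def by simp
  show "1 \<notin> P" using p.one_imp_carrier p.I_notcarr by (auto simp: integer_ring_simps)
qed

lemma P_mult2: "x \<in> P \<Longrightarrow> y \<in> OL \<Longrightarrow> x * y \<in> P"
  using P_mult[of y x] by (simp add: mult.commute)

lemma P_sum: "(\<And>i. i \<in> I \<Longrightarrow> f i \<in> P) \<Longrightarrow> (\<Sum>i\<in>I. f i) \<in> P"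
  by (induction I rule: infinite_finite_induct) (auto intro: P_add P_0)

lemma P_prime: "x \<in> OL \<Longrightarrow> y \<in> OL \<Longrightarrow> x * y \<in> P \<Longrightarrow> x \<in> P \<or> y \<in> P"
proof -
  interpret p: primeideal P "integer_ring L" by (rule P_primeideal)
  show "x \<in> OL \<Longrightarrow> y \<in> OL \<Longrightarrow> x * y \<in> P \<Longrightarrow> x \<in> P \<or> y \<in> P"
    using p.I_prime by (simp add: integer_ring_simps)
qed

lemma P_prime_power: "x \<in> OL \<Longrightarrow> x ^ n \<in> P \<Longrightarrow> x \<in> P"
proof (induction n)
  case (Suc n)
  then have "x \<in> P \<or> x ^ n \<in> P" using P_prime[OF _ OL_power] by simp
  then show ?case using Suc by blast
qed (simp add: P_1)

lemma P_of_int: "of_int k \<in> P \<longleftrightarrow> int l dvd k"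
proof
  assume k: "of_int k \<in> P"
  show "int l dvd k"
  proof (rule ccontr)
    assume "\<not> int l dvd k"
    then have "coprime (int l) k" using prime_l by (simp add: prime_imp_coprime)
    then obtain u v where "u * int l + v * k = 1" by (metis bezout_int coprime_imp_gcd_eq_1)
    then have "of_int u * of_nat l + of_int v * of_int k = (1 :: complex)"
      by (metis of_int_1 of_int_add of_int_mult of_int_of_nat_eq)
    then have "1 \<in> P" using P_add[OF P_mult[OF OL_of_int P_l, of u] P_mult[OF OL_of_int k, of v]] by simp
    then show False using P_1 by simp
  qed
next
  assume "int l dvd k"
  then obtain m where "k = int l * m" by blast
  then show "of_int k \<in> P" using P_mult[OF OL_of_int P_l, of m] by (simp add: mult.commute)
qed

text \<open>The relation is defined for all complex numbers; integrality enters only where products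
  are formed, as in \<open>cg_mult\<close>.\<close>

definition cg :: "complex \<Rightarrow> complex \<Rightarrow> bool" (infix "\<doteq>" 50) where
  "x \<doteq> y \<longleftrightarrow> x - y \<in> P"

lemma cg_refl [simp]: "x \<doteq> x" and cg_sym: "x \<doteq> y \<Longrightarrow> y \<doteq> x"
  and cg_trans [trans]: "x \<doteq> y \<Longrightarrow> y \<doteq> z \<Longrightarrow> x \<doteq> z"
  and cg_add: "x \<doteq> y \<Longrightarrow> x' \<doteq> y' \<Longrightarrow> x + x' \<doteq> y + y'"
  and cg_diff: "x \<doteq> y \<Longrightarrow> x' \<doteq> y' \<Longrightarrow> x - x' \<doteq> y - y'"
proof -
  show "x \<doteq> x" unfolding cg_def by (simp add: P_0)
  show "y \<doteq> x" if "x \<doteq> y" using P_uminus[of "x - y"] that unfolding cg_def by simp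
  show "x \<doteq> z" if "x \<doteq> y" "y \<doteq> z" using P_add[of "x - y" "y - z"] that unfolding cg_def by simp
  show "x + x' \<doteq> y + y'" if "x \<doteq> y" "x' \<doteq> y'"
    using P_add[of "x - y" "x' - y'"] that unfolding cg_def by (simp add: algebra_simps)
  show "x - x' \<doteq> y - y'" if "x \<doteq> y" "x' \<doteq> y'"
    using P_diff[of "x - y" "x' - y'"] that unfolding cg_def by (simp add: algebra_simps)
qed

lemma cg_mult:
  assumes "x \<doteq> y" "x' \<doteq> y'" "x \<in> OL" "y' \<in> OL"
  shows "x * x' \<doteq> y * y'"
proof -
  have "x * x' - y * y' = x * (x' - y') + (x - y) * y'" by (simp add: algebra_simps)
  then show ?thesis using assms unfolding cg_def by (simp add: P_add P_mult P_mult2)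
qed

lemma cg_OL: "x \<doteq> y \<Longrightarrow> x \<in> OL \<Longrightarrow> y \<in> OL"
  using P_OL[of "x - y"] OL_diff[of x "x - y"] unfolding cg_def by simp

lemma cg_power: "x \<doteq> y \<Longrightarrow> x \<in> OL \<Longrightarrow> x ^ n \<doteq> y ^ n"
  by (induction n) (auto intro!: cg_mult OL_power dest: cg_OL)

lemma cg_0: "x \<doteq> 0 \<longleftrightarrow> x \<in> P"
  unfolding cg_def by simp

lemma cg_of_int: "of_int a \<doteq> of_int b \<longleftrightarrow> [a = b] (mod int l)"
  unfolding cg_def of_int_diff[symmetric] P_of_int by (simp add: cong_iff_dvd_diff)

lemma cg_sum: "(\<And>i. i \<in> I \<Longrightarrow> f i \<doteq> g i) \<Longrightarrow> (\<Sum>i\<in>I. f i) \<doteq> (\<Sum>i\<in>I. g i)"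
  by (induction I rule: infinite_finite_induct) (auto intro: cg_add)

text \<open>The alternative m = 1 or m = l treats inertia (m = 1) and Frobenius elements (m = l) by
  the same statements: all that matters is that the m-th power is additive modulo P.\<close>

lemma cg_power_add:
  assumes x: "x \<in> OL" and y: "y \<in> OL" and m: "m = 1 \<or> m = l"
  shows "(x + y) ^ m \<doteq> x ^ m + y ^ m"
proof (cases "m = 1")
  case False
  then have m: "m = l" using m by simp
  have l0: "0 < l" using prime_gt_0_nat[OF prime_l] .
  have "(x + y) ^ l = (\<Sum>k\<le>l. of_nat (l choose k) * x ^ k * y ^ (l - k))" by (rule binomial_ring)
  also have "{..l} = insert 0 (insert l {1..<l})" using l0 by auto
  also have "(\<Sum>k\<in>\<dots>. of_nat (l choose k) * x ^ k * y ^ (l - k))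
      = y ^ l + (x ^ l + (\<Sum>k\<in>{1..<l}. of_nat (l choose k) * x ^ k * y ^ (l - k)))"
    using l0 by simp
  also have "\<dots> \<doteq> y ^ l + (x ^ l + (\<Sum>k\<in>{1..<l}. 0))"
  proof (intro cg_add cg_refl cg_sum)
    fix k assume k: "k \<in> {1..<l}"
    then have "l dvd (l choose k)" by (intro dvd_choose_prime) (use prime_l l0 in auto)
    then obtain c where "l choose k = l * c" by blast
    then have "of_nat (l choose k) * x ^ k * y ^ (l - k) = of_nat l * (of_nat c * x ^ k * y ^ (l - k))"
      by (simp add: mult.assoc)
    then show "of_nat (l choose k) * x ^ k * y ^ (l - k) \<doteq> 0"
      unfolding cg_0 by (simp only:) (intro P_mult2[OF P_l] OL_mult OL_power OL_of_nat x y)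
  qed
  finally show ?thesis unfolding m by (simp add: add.commute)
qed simp

lemma cg_fermat:
  assumes m: "m = 1 \<or> m = l"
  shows "(of_int k :: complex) ^ m \<doteq> of_int k"
proof (cases "m = 1")
  case False
  then have m: "m = l" using m by simp
  have l0: "0 < l" using prime_gt_0_nat[OF prime_l] .
  have nat: "(of_nat n :: complex) ^ l \<doteq> of_nat n" for n
  proof (induction n)
    case 0 show ?case using l0 by (simp add: zero_power)
  next
    case (Suc n)
    have "(of_nat n + 1 :: complex) ^ l \<doteq> of_nat n ^ l + 1 ^ l"
      by (rule cg_power_add) (auto simp: OL_of_nat OL_one)
    also have "\<dots> \<doteq> of_nat n + 1" using Suc by (simp add: cg_add)
    finally show ?case by (simp add: add.commute)
  qed
  define n where "n = nat (k mod int l)"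
  have "k mod int l \<ge> 0" using l0 by simp
  then have nk: "int n = k mod int l" unfolding n_def by simp
  have "of_int k \<doteq> of_int (int n)" unfolding cg_of_int nk by simp
  then have kn: "of_int k \<doteq> of_nat n" by simp
  have "(of_int k :: complex) ^ l \<doteq> of_nat n ^ l" by (rule cg_power[OF kn OL_of_int])
  also have "\<dots> \<doteq> of_nat n" by (rule nat)
  also have "\<dots> \<doteq> of_int k" by (rule cg_sym[OF kn])
  finally show ?thesis unfolding m .
qed simp

lemma two_notin_P: "odd l \<Longrightarrow> 2 \<notin> P"
proof
  assume l: "odd l" and "2 \<in> P"
  then have "of_int 2 \<in> P" by simp
  then have "int l dvd 2" unfolding P_of_int .
  then have "int l \<le> 2" by (intro zdvd_imp_le) auto
  then show False using l prime_ge_2_nat[OF prime_l] by (cases "l = 2") auto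
qed

text \<open>The device by which a sign is read off from a congruence: it works with any element that
  is a unit at P, provided that 2 is a unit there as well.\<close>

lemma neg_not_cg:
  assumes "2 \<notin> P" "x \<in> OL" "x \<notin> P" and c: "(-1) ^ m * x \<doteq> (-1) ^ n * x"
  shows "even m \<longleftrightarrow> even n"
proof (rule ccontr)
  assume ne: "\<not> (even m \<longleftrightarrow> even n)"
  have "2 * x \<in> P"
  proof (cases "even m")
    case True
    then show ?thesis using ne c unfolding cg_def by simp
  next
    case False
    then have "- (2 * x) \<in> P" using ne c unfolding cg_def by simp
    then show ?thesis using P_uminus[of "- (2 * x)"] by simp
  qed
  then show False using P_prime[of 2 x] assms OL_of_nat[of 2] by auto
qed

text \<open>A conjugate pair \<open>x, \<tau> x\<close> over \<open>F\<close> reduces to the roots of the reduced polynomial, so \<open>\<sigma> x\<close> is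
  congruent to \<open>x ^ m\<close> or to \<open>(\<tau> x) ^ m\<close>; as the integers of \<open>E\<close> are not the union of two proper
  additive subgroups, one alternative holds throughout.\<close>

lemma quadratic_lift:
  assumes \<sigma>: "\<sigma> \<in> carrier G" and \<tau>: "\<tau> \<in> carrier G" and m: "m = 1 \<or> m = l"
    and EL: "E \<subseteq> L" and Eadd: "\<And>x y. x \<in> E \<Longrightarrow> y \<in> E \<Longrightarrow> x + y \<in> E"
    and \<tau>E: "\<And>x. x \<in> E \<Longrightarrow> \<tau> x \<in> E" and \<tau>\<tau>: "\<And>x. x \<in> E \<Longrightarrow> \<tau> (\<tau> x) = x"
    and tr: "\<And>x. x \<in> E \<Longrightarrow> x + \<tau> x \<in> F" and nm: "\<And>x. x \<in> E \<Longrightarrow> x * \<tau> x \<in> F"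
    and F: "\<And>x. x \<in> F \<Longrightarrow> x \<in> OL \<Longrightarrow> \<sigma> x \<doteq> x ^ m"
  shows "(\<forall>x\<in>E \<inter> OL. \<sigma> x \<doteq> x ^ m) \<or> (\<forall>x\<in>E \<inter> OL. \<sigma> (\<tau> x) \<doteq> x ^ m)"
proof -
  have alt: "\<sigma> x \<doteq> x ^ m \<or> \<sigma> x \<doteq> \<tau> x ^ m" if x: "x \<in> E" "x \<in> OL" for x
  proof -
    have xL: "x \<in> L" "\<tau> x \<in> L" and tx: "\<tau> x \<in> OL"
      using x EL Gal_OL[OF \<tau>] Gal_closed[OF \<tau>] by blast+
    have s: "\<sigma> x \<in> OL" "\<sigma> (\<tau> x) \<in> OL" using Gal_OL[OF \<sigma>] x tx by blast+
    have 1: "\<sigma> x + \<sigma> (\<tau> x) \<doteq> x ^ m + \<tau> x ^ m"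
      using F[OF tr[OF x(1)]] Gal_add[OF \<sigma> xL] cg_power_add[OF x(2) tx m] OL_add[OF x(2) tx]
      by (metis cg_trans)
    have 2: "\<sigma> x * \<sigma> (\<tau> x) \<doteq> x ^ m * \<tau> x ^ m"
      using F[OF nm[OF x(1)]] Gal_mul[OF \<sigma> xL] OL_mult[OF x(2) tx] by (simp add: power_mult_distrib)
    have "(\<sigma> x - x ^ m) * (\<sigma> x - \<tau> x ^ m)
        = (\<sigma> x * \<sigma> x - (x ^ m + \<tau> x ^ m) * \<sigma> x) + x ^ m * \<tau> x ^ m" by (simp add: algebra_simps)
    also have "\<dots> \<doteq> (\<sigma> x * \<sigma> x - (\<sigma> x + \<sigma> (\<tau> x)) * \<sigma> x) + \<sigma> x * \<sigma> (\<tau> x)"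
      using 1 2 s x tx
      by (intro cg_add cg_diff cg_refl cg_sym[OF 2] cg_mult[OF cg_sym[OF 1]])
         (auto simp: OL_add OL_power)
    also have "\<dots> = 0" by (simp add: algebra_simps)
    finally have "(\<sigma> x - x ^ m) * (\<sigma> x - \<tau> x ^ m) \<in> P" unfolding cg_0 .
    then show ?thesis unfolding cg_def using s x tx by (intro P_prime) (auto simp: OL_diff OL_power)
  qed
  have add1: "\<sigma> (x + y) \<doteq> (x + y) ^ m \<longleftrightarrow> \<sigma> x \<doteq> x ^ m"
    if "x \<in> E" "x \<in> OL" "y \<in> E" "y \<in> OL" "\<sigma> y \<doteq> y ^ m" for x y
  proof -
    have e: "\<sigma> (x + y) = \<sigma> x + \<sigma> y" using Gal_add[OF \<sigma>] that EL by blast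
    note p = cg_power_add[OF that(2,4) m]
    show ?thesis
    proof
      assume "\<sigma> x \<doteq> x ^ m"
      then show "\<sigma> (x + y) \<doteq> (x + y) ^ m" unfolding e using cg_trans[OF cg_add[OF _ that(5)] cg_sym[OF p]] by blast
    next
      assume "\<sigma> (x + y) \<doteq> (x + y) ^ m"
      then have "\<sigma> x + \<sigma> y \<doteq> x ^ m + y ^ m" unfolding e using cg_trans[OF _ p] by blast
      from cg_diff[OF this that(5)] show "\<sigma> x \<doteq> x ^ m" by simp
    qed
  qed
  have add2: "\<sigma> (x + y) \<doteq> \<tau> (x + y) ^ m \<longleftrightarrow> \<sigma> x \<doteq> \<tau> x ^ m"
    if "x \<in> E" "x \<in> OL" "y \<in> E" "y \<in> OL" "\<sigma> y \<doteq> \<tau> y ^ m" for x y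
  proof -
    have e: "\<sigma> (x + y) = \<sigma> x + \<sigma> y" using Gal_add[OF \<sigma>] that EL by blast
    have e': "\<tau> (x + y) = \<tau> x + \<tau> y" using Gal_add[OF \<tau>] that EL by blast
    note p = cg_power_add[OF Gal_OL[OF \<tau> that(2)] Gal_OL[OF \<tau> that(4)] m]
    show ?thesis
    proof
      assume "\<sigma> x \<doteq> \<tau> x ^ m"
      then show "\<sigma> (x + y) \<doteq> \<tau> (x + y) ^ m"
        unfolding e e' using cg_trans[OF cg_add[OF _ that(5)] cg_sym[OF p]] by blast
    next
      assume "\<sigma> (x + y) \<doteq> \<tau> (x + y) ^ m"
      then have "\<sigma> x + \<sigma> y \<doteq> \<tau> x ^ m + \<tau> y ^ m" unfolding e e' using cg_trans[OF _ p] by blast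
      from cg_diff[OF this that(5)] show "\<sigma> x \<doteq> \<tau> x ^ m" by simp
    qed
  qed
  show ?thesis
  proof (cases "\<forall>x\<in>E \<inter> OL. \<sigma> x \<doteq> x ^ m")
    case False
    then obtain x where x: "x \<in> E" "x \<in> OL" "\<not> \<sigma> x \<doteq> x ^ m" by blast
    then have x2: "\<sigma> x \<doteq> \<tau> x ^ m" using alt by blast
    have all: "\<sigma> y \<doteq> \<tau> y ^ m" if y: "y \<in> E" "y \<in> OL" for y
    proof (rule ccontr)
      assume n: "\<not> \<sigma> y \<doteq> \<tau> y ^ m"
      then have y1: "\<sigma> y \<doteq> y ^ m" using alt[OF y] by blast
      have "\<sigma> (x + y) \<doteq> (x + y) ^ m \<or> \<sigma> (x + y) \<doteq> \<tau> (x + y) ^ m"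
        using alt[OF Eadd[OF x(1) y(1)] OL_add[OF x(2) y(2)]] .
      then show False
        using add1[OF x(1,2) y y1] add2[OF y x(1,2) x2] x(3) n by (simp add: add.commute)
    qed
    have "\<sigma> (\<tau> x) \<doteq> x ^ m" if x: "x \<in> E" "x \<in> OL" for x
      using all[OF \<tau>E[OF x(1)] Gal_OL[OF \<tau> x(2)]] \<tau>\<tau>[OF x(1)] by simp
    then show ?thesis by blast
  qed blast
qed

lemma inertia_iff: "\<sigma> \<in> inertia_group L P \<longleftrightarrow> \<sigma> \<in> carrier G \<and> (\<forall>x\<in>OL. \<sigma> x \<doteq> x)"
  unfolding inertia_group_def cg_def by (auto simp: integer_ring_simps)

lemma frobenius_iff: "\<sigma> \<in> frobenius_elements L P l \<longleftrightarrow> \<sigma> \<in> carrier G \<and> (\<forall>x\<in>OL. \<sigma> x \<doteq> x ^ l)"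
  unfolding frobenius_elements_def cg_def by (auto simp: integer_ring_simps)

lemma inertia_P:
  assumes "\<sigma> \<in> inertia_group L P" "x \<doteq> y" "x \<in> OL" "y \<in> OL"
  shows "\<sigma> x \<doteq> \<sigma> y"
  using assms cg_trans[OF cg_trans[of "\<sigma> x" x y]] cg_sym unfolding inertia_iff by blast

lemma inertia_comp:
  assumes "\<sigma> \<in> inertia_group L P" "\<tau> \<in> inertia_group L P"
  shows "\<sigma> \<otimes>\<^bsub>G\<^esub> \<tau> \<in> inertia_group L P"
  unfolding inertia_iff
proof (intro conjI ballI)
  have G: "\<sigma> \<in> carrier G" "\<tau> \<in> carrier G" using assms inertia_iff by auto
  then show "\<sigma> \<otimes>\<^bsub>G\<^esub> \<tau> \<in> carrier G" by simp
  fix x assume x: "x \<in> OL"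
  have "\<tau> x \<doteq> x" using assms(2) x inertia_iff by blast
  then have "\<sigma> (\<tau> x) \<doteq> \<sigma> x" using inertia_P[OF assms(1)] x Gal_OL[OF G(2) x] by blast
  moreover have "\<sigma> x \<doteq> x" using assms(1) x inertia_iff by blast
  ultimately show "(\<sigma> \<otimes>\<^bsub>G\<^esub> \<tau>) x \<doteq> x"
    using Gal_comp[OF G OL_L[OF x]] cg_trans by metis
qed

end

text \<open>The factor is defined by choosing a prime and a Frobenius element. The value is
  therefore computed for all choices, and the existence of a Frobenius element must be shown, since
  otherwise the choice would be arbitrary.\<close>

lemma artin_factor_eqI:
  assumes L: "csubfield L" and l: "prime l"
    and ex: "\<And>P. P \<in> primes_above L l \<Longrightarrow> frobenius_elements L P l \<noteq> {}"
    and val: "\<And>P Fr. P \<in> primes_above L l \<Longrightarrow> Fr \<in> frobenius_elements L P l \<Longrightarrow>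
      det_on n (fixed_space n \<phi> (inertia_group L P)) (1\<^sub>m n - (of_nat l powr (- s)) \<cdot>\<^sub>m \<phi> Fr) = d"
  shows "artin_factor L n \<phi> l s = inverse d"
proof -
  interpret number_field L by unfold_locales fact
  define P where "P = (SOME P. P \<in> primes_above L l)"
  have P: "P \<in> primes_above L l"
    unfolding P_def using primes_above_nonempty[OF l] by (simp add: some_in_eq)
  define Fr where "Fr = (SOME \<sigma>. \<sigma> \<in> frobenius_elements L P l)"
  have Fr: "Fr \<in> frobenius_elements L P l"
    unfolding Fr_def using ex[OF P] by (simp add: some_in_eq)
  show ?thesis unfolding artin_factor_def P_def[symmetric] Let_def Fr_def[symmetric] using val[OF P Fr] by simp
qed

subsection \<open>Quartic extensions\<close>

lemma csubfield_quadratic: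
  assumes F: "csubfield F" and w2: "w ^ 2 \<in> F" and w: "w \<notin> F"
  shows "csubfield {x + y * w | x y. x \<in> F \<and> y \<in> F}" (is "csubfield ?E")
proof -
  note [simp] = csubfieldD[OF F]
  have I: "x + y * w \<in> ?E" if "x \<in> F" "y \<in> F" for x y using that by blast
  show ?thesis
    unfolding csubfield_def
  proof (intro conjI ballI)
    show "1 \<in> ?E" using I[of 1 0] by simp
    fix u assume "u \<in> ?E"
    then obtain x y where u: "u = x + y * w" "x \<in> F" "y \<in> F" by blast
    show "- u \<in> ?E" using I[of "- x" "- y"] u by (simp add: algebra_simps)
    show "inverse u \<in> ?E"
    proof (cases "u = 0")
      case True
      then show ?thesis using I[of 0 0] by simp
    next
      case False
      have d: "u * (x - y * w) = x ^ 2 - y ^ 2 * w ^ 2" unfolding u by (simp add: power2_eq_square algebra_simps)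
      have "x - y * w \<noteq> 0"
      proof
        assume xy: "x - y * w = 0"
        then have "y \<noteq> 0" using False u(1) by auto
        then have "w = x / y" using xy by (simp add: field_simps)
        then show False using w u by simp
      qed
      with \<open>x - y * w \<noteq> 0\<close> have "inverse u = (x - y * w) / (x ^ 2 - y ^ 2 * w ^ 2)"
        unfolding d[symmetric] using False by (simp add: inverse_eq_divide)
      then have "inverse u = x / (x ^ 2 - y ^ 2 * w ^ 2) + (- y / (x ^ 2 - y ^ 2 * w ^ 2)) * w"
        by (simp add: diff_divide_distrib)
      then show ?thesis using I[of "x / (x ^ 2 - y ^ 2 * w ^ 2)" "- y / (x ^ 2 - y ^ 2 * w ^ 2)"] u w2 by simp
    qed
    fix v assume "v \<in> ?E"
    then obtain x' y' where v: "v = x' + y' * w" "x' \<in> F" "y' \<in> F" by blast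
    have eq: "u + v = (x + x') + (y + y') * w" "u * v = (x * x' + y * y' * w ^ 2) + (x * y' + y * x') * w"
      unfolding u v by (simp_all add: algebra_simps power2_eq_square)
    show "u + v \<in> ?E" unfolding eq(1) by (rule I) (use u v in simp_all)
    show "u * v \<in> ?E" unfolding eq(2) by (rule I) (use u v w2 in simp_all)
  qed
qed

context number_field
begin

lemma pow_apply_Suc: "\<sigma> \<in> carrier G \<Longrightarrow> x \<in> L \<Longrightarrow> (\<sigma> [^]\<^bsub>G\<^esub> Suc k) x = (\<sigma> [^]\<^bsub>G\<^esub> k) (\<sigma> x)"
  using Gal_comp[of "\<sigma> [^]\<^bsub>G\<^esub> k" \<sigma> x] by simp

lemma pow_apply_0: "x \<in> L \<Longrightarrow> (\<sigma> [^]\<^bsub>G\<^esub> (0::nat)) x = x"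
  by (simp add: Gal_one_apply)

lemma pow_apply_fixed:
  assumes "\<sigma> \<in> carrier G" "x \<in> L" "\<sigma> x = x"
  shows "(\<sigma> [^]\<^bsub>G\<^esub> (k::nat)) x = x"
proof (induction k)
  case 0 show ?case by (rule pow_apply_0[OF assms(2)])
next
  case (Suc k)
  show ?case unfolding pow_apply_Suc[OF assms(1,2)] assms(3) by (rule Suc)
qed

lemma pow_apply_neg:
  assumes "\<sigma> \<in> carrier G" "x \<in> L" "\<sigma> x = - x"
  shows "(\<sigma> [^]\<^bsub>G\<^esub> (k::nat)) x = (-1) ^ k * x"
proof (induction k)
  case 0 show ?case using pow_apply_0[OF assms(2)] by simp
next
  case (Suc k)
  show ?case unfolding pow_apply_Suc[OF assms(1,2)] assms(3)
    using Gal_uminus[OF G.nat_pow_closed[OF assms(1)] assms(2)] Suc by simp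
qed

end

text \<open>The tower is \<open>B\<close>, \<open>K = B(\<i>)\<close>, \<open>L = K(r)\<close>;
  \<open>t\<close> induces the conjugation of \<open>K\<close> over \<open>B\<close>, and
  \<open>e\<close> is that of \<open>L\<close> over \<open>K\<close>. For odd q one takes z =
  \<open>zeta q\<close> and \<open>N = q - 1\<close>, for q = 2 the square root z = r^2 of 2 and
  \<open>N = 2\<close>. The last two assumptions say that the conjugates of z are its images under
  powers of \<open>s\<close>, and that \<open>s\<close> moves z with period exactly
  \<open>N\<close>.\<close>

locale quartic = number_field +
  fixes r z :: complex and t s e :: "complex \<Rightarrow> complex" and N :: nat and K B :: "complex set"
  assumes L_gen: "L = gen {\<i>, z, r}" and K_gen: "K = gen {\<i>, z}" and B_gen: "B = gen {z}"
    and t: "t \<in> carrier G" and s: "s \<in> carrier G" and e: "e \<in> carrier G"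
    and t_i: "t \<i> = - \<i>" and t_z: "t z = z"
    and s_i: "s \<i> = \<i>" and s_z: "s z \<in> B"
    and e_i: "e \<i> = \<i>" and e_z: "e z = z" and e_r: "e r = - r"
    and r2: "r ^ 2 \<in> B" and r_nz: "r \<noteq> 0" and s_r2: "s (r ^ 2) = - (r ^ 2)"
    and sN_z: "(s [^]\<^bsub>G\<^esub> N) z = z" and N_even': "even N" and N_pos': "N > 0"
    and z_conj: "\<sigma> \<in> carrier G \<Longrightarrow> \<exists>b::nat. \<sigma> z = (s [^]\<^bsub>G\<^esub> b) z"
    and z_free: "(s [^]\<^bsub>G\<^esub> (b::nat)) z = z \<Longrightarrow> N dvd b"
begin

lemma i_L: "\<i> \<in> L" and z_L: "z \<in> L" and r_L: "r \<in> L" and z_B: "z \<in> B" and i_K: "\<i> \<in> K" and z_K: "z \<in> K"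
  unfolding L_gen B_gen K_gen by (auto intro: gen_incl)

lemma B_field: "csubfield B" and K_field: "csubfield K"
  unfolding B_gen K_gen by (rule csubfield_gen)+

lemma B_K: "B \<subseteq> K"
  unfolding B_gen K_gen by (rule gen_mono) (auto intro: gen_incl)

lemma K_L: "K \<subseteq> L"
  unfolding K_gen L_gen by (rule gen_mono) (auto intro: gen_incl)

lemma r2_L: "r ^ 2 \<in> L"
  using r_L L_closed by simp

lemma t_B: "x \<in> B \<Longrightarrow> t x = x"
  using Gal_gen_fixed[OF t G.one_closed, of "{z}" x] z_L t_z Gal_one_apply B_K K_L
  unfolding B_gen[symmetric] by auto

lemma e_K: "x \<in> K \<Longrightarrow> e x = x"
proof -
  assume x: "x \<in> K"
  have "e x = \<one>\<^bsub>G\<^esub> x"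
  proof (rule Gal_gen_fixed[OF e G.one_closed])
    show "x \<in> gen {\<i>, z}" using x K_gen by simp
  qed (use z_L i_L e_z e_i Gal_one_apply in auto)
  then show ?thesis using Gal_one_apply x K_L by auto
qed

lemma i_notin_B: "\<i> \<notin> B"
proof
  assume "\<i> \<in> B"
  then have "t \<i> = \<i>" by (rule t_B)
  then show False using t_i by (simp add: complex_eq_iff)
qed

lemma r_notin_K: "r \<notin> K"
proof
  assume "r \<in> K"
  then have "e r = r" by (rule e_K)
  then show False using e_r r_nz by simp
qed

lemma K_elim:
  assumes "x \<in> K"
  obtains a b where "a \<in> B" "b \<in> B" "x = a + b * \<i>"
proof -
  have "csubfield {x + y * \<i> | x y. x \<in> B \<and> y \<in> B}"
    using csubfieldD[OF B_field] i_notin_B by (intro csubfield_quadratic[OF B_field]) auto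
  moreover have "{\<i>, z} \<subseteq> {x + y * \<i> | x y. x \<in> B \<and> y \<in> B}"
  proof -
    have "\<i> = 0 + 1 * \<i>" "z = z + 0 * \<i>" by simp_all
    then show ?thesis using csubfield_zero[OF B_field] csubfield_one[OF B_field] z_B by blast
  qed
  ultimately have "K \<subseteq> {x + y * \<i> | x y. x \<in> B \<and> y \<in> B}" unfolding K_gen by (rule gen_least)
  then show ?thesis using assms that by blast
qed

lemma L_elim:
  assumes "x \<in> L"
  obtains a b where "a \<in> K" "b \<in> K" "x = a + b * r"
proof -
  have "csubfield {x + y * r | x y. x \<in> K \<and> y \<in> K}"
    using r2 B_K r_notin_K by (intro csubfield_quadratic[OF K_field]) auto
  moreover have "w \<in> {x + y * r | x y. x \<in> K \<and> y \<in> K}" if "w = \<i> \<or> w = z \<or> w = r" for w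
  proof (cases "w = r")
    case True
    then have "w = 0 + 1 * r" by simp
    then show ?thesis using csubfield_zero[OF K_field] csubfield_one[OF K_field] by blast
  next
    case False
    then have "w = w + 0 * r" "w \<in> K" using that z_K i_K by auto
    then show ?thesis using csubfield_zero[OF K_field] by blast
  qed
  then have "{\<i>, z, r} \<subseteq> {x + y * r | x y. x \<in> K \<and> y \<in> K}" by blast
  ultimately have "L \<subseteq> {x + y * r | x y. x \<in> K \<and> y \<in> K}" unfolding L_gen by (rule gen_least)
  then show ?thesis using assms that by blast
qed

lemma t_K_apply: "a \<in> B \<Longrightarrow> b \<in> B \<Longrightarrow> t (a + b * \<i>) = a - b * \<i>"
  using B_K K_L i_L by (simp add: Gal_add[OF t] Gal_mul[OF t] L_closed t_B t_i subset_iff)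

lemma e_L_apply: "a \<in> K \<Longrightarrow> b \<in> K \<Longrightarrow> e (a + b * r) = a - b * r"
  using K_L r_L by (simp add: Gal_add[OF e] Gal_mul[OF e] L_closed e_K e_r subset_iff)

lemma t_r: "t r = r \<or> t r = - r"
proof -
  have "(t r) ^ 2 = r ^ 2" using Gal_pow[OF t r_L, of 2] t_B[OF r2] by simp
  then show ?thesis by (simp add: power2_eq_iff)
qed

lemma s_r: "s r = \<i> * r \<or> s r = - (\<i> * r)"
proof -
  have "(s r) ^ 2 = (\<i> * r) ^ 2" using Gal_pow[OF s r_L, of 2] s_r2 by (simp add: power_mult_distrib)
  then show ?thesis by (simp add: power2_eq_iff)
qed

lemmas s_pow_i = pow_apply_fixed[OF s i_L s_i]
lemmas e_pow_i = pow_apply_fixed[OF e i_L e_i]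
lemmas e_pow_z = pow_apply_fixed[OF e z_L e_z]
lemmas e_pow_r = pow_apply_neg[OF e r_L e_r]
lemmas t_pow_i = pow_apply_neg[OF t i_L t_i]
lemmas t_pow_z = pow_apply_fixed[OF t z_L t_z]

lemma s_pow_r: "(s [^]\<^bsub>G\<^esub> (2 * k)) r = (-1) ^ k * r"
proof (induction k)
  case (Suc k)
  have ir: "\<i> * r \<in> L" using i_L r_L L_closed by simp
  have ss: "s (s r) = - r"
    using s_r Gal_mul[OF s i_L r_L] Gal_uminus[OF s ir] s_i by auto
  have "(s [^]\<^bsub>G\<^esub> Suc (Suc (2 * k))) r = (s [^]\<^bsub>G\<^esub> (2 * k)) (s (s r))"
    using pow_apply_Suc[OF s r_L, of "Suc (2 * k)"] pow_apply_Suc[OF s Gal_closed[OF s r_L], of "2 * k"] by simp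
  also have "\<dots> = - ((s [^]\<^bsub>G\<^esub> (2 * k)) r)"
    unfolding ss using Gal_uminus[OF G.nat_pow_closed[OF s] r_L] .
  finally show ?case using Suc by simp
qed (simp add: Gal_one_apply r_L)

abbreviation wd :: "nat \<Rightarrow> nat \<Rightarrow> nat \<Rightarrow> complex \<Rightarrow> complex" where
  "wd b a k \<equiv> s [^]\<^bsub>G\<^esub> b \<otimes>\<^bsub>G\<^esub> (t [^]\<^bsub>G\<^esub> a \<otimes>\<^bsub>G\<^esub> e [^]\<^bsub>G\<^esub> k)"

lemma wd_apply: "x \<in> L \<Longrightarrow> wd b a k x = (s [^]\<^bsub>G\<^esub> b) ((t [^]\<^bsub>G\<^esub> a) ((e [^]\<^bsub>G\<^esub> k) x))"
  using Gal_comp[of "s [^]\<^bsub>G\<^esub> b" "t [^]\<^bsub>G\<^esub> a \<otimes>\<^bsub>G\<^esub> e [^]\<^bsub>G\<^esub> k" x]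
    Gal_comp[of "t [^]\<^bsub>G\<^esub> a" "e [^]\<^bsub>G\<^esub> k" x] s t e by simp

lemma wd_i: "wd b a k \<i> = (-1) ^ a * \<i>"
  by (cases "even a") (auto simp: wd_apply i_L e_pow_i t_pow_i s_pow_i Gal_uminus[OF G.nat_pow_closed[OF s] i_L])

lemma wd_z: "wd b a k z = (s [^]\<^bsub>G\<^esub> b) z"
  by (simp add: wd_apply z_L e_pow_z t_pow_z)

lemma wd_r: "wd b a k r = (-1) ^ k * (s [^]\<^bsub>G\<^esub> b) ((t [^]\<^bsub>G\<^esub> a) r)"
proof -
  let ?u = "(t [^]\<^bsub>G\<^esub> a) r"
  have u: "?u \<in> L" by (rule Gal_closed[OF G.nat_pow_closed[OF t] r_L])
  show ?thesis unfolding wd_apply[OF r_L] e_pow_r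
    by (cases "even k") (simp_all add: Gal_uminus[OF G.nat_pow_closed[OF t] r_L]
      Gal_uminus[OF G.nat_pow_closed[OF s] u])
qed

lemma wd_r_sign: "wd b a k r = (-1) ^ k * wd b a 0 r"
  unfolding wd_r by simp

lemma wd_r_even: "even b \<Longrightarrow> wd b 0 k r = (-1) ^ k * (-1) ^ (b div 2) * r"
proof -
  assume "even b"
  then obtain m where m: "b = 2 * m" by blast
  show ?thesis unfolding wd_r pow_apply_0[OF r_L] m s_pow_r by simp
qed

text \<open>The exponents are found one after the other: b from the value at z, a from the value at
  \<i>. As r^2 lies in \<open>B\<close>, the value at r is then known up to a sign, which e^k
  supplies.\<close>

lemma wd_exhaust:
  assumes \<sigma>: "\<sigma> \<in> carrier G"
  shows "\<exists>(b::nat) (a::nat) (k::nat). \<sigma> = wd b a k"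
proof -
  obtain b :: nat where b: "\<sigma> z = (s [^]\<^bsub>G\<^esub> b) z" using z_conj[OF \<sigma>] by blast
  have "(\<sigma> \<i>) ^ 2 = \<i> ^ 2" using Gal_pow[OF \<sigma> i_L, of 2] Gal_uminus[OF \<sigma>, of 1] Gal_1[OF \<sigma>] L_closed by simp
  then have "\<sigma> \<i> = \<i> \<or> \<sigma> \<i> = - \<i>" using power2_eq_iff by blast
  then obtain a :: nat where a: "\<sigma> \<i> = (-1) ^ a * \<i>"
    by (metis mult_1 mult_minus1 power_0 power_one_right)
  have w: "wd b a 0 \<in> carrier G" using s t e by simp
  have "\<sigma> (r ^ 2) = wd b a 0 (r ^ 2)"
    by (rule Gal_gen_fixed[OF \<sigma> w, of "{z}"]) (use r2 z_L wd_z[of b a 0] b B_gen in auto)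
  then have "(\<sigma> r) ^ 2 = (wd b a 0 r) ^ 2" using Gal_pow[OF \<sigma> r_L, of 2] Gal_pow[OF w r_L, of 2] by simp
  then have "\<sigma> r = wd b a 0 r \<or> \<sigma> r = - wd b a 0 r" using power2_eq_iff by blast
  then obtain k :: nat where k: "\<sigma> r = (-1) ^ k * wd b a 0 r"
    by (metis mult_1 mult_minus1 power_0 power_one_right)
  have "\<sigma> = wd b a k"
  proof (rule Gal_eqI[OF L_gen \<sigma>])
    show "wd b a k \<in> carrier G" using s t e by simp
    show "\<sigma> x = wd b a k x" if "x \<in> {\<i>, z, r}" for x
      using that a b k wd_i wd_z wd_r_sign[of b a k] by auto
  qed
  then show ?thesis by blast
qed

text \<open>All relations are checked on \<i>, z and r. Since \<open>s\<close> fixes \<i> and maps r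
  to \<i> r up to sign, s^2 negates r; this is the reason for \<open>N div 2\<close>.\<close>

sublocale twisted_group G t s e N "N div 2"
proof (unfold_locales, rule t, rule s, rule e)
  note c = s t e
  show "e \<otimes>\<^bsub>G\<^esub> e = \<one>\<^bsub>G\<^esub>"
    by (rule Gal_eqI[OF L_gen])
      (use c in \<open>auto simp: Gal_comp Gal_one_apply i_L z_L r_L e_i e_z e_r Gal_uminus[OF e]\<close>)
  show "e \<noteq> \<one>\<^bsub>G\<^esub>" using e_r r_nz Gal_one_apply[OF r_L] by auto
  show "t \<otimes>\<^bsub>G\<^esub> t = \<one>\<^bsub>G\<^esub>"
    using t_r by (intro Gal_eqI[OF L_gen])
      (use c in \<open>auto simp: Gal_comp Gal_one_apply i_L z_L r_L t_i t_z Gal_uminus[OF t]\<close>)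
  show "t \<otimes>\<^bsub>G\<^esub> e = e \<otimes>\<^bsub>G\<^esub> t"
    using t_r by (intro Gal_eqI[OF L_gen])
      (use c in \<open>auto simp: Gal_comp Gal_one_apply i_L z_L r_L t_i t_z e_i e_z e_r Gal_uminus[OF t] Gal_uminus[OF e]\<close>)
  have ir: "\<i> * r \<in> L" using i_L r_L L_closed by simp
  have sz: "s z \<in> L" "s z \<in> K" using s_z B_K K_L by auto
  show "s \<otimes>\<^bsub>G\<^esub> e = e \<otimes>\<^bsub>G\<^esub> s"
    using s_r by (intro Gal_eqI[OF L_gen])
      (use c sz in \<open>auto simp: Gal_comp i_L z_L r_L s_i e_i e_z e_r e_K ir
        Gal_uminus[OF s] Gal_uminus[OF e] Gal_mul[OF e]\<close>)
  show "t \<otimes>\<^bsub>G\<^esub> s = e \<otimes>\<^bsub>G\<^esub> (s \<otimes>\<^bsub>G\<^esub> t)"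
  proof (rule Gal_eqI[OF L_gen])
    fix x assume "x \<in> {\<i>, z, r}"
    then consider "x = \<i>" | "x = z" | "x = r" by blast
    then show "(t \<otimes>\<^bsub>G\<^esub> s) x = (e \<otimes>\<^bsub>G\<^esub> (s \<otimes>\<^bsub>G\<^esub> t)) x"
    proof cases
      case 1
      then show ?thesis using c by (simp add: Gal_comp i_L s_i t_i e_i Gal_uminus[OF s] Gal_uminus[OF e])
    next
      case 2
      then show ?thesis using c by (simp add: Gal_comp z_L t_z t_B[OF s_z] e_K[OF sz(2)])
    next
      case 3
      then show ?thesis using c s_r t_r
        by (auto simp: Gal_comp r_L i_L ir t_i e_i e_r Gal_uminus[OF s] Gal_uminus[OF e] Gal_uminus[OF t]
            Gal_mul[OF s] Gal_mul[OF e] Gal_mul[OF t])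
    qed
  qed (use c in auto)
  show "s [^]\<^bsub>G\<^esub> N = e [^]\<^bsub>G\<^esub> (N div 2)"
  proof (rule Gal_eqI[OF L_gen])
    have "(s [^]\<^bsub>G\<^esub> N) r = (-1) ^ (N div 2) * r" using s_pow_r[of "N div 2"] N_even' by simp
    then show "(s [^]\<^bsub>G\<^esub> N) x = (e [^]\<^bsub>G\<^esub> (N div 2)) x" if "x \<in> {\<i>, z, r}" for x
      using that by (auto simp: s_pow_i e_pow_i sN_z e_pow_z e_pow_r)
  qed (use c in auto)
  show "even N" "N > 0" by (fact N_even' N_pos')+
  show "\<exists>b a k. x = wd b a k" if "x \<in> carrier G" for x using wd_exhaust[OF that] .
  show "N dvd b \<and> even a" if "wd b a k = \<one>\<^bsub>G\<^esub>" for b a k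
  proof
    have "(s [^]\<^bsub>G\<^esub> b) z = z" using that wd_z[of b a k] Gal_one_apply[OF z_L] by simp
    then show "N dvd b" by (rule z_free)
    have "(-1) ^ a * \<i> = \<i>" using that wd_i[of b a k] Gal_one_apply[OF i_L] by simp
    then show "even a" by (cases "even a") (auto simp: complex_eq_iff)
  qed
qed

end

lemma fixed_space_singleton_one:
  assumes "representation G n \<phi>" "group G"
  shows "fixed_space n \<phi> {\<one>\<^bsub>G\<^esub>} = carrier_vec n"
  unfolding fixed_space_def using rep_one[OF assms(2,1)] by auto

lemma fixed_space_zeroI:
  assumes "representation G n \<phi>" "H \<subseteq> carrier G"
    and "\<And>v. v \<in> carrier_vec n \<Longrightarrow> (\<And>h. h \<in> H \<Longrightarrow> \<phi> h *\<^sub>v v = v) \<Longrightarrow> v = 0\<^sub>v n"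
  shows "fixed_space n \<phi> H = {0\<^sub>v n}"
  unfolding fixed_space_def using assms(3) mat_mult_zero_vec[OF rep_closed[OF assms(1)]] assms(2) by auto

text \<open>For q = 2 the L-function is asserted for every irreducible representation of dimension 2
  and not just for the standard one, so local factors have to be carried along an
  isomorphism.\<close>

lemma rep_iso_det:
  assumes \<phi>: "representation G n \<phi>" and \<psi>: "representation G n \<psi>" and iso: "rep_iso G n \<phi> n \<psi>"
    and g: "g \<in> carrier G"
  shows "det (1\<^sub>m n - x \<cdot>\<^sub>m \<phi> g) = det (1\<^sub>m n - x \<cdot>\<^sub>m \<psi> g)"
proof -
  obtain T where T: "T \<in> carrier (GL n)" "T * \<phi> g = \<psi> g * T" using iso g unfolding rep_iso_def by blast
  then obtain T' where TT: "T \<in> carrier_mat n n" "T' \<in> carrier_mat n n" "T * T' = 1\<^sub>m n" unfolding GL_carrier by blast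
  have c: "\<phi> g \<in> carrier_mat n n" "\<psi> g \<in> carrier_mat n n" by (rule rep_closed[OF \<phi> g], rule rep_closed[OF \<psi> g])
  have "T * (1\<^sub>m n - x \<cdot>\<^sub>m \<phi> g) = T * 1\<^sub>m n - T * (x \<cdot>\<^sub>m \<phi> g)"
    by (rule mult_minus_distrib_mat[OF TT(1)]) (use c in auto)
  also have "\<dots> = 1\<^sub>m n * T - (x \<cdot>\<^sub>m \<psi> g) * T"
    using T(2) TT(1) c by (simp add: mult_smult_distrib[OF TT(1)] mult_smult_assoc_mat[of _ n n _ n])
  also have "\<dots> = (1\<^sub>m n - x \<cdot>\<^sub>m \<psi> g) * T"
    by (rule minus_mult_distrib_mat[symmetric, of _ n n _ _ n]) (use c TT in auto)
  finally have "T * (1\<^sub>m n - x \<cdot>\<^sub>m \<phi> g) = (1\<^sub>m n - x \<cdot>\<^sub>m \<psi> g) * T" .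
  moreover have "1\<^sub>m n - x \<cdot>\<^sub>m \<phi> g \<in> carrier_mat n n" "1\<^sub>m n - x \<cdot>\<^sub>m \<psi> g \<in> carrier_mat n n"
    by (rule minus_carrier_mat[OF smult_carrier_mat[OF c(1)]])
      (rule minus_carrier_mat[OF smult_carrier_mat[OF c(2)]])
  ultimately have "det T * det (1\<^sub>m n - x \<cdot>\<^sub>m \<phi> g) = det (1\<^sub>m n - x \<cdot>\<^sub>m \<psi> g) * det T"
    using det_mult[OF TT(1)] det_mult[OF _ TT(1)] by metis
  moreover have "det T \<noteq> 0" using det_mult[OF TT(1,2)] TT(3) by auto
  ultimately show ?thesis by simp
qed

lemma rep_iso_fixed_space_zero:
  assumes \<phi>: "representation G n \<phi>" and iso: "rep_iso G n \<phi> n \<psi>" and H: "H \<subseteq> carrier G"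
    and \<psi>: "representation G n \<psi>" and z: "fixed_space n \<psi> H = {0\<^sub>v n}"
  shows "fixed_space n \<phi> H = {0\<^sub>v n}"
proof (rule fixed_space_zeroI[OF \<phi> H])
  fix v :: "complex vec" assume v: "v \<in> carrier_vec n" and fx: "\<And>h. h \<in> H \<Longrightarrow> \<phi> h *\<^sub>v v = v"
  obtain T where T: "T \<in> carrier (GL n)" "\<And>g. g \<in> carrier G \<Longrightarrow> T * \<phi> g = \<psi> g * T"
    using iso unfolding rep_iso_def by blast
  then obtain T' where TT: "T \<in> carrier_mat n n" "T' \<in> carrier_mat n n" "T' * T = 1\<^sub>m n" unfolding GL_carrier by blast
  have "\<psi> h *\<^sub>v (T *\<^sub>v v) = T *\<^sub>v v" if h: "h \<in> H" for h
  proof -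
    have hG: "h \<in> carrier G" using h H by blast
    have "\<psi> h *\<^sub>v (T *\<^sub>v v) = (\<psi> h * T) *\<^sub>v v"
      by (rule assoc_mult_mat_vec[OF rep_closed[OF \<psi> hG] TT(1) v, symmetric])
    also have "\<dots> = T *\<^sub>v (\<phi> h *\<^sub>v v)"
      unfolding T(2)[OF hG, symmetric] by (rule assoc_mult_mat_vec[OF TT(1) rep_closed[OF \<phi> hG] v])
    finally show ?thesis using fx[OF h] by simp
  qed
  then have "T *\<^sub>v v \<in> fixed_space n \<psi> H" unfolding fixed_space_def using TT v by auto
  then have "T *\<^sub>v v = 0\<^sub>v n" using z by simp
  then have "T' *\<^sub>v (T *\<^sub>v v) = 0\<^sub>v n" using mat_mult_zero_vec[OF TT(2)] by simp
  then show "v = 0\<^sub>v n" using assoc_mult_mat_vec[OF TT(2,1) v] TT(3) v by simp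
qed

text \<open>This is det(1 - x \<rho>(s^b t^a e^k)), see \<open>det_word_mat\<close>. For even a and
  b the matrix is a scalar. Otherwise its trace is 0, only its determinant matters, and the sign
  (-1)^k drops out.\<close>

definition local_det :: "complex \<Rightarrow> nat \<Rightarrow> nat \<Rightarrow> nat \<Rightarrow> complex \<Rightarrow> complex" where
  "local_det c b a k x =
     (if even a \<and> even b then (1 - (-1) ^ k * c ^ (b div 2) * x) ^ 2
      else if odd a \<and> odd b then 1 + c ^ b * x ^ 2 else 1 - c ^ b * x ^ 2)"

lemma (in twisted_group) det_word_mat:
  "det (1\<^sub>m 2 - x \<cdot>\<^sub>m word_mat c b a k) = local_det c b a k x"
proof -
  have p: "((-1) ^ k * y) ^ 2 = (y :: complex) ^ 2" for y by (simp add: power_mult_distrib flip: power_mult)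
  show ?thesis
  proof (cases "even b")
    case True
    then obtain m where m: "b = 2 * m" by blast
    have c2: "c ^ b = ((-1) ^ k * c ^ m) ^ 2" unfolding m p by (metis power_mult mult.commute)
    show ?thesis unfolding word_mat_def local_det_def c2 using True
      by (cases "even a") (simp_all add: m m2_smult m2_one m2_minus m2_det power2_eq_square algebra_simps)
  next
    case False
    then obtain m where m: "b = 2 * m + 1" using oddE by blast
    have c2: "c ^ b = ((-1) ^ k * c ^ m) ^ 2 * c" unfolding m p by (simp add: power_mult[symmetric] mult.commute)
    show ?thesis unfolding word_mat_def local_det_def c2 using False
      by (cases "even a") (simp_all add: m m2_smult m2_one m2_minus m2_det power2_eq_square algebra_simps)
  qed
qed

locale quartic_at = quartic + prime_above
begin

lemma word_i: "word b a k \<i> = (-1) ^ a * \<i>" and word_z: "word b a k z = (s [^]\<^bsub>G\<^esub> b) z"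
  and word_r_even: "even b \<Longrightarrow> word b 0 k r = (-1) ^ k * (-1) ^ (b div 2) * r"
  unfolding word_def by (rule wd_i wd_z wd_r_even; assumption?)+

lemma i_OL: "\<i> \<in> OL"
  unfolding OL_def using i_L by auto

lemma i_notin_P: "\<i> \<notin> P"
proof
  assume "\<i> \<in> P"
  then have "\<i> * - \<i> \<in> P" by (intro P_mult2 OL_uminus i_OL)
  then show False using P_1 by simp
qed

text \<open>A congruence known on \<open>B\<close> extends to \<open>K\<close> either by \<sigma>
  itself or by \<sigma> after the conjugation \<open>t\<close>; the value at \<i> tells
  which.\<close>

lemma lift_K:
  assumes \<sigma>: "\<sigma> \<in> carrier G" and m: "m = 1 \<or> m = l" and B: "\<And>x. x \<in> B \<Longrightarrow> x \<in> OL \<Longrightarrow> \<sigma> x \<doteq> x ^ m"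
  shows "(\<forall>x\<in>K \<inter> OL. \<sigma> x \<doteq> x ^ m) \<or> (\<forall>x\<in>K \<inter> OL. \<sigma> (t x) \<doteq> x ^ m)"
proof (rule quadratic_lift[OF \<sigma> t m K_L])
  fix x assume "x \<in> K"
  then obtain a b where x: "a \<in> B" "b \<in> B" "x = a + b * \<i>" by (rule K_elim)
  note tx = t_K_apply[OF x(1,2)]
  have tx': "t x = a + (- b) * \<i>" using tx x(3) by simp
  show "t x \<in> K" unfolding tx'
    by (intro csubfield_add[OF K_field] csubfield_mult[OF K_field] csubfield_uminus[OF K_field] i_K subsetD[OF B_K] x)
  show "t (t x) = x" unfolding tx' using t_K_apply[OF x(1) csubfield_uminus[OF B_field x(2)]] x(3) by simp
  have "x + t x = a + a" using tx' x(3) by simp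
  then show "x + t x \<in> B" using csubfield_add[OF B_field x(1) x(1)] by simp
  have "x * t x = (a + b * \<i>) * (a + (- b) * \<i>)" using tx' x(3) by simp
  then have "x * t x = a * a + b * b" by (simp add: algebra_simps)
  then show "x * t x \<in> B" using x csubfieldD[OF B_field] by simp
qed (use B csubfieldD[OF K_field] in auto)

lemma lift_L:
  assumes \<sigma>: "\<sigma> \<in> carrier G" and m: "m = 1 \<or> m = l" and K: "\<And>x. x \<in> K \<Longrightarrow> x \<in> OL \<Longrightarrow> \<sigma> x \<doteq> x ^ m"
  obtains k :: nat where "\<And>x. x \<in> OL \<Longrightarrow> (\<sigma> \<otimes>\<^bsub>G\<^esub> e [^]\<^bsub>G\<^esub> k) x \<doteq> x ^ m"
proof -
  have "(\<forall>x\<in>L \<inter> OL. \<sigma> x \<doteq> x ^ m) \<or> (\<forall>x\<in>L \<inter> OL. \<sigma> (e x) \<doteq> x ^ m)"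
  proof (rule quadratic_lift[OF \<sigma> e m subset_refl])
    fix x assume xL: "x \<in> L"
    then obtain a b where x: "a \<in> K" "b \<in> K" "x = a + b * r" by (rule L_elim)
    note ex = e_L_apply[OF x(1,2)]
    have ex': "e x = a + (- b) * r" using ex x(3) by simp
    show "e x \<in> L" by (rule Gal_closed[OF e xL])
    show "e (e x) = x" unfolding ex' using e_L_apply[OF x(1) csubfield_uminus[OF K_field x(2)]] x(3) by simp
    have "x + e x = a + a" using ex' x(3) by simp
    then show "x + e x \<in> K" using csubfield_add[OF K_field x(1) x(1)] by simp
    have "x * e x = (a + b * r) * (a + (- b) * r)" using ex' x(3) by simp
    then have "x * e x = a * a - b * b * r ^ 2" by (simp add: algebra_simps power2_eq_square)
    then show "x * e x \<in> K" using x csubfieldD[OF K_field] r2 B_K by auto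
  qed (use K L_closed in auto)
  then show thesis
  proof
    assume 1: "\<forall>x\<in>L \<inter> OL. \<sigma> x \<doteq> x ^ m"
    have "(\<sigma> \<otimes>\<^bsub>G\<^esub> e [^]\<^bsub>G\<^esub> (0::nat)) x = \<sigma> x" for x using \<sigma> by simp
    then show thesis using 1 that[of 0] OL_L by simp
  next
    assume 2: "\<forall>x\<in>L \<inter> OL. \<sigma> (e x) \<doteq> x ^ m"
    have "(\<sigma> \<otimes>\<^bsub>G\<^esub> e [^]\<^bsub>G\<^esub> (1::nat)) x = \<sigma> (e x)" if "x \<in> OL" for x
      using Gal_comp[OF \<sigma> e OL_L[OF that]] e by simp
    then show thesis using 2 that[of 1] OL_L by simp
  qed
qed

text \<open>It suffices to find an automorphism that acts as the l-th power on the integers of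
  \<open>B\<close>; the two lifting steps correct it by \<open>t\<close> and by a power of
  \<open>e\<close>.\<close>

lemma frobenius_exists:
  assumes \<sigma>: "\<sigma> \<in> carrier G" and B: "\<And>x. x \<in> B \<Longrightarrow> x \<in> OL \<Longrightarrow> \<sigma> x \<doteq> x ^ l"
  shows "frobenius_elements L P l \<noteq> {}"
proof -
  obtain \<sigma>' where \<sigma>': "\<sigma>' \<in> carrier G" "\<And>x. x \<in> K \<Longrightarrow> x \<in> OL \<Longrightarrow> \<sigma>' x \<doteq> x ^ l"
  proof -
    consider "\<forall>x\<in>K \<inter> OL. \<sigma> x \<doteq> x ^ l" | "\<forall>x\<in>K \<inter> OL. \<sigma> (t x) \<doteq> x ^ l"
      using lift_K[OF \<sigma> _ B] by blast
    then show thesis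
    proof cases
      case 1
      then show ?thesis using that[OF \<sigma>] by blast
    next
      case 2
      then show ?thesis using that[of "\<sigma> \<otimes>\<^bsub>G\<^esub> t"] Gal_comp[OF \<sigma> t OL_L] \<sigma> t by simp
    qed
  qed
  obtain k :: nat where "\<And>x. x \<in> OL \<Longrightarrow> (\<sigma>' \<otimes>\<^bsub>G\<^esub> e [^]\<^bsub>G\<^esub> k) x \<doteq> x ^ l"
    using lift_L[OF \<sigma>'(1) _ \<sigma>'(2)] by blast
  then have "\<sigma>' \<otimes>\<^bsub>G\<^esub> e [^]\<^bsub>G\<^esub> k \<in> frobenius_elements L P l"
    unfolding frobenius_iff using \<sigma>'(1) e by simp
  then show ?thesis by blast
qed

lemma inertia_lift:
  assumes \<sigma>: "\<sigma> \<in> carrier G" and K: "\<And>x. x \<in> K \<Longrightarrow> x \<in> OL \<Longrightarrow> \<sigma> x \<doteq> x"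
  obtains k :: nat where "\<sigma> \<otimes>\<^bsub>G\<^esub> e [^]\<^bsub>G\<^esub> k \<in> inertia_group L P"
proof -
  obtain k :: nat where "\<And>x. x \<in> OL \<Longrightarrow> (\<sigma> \<otimes>\<^bsub>G\<^esub> e [^]\<^bsub>G\<^esub> k) x \<doteq> x ^ 1"
    using lift_L[OF \<sigma>, of 1] K by auto
  then show ?thesis using that[of k] \<sigma> e unfolding inertia_iff by simp
qed

text \<open>The bottom of the tower: a congruence for z carries over to integer polynomials in z, by
  Fermat for the coefficients and additivity of the m-th power. It reaches all integers of
  \<open>B\<close> once these are known to be such polynomials.\<close>

lemma cg_zpoly:
  assumes \<sigma>: "\<sigma> \<in> carrier G" and m: "m = 1 \<or> m = l" and z: "z \<in> OL" "\<sigma> z \<doteq> z ^ m"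
  shows "\<sigma> (\<Sum>k\<in>I. of_int (a k) * z ^ k) \<doteq> (\<Sum>k\<in>I. of_int (a k) * z ^ k) ^ m"
proof -
  have 1: "\<sigma> (\<Sum>k\<in>I. of_int (a k) * z ^ k) = (\<Sum>k\<in>I. of_int (a k) * (\<sigma> z) ^ k)"
    by (subst Gal_sum[OF \<sigma>])
      (auto simp: Gal_mul[OF \<sigma>] Gal_pow[OF \<sigma>] Gal_of_int[OF \<sigma>] z_L L_closed csubfield_of_int[OF subfield])
  have 2: "(\<Sum>k\<in>I. of_int (a k) * (\<sigma> z) ^ k) \<doteq> (\<Sum>k\<in>I. (of_int (a k) * z ^ k) ^ m)"
  proof (rule cg_sum)
    fix k
    have "of_int (a k) * (\<sigma> z) ^ k \<doteq> of_int (a k) ^ m * (z ^ m) ^ k"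
      by (intro cg_mult cg_power z(2) Gal_OL[OF \<sigma> z(1)] OL_of_int cg_sym[OF cg_fermat[OF m]] OL_power z(1))
    then show "of_int (a k) * (\<sigma> z) ^ k \<doteq> (of_int (a k) * z ^ k) ^ m"
      by (simp add: power_mult_distrib mult.commute flip: power_mult)
  qed
  have 3: "(\<Sum>k\<in>I. f k) ^ m \<doteq> (\<Sum>k\<in>I. (f k) ^ m)" if "\<And>k. f k \<in> OL" for f :: "nat \<Rightarrow> complex"
  proof (induction I rule: infinite_finite_induct)
    case (insert x F)
    have "(f x + (\<Sum>k\<in>F. f k)) ^ m \<doteq> f x ^ m + (\<Sum>k\<in>F. f k) ^ m"
      by (rule cg_power_add[OF that _ m]) (intro OL_sum that)
    also have "\<dots> \<doteq> f x ^ m + (\<Sum>k\<in>F. (f k) ^ m)" by (intro cg_add cg_refl insert.IH)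
    finally show ?case using insert by simp
  qed (use m prime_gt_0_nat[OF prime_l] in \<open>auto simp: zero_power\<close>)
  show ?thesis unfolding 1
    by (rule cg_trans[OF 2 cg_sym[OF 3]]) (intro OL_mult OL_of_int OL_power z(1))
qed

text \<open>Once z is fixed, an inertia element can change only the signs of \<i> and r. As 2, \<i>
  and r lie outside P, such a change would be visible modulo P.\<close>

lemma inertia_trivial:
  assumes two: "2 \<notin> P" and r: "r \<in> OL" "r \<notin> P"
    and sep: "\<And>\<sigma>. \<sigma> \<in> carrier G \<Longrightarrow> \<sigma> z \<doteq> z \<Longrightarrow> \<sigma> z = z" and z: "z \<in> OL"
  shows "inertia_group L P = {\<one>\<^bsub>G\<^esub>}"
proof
  show "{\<one>\<^bsub>G\<^esub>} \<subseteq> inertia_group L P"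
    unfolding inertia_iff using Gal_one_apply OL_L by (auto simp: inertia_iff)
  show "inertia_group L P \<subseteq> {\<one>\<^bsub>G\<^esub>}"
  proof
    fix \<sigma> assume \<sigma>: "\<sigma> \<in> inertia_group L P"
    then have \<sigma>G: "\<sigma> \<in> carrier G" and fx: "\<And>x. x \<in> OL \<Longrightarrow> \<sigma> x \<doteq> x" unfolding inertia_iff by auto
    have neg: "\<sigma> x \<noteq> - x" if x: "x \<in> OL" "x \<notin> P" for x
    proof
      assume "\<sigma> x = - x"
      then have "- x - x \<in> P" using fx[OF x(1)] unfolding cg_def by simp
      then have "2 * x \<in> P" using P_uminus[of "- x - x"] by simp
      then show False using P_prime[of 2 x] two x OL_of_nat[of 2] by auto
    qed
    obtain b a k where w: "\<sigma> = word b a k" using word_exhaust[OF \<sigma>G] by blast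
    have 1: "\<sigma> \<i> = \<i>" using neg[OF i_OL i_notin_P] word_i[of b a k] unfolding w by (cases "even a") auto
    have 2: "\<sigma> z = z" by (rule sep[OF \<sigma>G fx[OF z]])
    have "\<sigma> (r ^ 2) = \<one>\<^bsub>G\<^esub> (r ^ 2)"
      by (rule Gal_gen_fixed[OF \<sigma>G G.one_closed, of "{z}"]) (use r2 z_L 2 B_gen Gal_one_apply in auto)
    then have "(\<sigma> r) ^ 2 = r ^ 2" using Gal_pow[OF \<sigma>G r_L, of 2] Gal_one_apply[OF r2_L] by simp
    then have 3: "\<sigma> r = r" using neg[OF r] power2_eq_iff by blast
    have "\<sigma> = \<one>\<^bsub>G\<^esub>"
      by (rule Gal_eqI[OF L_gen \<sigma>G G.one_closed]) (use 1 2 3 Gal_one_apply i_L z_L r_L in auto)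
    then show "\<sigma> \<in> {\<one>\<^bsub>G\<^esub>}" by simp
  qed
qed

lemma inertia_carrier: "inertia_group L P \<subseteq> carrier G"
  unfolding inertia_group_def by auto

lemma frobenius_inertia_i:
  assumes F: "word b a k \<in> frobenius_elements L P l" and two: "2 \<notin> P" and l: "odd l"
  shows "even a \<longleftrightarrow> l mod 4 = 1"
proof -
  have "word b a k \<i> \<doteq> \<i> ^ l" using F i_OL unfolding frobenius_iff by blast
  then have eq: "(-1) ^ a * \<i> \<doteq> \<i> ^ l" unfolding word_i .
  obtain m where m: "l = 2 * m + 1" using l oddE by blast
  have il: "\<i> ^ l = (-1) ^ m * \<i>" unfolding m by (simp add: power_mult)
  have neq: "\<not> \<i> \<doteq> - \<i>" "\<not> - \<i> \<doteq> \<i>"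
  proof -
    have "2 * \<i> \<notin> P"
    proof
      assume "2 * \<i> \<in> P"
      then have "2 * \<i> * - \<i> \<in> P" by (rule P_mult2[OF _ OL_uminus[OF i_OL]])
      moreover have "2 * \<i> * - \<i> = 2" by (simp add: complex_eq_iff)
      ultimately show False using two by metis
    qed
    moreover have "- \<i> - \<i> = - (2 * \<i>)" "\<i> - - \<i> = 2 * \<i>" by simp_all
    ultimately show "\<not> \<i> \<doteq> - \<i>" "\<not> - \<i> \<doteq> \<i>" unfolding cg_def using P_uminus[of "- (2 * \<i>)"] by (auto simp del: minus_diff_eq)
  qed
  have "even a \<longleftrightarrow> even m"
    using eq neq unfolding il by (cases "even a"; cases "even m") auto
  also have "even m \<longleftrightarrow> l mod 4 = 1" unfolding m by presburger
  finally show ?thesis .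
qed

lemma good_local_factor:
  assumes \<rho>: "standard_rep c \<rho>" and triv: "inertia_group L P = {\<one>\<^bsub>G\<^esub>}"
  shows "det_on 2 (fixed_space 2 \<rho> (inertia_group L P)) (1\<^sub>m 2 - x \<cdot>\<^sub>m \<rho> (word b a k)) = local_det c b a k x"
proof -
  have rep: "representation G 2 \<rho>" using \<rho> unfolding standard_rep_def by simp
  have "fixed_space 2 \<rho> (inertia_group L P) = carrier_vec 2"
    unfolding triv by (rule fixed_space_singleton_one[OF rep G.group_axioms])
  moreover have "1\<^sub>m 2 - x \<cdot>\<^sub>m \<rho> (word b a k) \<in> carrier_mat 2 2"
    by (intro minus_carrier_mat smult_carrier_mat rep_closed[OF rep word_closed])
  ultimately show ?thesis
    using det_on_full by (simp add: standard_rep_word[OF \<rho>] det_word_mat)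
qed

end

subsection \<open>The cyclotomic field and the Gauss sum\<close>

lemma zeta_power: "zeta n ^ k = exp (2 * of_real pi * \<i> * of_nat k / of_nat n)"
  unfolding zeta_def by (simp add: exp_of_nat_mult[symmetric] mult_ac)

lemma zeta_power_eq: "1 \<le> n \<Longrightarrow> zeta n ^ j = zeta n ^ k \<longleftrightarrow> j mod n = k mod n"
  unfolding zeta_power by (rule complex_root_unity_eq)

lemma zeta_power_self: "1 \<le> n \<Longrightarrow> zeta n ^ n = 1"
  using zeta_power_eq[of n n 0] by simp

lemma zeta_power_mod: "1 \<le> n \<Longrightarrow> zeta n ^ (k mod n) = zeta n ^ k"
  by (simp add: zeta_power_eq)

lemma zeta_power_eq_1: "1 \<le> n \<Longrightarrow> zeta n ^ k = 1 \<longleftrightarrow> n dvd k"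
  using zeta_power_eq[of n k 0] by auto

lemma root_of_unity_zeta:
  assumes n: "1 \<le> n" and x: "x ^ n = 1"
  obtains k where "k < n" "x = zeta n ^ k"
proof -
  have "x \<in> (\<lambda>k. cis (2 * pi * real k / real n)) ` {..<n}"
    using Complex.bij_betw_roots_unity[of n] n x unfolding bij_betw_def by auto
  then obtain k where k: "k < n" "x = cis (2 * pi * real k / real n)" by auto
  have "zeta n ^ k = x" unfolding zeta_power k(2) cis_conv_exp by (simp add: mult_ac)
  then show ?thesis using that k by blast
qed

lemma zeta_nz: "zeta n \<noteq> 0"
  unfolding zeta_def by simp

lemma algebraic_int_zeta: "1 \<le> n \<Longrightarrow> algebraic_int (zeta n)"
proof -
  assume n: "1 \<le> n"
  show ?thesis
  proof (rule algebraic_int.intros)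
    show "poly (monom 1 n - 1) (zeta n) = 0"
      using zeta_power_self[OF n] by (simp add: poly_monom)
    have "degree (monom (1::complex) n - 1) = n"
      using n degree_add_eq_left[of "-1" "monom (1::complex) n"] by (simp add: degree_monom_eq)
    then show "lead_coeff (monom (1::complex) n - 1) = 1" using n by (simp add: coeff_1)
    show "\<forall>i. coeff (monom (1::complex) n - 1) i \<in> \<int>" by (auto simp: coeff_1)
  qed
qed

lemma sum_lessThan_shift_periodic:
  fixes f :: "nat \<Rightarrow> 'a :: comm_monoid_add"
  assumes "f n = f 0"
  shows "(\<Sum>k<n. f (Suc k)) = (\<Sum>k<n. f k)"
proof (cases n)
  case (Suc m)
  then show ?thesis using assms unfolding Suc sum.lessThan_Suc_shift[of f m]
    by (simp add: add.commute)
qed simp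

lemma prod_lessThan_shift_periodic:
  fixes f :: "nat \<Rightarrow> 'a :: comm_monoid_mult"
  assumes "f n = f 0"
  shows "(\<Prod>k<n. f (Suc k)) = (\<Prod>k<n. f k)"
proof (cases n)
  case (Suc m)
  then show ?thesis using assms unfolding Suc prod.lessThan_Suc_shift[of f m]
    by (simp add: mult.commute)
qed simp

text \<open>An automorphism with \<open>zeta q\<close> mapped to its \<open>g\<close>-th power for a
  primitive root \<open>g\<close> stands in for the irreducibility of the cyclotomic polynomial: it
  moves \<open>zeta q\<close> through all primitive q-th roots of unity.\<close>

locale cyclotomic = number_field +
  fixes q g :: nat and s :: "complex \<Rightarrow> complex"
  assumes q: "prime q" "odd q" and g: "residue_primroot q g"
    and z_L': "zeta q \<in> L" and s': "s \<in> carrier G" and s_zeta: "s (zeta q) = zeta q ^ g"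
begin

abbreviation "z \<equiv> zeta q"

lemma q1: "1 \<le> q" and q2: "2 < q"
  using prime_ge_2_nat[OF q(1)] q(2) by (auto simp: le_less)

definition Rz :: "complex set" where
  "Rz = {(\<Sum>k<q. a k * z ^ k) | a. \<forall>k. a k \<in> \<rat>}"

lemma Rz_monom: "c \<in> \<rat> \<Longrightarrow> c * z ^ n \<in> Rz"
proof -
  assume c: "c \<in> \<rat>"
  have "(\<Sum>k<q. (if k = n mod q then c else 0) * z ^ k) = c * z ^ (n mod q)"
    using q1 by (subst sum.mono_neutral_right[of _ "{n mod q}"]) (auto split: if_splits)
  also have "\<dots> = c * z ^ n" by (simp add: zeta_power_mod[OF q1])
  finally have "c * z ^ n = (\<Sum>k<q. (if k = n mod q then c else 0) * z ^ k)" ..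
  then show ?thesis unfolding Rz_def using c
    by (intro CollectI exI[of _ "\<lambda>k. if k = n mod q then c else 0"]) auto
qed

lemma Rz_add: "x \<in> Rz \<Longrightarrow> y \<in> Rz \<Longrightarrow> x + y \<in> Rz"
proof -
  assume "x \<in> Rz" "y \<in> Rz"
  then obtain a b where "x = (\<Sum>k<q. a k * z ^ k)" "\<forall>k. a k \<in> \<rat>" "y = (\<Sum>k<q. b k * z ^ k)" "\<forall>k. b k \<in> \<rat>"
    unfolding Rz_def by blast
  then show ?thesis unfolding Rz_def
    by (intro CollectI exI[of _ "\<lambda>k. a k + b k"]) (auto simp: sum.distrib algebra_simps)
qed

lemma Rz_rat: "c \<in> \<rat> \<Longrightarrow> c \<in> Rz"
  using Rz_monom[of c 0] by simp

lemma Rz_sum: "(\<And>i. i \<in> I \<Longrightarrow> f i \<in> Rz) \<Longrightarrow> (\<Sum>i\<in>I. f i) \<in> Rz"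
  by (induction I rule: infinite_finite_induct) (auto simp: Rz_rat Rz_add)

lemma Rz_mult: "x \<in> Rz \<Longrightarrow> y \<in> Rz \<Longrightarrow> x * y \<in> Rz"
proof -
  assume "x \<in> Rz" "y \<in> Rz"
  then obtain a b where ab: "x = (\<Sum>k<q. a k * z ^ k)" "\<And>k. a k \<in> \<rat>" "y = (\<Sum>k<q. b k * z ^ k)" "\<And>k. b k \<in> \<rat>"
    unfolding Rz_def by blast
  have "x * y = (\<Sum>i<q. \<Sum>j<q. (a i * b j) * z ^ (i + j))"
    unfolding ab(1,3) sum_product by (simp add: power_add mult_ac)
  then show ?thesis using ab(2,4) by (auto intro!: Rz_sum Rz_monom)
qed

lemma Rz_prod: "(\<And>i. i \<in> I \<Longrightarrow> f i \<in> Rz) \<Longrightarrow> (\<Prod>i\<in>I. f i) \<in> Rz"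
  by (induction I rule: infinite_finite_induct) (auto simp: Rz_rat Rz_mult)

lemma Rz_L: "x \<in> Rz \<Longrightarrow> x \<in> L"
proof -
  assume "x \<in> Rz"
  then obtain a where a: "x = (\<Sum>k<q. a k * z ^ k)" "\<And>k. a k \<in> \<rat>" unfolding Rz_def by blast
  show ?thesis unfolding a(1)
    by (intro csubfield_sum[OF subfield] csubfield_mult[OF subfield] csubfield_power[OF subfield] z_L'
      subsetD[OF csubfield_Rats[OF subfield] a(2)])
qed

lemma s_pow_zeta: "(s [^]\<^bsub>G\<^esub> (k::nat)) z = z ^ (g ^ k)"
proof (induction k)
  case 0 show ?case using pow_apply_0[OF z_L'] by simp
next
  case (Suc k)
  have "(s [^]\<^bsub>G\<^esub> Suc k) z = ((s [^]\<^bsub>G\<^esub> k) z) ^ g"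
    unfolding pow_apply_Suc[OF s' z_L'] s_zeta by (rule Gal_pow[OF G.nat_pow_closed[OF s'] z_L'])
  then show ?case unfolding Suc by (simp add: power_mult[symmetric] mult.commute)
qed

lemma Gal_sum_zeta:
  assumes "\<sigma> \<in> carrier G" "\<And>k. a k \<in> \<rat>"
  shows "\<sigma> (\<Sum>k\<in>I. a k * z ^ f k) = (\<Sum>k\<in>I. a k * \<sigma> z ^ f k)"
  using assms csubfield_Rats[OF subfield] z_L' L_closed
  by (subst Gal_sum) (auto simp: Gal_mul Gal_pow Gal_rat subset_iff)

lemma s_pow_Rz: "x \<in> Rz \<Longrightarrow> (s [^]\<^bsub>G\<^esub> (k::nat)) x \<in> Rz"
proof -
  assume "x \<in> Rz"
  then obtain a where a: "x = (\<Sum>k<q. a k * z ^ k)" "\<And>k. a k \<in> \<rat>" unfolding Rz_def by blast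
  show ?thesis unfolding a(1) Gal_sum_zeta[OF G.nat_pow_closed[OF s'] a(2)] s_pow_zeta power_mult[symmetric]
    by (intro Rz_sum Rz_monom a(2))
qed

lemma totient_q: "totient q = q - 1"
  by (rule totient_prime[OF q(1)])

lemma ord_g: "ord q g = q - 1"
  using g totient_q unfolding residue_primroot_def by simp

lemma g_pow_eq_1: "g ^ b mod q = 1 \<longleftrightarrow> (q - 1) dvd b"
  using ord_divides[of g b q] q2 unfolding ord_g cong_def by simp

lemma g_bij: "bij_betw (\<lambda>i. g ^ i mod q) {..<q - 1} {1..<q}"
proof -
  have t: "totatives q = {1..<q}"
    unfolding totatives_prime[OF q(1)] by (rule Set.set_eqI) (simp add: Suc_le_eq)
  have "bij_betw (\<lambda>i. g ^ i mod q) {..<totient q} (totatives q)"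
    by (rule residue_primroot_is_generator[OF _ g]) (use q2 in simp)
  then show ?thesis unfolding totient_q t .
qed

lemma s_pow_order: "x \<in> Rz \<Longrightarrow> (s [^]\<^bsub>G\<^esub> (q - 1)) x = x"
proof -
  assume "x \<in> Rz"
  then obtain a where a: "x = (\<Sum>k<q. a k * z ^ k)" "\<And>k. a k \<in> \<rat>" unfolding Rz_def by blast
  have "g ^ (q - 1) mod q = 1 mod q" using g_pow_eq_1[of "q - 1"] q2 by simp
  then have "z ^ (g ^ (q - 1)) = z" using zeta_power_eq[OF q1, of "g ^ (q - 1)" 1] by simp
  then show ?thesis unfolding a(1) Gal_sum_zeta[OF G.nat_pow_closed[OF s'] a(2)] s_pow_zeta by simp
qed

definition tr :: "complex \<Rightarrow> complex" where
  "tr x = (\<Sum>k<q - 1. (s [^]\<^bsub>G\<^esub> k) x)"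

lemma sum_zeta_nontrivial:
  assumes "\<not> q dvd n"
  shows "(\<Sum>m\<in>{1..<q}. z ^ (n * m)) = -1"
proof -
  have "z ^ n \<noteq> 1" using assms zeta_power_eq_1[OF q1] by simp
  moreover have "(z ^ n) ^ q = 1" using zeta_power_self[OF q1] by (metis power_commutes power_mult power_one mult.commute)
  ultimately have "(\<Sum>m<q. (z ^ n) ^ m) = 0" by (simp add: geometric_sum)
  moreover have "{..<q} = insert 0 {1..<q}" using q1 by auto
  ultimately show ?thesis 
    by (simp add: power_mult[symmetric] eq_neg_iff_add_eq_0 add.commute)
qed

lemma tr_zeta: "tr (z ^ n) = (if q dvd n then of_nat q - 1 else -1)"
proof -
  have 1: "tr (z ^ n) = (\<Sum>k<q - 1. z ^ (n * (g ^ k mod q)))"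
    unfolding tr_def
  proof (rule sum.cong[OF refl])
    fix k
    have "(s [^]\<^bsub>G\<^esub> k) (z ^ n) = z ^ (g ^ k * n)"
      using Gal_pow[OF G.nat_pow_closed[OF s'] z_L'] by (simp add: s_pow_zeta power_mult)
    also have "\<dots> = z ^ (n * (g ^ k mod q))"
      using zeta_power_eq[OF q1, of "g ^ k * n" "n * (g ^ k mod q)"] by (simp add: mod_mult_right_eq mult.commute)
    finally show "(s [^]\<^bsub>G\<^esub> k) (z ^ n) = z ^ (n * (g ^ k mod q))" .
  qed
  also have "\<dots> = (\<Sum>m\<in>{1..<q}. z ^ (n * m))"
    by (rule sum.reindex_bij_betw[OF g_bij])
  finally have eq: "tr (z ^ n) = (\<Sum>m\<in>{1..<q}. z ^ (n * m))" .
  show ?thesis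
  proof (cases "q dvd n")
    case True
    then have "z ^ (n * m) = 1" for m using zeta_power_eq_1[OF q1, of "n * m"] by simp
    then show ?thesis unfolding eq using True q1 by (simp add: of_nat_diff)
  next
    case False
    then show ?thesis unfolding eq using sum_zeta_nontrivial by simp
  qed
qed

lemma tr_sum:
  assumes "\<And>k. a k \<in> \<rat>"
  shows "tr (\<Sum>k\<in>I. a k * z ^ f k) = (\<Sum>k\<in>I. a k * tr (z ^ f k))"
proof -
  have "tr (\<Sum>k\<in>I. a k * z ^ f k) = (\<Sum>j<q - 1. \<Sum>k\<in>I. a k * (s [^]\<^bsub>G\<^esub> j) (z ^ f k))"
    unfolding tr_def Gal_sum_zeta[OF G.nat_pow_closed[OF s'] assms] Gal_pow[OF G.nat_pow_closed[OF s'] z_L'] ..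
  also have "\<dots> = (\<Sum>k\<in>I. a k * tr (z ^ f k))"
    unfolding tr_def sum_distrib_left by (rule sum.swap)
  finally show ?thesis .
qed

lemma tr_rat: "x \<in> Rz \<Longrightarrow> tr x \<in> \<rat>"
proof -
  assume "x \<in> Rz"
  then obtain a where a: "x = (\<Sum>k<q. a k * z ^ k)" "\<And>k. a k \<in> \<rat>" unfolding Rz_def by blast
  have "(\<Sum>k<q. a k * tr (z ^ k)) \<in> \<rat>"
    by (intro csubfield_sum[of \<rat>]) (auto simp: csubfield_def a(2) tr_zeta)
  then show ?thesis unfolding a(1) tr_sum[OF a(2)] .
qed

text \<open>The trace of a fixed element is q - 1 times the element, and traces are rational because
  those of the powers of z are integers.\<close>

lemma fixed_rat:
  assumes x: "x \<in> Rz" and "s x = x"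
  shows "x \<in> \<rat>"
proof -
  have "tr x = of_nat (q - 1) * x"
    unfolding tr_def using pow_apply_fixed[OF s' Rz_L[OF x] assms(2)] by simp
  then have "x = tr x / of_nat (q - 1)" using q2 by simp
  then show ?thesis using tr_rat[OF x] by (metis Rats_divide Rats_of_nat)
qed

lemma s_s_pow: "x \<in> L \<Longrightarrow> s ((s [^]\<^bsub>G\<^esub> (k::nat)) x) = (s [^]\<^bsub>G\<^esub> Suc k) x"
  using Gal_comp[OF s' G.nat_pow_closed[OF s']] G.nat_pow_Suc2[OF s'] by simp

lemma Rz_field: "csubfield Rz"
  unfolding csubfield_def
proof (intro conjI ballI Rz_add Rz_mult)
  show "1 \<in> Rz" by (rule Rz_rat) simp
  fix x assume x: "x \<in> Rz"
  show "- x \<in> Rz" using Rz_mult[OF Rz_rat[of "-1"] x] by simp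
  show "inverse x \<in> Rz"
  proof (cases "x = 0")
    case False
    \<comment> \<open>The norm: \<open>s\<close> permutes its factors cyclically, so it is rational,
      and the product of the other conjugates divided by it is the inverse.\<close>
    define nm where "nm = (\<Prod>k<q - 1. (s [^]\<^bsub>G\<^esub> k) x)"
    have xL: "(s [^]\<^bsub>G\<^esub> k) x \<in> L" for k :: nat using Rz_L s_pow_Rz x by blast
    have "s nm = (\<Prod>k<q - 1. (s [^]\<^bsub>G\<^esub> Suc k) x)"
      unfolding nm_def by (simp only: Gal_prod[OF s' xL] s_s_pow[OF Rz_L[OF x]])
    also have "\<dots> = nm" unfolding nm_def
      by (rule prod_lessThan_shift_periodic) (simp only: s_pow_order[OF x] pow_apply_0[OF Rz_L[OF x]])
    finally have "s nm = nm" .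
    moreover have "nm \<in> Rz" unfolding nm_def by (intro Rz_prod s_pow_Rz x)
    ultimately have nm: "nm \<in> \<rat>" using fixed_rat by blast
    have nz: "nm \<noteq> 0"
      unfolding nm_def using Gal_eq_0[OF G.nat_pow_closed[OF s'] Rz_L[OF x]] False by simp
    have "{..<q - 1} = insert 0 {1..<q - 1}" using q2 by auto
    then have "nm = x * (\<Prod>k\<in>{1..<q - 1}. (s [^]\<^bsub>G\<^esub> k) x)"
      unfolding nm_def using pow_apply_0[OF Rz_L[OF x]] by (simp del: G.nat_pow_0)
    then have "inverse x = inverse nm * (\<Prod>k\<in>{1..<q - 1}. (s [^]\<^bsub>G\<^esub> k) x)"
      using nz False by (simp add: field_simps)
    moreover have "inverse nm \<in> Rz" using nm by (intro Rz_rat) simp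
    ultimately show ?thesis using Rz_mult Rz_prod s_pow_Rz x by metis
  qed (simp add: Rz_rat)
qed

lemma gen_zeta: "gen {z} = Rz"
proof
  show "gen {z} \<subseteq> Rz" by (rule gen_least[OF Rz_field]) (use Rz_monom[of 1 1] in auto)
  have "z \<in> gen {z}" by (rule gen_incl) simp
  show "Rz \<subseteq> gen {z}"
  proof
    fix x assume "x \<in> Rz"
    then obtain a where a: "x = (\<Sum>k<q. a k * z ^ k)" "\<And>k. a k \<in> \<rat>" unfolding Rz_def by blast
    show "x \<in> gen {z}" unfolding a(1)
      by (intro csubfield_sum[OF csubfield_gen] csubfield_mult[OF csubfield_gen]
        csubfield_power[OF csubfield_gen] \<open>z \<in> gen {z}\<close> subsetD[OF csubfield_Rats[OF csubfield_gen] a(2)])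
  qed
qed

lemma zeta_OL: "z \<in> OL"
  unfolding OL_def using z_L' algebraic_int_zeta[OF q1] by simp

text \<open>The integers of the cyclotomic field: if \<open>x = \<Sum> c\<^sub>k z\<^sup>k\<close> (\<open>0 < k < q\<close>) is integral, then
  \<open>q c\<^sub>k\<close> is the trace of \<open>x (z\<^bsup>q-k\<^esup> - 1)\<close>, an integer divisible by \<open>1 - z\<close> and hence by \<open>q\<close>.\<close>

lemma integral_basis:
  assumes x: "x \<in> gen {z}" "x \<in> OL"
  obtains a :: "nat \<Rightarrow> int" where "x = (\<Sum>k\<in>{1..<q}. of_int (a k) * z ^ k)"
proof -
  obtain a' where a': "x = (\<Sum>k<q. a' k * z ^ k)" "\<And>k. a' k \<in> \<rat>"
    using x(1) unfolding gen_zeta Rz_def by blast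
  \<comment> \<open>Subtracting a multiple of the vanishing sum of all powers removes the constant
    term, so that the exponents run from 1 to q - 1.\<close>
  define c where "c k = a' k - a' 0" for k
  have c: "c k \<in> \<rat>" for k unfolding c_def using a'(2) by simp
  have s0: "(\<Sum>k<q. z ^ k) = 0"
    using sum_zeta_nontrivial[of 1] q2 lessThan_atLeast0[of q] sum.atLeast_Suc_lessThan[of 0 q "\<lambda>k. z ^ k"] by simp
  have "(\<Sum>k<q. c k * z ^ k) = x - a' 0 * (\<Sum>k<q. z ^ k)"
    unfolding c_def a'(1) by (simp add: algebra_simps sum_subtractf sum_distrib_left)
  then have "x = (\<Sum>k<q. c k * z ^ k)" unfolding s0 by simp
  moreover have "{..<q} = insert 0 {1..<q}" using q1 by auto
  ultimately have xc: "x = (\<Sum>k\<in>{1..<q}. c k * z ^ k)" by (simp add: c_def)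
  have "\<exists>m::int. c k = of_int m" if k: "k \<in> {1..<q}" for k
  proof -
    \<comment> \<open>The trace of x z^(q-k) is q c_k minus the sum of all coefficients, and
      subtracting the trace of x cancels that sum.\<close>
    define y where "y = x * z ^ (q - k) - x"
    have yO: "y \<in> OL" unfolding y_def using x zeta_OL by (simp add: OL_diff OL_mult OL_power)
    have tr_diff: "tr (u - v) = tr u - tr v" if "u \<in> L" "v \<in> L" for u v
      unfolding tr_def using that by (simp add: Gal_diff[OF G.nat_pow_closed[OF s']] sum_subtractf)
    have xL: "x \<in> L" "x * z ^ (q - k) \<in> L" using x OL_L zeta_OL OL_mult OL_power by blast+
    have dv: "q dvd j + (q - k) \<longleftrightarrow> j = k" if j: "j \<in> {1..<q}" for j
    proof
      assume "q dvd j + (q - k)"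
      then obtain m where m: "j + (q - k) = q * m" by blast
      have "0 < q * m" "q * m < q * 2" unfolding m[symmetric] using j k by auto
      then have "m = 1" using q1 by simp
      then have "j + (q - k) = q" unfolding m by (rule ssubst) (rule mult_1_right)
      moreover have "q - k + k = q" using k by simp
      ultimately show "j = k" by linarith
    qed (use k in auto)
    have t1: "tr (x * z ^ (q - k)) = of_nat q * c k - (\<Sum>j\<in>{1..<q}. c j)"
    proof -
      have "x * z ^ (q - k) = (\<Sum>j\<in>{1..<q}. c j * z ^ (j + (q - k)))"
        unfolding xc sum_distrib_right by (simp add: power_add mult.assoc)
      then have "tr (x * z ^ (q - k)) = (\<Sum>j\<in>{1..<q}. c j * tr (z ^ (j + (q - k))))"
        using tr_sum[OF c] by simp
      also have "\<dots> = (\<Sum>j\<in>{1..<q}. (if j = k then of_nat q * c j else 0) - c j)"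
        by (rule sum.cong[OF refl]) (use dv in \<open>auto simp: tr_zeta algebra_simps\<close>)
      also have "\<dots> = of_nat q * c k - (\<Sum>j\<in>{1..<q}. c j)" using k by (simp add: sum_subtractf)
      finally show ?thesis .
    qed
    have t2: "tr x = - (\<Sum>j\<in>{1..<q}. c j)"
    proof -
      have "tr x = (\<Sum>j\<in>{1..<q}. c j * tr (z ^ j))" using tr_sum[where a = c and I = "{1..<q}" and f = "\<lambda>j. j", OF c] xc by simp
      also have "\<dots> = (\<Sum>j\<in>{1..<q}. - c j)"
        by (rule sum.cong[OF refl]) (auto simp: tr_zeta dest: dvd_imp_le)
      finally show ?thesis by (simp add: sum_negf)
    qed
    have ty: "tr y = of_nat q * c k" unfolding y_def tr_diff[OF xL(2,1)] t1 t2 by simp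
    have "tr y \<in> OL" unfolding tr_def by (intro OL_sum Gal_OL[OF G.nat_pow_closed[OF s'] yO])
    moreover have "tr y \<in> \<rat>" unfolding ty using c by simp
    ultimately have "tr y \<in> \<int>" using algebraic_int_rat unfolding OL_def by blast
    then obtain n where n: "tr y = of_int n" by (rule Ints_cases)
    \<comment> \<open>Divisibility by q of the integer tr y is tested at a prime above q, where z is
      congruent to 1.\<close>
    obtain P where P: "P \<in> primes_above L q" using primes_above_nonempty[OF q(1)] by blast
    interpret P: prime_above L P q by unfold_locales (use P q in auto)
    have "(z - 1) ^ q \<in> P"
    proof -
      have "((z - 1) + 1) ^ q - ((z - 1) ^ q + 1 ^ q) \<in> P"
        using P.cg_power_add[of "z - 1" 1 q] zeta_OL unfolding P.cg_def by (simp add: OL_diff OL_one)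
      then have "- ((z - 1) ^ q) \<in> P" using zeta_power_self[OF q1] by simp
      then show ?thesis using P.P_uminus by fastforce
    qed
    then have z1: "z - 1 \<in> P" using P.P_prime_power zeta_OL by (simp add: OL_diff OL_one)
    have zj: "z ^ j - 1 \<in> P" for j
    proof (induction j)
      case (Suc j)
      have "z ^ Suc j - 1 = z * (z ^ j - 1) + (z - 1)" by (simp add: algebra_simps)
      then show ?case using P.P_add[OF P.P_mult[OF zeta_OL Suc] z1] by (simp only:)
    qed (simp add: P.P_0)
    have "(s [^]\<^bsub>G\<^esub> i) y \<in> P" for i :: nat
    proof -
      note si = G.nat_pow_closed[OF s', of i]
      have "(s [^]\<^bsub>G\<^esub> i) y = (s [^]\<^bsub>G\<^esub> i) x * (z ^ (g ^ i * (q - k)) - 1)"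
        unfolding y_def
        by (simp add: Gal_diff[OF si xL(2,1)] Gal_mul[OF si xL(1)] L_closed z_L' Gal_pow[OF si z_L']
            s_pow_zeta power_mult right_diff_distrib)
      then show ?thesis using P.P_mult[OF Gal_OL[OF si x(2)] zj] by simp
    qed
    then have "tr y \<in> P" unfolding tr_def by (rule P.P_sum)
    then have "int q dvd n" unfolding n P.P_of_int .
    then obtain m where "n = int q * m" by blast
    then have "of_nat q * c k = of_nat q * of_int m" using trans[OF ty[symmetric] n] by simp
    moreover have "(of_nat q :: complex) \<noteq> 0" using q1 by simp
    ultimately have "c k = of_int m" using mult_left_cancel by blast
    then show ?thesis ..
  qed
  then obtain a where "\<And>k. k \<in> {1..<q} \<Longrightarrow> c k = of_int (a k)" by metis
  then have "x = (\<Sum>k\<in>{1..<q}. of_int (a k) * z ^ k)" unfolding xc by simp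
  then show ?thesis using that by blast
qed

text \<open>The quadratic Gauss sum, indexed by exponents of \<open>g\<close>: the quadratic
  character of g^k is (-1)^k, and the k-th power of \<open>s\<close> maps z to z^(g^k).\<close>

definition gauss_sum :: complex where
  "gauss_sum = (\<Sum>k<q - 1. (-1) ^ k * (s [^]\<^bsub>G\<^esub> k) z)"

lemma gauss_sum_Rz: "gauss_sum \<in> Rz"
  unfolding gauss_sum_def s_pow_zeta by (intro Rz_sum Rz_monom) simp

lemma s_pow_L: "x \<in> L \<Longrightarrow> (s [^]\<^bsub>G\<^esub> (k::nat)) x \<in> L"
  by (rule Gal_closed[OF G.nat_pow_closed[OF s']])

lemma s_gauss_sum: "s gauss_sum = - gauss_sum"
proof -
  let ?f = "\<lambda>k. (-1) ^ k * (s [^]\<^bsub>G\<^esub> k) z"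
  have m1: "(-1) ^ k \<in> L" for k :: nat using L_closed by simp
  have "s gauss_sum = (\<Sum>k<q - 1. s (?f k))"
    unfolding gauss_sum_def by (rule Gal_sum[OF s']) (intro L_closed m1 s_pow_L z_L')
  also have "\<dots> = (\<Sum>k<q - 1. - ?f (Suc k))"
    by (rule sum.cong[OF refl])
      (simp only: Gal_mul[OF s' m1 s_pow_L[OF z_L']] s_s_pow[OF z_L'] Gal_rat[OF s'] Rats_power Rats_minus_iff Rats_1,
        simp del: G.nat_pow_Suc)
  also have "\<dots> = - (\<Sum>k<q - 1. ?f (Suc k))" by (rule sum_negf)
  also have "(\<Sum>k<q - 1. ?f (Suc k)) = (\<Sum>k<q - 1. ?f k)"
  proof (rule sum_lessThan_shift_periodic)
    have "even (q - 1)" using q by simp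
    then show "?f (q - 1) = ?f 0"
      using s_pow_order[of z] Rz_monom[of 1 1] by (simp add: Gal_one_apply[OF z_L'])
  qed
  finally show ?thesis unfolding gauss_sum_def .
qed

text \<open>The power of \<open>g\<close> with exponent (q - 1)/2 is -1 modulo q, since its square
  is 1 and it is not 1 itself; injectivity of the powers excludes other exponents.\<close>

lemma g_pow_half: "d < q - 1 \<Longrightarrow> q dvd 1 + g ^ d \<longleftrightarrow> d = (q - 1) div 2"
proof -
  define h where "h = (q - 1) div 2"
  have q1h: "q - 1 = 2 * h" unfolding h_def using q(2) by simp
  have h0: "0 < h" using q1h q2 by linarith
  have "\<not> (q - 1) dvd h" using h0 q1h by (auto dest: dvd_imp_le)
  then have ne: "\<not> [g ^ h = 1] (mod q)" using g_pow_eq_1[of h] q2 unfolding cong_def by simp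
  have gh: "g ^ h \<ge> 1"
    using g_pow_eq_1[of "2 * h"] q1h h0 by (cases "g = 0") (auto simp: zero_power)
  have "q dvd (g ^ h + 1) * (g ^ h - 1)"
  proof -
    have g2: "g ^ (2 * h) = (g ^ h) ^ 2" by (simp only: power_mult[symmetric] mult.commute)
    have "g ^ (2 * h) mod q = 1" using g_pow_eq_1[of "2 * h"] q1h by simp
    then have "[(g ^ h) ^ 2 = 1] (mod q)" unfolding g2 using q2 by (simp add: cong_def)
    then have "q dvd (g ^ h) ^ 2 - 1" using one_le_power[OF gh, of 2] by (simp only: cong_altdef_nat)
    also obtain y where "g ^ h = Suc y" using gh by (cases "g ^ h") auto
    then have "(g ^ h) ^ 2 - 1 = (g ^ h + 1) * (g ^ h - 1)"
      by (simp add: power2_eq_square algebra_simps)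
    finally show ?thesis .
  qed
  then have "q dvd g ^ h + 1 \<or> q dvd g ^ h - 1" by (rule prime_dvd_multD[OF q(1)])
  moreover have "\<not> q dvd g ^ h - 1" using ne gh by (simp only: cong_altdef_nat not_False_eq_True)
  ultimately have dh: "q dvd 1 + g ^ h" by (simp add: add.commute)
  assume d: "d < q - 1"
  have "d = h" if "q dvd 1 + g ^ d"
  proof -
    have "[1 + g ^ d = 1 + g ^ h] (mod q)" using that dh by (simp add: cong_def mod_eq_0_iff_dvd)
    then have "g ^ d mod q = g ^ h mod q" unfolding cong_add_lcancel_nat by (simp add: cong_def)
    moreover have "h < q - 1" using q1h h0 by simp
    ultimately show ?thesis using g_bij d unfolding bij_betw_def inj_on_def by auto
  qed
  then show ?thesis using dh unfolding h_def[symmetric] by blast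
qed

text \<open>As s^j multiplies the sum \<tau> by (-1)^j, one of the two factors can be absorbed into
  a trace: \<tau>^2 = tr(z \<tau>). In this trace the terms z^(1 + g^d) are alike except for the one
  exponent where 1 + g^d is divisible by q.\<close>

lemma gauss_sum_square: "gauss_sum ^ 2 = of_int (qstar q)"
proof -
  let ?h = "(q - 1) div 2"
  have gL: "gauss_sum \<in> L" by (rule Rz_L[OF gauss_sum_Rz])
  have "gauss_sum ^ 2 = (\<Sum>j<q - 1. ((-1) ^ j * (s [^]\<^bsub>G\<^esub> j) z) * gauss_sum)"
    unfolding power2_eq_square sum_distrib_right[symmetric] gauss_sum_def ..
  also have "\<dots> = tr (z * gauss_sum)"
    unfolding tr_def
  proof (rule sum.cong[OF refl])
    fix j
    have "(s [^]\<^bsub>G\<^esub> j) gauss_sum = (-1) ^ j * gauss_sum"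
      by (rule pow_apply_neg[OF s' gL s_gauss_sum])
    then show "(-1) ^ j * (s [^]\<^bsub>G\<^esub> j) z * gauss_sum = (s [^]\<^bsub>G\<^esub> j) (z * gauss_sum)"
      using Gal_mul[OF G.nat_pow_closed[OF s'] z_L' gL] by simp
  qed
  also have "z * gauss_sum = (\<Sum>d<q - 1. (-1) ^ d * z ^ (1 + g ^ d))"
    unfolding gauss_sum_def s_pow_zeta sum_distrib_left by (simp add: mult_ac)
  also have "tr \<dots> = (\<Sum>d<q - 1. (-1) ^ d * tr (z ^ (1 + g ^ d)))"
    by (rule tr_sum) simp
  also have "\<dots> = (\<Sum>d<q - 1. (if d = ?h then (-1) ^ d * of_nat q else 0) - (-1) ^ d)"
  proof (rule sum.cong[OF refl])
    fix d assume "d \<in> {..<q - 1}"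
    then have "tr (z ^ (1 + g ^ d)) = (if d = ?h then of_nat q - 1 else -1)"
      unfolding tr_zeta using g_pow_half by simp
    then show "(-1) ^ d * tr (z ^ (1 + g ^ d)) = (if d = ?h then (-1) ^ d * of_nat q else 0) - (-1) ^ d"
      by (simp only:) (simp add: algebra_simps)
  qed
  also have "\<dots> = (-1) ^ ?h * of_nat q - (\<Sum>d<q - 1. (-1) ^ d)"
    using q2 by (simp add: sum_subtractf)
  also have "(\<Sum>d<q - 1. (-1) ^ d) = (0 :: complex)"
    using q by (simp add: geometric_sum)
  finally show ?thesis unfolding qstar_def using q by auto
qed

lemma Gal_zeta:
  assumes \<sigma>: "\<sigma> \<in> carrier G"
  obtains b where "\<sigma> z = (s [^]\<^bsub>G\<^esub> (b::nat)) z"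
proof -
  have "\<sigma> z ^ q = 1" using Gal_pow[OF \<sigma> z_L', of q] zeta_power_self[OF q1] Gal_1[OF \<sigma>] by simp
  then obtain k where k: "k < q" "\<sigma> z = z ^ k" using root_of_unity_zeta[OF q1] by blast
  have "k \<noteq> 0"
  proof
    assume "k = 0"
    then have "\<sigma> z = \<sigma> 1" using k Gal_1[OF \<sigma>] by simp
    then have "z = 1" using Gal_inj[OF \<sigma> z_L'] L_closed by simp
    then show False using zeta_power_eq_1[OF q1, of 1] q2 by simp
  qed
  then have "k \<in> {1..<q}" using k by simp
  then have "k \<in> (\<lambda>i. g ^ i mod q) ` {..<q - 1}" using bij_betw_imp_surj_on[OF g_bij] by blast
  then obtain b where "g ^ b mod q = k" by blast
  then have "z ^ (g ^ b) = z ^ k" using zeta_power_mod[OF q1, of "g ^ b"] by simp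
  then show ?thesis using that k s_pow_zeta by metis
qed

lemma zeta_free: "(s [^]\<^bsub>G\<^esub> (b::nat)) z = z \<Longrightarrow> (q - 1) dvd b"
  using zeta_power_eq[OF q1, of "g ^ b" 1] g_pow_eq_1[of b] q2 unfolding s_pow_zeta by simp

end

subsection \<open>Local factors for odd \<open>q\<close>\<close>

locale odd_quartic = cyclotomic +
  fixes r :: complex and t e :: "complex \<Rightarrow> complex" and K B :: "complex set"
  assumes L_gen': "L = gen {\<i>, zeta q, r}" and K_gen': "K = gen {\<i>, zeta q}" and B_gen': "B = gen {zeta q}"
    and r4: "r ^ 4 = of_int (qstar q)" and t': "t \<in> carrier G" and e': "e \<in> carrier G"
    and t_i': "t \<i> = - \<i>" and t_z': "t (zeta q) = zeta q" and s_i': "s \<i> = \<i>"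
    and e_i': "e \<i> = \<i>" and e_z': "e (zeta q) = zeta q" and e_r': "e r = - r"
begin

text \<open>\<open>r\<close> is an arbitrary fourth root, so its square is the Gauss sum up to sign
  only. Both signs lie in \<open>B\<close> and are negated by \<open>s\<close>, which is what the
  tower needs.\<close>

lemma r2_gauss: "r ^ 2 = gauss_sum \<or> r ^ 2 = - gauss_sum"
proof -
  have "(r ^ 2) ^ 2 = gauss_sum ^ 2" unfolding gauss_sum_square r4[symmetric] by (simp add: power_mult[symmetric])
  then show ?thesis by (simp only: power2_eq_iff)
qed

sublocale quartic L r "zeta q" t s e "q - 1" K B
proof (unfold_locales, (rule L_gen' K_gen' B_gen' t' s' e' t_i' t_z' s_i')+)
  have gB: "gauss_sum \<in> B" using gauss_sum_Rz gen_zeta B_gen' by simp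
  show "s (zeta q) \<in> B" unfolding s_zeta B_gen' by (intro csubfield_power[OF csubfield_gen] gen_incl) simp
  show "e \<i> = \<i>" "e (zeta q) = zeta q" "e r = - r" by (fact e_i' e_z' e_r')+
  show "r ^ 2 \<in> B" using r2_gauss gB csubfield_uminus[OF csubfield_gen] B_gen' by auto
  show "r \<noteq> 0"
  proof
    assume "r = 0"
    then have "of_int (qstar q) = (0 :: complex)" using r4 by simp
    then have "qstar q = 0" by (simp only: of_int_eq_0_iff)
    then show False using q1 unfolding qstar_def by (auto split: if_splits)
  qed
  show "s (r ^ 2) = - (r ^ 2)"
    using r2_gauss s_gauss_sum Gal_uminus[OF s' Rz_L[OF gauss_sum_Rz]] by auto
  show "(s [^]\<^bsub>G\<^esub> (q - 1)) (zeta q) = zeta q" using s_pow_order[of z] Rz_monom[of 1 1] by simp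
  show "even (q - 1)" using q by simp
  show "q - 1 > 0" using q2 by simp
  show "\<exists>b. \<sigma> (zeta q) = (s [^]\<^bsub>G\<^esub> (b::nat)) (zeta q)" if "\<sigma> \<in> carrier G" for \<sigma>
    using Gal_zeta[OF that] by metis
  show "(q - 1) dvd b" if "(s [^]\<^bsub>G\<^esub> (b::nat)) (zeta q) = zeta q" for b using zeta_free[OF that] .
qed

lemma r_OL: "r \<in> OL"
proof -
  have "algebraic_int (of_int (qstar q) :: complex)" by (rule algebraic_int_of_int)
  then have "algebraic_int (r ^ 4)" unfolding r4 .
  then have "algebraic_int r" by (rule algebraic_int_power_root) simp
  then show ?thesis unfolding OL_def using r_L by simp
qed

lemma integral_basis_B:
  assumes "x \<in> B" "x \<in> OL"
  obtains a :: "nat \<Rightarrow> int" where "x = (\<Sum>k\<in>{1..<q}. of_int (a k) * z ^ k)"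
  using integral_basis[of x] assms unfolding B_gen' by blast

lemma word_mod: "word b a k = word (b mod (q - 1)) a (k + (q - 1) div 2 * (b div (q - 1)))"
proof -
  let ?N = "q - 1"
  have "word b a k = word (?N * (b div ?N) + b mod ?N) (0 + a) (0 + k + 0 * (b mod ?N))"
    by (simp only: mult_div_mod_eq add_0 mult_zero_left add_0_right)
  also have "\<dots> = word (?N * (b div ?N)) 0 0 \<otimes>\<^bsub>G\<^esub> word (b mod ?N) a k"
    by (rule word_mult[symmetric])
  also have "\<dots> = word 0 0 (0 + ?N div 2 * (b div ?N)) \<otimes>\<^bsub>G\<^esub> word (b mod ?N) a k"
    unfolding word_N ..
  finally show ?thesis unfolding word_mult by (simp only: add_0 mult_zero_left add_0_right add.commute)
qed

lemma word_cong:
  assumes "[b = b0] (mod (q - 1))"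
  obtains k' where "word b a k = word b0 a k'"
proof -
  let ?h = "(q - 1) div 2"
  \<comment> \<open>Both quotients are added, although one of them ought to be subtracted; the
    exponent of \<open>e\<close> matters only modulo 2.\<close>
  define k' where "k' = k + ?h * (b div (q - 1)) + ?h * (b0 div (q - 1))"
  have "word b0 a k' = word (b0 mod (q - 1)) a (k' + ?h * (b0 div (q - 1)))" by (rule word_mod)
  also have "k' + ?h * (b0 div (q - 1)) = k + ?h * (b div (q - 1)) + 2 * (?h * (b0 div (q - 1)))"
    unfolding k'_def by simp
  also have "word (b0 mod (q - 1)) a \<dots> = word (b0 mod (q - 1)) a (k + ?h * (b div (q - 1)))"
    by (rule word_shift_even)
  also have "b0 mod (q - 1) = b mod (q - 1)" using assms unfolding cong_def by simp
  finally show ?thesis using that[of k'] word_mod[of b a k] by simp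
qed

lemma word_a_even: "even a \<Longrightarrow> word b a k = word b 0 k"
  unfolding word_def by (simp add: t_pow_even)

lemma word_a_odd: "odd a \<Longrightarrow> word b a k = word b 1 k"
  unfolding word_def using t_pow_even by (auto elim!: oddE)

lemma index_nat:
  assumes l: "prime l" "l \<noteq> q"
  obtains b where "[l = g ^ b] (mod q)"
proof -
  have "\<not> q dvd l" using l q(1) primes_dvd_imp_eq by blast
  then have "l mod q \<in> {1..<q}" using q1 by (auto simp: Suc_le_eq mod_greater_zero_iff_not_dvd)
  then have "l mod q \<in> (\<lambda>i. g ^ i mod q) ` {..<q - 1}" using bij_betw_imp_surj_on[OF g_bij] by blast
  then obtain b where "l mod q = g ^ b mod q" by blast
  then show ?thesis using that[of b] unfolding cong_def by blast
qed

end

section \<open>Primes not dividing 2q, for odd q\<close>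

locale odd_at = odd_quartic + prime_above
begin

sublocale quartic_at L r "zeta q" t s e "q - 1" K B P l
  by unfold_locales

lemma B_cong:
  assumes \<sigma>: "\<sigma> \<in> carrier G" and m: "m = 1 \<or> m = l" and z: "\<sigma> z \<doteq> z ^ m" and x: "x \<in> B" "x \<in> OL"
  shows "\<sigma> x \<doteq> x ^ m"
proof -
  obtain a :: "nat \<Rightarrow> int" where a: "x = (\<Sum>k\<in>{1..<q}. of_int (a k) * z ^ k)"
    using integral_basis_B[OF x] by blast
  show ?thesis unfolding a by (rule cg_zpoly[OF \<sigma> m zeta_OL z])
qed

lemma z_cg_1: "l = q \<Longrightarrow> z \<doteq> 1"
proof -
  assume l: "l = q"
  have "z ^ q \<doteq> 1 ^ q" using zeta_power_self[OF q1] by simp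
  have "((z - 1) + 1) ^ l \<doteq> (z - 1) ^ l + 1 ^ l"
    by (rule cg_power_add) (auto intro: OL_diff zeta_OL OL_one)
  then have "1 \<doteq> (z - 1) ^ l + 1" using zeta_power_self[OF q1] l by simp
  then have "(z - 1) ^ l \<in> P" unfolding cg_def using P_uminus[of "- ((z - 1) ^ l)"] by simp
  then have "z - 1 \<in> P" by (rule P_prime_power[OF OL_diff[OF zeta_OL OL_one]])
  then show ?thesis unfolding cg_def .
qed

lemma frobenius_nonempty: "frobenius_elements L P l \<noteq> {}"
proof (cases "l = q")
  \<comment> \<open>At l = q one has z^q = 1 and z congruent to 1, so the identity already acts as
    the q-th power on z.\<close>
  case True
  have "\<one>\<^bsub>G\<^esub> z \<doteq> z ^ l"
    using zeta_power_self[OF q1] z_cg_1[OF True] True by (simp add: Gal_one_apply z_L)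
  then show ?thesis using frobenius_exists[OF G.one_closed] B_cong[OF G.one_closed] by blast
next
  case False
  obtain b where b: "[l = g ^ b] (mod q)" using index_nat[OF prime_l False] by blast
  have sb: "s [^]\<^bsub>G\<^esub> b \<in> carrier G" using s by simp
  have "(s [^]\<^bsub>G\<^esub> b) z = z ^ l"
    unfolding s_pow_zeta using zeta_power_eq[OF q1] b unfolding cong_def by metis
  then have "(s [^]\<^bsub>G\<^esub> b) z \<doteq> z ^ l" by simp
  then show ?thesis using frobenius_exists[OF sb] B_cong[OF sb] by blast
qed

text \<open>The exponent n = i + (q - 1) j plays the role of i - j. If z^n is congruent to 1 but q
  does not divide n, the sum of the powers z^(nm) for 0 < m < q is -1 and congruent to q - 1, so l
  divides q.\<close>

lemma zeta_separated:
  assumes l: "l \<noteq> q" and ij: "z ^ i \<doteq> z ^ j"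
  shows "z ^ i = z ^ j"
proof -
  define n where "n = i + (q - 1) * j"
  have j: "z ^ j * z ^ ((q - 1) * j) = 1"
  proof -
    have "j + (q - 1) * j = q * j" using q1 by (simp add: algebra_simps diff_mult_distrib)
    then show ?thesis using zeta_power_eq_1[OF q1, of "q * j"] by (simp flip: power_add)
  qed
  have "z ^ i * z ^ ((q - 1) * j) \<doteq> z ^ j * z ^ ((q - 1) * j)"
    by (intro cg_mult ij cg_refl OL_power zeta_OL)
  then have n1: "z ^ n \<doteq> 1" unfolding j n_def power_add .
  have "q dvd n"
  proof (rule ccontr)
    assume "\<not> q dvd n"
    then have "(\<Sum>m\<in>{1..<q}. z ^ (n * m)) = -1" by (rule sum_zeta_nontrivial)
    moreover have "(\<Sum>m\<in>{1..<q}. z ^ (n * m)) \<doteq> (\<Sum>m\<in>{1..<q}. 1 ^ m)"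
      unfolding power_mult by (intro cg_sum cg_power n1 OL_power zeta_OL)
    ultimately have "-1 \<doteq> of_nat (q - 1)" by simp
    then have "of_int (-1) \<doteq> of_int (int (q - 1))" by simp
    then have "[-1 = int (q - 1)] (mod int l)" unfolding cg_of_int .
    then have "int l dvd int (q - 1) - (-1)" using cong_sym cong_iff_dvd_diff by blast
    moreover have "int (q - 1) - (-1) = int q" using q1 by linarith
    ultimately have "int l dvd int q" by (simp only:)
    then have "l dvd q" by simp
    then show False using l q(1) prime_l primes_dvd_imp_eq by blast
  qed
  then have "z ^ i * z ^ ((q - 1) * j) = z ^ j * z ^ ((q - 1) * j)"
    using zeta_power_eq_1[OF q1, of n] unfolding j n_def power_add by simp
  then show ?thesis using zeta_nz by simp
qed

lemma sep: "l \<noteq> q \<Longrightarrow> \<sigma> \<in> carrier G \<Longrightarrow> \<sigma> z \<doteq> z \<Longrightarrow> \<sigma> z = z"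
proof -
  assume l: "l \<noteq> q" and \<sigma>: "\<sigma> \<in> carrier G" and zz: "\<sigma> z \<doteq> z"
  obtain b where b: "\<sigma> z = z ^ (g ^ b)" using Gal_zeta[OF \<sigma>] s_pow_zeta by metis
  then show ?thesis using zeta_separated[OF l, of "g ^ b" 1] zz by simp
qed

lemma r_notin_P: "l \<noteq> q \<Longrightarrow> r \<notin> P"
proof
  assume l: "l \<noteq> q" and "r \<in> P"
  then have "r * r ^ 3 \<in> P" by (intro P_mult2 OL_power r_OL)
  then have "of_int (qstar q) \<in> P" using r4 by (simp add: numeral_eq_Suc)
  then have "int l dvd qstar q" unfolding P_of_int .
  then have "int l dvd int q" unfolding qstar_def using q by (auto simp: minus_one_power_iff split: if_splits)
  then have "l dvd q" by simp
  then show False using l q(1) prime_l primes_dvd_imp_eq by blast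
qed

lemma inertia_good:
  assumes "odd l" "l \<noteq> q"
  shows "inertia_group L P = {\<one>\<^bsub>G\<^esub>}"
proof (rule inertia_trivial)
  show "\<sigma> z = z" if "\<sigma> \<in> carrier G" "\<sigma> z \<doteq> z" for \<sigma> by (rule sep[OF assms(2) that])
qed (rule two_notin_P[OF assms(1)] r_OL r_notin_P[OF assms(2)] zeta_OL)+

text \<open>Powers of z are determined by their residues, so the exponent of \<open>s\<close> is
  known modulo q - 1 and may be prescribed within its class; the change goes into the exponent of
  \<open>e\<close>.\<close>

lemma frobenius_word:
  assumes l: "l \<noteq> q" and F: "F \<in> frobenius_elements L P l" and b0: "[l = g ^ b0] (mod q)"
  obtains a k where "F = word b0 a k"
proof -
  have FG: "F \<in> carrier G" and Fz: "F z \<doteq> z ^ l" using F zeta_OL unfolding frobenius_iff by auto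
  obtain b a k where w: "F = word b a k" using word_exhaust[OF FG] by blast
  have "z ^ (g ^ b) \<doteq> z ^ l" using Fz unfolding w word_z s_pow_zeta .
  then have "z ^ (g ^ b) = z ^ l" by (rule zeta_separated[OF l])
  then have "[g ^ b = l] (mod q)" using zeta_power_eq[OF q1] unfolding cong_def by metis
  then have "[g ^ b = g ^ b0] (mod q)" using b0 cong_trans by blast
  moreover have "coprime q g" using g unfolding residue_primroot_def by blast
  ultimately have "[b = b0] (mod (q - 1))" using order_divides_expdiff[of q g b b0] ord_g by simp
  then obtain k' where "word b a k = word b0 a k'" by (rule word_cong)
  then show ?thesis using that w by simp
qed

lemma frobenius_sign:
  assumes l: "l \<noteq> q" "l mod 4 = 1" and F: "word b 0 k \<in> frobenius_elements L P l" and b: "even b"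
    and \<alpha>: "[\<alpha> ^ 2 = qstar q] (mod int l)"
  shows "(-1) ^ k = of_int (Legendre \<alpha> (int l)) * (-1 :: complex) ^ (b div 2)"
proof -
  have odd: "odd l" using l(2) by presburger
  then have l2: "2 < l" using prime_ge_2_nat[OF prime_l] by (cases "l = 2") auto
  note two = two_notin_P[OF odd]
  obtain m where m: "l = 4 * m + 1" using l(2) by (metis mult_div_mod_eq)
  have "r ^ (4 * m) = of_int (qstar q ^ m)" using r4 by (simp add: power_mult)
  also have "\<dots> \<doteq> of_int ((\<alpha> ^ 2) ^ m)" unfolding cg_of_int by (rule cong_sym[OF cong_pow[OF \<alpha>]])
  also have "(\<alpha> ^ 2) ^ m = \<alpha> ^ ((l - 1) div 2)" unfolding m by (simp flip: power_mult)
  also have "of_int \<dots> \<doteq> of_int (Legendre \<alpha> (int l))"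
    unfolding cg_of_int by (rule cong_sym[OF euler_criterion[OF prime_l l2]])
  finally have rl: "r ^ (4 * m) \<doteq> of_int (Legendre \<alpha> (int l))" .
  have "word b 0 k r \<doteq> r ^ l" using F r_OL unfolding frobenius_iff by blast
  then have "(-1) ^ k * (-1) ^ (b div 2) * r \<doteq> r ^ (4 * m) * r"
    unfolding word_r_even[OF b] m by (simp add: mult.commute)
  also have "\<dots> \<doteq> of_int (Legendre \<alpha> (int l)) * r" by (intro cg_mult rl cg_refl OL_power r_OL)
  finally have "((-1) ^ k * (-1) ^ (b div 2) - of_int (Legendre \<alpha> (int l))) * r \<in> P"
    unfolding cg_def by (simp add: algebra_simps)
  moreover have pm: "(-1) ^ k * (-1) ^ (b div 2) - of_int (Legendre \<alpha> (int l))
      = (of_int ((-1) ^ k * (-1) ^ (b div 2) - Legendre \<alpha> (int l)) :: complex)" by simp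
  ultimately have "of_int ((-1) ^ k * (-1) ^ (b div 2) - Legendre \<alpha> (int l)) \<in> P"
    using P_prime[OF OL_of_int r_OL] r_notin_P[OF l(1)] by metis
  then have dv: "int l dvd (-1) ^ k * (-1) ^ (b div 2) - Legendre \<alpha> (int l)" unfolding P_of_int .
  define x :: int where "x = (-1) ^ k * (-1) ^ (b div 2)"
  have x: "x = 1 \<or> x = -1" unfolding x_def by (cases "even k"; cases "even (b div 2)") auto
  \<comment> \<open>The Legendre symbol might a priori be 0, so the two values are compared by size:
    they differ by at most 2, and l > 2.\<close>
  have L: "Legendre \<alpha> (int l) = 1 \<or> Legendre \<alpha> (int l) = -1 \<or> Legendre \<alpha> (int l) = 0"
    unfolding Legendre_def by auto
  have "\<bar>x - Legendre \<alpha> (int l)\<bar> < int l" using x L l2 by auto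
  then have "x = Legendre \<alpha> (int l)" using dv zdvd_not_zless[of "\<bar>x - Legendre \<alpha> (int l)\<bar>" "int l"]
    unfolding x_def[symmetric] by (cases "x = Legendre \<alpha> (int l)") auto
  then have "Legendre \<alpha> (int l) = (-1) ^ k * (-1) ^ (b div 2)" unfolding x_def ..
  then have "of_int (Legendre \<alpha> (int l)) = (-1 :: complex) ^ k * (-1) ^ (b div 2)" by simp
  then show ?thesis by (simp only: mult.assoc minus_one_mult_self mult_1_right)
qed

end

context odd_quartic
begin

lemma odd_atI:
  assumes "prime l" "P \<in> primes_above L l"
  shows "odd_at L q g s r t e K B P l"
proof (rule odd_at.intro[OF odd_quartic_axioms])
  show "prime_above L P l"
    by (rule prime_above.intro[OF number_field_axioms]) (rule prime_above_axioms.intro[OF assms(2,1)])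
qed

text \<open>A Frobenius element is a word with the given exponent b of \<open>s\<close>. The parity
  of a is decided by l modulo 4, and k enters only if a and b are both even, which is the only case
  that needs \<alpha>.\<close>

lemma artin_factor_good:
  assumes l: "prime l" "odd l" "l \<noteq> q" and b: "[l = g ^ b] (mod q)" and \<rho>: "standard_rep c \<rho>"
  shows "l mod 4 = 1 \<and> odd b \<or> l mod 4 = 3 \<and> even b \<Longrightarrow>
      artin_factor L 2 \<rho> l w = inverse (1 - c ^ b * (of_nat l powr (- w)) ^ 2)"
    and "l mod 4 = 3 \<and> odd b \<Longrightarrow>
      artin_factor L 2 \<rho> l w = inverse (1 + c ^ b * (of_nat l powr (- w)) ^ 2)"
    and "l mod 4 = 1 \<and> even b \<Longrightarrow> [\<alpha> ^ 2 = qstar q] (mod int l) \<Longrightarrow>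
      artin_factor L 2 \<rho> l w = inverse ((1 - of_int (Legendre \<alpha> (int l)) * (-1) ^ (b div 2)
        * c ^ (b div 2) * of_nat l powr (- w)) ^ 2)"
proof -
  let ?X = "of_nat l powr (- w) :: complex"
  have main: "artin_factor L 2 \<rho> l w = inverse d"
    if d: "\<And>P a k. P \<in> primes_above L l \<Longrightarrow> word b a k \<in> frobenius_elements L P l \<Longrightarrow> local_det c b a k ?X = d" for d
  proof (rule artin_factor_eqI[OF subfield l(1)])
    fix P assume P: "P \<in> primes_above L l"
    interpret A: odd_at L q g s r t e K B P l by (rule odd_atI[OF l(1) P])
    show "frobenius_elements L P l \<noteq> {}" by (rule A.frobenius_nonempty)
    fix F assume F: "F \<in> frobenius_elements L P l"
    obtain a k where w: "F = word b a k" by (rule A.frobenius_word[OF l(3) F b])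
    show "det_on 2 (fixed_space 2 \<rho> (inertia_group L P)) (1\<^sub>m 2 - ?X \<cdot>\<^sub>m \<rho> F) = d"
      unfolding w A.good_local_factor[OF \<rho> A.inertia_good[OF l(2,3)]]
      using d[OF P] F unfolding w by blast
  qed
  have par: "even a \<longleftrightarrow> l mod 4 = 1"
    if P: "P \<in> primes_above L l" and F: "word b a k \<in> frobenius_elements L P l" for P a k
  proof -
    interpret A: odd_at L q g s r t e K B P l by (rule odd_atI[OF l(1) P])
    show ?thesis by (rule A.frobenius_inertia_i[OF F A.two_notin_P[OF l(2)] l(2)])
  qed
  show "artin_factor L 2 \<rho> l w = inverse (1 - c ^ b * ?X ^ 2)"
    if "l mod 4 = 1 \<and> odd b \<or> l mod 4 = 3 \<and> even b"
    by (rule main) (use par that in \<open>auto simp: local_det_def\<close>)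
  show "artin_factor L 2 \<rho> l w = inverse (1 + c ^ b * ?X ^ 2)" if "l mod 4 = 3 \<and> odd b"
    by (rule main) (use par that in \<open>auto simp: local_det_def\<close>)
  show "artin_factor L 2 \<rho> l w = inverse ((1 - of_int (Legendre \<alpha> (int l)) * (-1) ^ (b div 2)
        * c ^ (b div 2) * ?X) ^ 2)"
    if b: "l mod 4 = 1 \<and> even b" and \<alpha>: "[\<alpha> ^ 2 = qstar q] (mod int l)"
  proof (rule main)
    fix P a k assume P: "P \<in> primes_above L l" and F: "word b a k \<in> frobenius_elements L P l"
    interpret A: odd_at L q g s r t e K B P l by (rule odd_atI[OF l(1) P])
    have a: "even a" using par[OF P F] b by blast
    have F0: "word b 0 k \<in> frobenius_elements L P l" using F unfolding word_a_even[OF a] .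
    have "(-1) ^ k = of_int (Legendre \<alpha> (int l)) * (-1 :: complex) ^ (b div 2)"
      by (rule A.frobenius_sign[OF l(3) conjunct1[OF b] F0 conjunct2[OF b] \<alpha>])
    then show "local_det c b a k ?X = (1 - of_int (Legendre \<alpha> (int l)) * (-1) ^ (b div 2) * c ^ (b div 2) * ?X) ^ 2"
      unfolding local_det_def using a b by simp
  qed
qed

end

section \<open>The local factor at q\<close>

lemma fixed_space_lineI:
  assumes w: "w \<in> carrier_vec n" and rep: "representation G n \<phi>" and H: "H \<subseteq> carrier G"
    and fx: "\<And>h. h \<in> H \<Longrightarrow> \<phi> h *\<^sub>v w = w"
    and line: "\<And>v. v \<in> carrier_vec n \<Longrightarrow> (\<And>h. h \<in> H \<Longrightarrow> \<phi> h *\<^sub>v v = v) \<Longrightarrow> \<exists>k. v = k \<cdot>\<^sub>v w"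
  shows "fixed_space n \<phi> H = {k \<cdot>\<^sub>v w | k. True}"
proof (rule Set.set_eqI)
  fix v
  show "v \<in> fixed_space n \<phi> H \<longleftrightarrow> v \<in> {k \<cdot>\<^sub>v w | k. True}"
  proof
    assume "v \<in> fixed_space n \<phi> H"
    then have "\<exists>k. v = k \<cdot>\<^sub>v w" by (intro line) (auto simp: fixed_space_def)
    then show "v \<in> {k \<cdot>\<^sub>v w | k. True}" by simp
  next
    assume "v \<in> {k \<cdot>\<^sub>v w | k. True}"
    then obtain k where v: "v = k \<cdot>\<^sub>v w" by blast
    have "\<phi> h *\<^sub>v v = v" if h: "h \<in> H" for h
    proof -
      have "\<phi> h \<in> carrier_mat n n" using rep_closed[OF rep] h H by blast
      then show ?thesis unfolding v by (subst mult_mat_vec[OF _ w]) (auto simp: fx[OF h])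
    qed
    then show "v \<in> fixed_space n \<phi> H" unfolding fixed_space_def using v w by simp
  qed
qed

lemma one_minus_smult_mult_vec:
  assumes A: "A \<in> carrier_mat n n" and w: "w \<in> carrier_vec n" and ev: "A *\<^sub>v w = d \<cdot>\<^sub>v (w :: complex vec)"
  shows "(1\<^sub>m n - x \<cdot>\<^sub>m A) *\<^sub>v w = (1 - x * d) \<cdot>\<^sub>v w"
proof -
  have "(1\<^sub>m n - x \<cdot>\<^sub>m A) *\<^sub>v w = 1\<^sub>m n *\<^sub>v w - (x \<cdot>\<^sub>m A) *\<^sub>v w"
    by (rule minus_mult_distrib_mat_vec[of _ n n]) (use A w in auto)
  also have "(x \<cdot>\<^sub>m A) *\<^sub>v w = (x * d) \<cdot>\<^sub>v w"
    using smult_mat_mult_vec[OF A w] ev by (simp add: smult_smult_assoc)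
  finally show ?thesis using w by (intro eq_vecI) (auto simp: algebra_simps)
qed

context odd_at
begin

lemma inertia_a_even:
  assumes "2 \<notin> P" "word b a k \<in> inertia_group L P"
  shows "even a"
proof -
  have "word b a k \<i> \<doteq> \<i>" using assms(2) i_OL unfolding inertia_iff by blast
  then have "(-1) ^ a * \<i> \<doteq> (-1) ^ 0 * \<i>" unfolding word_i by simp
  then have "even a \<longleftrightarrow> even (0::nat)" by (rule neg_not_cg[OF assms(1) i_OL i_notin_P])
  then show ?thesis by simp
qed

text \<open>Since z is congruent to 1, \<open>s\<close> acts trivially on the residues of
  \<open>B\<close>. The same then holds on \<open>K\<close> for \<open>s\<close> or for
  \<open>s\<close> after \<open>t\<close>; the latter negates \<i> and is excluded. A power of
  \<open>e\<close> corrects the action on \<open>L\<close>.\<close>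

lemma inertia_s:
  assumes l: "l = q"
  obtains k where "word 1 0 k \<in> inertia_group L P"
proof -
  have z: "z \<doteq> 1" by (rule z_cg_1[OF l])
  have "z ^ g \<doteq> 1 ^ g" by (rule cg_power[OF z zeta_OL])
  then have "s z \<doteq> z ^ 1" using cg_trans[OF _ cg_sym[OF z]] s_zeta by simp
  then have B: "s x \<doteq> x ^ 1" if "x \<in> B" "x \<in> OL" for x
    using B_cong[OF s _ _ that, of 1] by simp
  have odd: "odd l" using l q(2) by simp
  have "\<not> s (t \<i>) \<doteq> \<i> ^ 1"
  proof
    assume "s (t \<i>) \<doteq> \<i> ^ 1"
    then have "(-1) ^ 1 * \<i> \<doteq> (-1) ^ 0 * \<i>" using t_i Gal_uminus[OF s i_L] s_i by simp
    then have "even (1::nat) \<longleftrightarrow> even (0::nat)" by (rule neg_not_cg[OF two_notin_P[OF odd] i_OL i_notin_P])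
    then show False by simp
  qed
  moreover have "\<i> \<in> K \<inter> OL" using i_K i_OL by blast
  moreover have "(\<forall>x\<in>K \<inter> OL. s x \<doteq> x ^ 1) \<or> (\<forall>x\<in>K \<inter> OL. s (t x) \<doteq> x ^ 1)"
    by (rule lift_K[OF s _ B]) auto
  ultimately have K: "\<And>x. x \<in> K \<Longrightarrow> x \<in> OL \<Longrightarrow> s x \<doteq> x" by auto
  obtain k :: nat where "s \<otimes>\<^bsub>G\<^esub> e [^]\<^bsub>G\<^esub> k \<in> inertia_group L P" by (rule inertia_lift[OF s K])
  moreover have "s \<otimes>\<^bsub>G\<^esub> e [^]\<^bsub>G\<^esub> k = word 1 0 k" unfolding word_def using s e by simp
  ultimately show thesis using that[of k] by simp
qed

lemma inertia_s_pow:
  assumes "word 1 0 k \<in> inertia_group L P"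
  shows "word b 0 (k * b) \<in> inertia_group L P"
proof (induction b)
  case 0
  have "\<one>\<^bsub>G\<^esub> \<in> inertia_group L P" unfolding inertia_iff using Gal_one_apply OL_L by auto
  then show ?case unfolding one_word by simp
next
  case (Suc b)
  have "word (Suc b) 0 (k * Suc b) = word b 0 (k * b) \<otimes>\<^bsub>G\<^esub> word 1 0 k"
    unfolding word_mult by (simp add: add.commute)
  then show ?case using inertia_comp[OF Suc assms] by simp
qed

text \<open>The inertia element s e^k squares to the scalar c, so a fixed vector v satisfies c v =
  v.\<close>

lemma local_det_q_nontrivial:
  assumes \<rho>: "standard_rep c \<rho>" and l: "l = q" and c: "c \<noteq> 1" and F: "F \<in> carrier G"
  shows "det_on 2 (fixed_space 2 \<rho> (inertia_group L P)) (1\<^sub>m 2 - x \<cdot>\<^sub>m \<rho> F) = 1"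
proof -
  have rep: "representation G 2 \<rho>" using \<rho> unfolding standard_rep_def by simp
  obtain k where k: "word 1 0 k \<in> inertia_group L P" by (rule inertia_s[OF l])
  have "fixed_space 2 \<rho> (inertia_group L P) = {0\<^sub>v 2}"
  proof (rule fixed_space_zeroI[OF rep inertia_carrier])
    fix v :: "complex vec" assume v: "v \<in> carrier_vec 2" and fx: "\<And>h. h \<in> inertia_group L P \<Longrightarrow> \<rho> h *\<^sub>v v = v"
    obtain a b where ab: "v = v2 a b" using v2_exhaust[OF v] by blast
    have "word_mat c 1 0 k *\<^sub>v v2 a b = v2 a b" using fx[OF k] unfolding ab standard_rep_word[OF \<rho>] .
    then have *: "(-1) ^ k * c * b = a" "(-1) ^ k * a = b"
      unfolding word_mat_def by (simp_all add: m2_smult m2_mult_vec v2_eq_iff)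
    have "(-1) ^ k * ((-1) ^ k * c * b) = b" using * by simp
    then have "((-1) ^ k * (-1) ^ k) * (c * b) = b" by (simp only: mult.assoc)
    then have "c * b = b" by (simp add: minus_one_mult_self)
    then have "b = 0" using c by simp
    then show "v = 0\<^sub>v 2" using * unfolding ab v2_zero by simp
  qed
  then show ?thesis
    using det_on_zero[OF minus_carrier_mat[OF smult_carrier_mat[OF rep_closed[OF rep F]]]] by simp
qed

text \<open>As \<open>(z - 1)\<^bsup>q-1\<^esup>\<close> is \<open>-q\<close> times a principal unit, \<open>w = (z - 1)\<^bsup>(q-1)/4\<^esup> / r\<close> is a unit at \<open>P\<close>;
  the inertia group is seen through its sign under \<open>e\<close>.\<close>

lemma uniformizer_quotient:
  assumes l: "l = q" and q4: "q mod 4 = 1"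
  obtains w where "w \<in> OL" "w \<notin> P" "w ^ 4 \<doteq> -1" "e w = - w"
proof -
  define p where "p = z - 1"
  have pP: "p \<in> P" using z_cg_1[OF l] unfolding cg_def p_def .
  note pO = P_OL[OF pP]
  define n where "n = (q - 1) div 4"
  have n: "q - 1 = 4 * n" using q4 unfolding n_def by presburger
  define c where "c k = (q choose k) div q" for k
  define Y where "Y = (\<Sum>k\<in>{2..<q}. of_nat (c k) * p ^ (k - 2))"
  have YO: "Y \<in> OL" unfolding Y_def by (intro OL_sum OL_mult OL_of_nat OL_power pO)
  \<comment> \<open>Expanding z^q = 1 at z = 1 + p and dividing by p gives p^(q-1) = -q (1 + p Y),
    because the inner binomial coefficients are divisible by q.\<close>
  have "(p + 1) ^ q = (\<Sum>k\<le>q. of_nat (q choose k) * p ^ k * 1 ^ (q - k))" by (rule binomial_ring)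
  also have "{..q} = insert 0 (insert 1 (insert q {2..<q}))" using q2 by auto
  also have "(\<Sum>k\<in>\<dots>. of_nat (q choose k) * p ^ k * 1 ^ (q - k))
      = 1 + (of_nat q * p + (p ^ q + (\<Sum>k\<in>{2..<q}. of_nat (q choose k) * p ^ k)))"
    using q2 by simp
  also have "(\<Sum>k\<in>{2..<q}. of_nat (q choose k) * p ^ k) = of_nat q * p ^ 2 * Y"
    unfolding Y_def sum_distrib_left
  proof (rule sum.cong[OF refl])
    fix k assume k: "k \<in> {2..<q}"
    have "q dvd (q choose k)" by (intro dvd_choose_prime) (use k q(1) in auto)
    then have "q choose k = q * c k" unfolding c_def by simp
    moreover have "p ^ k = p ^ 2 * p ^ (k - 2)" 
    proof -
      have "2 + (k - 2) = k" by (rule le_add_diff_inverse) (use k in simp)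
      then show ?thesis by (metis power_add)
    qed
    ultimately show "of_nat (q choose k) * p ^ k = of_nat q * p ^ 2 * (of_nat (c k) * p ^ (k - 2))" by simp
  qed
  finally have "of_nat q * p + (p ^ q + of_nat q * p ^ 2 * Y) = 0"
    using zeta_power_self[OF q1] unfolding p_def by simp
  moreover have "p ^ q = p * p ^ (q - 1)" using q1 by (simp flip: power_Suc)
  ultimately have "p * (p ^ (q - 1) + of_nat q * (1 + p * Y)) = 0" by (simp add: algebra_simps power2_eq_square)
  moreover have "p \<noteq> 0" using zeta_power_eq_1[OF q1, of 1] q2 unfolding p_def by auto
  ultimately have pq: "p ^ (q - 1) = - (of_nat q * (1 + p * Y))" by (simp add: add_eq_0_iff2)
  have "even ((q - 1) div 2)" unfolding n by simp
  then have "qstar q = int q" using q2 unfolding qstar_def by simp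
  then have r4': "r ^ 4 = of_nat q" using r4 by simp
  \<comment> \<open>Here r^4 = q, so the fourth power is p^(q-1) / q = -(1 + p Y). This is integral,
    and therefore so is the quotient w.\<close>
  define w where "w = p ^ n * inverse r"
  have "w ^ 4 = p ^ (q - 1) * inverse (r ^ 4)"
    unfolding w_def n by (simp add: power_mult_distrib power_inverse mult.commute flip: power_mult)
  also have "\<dots> = (- (1 + p * Y)) * (of_nat q * inverse (of_nat q))" unfolding pq r4' by (simp add: algebra_simps)
  finally have w4: "w ^ 4 = - (1 + p * Y)" using q1 by simp
  have w4O: "w ^ 4 \<in> OL" unfolding w4 by (intro OL_uminus OL_add OL_mult OL_one pO YO)
  have wL: "w \<in> L" unfolding w_def using OL_L[OF pO] r_L L_closed by simp
  have "algebraic_int (w ^ 4)" using w4O unfolding OL_def by blast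
  then have "algebraic_int w" by (rule algebraic_int_power_root) simp
  then have wO: "w \<in> OL" unfolding OL_def using wL by simp
  have "w ^ 4 - -1 = - (p * Y)" unfolding w4 by simp
  then have c4: "w ^ 4 \<doteq> -1" unfolding cg_def using P_uminus[OF P_mult2[OF pP YO]] by simp
  have wP: "w \<notin> P"
  proof
    assume "w \<in> P"
    then have "w * w ^ 3 \<in> P" by (rule P_mult2[OF _ OL_power[OF wO]])
    moreover have "w * w ^ 3 = w ^ 4" by (simp add: numeral_eq_Suc)
    ultimately have "w ^ 4 \<in> P" by simp
    then have "w ^ 4 - (w ^ 4 - -1) \<in> P" using c4 unfolding cg_def by (rule P_diff)
    then show False using P_uminus[of "-1"] P_1 by simp
  qed
  have ep: "e p = p" unfolding p_def using Gal_diff[OF e z_L, of 1] Gal_1[OF e] e_z L_closed by simp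
  have "e w = e (p ^ n) * e (inverse r)"
    unfolding w_def by (rule Gal_mul[OF e]) (use OL_L[OF pO] r_L L_closed in simp_all)
  also have "\<dots> = - w"
    unfolding Gal_pow[OF e OL_L[OF pO]] ep Gal_inverse[OF e r_L] e_r w_def by (simp add: inverse_minus_eq)
  finally show thesis using that[OF wO wP c4] by simp
qed

text \<open>The word differs from the b-th power of the inertia element s e^k by the power
  \<open>k2 + k * b\<close> of \<open>e\<close>. The inertia part does not move w modulo P, so only
  the sign under \<open>e\<close> remains.\<close>

lemma word_uniformizer:
  assumes k: "word 1 0 k \<in> inertia_group L P" and w: "w \<in> OL" "e w = - w"
  shows "word b 0 k2 w \<doteq> (-1) ^ (k2 + k * b) * w"
proof -
  let ?j = "k2 + k * b" and ?\<tau> = "word b 0 (k * b)"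
  have \<tau>: "?\<tau> \<in> inertia_group L P" by (rule inertia_s_pow[OF k])
  have "word b 0 k2 = word b 0 (k2 + 2 * (k * b))" by (rule word_shift_even[symmetric])
  also have "k2 + 2 * (k * b) = k * b + ?j + 0 * 0" by linarith
  also have "word b 0 \<dots> = ?\<tau> \<otimes>\<^bsub>G\<^esub> word 0 0 ?j" unfolding word_mult by simp
  finally have "word b 0 k2 w = ?\<tau> (word 0 0 ?j w)"
    using Gal_comp[OF word_closed word_closed OL_L[OF w(1)]] by simp
  also have "word 0 0 ?j w = (-1) ^ ?j * w"
    unfolding word_def using pow_apply_neg[OF e OL_L[OF w(1)] w(2)] e by simp
  also have "?\<tau> \<dots> \<doteq> \<dots>" using \<tau> w(1) OL_mult[OF OL_power[OF OL_uminus[OF OL_one]]] unfolding inertia_iff by blast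
  finally show ?thesis .
qed

text \<open>A word multiplies \<open>v0\<close> by the same sign as the residue of w. Inertia fixes
  that residue and therefore \<open>v0\<close>. A Frobenius element multiplies it by w^(q-1) =
  (w^4)^((q-1)/4), which is congruent to (-1)^((q-1)/4).\<close>

lemma local_det_q_trivial:
  assumes \<rho>: "standard_rep 1 \<rho>" and l: "l = q" and q4: "q mod 4 = 1" and F: "F \<in> frobenius_elements L P l"
  shows "det_on 2 (fixed_space 2 \<rho> (inertia_group L P)) (1\<^sub>m 2 - x \<cdot>\<^sub>m \<rho> F) = 1 - (-1) ^ ((q - 1) div 4) * x"
proof -
  have rep: "representation G 2 \<rho>" using \<rho> unfolding standard_rep_def by simp
  obtain w where w: "w \<in> OL" "w \<notin> P" "w ^ 4 \<doteq> -1" "e w = - w" by (rule uniformizer_quotient[OF l q4])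
  obtain k where k: "word 1 0 k \<in> inertia_group L P" by (rule inertia_s[OF l])
  have odd: "odd l" using l q(2) by simp
  note two = two_notin_P[OF odd]
  define n where "n = (q - 1) div 4"
  have n: "q = 4 * n + 1" using q4 q1 unfolding n_def by presburger
  \<comment> \<open>For c = 1 the matrix of s e^k interchanges the coordinates up to (-1)^k; this is
    its eigenvector for the eigenvalue 1.\<close>
  define v0 where "v0 = v2 ((-1) ^ k) 1"
  have ev: "\<rho> (word b 0 k2) *\<^sub>v v0 = (-1) ^ (k2 + k * b) \<cdot>\<^sub>v v0" for b k2
    unfolding v0_def standard_rep_word[OF \<rho>] word_mat_def
    by (cases "even b"; cases "even k") (simp_all add: m2_smult m2_mult_vec v2_smult v2_eq_iff power_add)
  have I: "\<rho> h *\<^sub>v v0 = v0" if h: "h \<in> inertia_group L P" for h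
  proof -
    have hG: "h \<in> carrier G" using h inertia_carrier by blast
    obtain b a k2 where hw: "h = word b a k2" using word_exhaust[OF hG] by blast
    have "even a" using inertia_a_even[OF two] h unfolding hw by blast
    then have hw: "h = word b 0 k2" unfolding hw by (rule word_a_even)
    have "(-1) ^ (k2 + k * b) * w \<doteq> h w" unfolding hw by (rule cg_sym[OF word_uniformizer[OF k w(1,4)]])
    also have "\<dots> \<doteq> (-1) ^ 0 * w" using h w(1) unfolding inertia_iff by simp
    finally have "even (k2 + k * b) \<longleftrightarrow> even (0::nat)" by (rule neg_not_cg[OF two w(1,2)])
    then have "(-1) ^ (k2 + k * b) = (1::complex)" by simp
    then show ?thesis unfolding hw ev by (simp add: v0_def v2_smult)
  qed
  have W: "fixed_space 2 \<rho> (inertia_group L P) = {k \<cdot>\<^sub>v v0 | k. True}"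
  proof (rule fixed_space_lineI[OF _ rep inertia_carrier I])
    fix v :: "complex vec" assume v: "v \<in> carrier_vec 2" and fx: "\<And>h. h \<in> inertia_group L P \<Longrightarrow> \<rho> h *\<^sub>v v = v"
    obtain a b where ab: "v = v2 a b" using v2_exhaust[OF v] by blast
    have "word_mat 1 1 0 k *\<^sub>v v2 a b = v2 a b" using fx[OF k] unfolding ab standard_rep_word[OF \<rho>] .
    then have "(-1) ^ k * b = a"
      unfolding word_mat_def by (simp_all add: m2_smult m2_mult_vec v2_eq_iff)
    then have "v = b \<cdot>\<^sub>v v0" unfolding ab v0_def by (simp add: v2_smult v2_eq_iff mult.commute)
    then show "\<exists>k. v = k \<cdot>\<^sub>v v0" by blast
  qed (simp add: v0_def)
  have FG: "F \<in> carrier G" using F unfolding frobenius_iff by blast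
  obtain b a k2 where Fw: "F = word b a k2" using word_exhaust[OF FG] by blast
  have "even a" using frobenius_inertia_i[OF F[unfolded Fw] two odd] l q4 by simp
  then have Fw: "F = word b 0 k2" unfolding Fw by (rule word_a_even)
  have "(-1) ^ (k2 + k * b) * w \<doteq> F w" unfolding Fw by (rule cg_sym[OF word_uniformizer[OF k w(1,4)]])
  also have "\<dots> \<doteq> w ^ q" using F w(1) l unfolding frobenius_iff by simp
  also have "w ^ q = (w ^ 4) ^ n * w" unfolding n by (simp add: power_add power_mult)
  also have "\<dots> \<doteq> (-1) ^ n * w" by (intro cg_mult cg_power w OL_power cg_refl)
  finally have "even (k2 + k * b) \<longleftrightarrow> even n" by (rule neg_not_cg[OF two w(1,2)])
  then have sg: "(-1) ^ (k2 + k * b) = ((-1) ^ n :: complex)" by (simp only: minus_one_power_iff)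
  show ?thesis
  proof (rule det_on_line[OF _ _ _ _ W])
    show "v0 \<in> carrier_vec 2" "v0 \<noteq> 0\<^sub>v 2" unfolding v0_def v2_zero by (simp_all add: v2_eq_iff)
    show "1\<^sub>m 2 - x \<cdot>\<^sub>m \<rho> F \<in> carrier_mat 2 2"
      by (intro minus_carrier_mat smult_carrier_mat rep_closed[OF rep FG])
    have "(1\<^sub>m 2 - x \<cdot>\<^sub>m \<rho> F) *\<^sub>v v0 = (1 - x * (-1) ^ n) \<cdot>\<^sub>v v0"
      using ev[of b k2] unfolding sg Fw[symmetric]
      by (intro one_minus_smult_mult_vec[OF rep_closed[OF rep FG]]) (simp_all add: v0_def)
    then show "(1\<^sub>m 2 - x \<cdot>\<^sub>m \<rho> F) *\<^sub>v v0 = (1 - (-1) ^ ((q - 1) div 4) * x) \<cdot>\<^sub>v v0"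
      unfolding n_def by (simp add: mult.commute)
  qed
qed

end

context odd_quartic
begin

lemma artin_factor_q:
  assumes \<rho>: "standard_rep c \<rho>"
  shows "c \<noteq> 1 \<Longrightarrow> artin_factor L 2 \<rho> q w = 1"
    and "c = 1 \<Longrightarrow> q mod 4 = 1 \<Longrightarrow>
      artin_factor L 2 \<rho> q w = inverse (1 - (-1) ^ ((q - 1) div 4) * of_nat q powr (- w))"
proof -
  have ex: "frobenius_elements L P q \<noteq> {}" if P: "P \<in> primes_above L q" for P
  proof -
    interpret A: odd_at L q g s r t e K B P q by (rule odd_atI[OF q(1) P])
    show ?thesis by (rule A.frobenius_nonempty)
  qed
  {
    assume c: "c \<noteq> 1"
    have "artin_factor L 2 \<rho> q w = inverse 1"
    proof (rule artin_factor_eqI[OF subfield q(1) ex])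
      fix P F assume P: "P \<in> primes_above L q" and F: "F \<in> frobenius_elements L P q"
      interpret A: odd_at L q g s r t e K B P q by (rule odd_atI[OF q(1) P])
      have FG: "F \<in> carrier G" using F unfolding A.frobenius_iff by blast
      show "det_on 2 (fixed_space 2 \<rho> (inertia_group L P)) (1\<^sub>m 2 - of_nat q powr - w \<cdot>\<^sub>m \<rho> F) = 1"
        by (rule A.local_det_q_nontrivial[OF \<rho> refl c FG])
    qed
    then show "artin_factor L 2 \<rho> q w = 1" by simp
  }
  assume c: "c = 1" and q4: "q mod 4 = 1"
  show "artin_factor L 2 \<rho> q w = inverse (1 - (-1) ^ ((q - 1) div 4) * of_nat q powr (- w))"
  proof (rule artin_factor_eqI[OF subfield q(1) ex])
    fix P F assume P: "P \<in> primes_above L q" and F: "F \<in> frobenius_elements L P q"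
    interpret A: odd_at L q g s r t e K B P q by (rule odd_atI[OF q(1) P])
    show "det_on 2 (fixed_space 2 \<rho> (inertia_group L P)) (1\<^sub>m 2 - of_nat q powr - w \<cdot>\<^sub>m \<rho> F)
        = 1 - (-1) ^ ((q - 1) div 4) * of_nat q powr - w"
      by (rule A.local_det_q_trivial[OF \<rho>[unfolded c] refl q4 F])
  qed
qed

end

section \<open>The local factor at 2 for odd q\<close>

context odd_at
begin

text \<open>If \<open>\<sigma>\<close> raises \<open>z\<close> to its square, then \<open>\<sigma> y - y\<^sup>2\<close> is divisible by 2, so that \<open>2\<close> divides
  \<open>\<sigma> y\<close> whenever it divides \<open>y\<^sup>2\<close>: the ring of integers of \<open>B\<close> is reduced modulo 2.\<close>

lemma halve_power:
  assumes b: "[2 = g ^ b] (mod q)" and y: "y \<in> B" "y \<in> OL" and y2: "y ^ 2 / 2 \<in> OL"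
  shows "y / 2 \<in> OL"
proof -
  let ?\<sigma> = "s [^]\<^bsub>G\<^esub> b"
  have \<sigma>: "?\<sigma> \<in> carrier G" using s by simp
  have \<sigma>z: "?\<sigma> z = z ^ 2"
    unfolding s_pow_zeta using zeta_power_eq[OF q1] b unfolding cong_def by metis
  obtain a :: "nat \<Rightarrow> int" where a: "y = (\<Sum>k\<in>{1..<q}. of_int (a k) * z ^ k)"
    using integral_basis_B[OF y] by blast
  have \<sigma>y: "?\<sigma> y = (\<Sum>k\<in>{1..<q}. of_int (a k) * (z ^ k) ^ 2)"
  proof -
    have "?\<sigma> y = (\<Sum>k\<in>{1..<q}. of_int (a k) * ?\<sigma> z ^ k)"
      unfolding a by (rule Gal_sum_zeta[OF \<sigma>]) simp
    then show ?thesis unfolding \<sigma>z by (simp add: mult.commute flip: power_mult)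
  qed
  \<comment> \<open>Modulo 2 the mixed terms of the square vanish and each coefficient agrees with
    its square.\<close>
  have fr: "((\<Sum>k\<in>I. of_int (a k) * (z ^ k) ^ 2) - (\<Sum>k\<in>I. of_int (a k) * z ^ k) ^ 2) / 2 \<in> OL" for I :: "nat set"
  proof (induction I rule: infinite_finite_induct)
    case (insert x F)
    define S where "S = (\<Sum>k\<in>F. of_int (a k) * z ^ k)"
    define T where "T = (\<Sum>k\<in>F. of_int (a k) * (z ^ k) ^ 2)"
    have SO: "S \<in> OL" unfolding S_def by (intro OL_sum OL_mult OL_of_int OL_power zeta_OL)
    have "even (a x - a x ^ 2)" by simp
    then obtain m where m: "a x - a x ^ 2 = 2 * m" by blast
    then have am: "of_int (a x) - of_int (a x) ^ 2 = (2 * of_int m :: complex)"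
      by (metis of_int_diff of_int_mult of_int_numeral of_int_power)
    have "(of_int (a x) * (z ^ x) ^ 2 + T - (of_int (a x) * z ^ x + S) ^ 2) / 2
        = (of_int (a x) - of_int (a x) ^ 2) / 2 * (z ^ x) ^ 2 + (T - S ^ 2) / 2 - of_int (a x) * z ^ x * S"
      by (simp add: field_simps power2_eq_square)
    also have "(of_int (a x) - of_int (a x) ^ 2) / 2 = (of_int m :: complex)" unfolding am by simp
    also have "of_int m * (z ^ x) ^ 2 + (T - S ^ 2) / 2 - of_int (a x) * z ^ x * S \<in> OL"
      by (intro OL_diff OL_add OL_mult OL_of_int OL_power zeta_OL SO insert.IH[folded S_def T_def])
    finally show ?case using insert.hyps unfolding S_def T_def by simp
  qed (simp_all add: OL_zero)
  have yL: "y \<in> L" "y / 2 \<in> L" using OL_L[OF y(2)] L_closed csubfield_of_nat[OF subfield, of 2] csubfield_divide[OF subfield] by auto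
  have "?\<sigma> (y / 2) = ?\<sigma> y / 2"
    using Gal_divide[OF \<sigma> yL(1), of 2] csubfield_of_nat[OF subfield, of 2] Gal_of_nat[OF \<sigma>, of 2] by simp
  also have "\<dots> = y ^ 2 / 2 + (?\<sigma> y - y ^ 2) / 2" by (simp add: field_simps)
  also have "\<dots> \<in> OL" by (intro OL_add y2) (use fr[of "{1..<q}"] \<sigma>y a in simp)
  finally have so: "?\<sigma> (y / 2) \<in> OL" .
  \<comment> \<open>\<sigma> is bijective on the integers of \<open>L\<close>, so the integrality of
    \<sigma>(y/2) passes back to y/2.\<close>
  obtain w where w: "w \<in> OL" "?\<sigma> w = ?\<sigma> (y / 2)" by (rule Gal_surj[OF \<sigma> so])
  have "w = y / 2" using Gal_inj[OF \<sigma> OL_L[OF w(1)] yL(2)] w(2) by blast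
  then show ?thesis using w(1) by (simp only:)
qed

lemma half_OL_P: "l = 2 \<Longrightarrow> y / 2 \<in> OL \<Longrightarrow> y \<in> P"
  using P_mult2[OF P_l, of "y / 2"] by simp

text \<open>For x = a + b \<i> the numbers \<alpha> = 2a, \<beta> = 2b are integers of
  \<open>B\<close> with \<alpha>^2 + \<beta>^2 = 4\<nu>. By \<open>halve_power\<close>, 2 divides
  \<alpha> + \<beta>, because it divides its square. Substituting this, it divides \<beta>^2 and
  hence \<beta>, and t x - x = -\<beta> \<i>.\<close>

lemma t_cg_two:
  assumes l: "l = 2" and x: "x \<in> K" "x \<in> OL"
  shows "t x \<doteq> x"
proof -
  have lq: "l \<noteq> q" using l q2 by simp
  obtain b0 where b0: "[2 = g ^ b0] (mod q)" using index_nat[OF prime_l lq] l by blast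
  obtain a b where ab: "a \<in> B" "b \<in> B" "x = a + b * \<i>" using K_elim[OF x(1)] by blast
  have tx: "t x = a - b * \<i>" unfolding ab(3) by (rule t_K_apply[OF ab(1,2)])
  have txO: "t x \<in> OL" by (rule Gal_OL[OF t x(2)])
  define \<alpha> \<beta> where "\<alpha> = 2 * a" and "\<beta> = 2 * b"
  define \<nu> where "\<nu> = a * a + b * b"
  have "\<alpha> = x + t x" unfolding \<alpha>_def tx by (simp add: ab(3))
  then have \<alpha>O: "\<alpha> \<in> OL" using OL_add[OF x(2) txO] by simp
  have "\<beta> = - \<i> * (x - t x)" unfolding \<beta>_def tx by (simp add: ab(3))
  then have \<beta>O: "\<beta> \<in> OL" using OL_mult[OF OL_uminus[OF i_OL] OL_diff[OF x(2) txO]] by simp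
  have "\<nu> = x * t x" unfolding \<nu>_def tx by (simp add: ab(3) algebra_simps)
  then have \<nu>O: "\<nu> \<in> OL" using OL_mult[OF x(2) txO] by simp
  have "(2::complex) = of_nat 2" by simp
  then have twoB: "2 \<in> B" using csubfield_of_nat[OF B_field, of 2] by simp
  have B: "\<alpha> \<in> B" "\<beta> \<in> B" unfolding \<alpha>_def \<beta>_def by (intro csubfield_mult[OF B_field] twoB ab)+
  define \<delta> where "\<delta> = (\<alpha> + \<beta>) / 2"
  have two: "2 \<in> OL" using OL_of_nat[of 2] by simp
  have "(\<alpha> + \<beta>) ^ 2 / 2 = 2 * \<nu> + \<alpha> * \<beta>"
    unfolding \<alpha>_def \<beta>_def \<nu>_def by (simp add: field_simps power2_eq_square)
  then have "(\<alpha> + \<beta>) ^ 2 / 2 \<in> OL" using OL_add[OF OL_mult[OF two \<nu>O] OL_mult[OF \<alpha>O \<beta>O]] by (simp only:)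
  then have \<delta>O: "\<delta> \<in> OL" unfolding \<delta>_def
    by (rule halve_power[OF b0 csubfield_add[OF B_field B] OL_add[OF \<alpha>O \<beta>O]])
  have "\<beta> ^ 2 / 2 = \<delta> * \<beta> - (\<delta> ^ 2 - \<nu>)"
    unfolding \<delta>_def \<alpha>_def \<beta>_def \<nu>_def by (simp add: field_simps power2_eq_square)
  then have "\<beta> ^ 2 / 2 \<in> OL"
    using OL_diff[OF OL_mult[OF \<delta>O \<beta>O] OL_diff[OF OL_power[OF \<delta>O, of 2] \<nu>O]] by (simp only:)
  then have "\<beta> / 2 \<in> OL" by (rule halve_power[OF b0 B(2) \<beta>O])
  then have "\<beta> \<in> P" by (rule half_OL_P[OF l])
  then have "- (\<beta> * \<i>) \<in> P" by (intro P_uminus P_mult2 i_OL)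
  moreover have "t x - x = - (\<beta> * \<i>)" unfolding tx \<beta>_def by (simp add: ab(3))
  ultimately show ?thesis unfolding cg_def by simp
qed

lemma inertia_t:
  assumes "l = 2"
  obtains k where "word 0 1 k \<in> inertia_group L P"
proof -
  obtain k :: nat where "t \<otimes>\<^bsub>G\<^esub> e [^]\<^bsub>G\<^esub> k \<in> inertia_group L P" by (rule inertia_lift[OF t t_cg_two[OF assms]])
  moreover have "t \<otimes>\<^bsub>G\<^esub> e [^]\<^bsub>G\<^esub> k = word 0 1 k" unfolding word_def using t e by simp
  ultimately show thesis using that[of k] by simp
qed

text \<open>For odd \<open>b\<close>, conjugation by a Frobenius element sends the generator \<open>t e\<^bsup>k\<^esup>\<close> of inertia to
  \<open>t e\<^bsup>k+1\<^esup>\<close>, so that inertia contains \<open>e\<close>, which acts as \<open>-1\<close>.\<close>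

lemma local_det_two_trivial:
  assumes \<rho>: "standard_rep c \<rho>" and l: "l = 2" and b0: "[2 = g ^ b0] (mod q)" "odd b0"
    and F: "F \<in> frobenius_elements L P l"
  shows "det_on 2 (fixed_space 2 \<rho> (inertia_group L P)) (1\<^sub>m 2 - x \<cdot>\<^sub>m \<rho> F) = 1"
proof -
  have lq: "l \<noteq> q" using l q2 by simp
  have rep: "representation G 2 \<rho>" using \<rho> unfolding standard_rep_def by simp
  obtain k0 where k0: "word 0 1 k0 \<in> inertia_group L P" by (rule inertia_t[OF l])
  have FG: "F \<in> carrier G" and Fr: "\<And>x. x \<in> OL \<Longrightarrow> F x \<doteq> x ^ 2" using F l unfolding frobenius_iff by auto
  obtain a k where w: "F = word b0 a k" using frobenius_word[OF lq F] b0 l by blast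
  have "F \<otimes>\<^bsub>G\<^esub> word 0 1 k0 = word b0 (a + 1) (k + k0)"
    unfolding w word_mult by simp
  \<comment> \<open>The exponent of \<open>e\<close> is changed by the even number b0 + 1: b0 is the
    cost of moving t past s^b0, and the remaining 1 is the extra factor \<open>e\<close>.\<close>
  also have "\<dots> = word b0 (a + 1) (k + k0 + 2 * ((b0 + 1) div 2))" by (rule word_shift_even[symmetric])
  also have "2 * ((b0 + 1) div 2) = b0 + 1" using b0(2) by simp
  also have "word b0 (a + 1) (k + k0 + (b0 + 1)) = word 0 1 (k0 + 1) \<otimes>\<^bsub>G\<^esub> F"
    unfolding w word_mult by (simp add: ac_simps)
  finally have conj: "F \<otimes>\<^bsub>G\<^esub> word 0 1 k0 = word 0 1 (k0 + 1) \<otimes>\<^bsub>G\<^esub> F" .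
  have k1: "word 0 1 (k0 + 1) \<in> inertia_group L P"
    unfolding inertia_iff
  proof (intro conjI ballI word_closed)
    fix u assume u: "u \<in> OL"
    obtain y where y: "y \<in> OL" "F y = u" by (rule Gal_surj[OF FG u])
    have ty: "word 0 1 k0 y \<doteq> y" "word 0 1 k0 y \<in> OL"
      using k0 y(1) Gal_OL[OF word_closed y(1)] unfolding inertia_iff by auto
    have "word 0 1 (k0 + 1) u = F (word 0 1 k0 y)"
      using arg_cong[OF conj, of "\<lambda>f. f y"] y(2)
      by (simp only: Gal_comp[OF FG word_closed OL_L[OF y(1)]] Gal_comp[OF word_closed FG OL_L[OF y(1)]])
    also have "\<dots> \<doteq> (word 0 1 k0 y) ^ 2" by (rule Fr[OF ty(2)])
    also have "\<dots> \<doteq> y ^ 2" by (rule cg_power[OF ty])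
    also have "\<dots> \<doteq> u" using cg_sym[OF Fr[OF y(1)]] unfolding y(2) .
    finally show "word 0 1 (k0 + 1) u \<doteq> u" .
  qed
  have "fixed_space 2 \<rho> (inertia_group L P) = {0\<^sub>v 2}"
  proof (rule fixed_space_zeroI[OF rep inertia_carrier])
    fix v :: "complex vec" assume v: "v \<in> carrier_vec 2" and fx: "\<And>h. h \<in> inertia_group L P \<Longrightarrow> \<rho> h *\<^sub>v v = v"
    obtain a b where ab: "v = v2 a b" using v2_exhaust[OF v] by blast
    have "word_mat c 0 1 k0 *\<^sub>v v2 a b = v2 a b" "word_mat c 0 1 (k0 + 1) *\<^sub>v v2 a b = v2 a b"
      using fx[OF k0] fx[OF k1] unfolding ab standard_rep_word[OF \<rho>] by simp_all
    then have "a = 0 \<and> b = 0"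
      unfolding word_mat_def by (cases "even k0") (auto simp: m2_smult m2_mult_vec v2_eq_iff)
    then show "v = 0\<^sub>v 2" unfolding ab v2_zero by simp
  qed
  then show ?thesis
    using det_on_zero[OF minus_carrier_mat[OF smult_carrier_mat[OF rep_closed[OF rep FG]]]] by simp
qed

end

lemma algebraic_int_ipolyI:
  fixes x :: complex
  assumes "poly (map_poly of_int p) x = 0" "lead_coeff p = 1"
  shows "algebraic_int x"
  using assms unfolding algebraic_int_altdef_ipoly by blast

text \<open>The product of \<open>X\<^sup>2 - a X - a m\<close> with its conjugate has integral coefficients.\<close>

lemma algebraic_int_half_unit:
  fixes a y :: complex
  assumes a: "a ^ 2 = a + 2 * of_int m" and y: "y ^ 2 = a * y + a * of_int m"
  shows "algebraic_int y"
proof (rule algebraic_int_ipolyI)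
  let ?m = "of_int m :: complex"
  have "y ^ 4 - y ^ 3 - 3 * ?m * y ^ 2 - 4 * ?m ^ 2 * y - 2 * ?m ^ 3
      = (y ^ 2 - (a * y + a * ?m)) * (y ^ 2 - ((1 - a) * y + (1 - a) * ?m)) + (a ^ 2 - (a + 2 * ?m)) * (y + ?m) ^ 2"
    by (simp add: algebra_simps power2_eq_square power3_eq_cube power4_eq_xxxx)
  also have "\<dots> = 0" using a y by simp
  finally show "poly (map_poly of_int [:- 2 * m ^ 3, - 4 * m ^ 2, - 3 * m, -1, 1:]) y = 0"
    by (simp add: map_poly_pCons algebra_simps power2_eq_square power3_eq_cube power4_eq_xxxx)
qed simp

context odd_at
begin

text \<open>The element \<open>y = (\<omega> + 1) (1 + r') / 2\<close>, where \<open>\<omega> = (\<gamma> - 1) / 2 \<in> P\<close> and \<open>r'\<^sup>2 = \<gamma> = \<plusminus> r\<^sup>2\<close>,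
  is a root of \<open>y\<^sup>2 = (\<omega> + 1) (y + m)\<close>, so that its residue distinguishes \<open>r'\<close> from \<open>- r'\<close>.\<close>

lemma dyadic_unit:
  assumes l: "l = 2" and m: "qstar q - 1 = 8 * m"
  obtains r' y where "r' = r \<or> r' = \<i> * r" "r' ^ 2 = r ^ 2 \<or> r' ^ 2 = - (r ^ 2)" "y \<in> OL"
    "y ^ 2 \<doteq> y + of_int m"
    "\<And>\<sigma>. \<sigma> \<in> carrier G \<Longrightarrow> \<sigma> (r ^ 2) = r ^ 2 \<Longrightarrow> \<sigma> r' = r' \<Longrightarrow> \<sigma> y = y"
    "\<And>\<sigma>. \<sigma> \<in> carrier G \<Longrightarrow> \<sigma> (r ^ 2) = r ^ 2 \<Longrightarrow> \<sigma> r' = - r' \<Longrightarrow> \<sigma> y \<doteq> y + 1"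
proof -
  have q8: "of_int (qstar q) = (1 + 8 * of_int m :: complex)"
    using arg_cong[OF m, of "of_int :: int \<Rightarrow> complex"] by (simp add: algebra_simps)
  have r4': "(r ^ 2) ^ 2 = 1 + 8 * of_int m" using r4 q8 by (simp flip: power_mult)
  have two: "2 \<in> OL" using OL_of_nat[of 2] by simp
  have twoP: "2 \<in> P" using P_l l by simp
  have twoL: "2 \<in> L" by (rule OL_L[OF two])
  have irL: "\<i> * r \<in> L" using i_L r_L L_closed by simp
  \<comment> \<open>As in the quadratic field of a discriminant that is 1 mod 8, (x - 1)/2 is a root
    of X^2 + X - 2m, so it is integral and reduces to 0 or -1.\<close>
  have om: "(x - 1) / 2 \<in> OL \<and> ((x - 1) / 2) * ((x - 1) / 2 + 1) \<in> P"
    if x: "x \<in> L" "x ^ 2 = 1 + 8 * of_int m" for x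
  proof -
    let ?w = "(x - 1) / 2"
    have eq: "?w * (?w + 1) = 2 * of_int m"
    proof -
      have "?w * (?w + 1) = (x ^ 2 - 1) / 4" by (simp add: field_simps power2_eq_square)
      then show ?thesis unfolding x(2) by simp
    qed
    have "algebraic_int ?w"
    proof (rule algebraic_int_ipolyI)
      show "poly (map_poly of_int [:- 2 * m, 1, 1:]) ?w = 0"
        using eq by (simp add: map_poly_pCons algebra_simps)
    qed simp
    moreover have "?w \<in> L" using x(1) twoL L_closed csubfield_divide[OF subfield] by simp
    ultimately show ?thesis unfolding OL_def eq using P_mult2[OF twoP OL_of_int[of m]] by simp
  qed
  have r2L: "r ^ 2 \<in> L" by (rule r2_L)
  \<comment> \<open>If w belongs to r^2, then -(w + 1) belongs to -r^2. The product of w and w + 1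
    lies in P, so one sign of r^2 is suitable.\<close>
  obtain \<gamma> where \<gamma>: "\<gamma> = r ^ 2 \<or> \<gamma> = - (r ^ 2)" "(\<gamma> - 1) / 2 \<in> P"
  proof -
    let ?w = "(r ^ 2 - 1) / 2"
    have w: "?w \<in> OL" "?w * (?w + 1) \<in> P" using om[OF r2L r4'] by auto
    then have "?w \<in> P \<or> ?w + 1 \<in> P" by (intro P_prime OL_add OL_one) auto
    then show thesis
    proof
      assume "?w + 1 \<in> P"
      then have "- (?w + 1) \<in> P" by (rule P_uminus)
      moreover have "- (?w + 1) = (- (r ^ 2) - 1) / 2" by (simp add: field_simps)
      ultimately have "(- (r ^ 2) - 1) / 2 \<in> P" by (simp only:)
      then show thesis by (rule that[OF disjI2[OF refl]])
    qed (use that[of "r ^ 2"] in simp)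
  qed
  obtain r' where r': "r' = r \<or> r' = \<i> * r" "r' ^ 2 = \<gamma>"
  proof (cases "\<gamma> = r ^ 2")
    case False
    then have "(\<i> * r) ^ 2 = \<gamma>" using \<gamma>(1) by (simp add: power_mult_distrib)
    then show thesis using that by blast
  qed (use that in blast)
  have r'L: "r' \<in> L" using r'(1) r_L irL by auto
  have \<gamma>L: "\<gamma> \<in> L" using \<gamma>(1) r2L L_closed by auto
  have \<gamma>2: "\<gamma> ^ 2 = 1 + 8 * of_int m" using \<gamma>(1) r4' by auto
  define a where "a = (\<gamma> - 1) / 2 + 1"
  have aO: "a \<in> OL" unfolding a_def by (intro OL_add OL_one P_OL[OF \<gamma>(2)])
  have a1: "a \<doteq> 1" unfolding cg_def a_def using \<gamma>(2) by simp
  have a2: "a ^ 2 = a + 2 * of_int m"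
  proof -
    have "a ^ 2 - a = (\<gamma> ^ 2 - 1) / 4" unfolding a_def by (simp add: field_simps power2_eq_square)
    then show ?thesis unfolding \<gamma>2 by (simp add: algebra_simps)
  qed
  have \<gamma>a: "r' ^ 2 = 2 * a - 1" unfolding r'(2) a_def by (simp add: field_simps)
  \<comment> \<open>The values for r' and -r' add up to a, which is congruent to 1, and signs do not
    matter modulo P; hence changing the sign of r' changes the residue of y by 1.\<close>
  define y where "y = a * (1 + r') / 2"
  have "y ^ 2 = a ^ 2 * (1 + 2 * r' + r' ^ 2) / 4" unfolding y_def by (simp add: field_simps power2_eq_square)
  also have "\<dots> = a * (a * (1 + r') / 2) + a * ((a ^ 2 - a) / 2)"
    unfolding \<gamma>a by (simp add: field_simps power2_eq_square)
  finally have y2: "y ^ 2 = a * y + a * of_int m" unfolding y_def[symmetric] a2 by simp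
  have aL: "a \<in> L" by (rule OL_L[OF aO])
  have yL: "y \<in> L" unfolding y_def using aL r'L twoL L_closed csubfield_divide[OF subfield] by simp
  have yO: "y \<in> OL" unfolding OL_def using yL algebraic_int_half_unit[OF a2 y2] by simp
  have "a * y + a * of_int m \<doteq> 1 * y + 1 * of_int m"
    by (intro cg_add cg_mult a1 cg_refl aO yO OL_of_int)
  then have yy: "y ^ 2 \<doteq> y + of_int m" unfolding y2 by simp
  have \<sigma>y: "\<sigma> y = a * (1 + \<sigma> r') / 2" if \<sigma>: "\<sigma> \<in> carrier G" "\<sigma> (r ^ 2) = r ^ 2" for \<sigma>
  proof -
    have "\<sigma> \<gamma> = \<gamma>" using \<gamma>(1) \<sigma>(2) Gal_uminus[OF \<sigma>(1) r2L] by auto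
    moreover have \<sigma>2: "\<sigma> 2 = 2" using Gal_of_nat[OF \<sigma>(1), of 2] by simp
    ultimately have "\<sigma> a = a"
      unfolding a_def using \<gamma>L twoL L_closed csubfield_divide[OF subfield]
      by (simp add: Gal_add[OF \<sigma>(1)] Gal_divide[OF \<sigma>(1)] Gal_diff[OF \<sigma>(1)] Gal_1[OF \<sigma>(1)])
    then show ?thesis
      unfolding y_def using \<sigma>2 aL r'L twoL L_closed
      by (simp add: Gal_add[OF \<sigma>(1)] Gal_divide[OF \<sigma>(1)] Gal_mul[OF \<sigma>(1)] Gal_1[OF \<sigma>(1)])
  qed
  show thesis
  proof (rule that[of r' y, OF r'(1) _ yO yy])
    show "r' ^ 2 = r ^ 2 \<or> r' ^ 2 = - (r ^ 2)" using r'(2) \<gamma>(1) by simp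
    fix \<sigma> assume \<sigma>: "\<sigma> \<in> carrier G" "\<sigma> (r ^ 2) = r ^ 2"
    show "\<sigma> y = y" if "\<sigma> r' = r'" using \<sigma>y[OF \<sigma>] that unfolding y_def by simp
    show "\<sigma> y \<doteq> y + 1" if "\<sigma> r' = - r'"
    proof -
      have sy: "\<sigma> y = a * (1 - r') / 2" using \<sigma>y[OF \<sigma>] that by simp
      have "\<sigma> y - (y + 1) = (a - 1) - 2 * y" unfolding sy by (simp add: y_def field_simps)
      also have "\<dots> \<in> P" using a1 P_mult2[OF twoP yO] unfolding cg_def by (rule P_diff)
      finally show ?thesis unfolding cg_def .
    qed
  qed
qed

text \<open>Inertia preserves the residue of y, so it fixes r' and consists at most of the identity
  and t e^k0. A Frobenius element squares the residue, that is, it adds m to it, so it fixes r'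
  exactly when m is even. This settles its sign on the line fixed by t e^k0.\<close>

lemma local_det_two_nontrivial:
  assumes \<rho>: "standard_rep c \<rho>" and l: "l = 2" and b0: "[2 = g ^ b0] (mod q)" "even b0"
    and F: "F \<in> frobenius_elements L P l" and m: "qstar q - 1 = 8 * m"
  shows "det_on 2 (fixed_space 2 \<rho> (inertia_group L P)) (1\<^sub>m 2 - x \<cdot>\<^sub>m \<rho> F)
    = 1 - (if even m then 1 else -1) * (-1) ^ (b0 div 2) * c ^ (b0 div 2) * x"
proof -
  have lq: "l \<noteq> q" using l q2 by simp
  have rep: "representation G 2 \<rho>" using \<rho> unfolding standard_rep_def by simp
  obtain k0 where k0: "word 0 1 k0 \<in> inertia_group L P" by (rule inertia_t[OF l])
  obtain r' y where r': "r' = r \<or> r' = \<i> * r" and r'2: "r' ^ 2 = r ^ 2 \<or> r' ^ 2 = - (r ^ 2)" and yO: "y \<in> OL"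
    and y2: "y ^ 2 \<doteq> y + of_int m"
    and y_fix: "\<And>\<sigma>. \<sigma> \<in> carrier G \<Longrightarrow> \<sigma> (r ^ 2) = r ^ 2 \<Longrightarrow> \<sigma> r' = r' \<Longrightarrow> \<sigma> y = y"
    and y_neg: "\<And>\<sigma>. \<sigma> \<in> carrier G \<Longrightarrow> \<sigma> (r ^ 2) = r ^ 2 \<Longrightarrow> \<sigma> r' = - r' \<Longrightarrow> \<sigma> y \<doteq> y + 1"
    using dyadic_unit[OF l m] by blast
  have irL: "\<i> * r \<in> L" using i_L r_L L_closed by simp
  have r'L: "r' \<in> L" using r' r_L irL by auto
  have sgn: "\<sigma> r' = r' \<or> \<sigma> r' = - r'" if \<sigma>: "\<sigma> \<in> carrier G" "\<sigma> (r ^ 2) = r ^ 2" for \<sigma>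
  proof -
    have "\<sigma> (r' ^ 2) = r' ^ 2" using r'2 \<sigma>(2) Gal_uminus[OF \<sigma>(1) r2_L] by auto
    then have "(\<sigma> r') ^ 2 = r' ^ 2" using Gal_pow[OF \<sigma>(1) r'L, of 2] by simp
    then show ?thesis by (simp only: power2_eq_iff)
  qed
  have I_r2: "\<sigma> z = z" "\<sigma> (r ^ 2) = r ^ 2" "\<sigma> r' = r'" if \<sigma>: "\<sigma> \<in> inertia_group L P" for \<sigma>
  proof -
    have \<sigma>G: "\<sigma> \<in> carrier G" and fx: "\<And>x. x \<in> OL \<Longrightarrow> \<sigma> x \<doteq> x" using \<sigma> unfolding inertia_iff by auto
    show zz: "\<sigma> z = z" by (rule sep[OF lq \<sigma>G fx[OF zeta_OL]])
    have "\<sigma> (r ^ 2) = \<one>\<^bsub>G\<^esub> (r ^ 2)"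
      by (rule Gal_gen_fixed[OF \<sigma>G G.one_closed, of "{z}"]) (use r2 z_L zz B_gen Gal_one_apply in auto)
    then show r2: "\<sigma> (r ^ 2) = r ^ 2" using Gal_one_apply[OF r2_L] by simp
    have "\<not> \<sigma> r' = - r'"
    proof
      assume "\<sigma> r' = - r'"
      then have "y + 1 \<doteq> y" using cg_trans[OF cg_sym[OF y_neg[OF \<sigma>G r2]] fx[OF yO]] by simp
      then show False unfolding cg_def using P_1 by simp
    qed
    then show "\<sigma> r' = r'" using sgn[OF \<sigma>G r2] by blast
  qed
  have I: "\<sigma> = \<one>\<^bsub>G\<^esub> \<or> \<sigma> = word 0 1 k0" if \<sigma>: "\<sigma> \<in> inertia_group L P" for \<sigma>
  proof -
    \<comment> \<open>As z and r' are fixed by inertia, the value at \<i> determines an inertia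
      element.\<close>
    have eqI: "\<sigma> = \<tau>" if \<tau>: "\<tau> \<in> inertia_group L P" and i: "\<sigma> \<i> = \<tau> \<i>" for \<tau>
    proof (rule Gal_eqI[OF L_gen])
      show G: "\<sigma> \<in> carrier G" "\<tau> \<in> carrier G" using \<sigma> \<tau> inertia_carrier by auto
      have r: "\<sigma> r = \<tau> r"
        using r'
      proof
        assume "r' = \<i> * r"
        then have "\<sigma> \<i> * \<sigma> r = \<tau> \<i> * \<tau> r"
          using I_r2(3)[OF \<sigma>] I_r2(3)[OF \<tau>] Gal_mul[OF G(1) i_L r_L] Gal_mul[OF G(2) i_L r_L] by simp
        moreover have "\<tau> \<i> \<noteq> 0" using Gal_eq_0[OF G(2) i_L] by simp
        ultimately show ?thesis using i by simp
      qed (use I_r2(3)[OF \<sigma>] I_r2(3)[OF \<tau>] in simp)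
      show "\<sigma> x = \<tau> x" if "x \<in> {\<i>, z, r}" for x
        using that i r I_r2(1)[OF \<sigma>] I_r2(1)[OF \<tau>] by auto
    qed
    have \<sigma>G: "\<sigma> \<in> carrier G" using \<sigma> inertia_carrier by blast
    have one: "\<one>\<^bsub>G\<^esub> \<in> inertia_group L P" unfolding inertia_iff using Gal_one_apply OL_L by auto
    obtain b a k where "\<sigma> = word b a k" using word_exhaust[OF \<sigma>G] by blast
    then have "\<sigma> \<i> = (-1) ^ a * \<i>" using word_i by simp
    then have "\<sigma> \<i> = \<i> \<or> \<sigma> \<i> = - \<i>" by (cases "even a") auto
    then show ?thesis
    proof
      assume "\<sigma> \<i> = \<i>"
      then show ?thesis using eqI[OF one] Gal_one_apply[OF i_L] by simp
    next
      assume "\<sigma> \<i> = - \<i>"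
      then show ?thesis using eqI[OF k0] word_i[of 0 1 k0] by simp
    qed
  qed
  \<comment> \<open>The matrix of t e^k0 is diagonal with entries (-1)^k0 and -(-1)^k0; this is the
    axis on which it is 1.\<close>
  define v0 where "v0 = (if even k0 then v2 1 0 else v2 0 1)"
  have v0: "v0 \<in> carrier_vec 2" "v0 \<noteq> 0\<^sub>v 2" unfolding v0_def v2_zero by (simp_all add: v2_eq_iff)
  have W: "fixed_space 2 \<rho> (inertia_group L P) = {k \<cdot>\<^sub>v v0 | k. True}"
  proof (rule fixed_space_lineI[OF v0(1) rep inertia_carrier])
    fix h assume "h \<in> inertia_group L P"
    then show "\<rho> h *\<^sub>v v0 = v0"
    proof (rule I[THEN disjE])
      assume "h = \<one>\<^bsub>G\<^esub>"
      then show ?thesis using rep_one[OF G.group_axioms rep] v0(1) by simp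
    next
      assume "h = word 0 1 k0"
      then show ?thesis unfolding v0_def standard_rep_word[OF \<rho>] word_mat_def
        by (cases "even k0") (simp_all add: standard_rep_word[OF \<rho>] word_mat_def m2_smult m2_mult_vec)
    qed
  next
    fix v :: "complex vec" assume v: "v \<in> carrier_vec 2" and fx: "\<And>h. h \<in> inertia_group L P \<Longrightarrow> \<rho> h *\<^sub>v v = v"
    obtain a b where ab: "v = v2 a b" using v2_exhaust[OF v] by blast
    have "word_mat c 0 1 k0 *\<^sub>v v2 a b = v2 a b" using fx[OF k0] unfolding ab standard_rep_word[OF \<rho>] .
    then have "if even k0 then b = 0 else a = 0"
      unfolding word_mat_def by (cases "even k0") (simp_all add: m2_smult m2_mult_vec v2_eq_iff)
    then have "v = (if even k0 then a else b) \<cdot>\<^sub>v v0" unfolding ab v0_def by (simp add: v2_smult v2_eq_iff)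
    then show "\<exists>k. v = k \<cdot>\<^sub>v v0" by blast
  qed
  have FG: "F \<in> carrier G" and Fr: "\<And>x. x \<in> OL \<Longrightarrow> F x \<doteq> x ^ 2" using F l unfolding frobenius_iff by auto
  obtain a k where w: "F = word b0 a k" using frobenius_word[OF lq F] b0 l by blast
  \<comment> \<open>If the Frobenius element negates \<i>, splitting off the inertia element t e^k0
    removes the factor t. That element fixes r' and \<open>v0\<close>, so both see only
    \<open>word b0 0 j\<close>.\<close>
  define j where "j = k + (if even a then 0 else k0)"
  have rr: "word b0 0 j r = (-1) ^ j * (-1) ^ (b0 div 2) * r" by (rule word_r_even[OF b0(2)])
  have ri: "word b0 0 j \<i> = \<i>" using word_i[of b0 0 j] by simp
  have jr': "word b0 0 j r' = (-1) ^ j * (-1) ^ (b0 div 2) * r'"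
    using r' rr ri Gal_mul[OF word_closed i_L r_L, of b0 0 j] by auto
  have Fr': "F r' = (-1) ^ j * (-1) ^ (b0 div 2) * r'" and Fr2: "F (r ^ 2) = r ^ 2"
  proof -
    have j2: "word b0 0 j (r ^ 2) = r ^ 2"
      unfolding Gal_pow[OF word_closed r_L] rr
      by (cases "even j"; cases "even (b0 div 2)") simp_all
    have "F r' = word b0 0 j r' \<and> F (r ^ 2) = word b0 0 j (r ^ 2)"
    proof (cases "even a")
      case True
      then have "F = word b0 0 j" unfolding w j_def using word_a_even[OF True, of b0 k] True by simp
      then show ?thesis by simp
    next
      case False
      have "F = word b0 1 k" unfolding w by (rule word_a_odd[OF False])
      also have "\<dots> = word b0 1 (k + 2 * k0)" by (rule word_shift_even[symmetric])
      also have "\<dots> = word b0 0 j \<otimes>\<^bsub>G\<^esub> word 0 1 k0"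
        unfolding word_mult j_def using False by (simp add: mult_2 add.assoc)
      finally have "F r' = word b0 0 j (word 0 1 k0 r')" "F (r ^ 2) = word b0 0 j (word 0 1 k0 (r ^ 2))"
        using Gal_comp[OF word_closed word_closed r'L] Gal_comp[OF word_closed word_closed r2_L] by simp_all
      then show ?thesis using I_r2[OF k0] by simp
    qed
    then show "F r' = (-1) ^ j * (-1) ^ (b0 div 2) * r'" "F (r ^ 2) = r ^ 2" using jr' j2 by simp_all
  qed
  have mj: "(-1) ^ j * (-1) ^ (b0 div 2) = (if even m then 1 else -1 :: complex)"
  proof -
    define \<epsilon> :: complex where "\<epsilon> = (-1) ^ j * (-1) ^ (b0 div 2)"
    have \<epsilon>: "\<epsilon> = 1 \<or> \<epsilon> = -1" unfolding \<epsilon>_def by (cases "even j"; cases "even (b0 div 2)") simp_all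
    have "\<epsilon> = 1 \<longleftrightarrow> even m"
    proof
      assume "\<epsilon> = 1"
      then have "F y = y" using y_fix[OF FG Fr2] Fr' unfolding \<epsilon>_def by simp
      then have "y \<doteq> y + of_int m" using cg_trans[OF Fr[OF yO] y2] by simp
      then have "of_int m \<in> P" unfolding cg_def using P_uminus[of "- of_int m"] by simp
      then show "even m" unfolding P_of_int l by simp
    next
      assume ev: "even m"
      then have mP: "of_int m \<in> P" unfolding P_of_int l by simp
      show "\<epsilon> = 1"
      proof (rule ccontr)
        assume "\<epsilon> \<noteq> 1"
        then have "F r' = - r'" using \<epsilon> Fr' unfolding \<epsilon>_def by auto
        then have "y + 1 \<doteq> y + of_int m" using cg_trans[OF cg_sym[OF y_neg[OF FG Fr2]] cg_trans[OF Fr[OF yO] y2]] by simp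
        then have "1 - of_int m \<in> P" unfolding cg_def by (simp add: algebra_simps)
        then have "1 - of_int m + of_int m \<in> P" using mP by (rule P_add)
        then show False using P_1 by simp
      qed
    qed
    then show ?thesis using \<epsilon> unfolding \<epsilon>_def by auto
  qed
  have ev: "\<rho> F *\<^sub>v v0 = ((if even m then 1 else -1) * (-1) ^ (b0 div 2) * c ^ (b0 div 2)) \<cdot>\<^sub>v v0"
  proof -
    have "\<rho> F *\<^sub>v v0 = ((-1) ^ j * c ^ (b0 div 2)) \<cdot>\<^sub>v v0"
      unfolding w standard_rep_word[OF \<rho>] word_mat_def v0_def j_def using b0(2)
      by (cases "even k0"; cases "even a") (simp_all add: m2_smult m2_mult_vec v2_smult power_add)
    also have "(-1) ^ j = (if even m then 1 else -1) * (-1 :: complex) ^ (b0 div 2)"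
      unfolding mj[symmetric] by (simp add: mult.assoc)
    finally show ?thesis .
  qed
  show ?thesis
  proof (rule det_on_line[OF v0 _ _ W])
    show "1\<^sub>m 2 - x \<cdot>\<^sub>m \<rho> F \<in> carrier_mat 2 2"
      by (intro minus_carrier_mat smult_carrier_mat rep_closed[OF rep FG])
    show "(1\<^sub>m 2 - x \<cdot>\<^sub>m \<rho> F) *\<^sub>v v0 = (1 - (if even m then 1 else -1) * (-1) ^ (b0 div 2) * c ^ (b0 div 2) * x) \<cdot>\<^sub>v v0"
      using one_minus_smult_mult_vec[OF rep_closed[OF rep FG] v0(1) ev, of x] by (simp add: mult.commute)
  qed
qed

end

context odd_quartic
begin

lemma artin_factor_two:
  assumes \<rho>: "standard_rep c \<rho>" and b: "[2 = g ^ b] (mod q)"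
  shows "odd b \<Longrightarrow> artin_factor L 2 \<rho> 2 w = 1"
    and "even b \<Longrightarrow> 8 dvd qstar q - 1 \<Longrightarrow>
      artin_factor L 2 \<rho> 2 w = inverse (1 - (if 16 dvd qstar q - 1 then 1 else -1) * (-1) ^ (b div 2)
        * c ^ (b div 2) * 2 powr (- w))"
proof -
  have two: "prime (2::nat)" by simp
  have ex: "frobenius_elements L P 2 \<noteq> {}" if P: "P \<in> primes_above L 2" for P
  proof -
    interpret A: odd_at L q g s r t e K B P 2 by (rule odd_atI[OF two P])
    show ?thesis by (rule A.frobenius_nonempty)
  qed
  {
    assume o: "odd b"
    have "artin_factor L 2 \<rho> 2 w = inverse 1"
    proof (rule artin_factor_eqI[OF subfield two ex])
      fix P F assume P: "P \<in> primes_above L 2" and F: "F \<in> frobenius_elements L P 2"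
      interpret A: odd_at L q g s r t e K B P 2 by (rule odd_atI[OF two P])
      show "det_on 2 (fixed_space 2 \<rho> (inertia_group L P)) (1\<^sub>m 2 - of_nat 2 powr - w \<cdot>\<^sub>m \<rho> F) = 1"
        by (rule A.local_det_two_trivial[OF \<rho> refl b o F])
    qed
    then show "artin_factor L 2 \<rho> 2 w = 1" by simp
  }
  assume ev: "even b" and "8 dvd qstar q - 1"
  then obtain m where m: "qstar q - 1 = 8 * m" by blast
  have "(16::int) dvd 8 * m \<longleftrightarrow> even m" using dvd_mult_cancel_left[of 8 2 m] by simp
  then have em: "16 dvd qstar q - 1 \<longleftrightarrow> even m" unfolding m .
  have "artin_factor L 2 \<rho> 2 w = inverse (1 - (if even m then 1 else -1) * (-1) ^ (b div 2)
        * c ^ (b div 2) * of_nat 2 powr (- w))"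
  proof (rule artin_factor_eqI[OF subfield two ex])
    fix P F assume P: "P \<in> primes_above L 2" and F: "F \<in> frobenius_elements L P 2"
    interpret A: odd_at L q g s r t e K B P 2 by (rule odd_atI[OF two P])
    show "det_on 2 (fixed_space 2 \<rho> (inertia_group L P)) (1\<^sub>m 2 - of_nat 2 powr - w \<cdot>\<^sub>m \<rho> F)
        = 1 - (if even m then 1 else -1) * (-1) ^ (b div 2) * c ^ (b div 2) * of_nat 2 powr - w"
      by (rule A.local_det_two_nontrivial[OF \<rho> refl b ev F m])
  qed
  then show "artin_factor L 2 \<rho> 2 w = inverse (1 - (if 16 dvd qstar q - 1 then 1 else -1) * (-1) ^ (b div 2)
        * c ^ (b div 2) * 2 powr (- w))" unfolding em by simp
qed

end

section \<open>Indices modulo q and the Euler product for odd q\<close>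

lemma zeta_double: "n \<ge> 1 \<Longrightarrow> zeta (2 * n) ^ 2 = zeta n"
  using zeta_power[of "2 * n" 2] zeta_power[of n 1] by (simp add: field_simps)

lemma zeta_powi_cong:
  assumes n: "n \<ge> 1" and xy: "[x = int y] (mod int n)"
  shows "zeta n powi x = zeta n ^ y"
proof -
  obtain k where k: "x - int y = int n * k" using xy unfolding cong_iff_dvd_diff by blast
  have "zeta n powi x = zeta n powi (int y + int n * k)" using k by (simp add: algebra_simps)
  also have "\<dots> = zeta n ^ y * (zeta n ^ n) powi k"
    using zeta_nz by (simp add: power_int_add power_int_mult)
  finally show ?thesis using zeta_power_self[OF n] by simp
qed

lemma zeta_half:
  assumes "n \<ge> 1"
  shows "zeta (2 * n) ^ n = -1"
proof -
  have "(zeta (2 * n) ^ n) ^ 2 = 1 ^ 2" using zeta_power_self[of "2 * n"] assms by (simp add: mult.commute flip: power_mult)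
  moreover have "zeta (2 * n) ^ n \<noteq> 1"
  proof
    assume "zeta (2 * n) ^ n = 1"
    then have "2 * n dvd n" using zeta_power_eq_1[of "2 * n" n] assms by simp
    then show False using assms by (auto dest: dvd_imp_le)
  qed
  ultimately show ?thesis unfolding power2_eq_iff by blast
qed

lemma norm_zeta [simp]: "norm (zeta n) = 1"
proof -
  have "zeta n = exp (\<i> * of_real (2 * pi / real n))" unfolding zeta_def by (simp add: mult_ac)
  then show ?thesis by (simp only: norm_exp_i_times)
qed

lemma nat_powr_double: "(of_nat l powr (- w :: complex)) ^ 2 = of_nat l powr (- 2 * w)"
  unfolding power2_eq_square by (simp flip: powr_add)

context odd_quartic
begin

lemma q11: "1 \<le> q - 1"
  using q2 by simp

lemma g_power_cong_iff: "[g ^ i = g ^ j] (mod q) \<longleftrightarrow> [i = j] (mod (q - 1))"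
proof -
  have "coprime q g" using g unfolding residue_primroot_def by blast
  then show ?thesis using order_divides_expdiff[of q g i j] ord_g by simp
qed

lemma q_half: "q - 1 = 2 * ((q - 1) div 2)" and q_half_pos: "(q - 1) div 2 \<ge> 1"
  using q(2) q2 by presburger+

text \<open>A natural index with the same residue modulo \<open>2 (q - 1)\<close> gives the same local factors.\<close>

lemma is_index_nat:
  assumes "is_index q g l b"
  obtains b' :: nat where "[l = g ^ b'] (mod q)" "even b' \<longleftrightarrow> even b" "int b' mod 4 = b mod 4"
    "[b = int b'] (mod int (2 * (q - 1)))"
proof -
  let ?n = "2 * (q - 1)"
  define b' where "b' = nat (b mod int ?n)"
  have b': "int b' = b mod int ?n" unfolding b'_def using q2 by simp
  then have c: "[b = int b'] (mod int ?n)" by (simp add: cong_def)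
  have "int 4 dvd int ?n"
  proof -
    have "?n = 4 * ((q - 1) div 2)" using q_half by linarith
    then show ?thesis unfolding of_nat_dvd_iff by (metis dvd_triv_left)
  qed
  then have m4: "int b' mod 4 = b mod 4" unfolding b' by (simp add: mod_mod_cancel)
  have "[b' + nat (- b) = nat b] (mod (q - 1))"
  proof -
    have "[b = int b'] (mod int (q - 1))"
      by (rule cong_dvd_modulus[OF c]) (simp only: of_nat_dvd_iff dvd_triv_right)
    then have "[b + int (nat (- b)) = int b' + int (nat (- b))] (mod int (q - 1))" by (rule cong_add[OF _ cong_refl])
    moreover have "b + int (nat (- b)) = int (nat b)" by simp
    ultimately have "[int (nat b) = int (b' + nat (- b))] (mod int (q - 1))" by simp
    then show ?thesis unfolding cong_int_iff by (rule cong_sym)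
  qed
  then have "[g ^ (b' + nat (- b)) = g ^ nat b] (mod q)" unfolding g_power_cong_iff .
  moreover have "[l * g ^ nat (- b) = g ^ nat b] (mod q)" using assms unfolding is_index_def .
  ultimately have "[l * g ^ nat (- b) = g ^ b' * g ^ nat (- b)] (mod q)"
    unfolding power_add using cong_sym cong_trans by blast
  moreover have "coprime (g ^ nat (- b)) q" using g unfolding residue_primroot_def by (simp add: coprime_commute)
  ultimately have "[l = g ^ b'] (mod q)" using cong_mult_rcancel_nat by blast
  moreover have "even b' \<longleftrightarrow> even b" using m4 by presburger
  ultimately show thesis using that m4 c by blast
qed

lemma index_zeta:
  assumes c: "[b = int b'] (mod int (2 * (q - 1)))"
  shows "zeta (q - 1) powi (int j * b) = (zeta (q - 1) ^ j) ^ b'"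
    and "even b' \<Longrightarrow> zeta (2 * (q - 1)) powi (int j * b) = (zeta (q - 1) ^ j) ^ (b' div 2)"
proof -
  have "[int j * b = int j * int b'] (mod int (2 * (q - 1)))" by (intro cong_mult cong_refl c)
  then have jb: "[int j * b = int (j * b')] (mod int (2 * (q - 1)))" by simp
  have "[int j * b = int (j * b')] (mod int (q - 1))"
    by (rule cong_dvd_modulus[OF jb]) (simp only: of_nat_dvd_iff dvd_triv_right)
  then show "zeta (q - 1) powi (int j * b) = (zeta (q - 1) ^ j) ^ b'"
    unfolding power_mult[symmetric] by (rule zeta_powi_cong[OF q11])
  assume "even b'"
  then obtain m where m: "b' = 2 * m" by blast
  have "zeta (2 * (q - 1)) powi (int j * b) = zeta (2 * (q - 1)) ^ (j * b')"
    by (rule zeta_powi_cong[OF _ jb]) (use q2 in simp)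
  also have "\<dots> = (zeta (2 * (q - 1)) ^ 2) ^ (j * m)" unfolding m by (simp add: mult.left_commute flip: power_mult)
  also have "\<dots> = (zeta (q - 1) ^ j) ^ (b' div 2)" using zeta_double[of "q - 1"] q2 m by (simp add: power_mult)
  finally show "zeta (2 * (q - 1)) powi (int j * b) = (zeta (q - 1) ^ j) ^ (b' div 2)" .
qed

lemma index_sign:
  assumes "int b' mod 4 = b mod 4"
  shows "(-1 :: complex) powi (b div 2) = (-1) ^ (b' div 2)"
proof -
  have "even (b div 2) \<longleftrightarrow> even (b' div 2)" using assms by presburger
  then show ?thesis by (simp add: power_int_minus_left minus_one_power_iff)
qed

lemma half_q_parity: "even ((q - 1) div 2) \<longleftrightarrow> q mod 4 = 1"
  using q(2) by presburger

lemma zeta_pow_half: "(zeta (q - 1) ^ j) ^ ((q - 1) div 2) = (-1) ^ j"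
proof -
  have "zeta (q - 1) ^ ((q - 1) div 2) = -1" using zeta_half[OF q_half_pos] q_half by metis
  then show ?thesis by (metis power_mult mult.commute)
qed

text \<open>The parity of j is chosen so that c = \<open>zeta (q - 1) ^ j\<close> satisfies the
  relation between c, \<open>N\<close> and \<open>h\<close> under which a standard representation
  exists.\<close>

lemma J_set_iff: "j \<in> J_set q \<longleftrightarrow> j < q - 1 \<and> (-1 :: complex) ^ j = (-1) ^ ((q - 1) div 2)"
  unfolding J_set_def using half_q_parity by (auto simp: minus_one_power_iff)

lemma J_set_exists:
  assumes "c ^ ((q - 1) div 2) = (-1) ^ ((q - 1) div 2)"
  obtains j where "j \<in> J_set q" "c = zeta (q - 1) ^ j"
proof -
  have "c ^ (q - 1) = (c ^ ((q - 1) div 2)) ^ 2" using q_half by (metis power_mult mult.commute)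
  also have "\<dots> = 1" unfolding assms by (simp flip: power_mult)
  finally have "c ^ (q - 1) = 1" .
  then obtain j where j: "j < q - 1" "c = zeta (q - 1) ^ j" by (rule root_of_unity_zeta[OF q11])
  have "(-1 :: complex) ^ j = (-1) ^ ((q - 1) div 2)" using assms zeta_pow_half[of j] unfolding j(2) by simp
  then show thesis using that j J_set_iff by blast
qed

lemma is_rho_iff: "is_rho G q t s e j \<rho> \<longleftrightarrow> standard_rep (zeta (q - 1) ^ j) \<rho>"
  unfolding is_rho_def standard_rep_def m2_def ..

text \<open>c = 1 means j = 0, and 0 lies in \<open>J_set q\<close> only for q = 1 mod 4; for every
  other j nothing is fixed by inertia.\<close>

lemma E_q_factor:
  assumes j: "j \<in> J_set q" and \<rho>: "standard_rep (zeta (q - 1) ^ j) \<rho>"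
  shows "artin_factor L 2 \<rho> q w = E_q q j w"
proof (cases "q mod 4 = 1 \<and> j = 0")
  case True
  then show ?thesis using artin_factor_q(2)[OF \<rho>, of w] unfolding E_q_def by simp
next
  case False
  have "j \<noteq> 0"
  proof
    assume "j = 0"
    then show False using j False unfolding J_set_def by simp
  qed
  moreover have "j < q - 1" using j unfolding J_set_def by simp
  ultimately have "\<not> (q - 1) dvd j" by (auto dest: dvd_imp_le)
  then have "zeta (q - 1) ^ j \<noteq> 1" using zeta_power_eq_1[of "q - 1" j] q2 by simp
  then show ?thesis using artin_factor_q(1)[OF \<rho>, of w] unfolding E_q_def if_not_P[OF False] by simp
qed

lemma two_square_iff:
  assumes "[2 = g ^ b] (mod q)"
  shows "Legendre 2 (int q) = 1 \<longleftrightarrow> even b"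
proof -
  let ?h = "(q - 1) div 2"
  have "[Legendre 2 (int q) = 2 ^ ?h] (mod int q)" by (rule euler_criterion[OF q(1) q2])
  moreover have "[int 2 ^ ?h = int (g ^ b) ^ ?h] (mod int q)"
    using assms by (intro cong_pow) (simp only: cong_int_iff)
  ultimately have L: "[Legendre 2 (int q) = int (g ^ (b * ?h))] (mod int q)"
    unfolding cong_def by (simp add: power_mult)
  have gb: "[g ^ (b * ?h) = 1] (mod q) \<longleftrightarrow> even b"
  proof -
    have "[g ^ (b * ?h) = g ^ 0] (mod q) \<longleftrightarrow> (q - 1) dvd b * ?h" unfolding g_power_cong_iff by (simp add: cong_0_iff)
    also have "\<dots> \<longleftrightarrow> 2 * ?h dvd b * ?h" using q_half by simp
    also have "\<dots> \<longleftrightarrow> even b" using q_half_pos by simp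
    finally show ?thesis by simp
  qed
  have "[Legendre 2 (int q) = 1] (mod int q) \<longleftrightarrow> [int (g ^ (b * ?h)) = int 1] (mod int q)"
    using L unfolding cong_def by simp
  then have 1: "[Legendre 2 (int q) = 1] (mod int q) \<longleftrightarrow> even b" unfolding cong_int_iff gb .
  have "Legendre 2 (int q) \<in> {0, 1, -1}" unfolding Legendre_def by auto
  moreover have "\<not> [(0::int) = 1] (mod int q)" "\<not> [(-1::int) = 1] (mod int q)"
    using q2 zdvd_imp_le[of "int q" 1] zdvd_imp_le[of "int q" 2] by (auto simp: cong_iff_dvd_diff)
  ultimately show ?thesis using 1 by auto
qed

text \<open>The sign (-1)^(b/2) has to be expressed through q. For q = 1 mod 8, the index of 2 is
  divisible by 4 exactly if 2 is a fourth power modulo q, which is the condition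
  \<open>q \<in> P0\<close>. For q = 7 mod 8, q is not in \<open>P0\<close>, and the normalisation
  of b modulo 4 makes the sign -1.\<close>

lemma E_2_factor:
  assumes j: "j \<in> J_set q" and \<rho>: "standard_rep (zeta (q - 1) ^ j) \<rho>" and b: "is_index q g 2 (b 2)"
    and b4: "Legendre 2 (int q) = 1 \<and> q mod 4 = 3 \<longrightarrow> b 2 mod 4 = 2"
  shows "artin_factor L 2 \<rho> 2 w = E_2 q j b w"
proof -
  obtain b' :: nat where b': "[2 = g ^ b'] (mod q)" "even b' \<longleftrightarrow> even (b 2)" "int b' mod 4 = b 2 mod 4"
    "[b 2 = int b'] (mod int (2 * (q - 1)))" using is_index_nat[OF b] by blast
  show ?thesis
  proof (cases "even b'")
    case False
    then show ?thesis using artin_factor_two(1)[OF \<rho> b'(1)] two_square_iff[OF b'(1)] unfolding E_2_def by simp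
  next
    case True
    then have L1: "Legendre 2 (int q) = 1" using two_square_iff[OF b'(1)] by simp
    then have "chi8 q = 1" using Legendre_two[OF q(1) q2] by simp
    then have q8: "q mod 8 = 1 \<or> q mod 8 = 7" unfolding chi8_def by (auto split: if_splits)
    have sgn: "(-1) ^ (b' div 2) = (if q \<in> P0 then 1 else -1 :: complex)"
      and q8': "8 dvd qstar q - 1"
    proof -
      show "8 dvd qstar q - 1"
        using q8
      proof
        assume "q mod 8 = 1"
        then have "int q mod 8 = 1" "even ((q - 1) div 2)" by presburger+
        then show ?thesis using q2 unfolding qstar_def by (simp, presburger)
      next
        assume "q mod 8 = 7"
        then have "int q mod 8 = 7" "odd ((q - 1) div 2)" by presburger+
        then show ?thesis using q2 unfolding qstar_def by (simp, presburger)
      qed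
      show "(-1) ^ (b' div 2) = (if q \<in> P0 then 1 else -1 :: complex)"
        using q8
      proof
        assume q81: "q mod 8 = 1"
        define n where "n = (q - 1) div 4"
        have n: "q - 1 = 4 * n" unfolding n_def using q81 by presburger
        have n0: "n \<noteq> 0" using n q2 by auto
        have "q \<in> P0 \<longleftrightarrow> [int (2 ^ n) = int 1] (mod int q)"
          using P0_iff_biquadratic[OF q(1) q81] unfolding n_def by simp
        also have "\<dots> \<longleftrightarrow> [2 ^ n = 1] (mod q)" by (rule cong_int_iff)
        also have "\<dots> \<longleftrightarrow> [g ^ (b' * n) = g ^ 0] (mod q)"
        proof -
          have "[2 ^ n = g ^ (b' * n)] (mod q)" using cong_pow[OF b'(1), of n] by (simp add: power_mult)
          then show ?thesis unfolding cong_def by simp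
        qed
        also have "\<dots> \<longleftrightarrow> 4 * n dvd b' * n" unfolding g_power_cong_iff n by (simp add: cong_0_iff)
        also have "\<dots> \<longleftrightarrow> 4 dvd b'" using n0 by simp
        also have "\<dots> \<longleftrightarrow> even (b' div 2)" using True by presburger
        finally show ?thesis by (simp add: minus_one_power_iff)
      next
        assume q87: "q mod 8 = 7"
        then have "q \<notin> P0" using P0_mod_8[of q] by auto
        moreover have "q mod 4 = 3" using q87 by presburger
        then have "int b' mod 4 = 2" using b4 L1 b'(3) by simp
        then have "odd (b' div 2)" by presburger
        ultimately show ?thesis by simp
      qed
    qed
    have "artin_factor L 2 \<rho> 2 w = inverse (1 - (if 16 dvd qstar q - 1 then 1 else -1) * (-1) ^ (b' div 2)
        * (zeta (q - 1) ^ j) ^ (b' div 2) * 2 powr (- w))"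
      by (rule artin_factor_two(2)[OF \<rho> b'(1) True q8'])
    also have "(if 16 dvd qstar q - 1 then 1 else -1) * (-1) ^ (b' div 2) = u_q q"
      unfolding sgn u_q_def by simp
    finally show ?thesis unfolding E_2_def index_zeta(2)[OF b'(4) True] using L1 by simp
  qed
qed

theorem artin_L_standard_rep:
  assumes j: "j \<in> J_set q" and \<rho>: "standard_rep (zeta (q - 1) ^ j) \<rho>" and w: "Re w > 1"
    and b: "\<And>l. prime l \<Longrightarrow> l \<noteq> q \<Longrightarrow> is_index q g l (b l)"
    and b4: "Legendre 2 (int q) = 1 \<and> q mod 4 = 3 \<longrightarrow> b 2 mod 4 = 2"
    and \<alpha>: "\<And>l. prime l \<Longrightarrow> l \<noteq> q \<Longrightarrow> l mod 4 = 1 \<Longrightarrow> even (b l) \<Longrightarrow> [\<alpha> l ^ 2 = qstar q] (mod int l)"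
  defines "A1 \<equiv> {l. prime l \<and> odd l \<and> l \<noteq> q \<and> (l mod 4 = 1 \<and> odd (b l) \<or> l mod 4 = 3 \<and> even (b l))}"
    and "f1 \<equiv> \<lambda>l. inverse (1 - zeta (q - 1) powi (int j * b l) * of_nat l powr (- 2 * w))"
    and "A2 \<equiv> {l. prime l \<and> odd l \<and> l \<noteq> q \<and> l mod 4 = 3 \<and> odd (b l)}"
    and "f2 \<equiv> \<lambda>l. inverse (1 + zeta (q - 1) powi (int j * b l) * of_nat l powr (- 2 * w))"
    and "A3 \<equiv> {l. prime l \<and> odd l \<and> l \<noteq> q \<and> l mod 4 = 1 \<and> even (b l)}"
    and "f3 \<equiv> \<lambda>l. inverse ((1 - u_sign \<alpha> b l * zeta (2 * (q - 1)) powi (int j * b l) * of_nat l powr (- w)) ^ 2)"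
  shows "artin_L_converges L 2 \<rho> w \<and> prime_prod_converges A1 f1 \<and> prime_prod_converges A2 f2 \<and>
    prime_prod_converges A3 f3 \<and> artin_L L 2 \<rho> w = E_2 q j b w * E_q q j w *
      prime_prod A1 f1 * prime_prod A2 f2 * prime_prod A3 f3"
proof -
  let ?c = "zeta (q - 1) ^ j"
  define f where "f l = artin_factor L 2 \<rho> l w" for l
  have good: "(l \<in> A1 \<longrightarrow> f l = f1 l) \<and> (l \<in> A2 \<longrightarrow> f l = f2 l) \<and> (l \<in> A3 \<longrightarrow> f l = f3 l)"
    if l: "prime l" "odd l" "l \<noteq> q" for l
  proof -
    obtain b' :: nat where b': "[l = g ^ b'] (mod q)" "even b' \<longleftrightarrow> even (b l)" "int b' mod 4 = b l mod 4"
      "[b l = int b'] (mod int (2 * (q - 1)))" using is_index_nat[OF b[OF l(1,3)]] by blast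
    note F = artin_factor_good[OF l b'(1) \<rho>]
    show ?thesis
    proof (intro conjI impI)
      assume "l \<in> A1"
      then have "l mod 4 = 1 \<and> odd b' \<or> l mod 4 = 3 \<and> even b'" unfolding A1_def b'(2) by blast
      then show "f l = f1 l" unfolding f_def f1_def index_zeta(1)[OF b'(4)] nat_powr_double[symmetric] by (rule F(1))
    next
      assume "l \<in> A2"
      then have "l mod 4 = 3 \<and> odd b'" unfolding A2_def b'(2) by blast
      then show "f l = f2 l" unfolding f_def f2_def index_zeta(1)[OF b'(4)] nat_powr_double[symmetric] by (rule F(2))
    next
      assume "l \<in> A3"
      then have l3: "l mod 4 = 1 \<and> even b'" "even b'" "l mod 4 = 1" "even (b l)" unfolding A3_def b'(2) by auto
      have "[\<alpha> l ^ 2 = qstar q] (mod int l)" by (rule \<alpha>[OF l(1,3) l3(3,4)])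
      then show "f l = f3 l"
        unfolding f_def f3_def u_sign_def index_zeta(2)[OF b'(4) l3(2)] index_sign[OF b'(3)]
        by (rule F(3)[OF l3(1)])
    qed
  qed
  have eq: "f l = f1 l" if "l \<in> A1" for l using good[of l] that unfolding A1_def by blast
  have eq2: "f l = f2 l" if "l \<in> A2" for l using good[of l] that unfolding A2_def by blast
  have eq3: "f l = f3 l" if "l \<in> A3" for l using good[of l] that unfolding A3_def by blast
  have nrm: "norm (zeta n powi k) = 1" for n k by (simp add: norm_power_int)
  have w2: "Re (2 * w) > 1" using w by simp
  have c1: "prime_prod_converges A1 f1"
    unfolding f1_def using prime_prod_converges_euler[OF _ _ w2, of A1 "\<lambda>l. zeta (q - 1) powi (int j * b l)"] nrm
    by (simp add: A1_def prime_ge_2_nat)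
  have c2: "prime_prod_converges A2 f2"
    unfolding f2_def using prime_prod_converges_euler[OF _ _ w2, of A2 "\<lambda>l. - (zeta (q - 1) powi (int j * b l))"] nrm
    by (simp add: A2_def prime_ge_2_nat)
  have u: "norm (u_sign \<alpha> b l) \<le> 1" for l
    unfolding u_sign_def Legendre_def by (simp add: norm_mult norm_power_int)
  have "prime_prod_converges A3 (\<lambda>l. inverse (1 - u_sign \<alpha> b l * zeta (2 * (q - 1)) powi (int j * b l) * of_nat l powr (- w)))"
    by (rule prime_prod_converges_euler[OF _ _ w]) (use nrm u in \<open>auto simp: A3_def prime_ge_2_nat norm_mult\<close>)
  from prime_prod_converges_mult[OF this this] have c3: "prime_prod_converges A3 f3"
    unfolding f3_def by (simp add: power2_eq_square inverse_mult_distrib)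
  \<comment> \<open>2 and q form a finite set, where convergence is automatic and the factors are
    \<open>E_2\<close> and \<open>E_q\<close>.\<close>
  have split: "{l. prime l} = (({2} \<union> {q}) \<union> A1) \<union> A2 \<union> A3"
  proof (rule Set.set_eqI)
    fix l :: nat
    have "l mod 4 = 1 \<or> l mod 4 = 3" if "odd l" using that by presburger
    moreover have "prime l \<Longrightarrow> even l \<Longrightarrow> l = 2" using prime_odd_nat prime_ge_2_nat by (metis le_neq_implies_less)
    ultimately show "l \<in> {l. prime l} \<longleftrightarrow> l \<in> (({2} \<union> {q}) \<union> A1) \<union> A2 \<union> A3"
      unfolding A1_def A2_def A3_def using q(1) two_is_prime_nat by auto
  qed
  have f': "prime_prod_converges A1 f" "prime_prod_converges A2 f" "prime_prod_converges A3 f"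
    "prime_prod A1 f = prime_prod A1 f1" "prime_prod A2 f = prime_prod A2 f2" "prime_prod A3 f = prime_prod A3 f3"
    using c1 c2 c3 prime_prod_converges_cong[OF eq] prime_prod_converges_cong[OF eq2] prime_prod_converges_cong[OF eq3]
      prime_prod_cong[OF eq] prime_prod_cong[OF eq2] prime_prod_cong[OF eq3] by simp_all
  have "({2} \<union> {q}) \<inter> A1 = {}" unfolding A1_def by auto
  note u2 = prime_prod_converges_union[OF this _ f'(1)]
  have "(({2} \<union> {q}) \<union> A1) \<inter> A2 = {}" unfolding A1_def A2_def by auto
  note u3 = prime_prod_converges_union[OF this _ f'(2)]
  have "((({2} \<union> {q}) \<union> A1) \<union> A2) \<inter> A3 = {}" unfolding A1_def A2_def A3_def by auto
  note u4 = prime_prod_converges_union[OF this _ f'(3)]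
  have u0: "prime_prod_converges ({2} \<union> {q}) f" by (rule prime_prod_converges_finite) simp
  have "{2} \<inter> {q} = {}" using q2 by auto
  then have p0: "prime_prod ({2} \<union> {q}) f = f 2 * f q"
    using prime_prod_converges_union(2)[of "{2}" "{q}" f] prime_prod_converges_finite[of "{2}" f]
      prime_prod_converges_finite[of "{q}" f] prime_prod_singleton[of 2 f] prime_prod_singleton[of q f] by simp
  note v2 = u2[OF u0]
  note v3 = u3[OF v2(1)]
  note v4 = u4[OF v3(1)]
  have b2: "is_index q g 2 (b 2)" by (rule b) (use q2 in simp_all)
  have f2q: "f 2 = E_2 q j b w" "f q = E_q q j w"
    unfolding f_def by (rule E_2_factor[where b = b, OF j \<rho> b2 b4], rule E_q_factor[OF j \<rho>])
  have "artin_L_converges L 2 \<rho> w" unfolding artin_L_converges_def split using v4(1) unfolding f_def .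
  moreover have "artin_L L 2 \<rho> w = E_2 q j b w * E_q q j w * prime_prod A1 f1 * prime_prod A2 f2 * prime_prod A3 f3"
    unfolding artin_L_def split using v4(2) v3(2) v2(2) p0 f'(4-6) f2q unfolding f_def[symmetric, abs_def] by simp
  ultimately show ?thesis using c1 c2 c3 by blast
qed

end

subsection \<open>The case \<open>q = 2\<close>\<close>

locale two_quartic = quartic L r z t s e 2 K B
  for L :: "complex set" and r z t s e K B + assumes z_r: "z = r ^ 2" and r4: "r ^ 4 = 2"
begin

lemma z2: "z ^ 2 = 2"
  unfolding z_r r4[symmetric] by (simp flip: power_mult)

lemma s_z_neg: "s z = - z"
  using s_r2 unfolding z_r .

lemma z_nz: "z \<noteq> 0"
  using z2 by auto

lemma z_irrational: "z \<notin> \<rat>"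
proof
  assume "z \<in> \<rat>"
  then have "s z = z" by (rule Gal_rat[OF s])
  then show False using s_z_neg z_nz by simp
qed

lemma B_elim:
  assumes "x \<in> B"
  obtains a b where "a \<in> \<rat>" "b \<in> \<rat>" "x = a + b * z"
proof -
  have F: "csubfield \<rat>" unfolding csubfield_def by auto
  have "(2::complex) \<in> \<rat>" by simp
  then have "csubfield {x + y * z | x y. x \<in> \<rat> \<and> y \<in> \<rat>}"
    using z2 z_irrational by (intro csubfield_quadratic[OF F]) simp_all
  moreover have "z = 0 + 1 * z" by simp
  then have "{z} \<subseteq> {x + y * z | x y. x \<in> \<rat> \<and> y \<in> \<rat>}" using Rats_0 Rats_1 by blast
  ultimately have "B \<subseteq> {x + y * z | x y. x \<in> \<rat> \<and> y \<in> \<rat>}" unfolding B_gen by (rule gen_least)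
  then show ?thesis using assms that by blast
qed

lemma B_unique:
  assumes "a \<in> \<rat>" "b \<in> \<rat>" "a' \<in> \<rat>" "b' \<in> \<rat>" and eq: "a + b * z = a' + b' * z"
  shows "a = a' \<and> b = b'"
proof -
  have "b = b'"
  proof (rule ccontr)
    assume "b \<noteq> b'"
    then have "z = (a' - a) / (b - b')" using eq by (simp add: field_simps)
    then show False using assms z_irrational by simp
  qed
  then show ?thesis using eq by simp
qed

lemma rat_L: "x \<in> \<rat> \<Longrightarrow> x \<in> L"
  using csubfield_Rats[OF subfield] by blast

lemma s_B_apply: "a \<in> \<rat> \<Longrightarrow> b \<in> \<rat> \<Longrightarrow> s (a + b * z) = a - b * z"
  using z_L rat_L L_closed by (simp add: Gal_add[OF s] Gal_mul[OF s] Gal_rat[OF s] s_z_neg)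

text \<open>For x = a + b z the trace 2a and the norm a^2 - 2b^2 are integers, and (4b)^2 = 2 (2a)^2
  - 8 (a^2 - 2b^2) makes 4b one too. Reading this equation modulo 2 three times shows that a and b
  are integers.\<close>

lemma integral_basis_two:
  assumes x: "x \<in> B" "x \<in> OL"
  obtains m n :: int where "x = of_int m + of_int n * z"
proof -
  obtain a b where ab: "a \<in> \<rat>" "b \<in> \<rat>" "x = a + b * z" using B_elim[OF x(1)] by blast
  have sx: "s x = a - b * z" unfolding ab(3) by (rule s_B_apply[OF ab(1,2)])
  have sO: "s x \<in> OL" by (rule Gal_OL[OF s x(2)])
  have "2 * a = x + s x" unfolding sx by (simp add: ab(3))
  then have "2 * a \<in> OL" using OL_add[OF x(2) sO] by simp
  moreover have "2 * a \<in> \<rat>" using ab by simp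
  ultimately have "2 * a \<in> \<int>" using algebraic_int_rat unfolding OL_def by blast
  then obtain A where A: "2 * a = of_int A" by (rule Ints_cases)
  have "a ^ 2 - 2 * b ^ 2 = x * s x"
    unfolding sx z2[symmetric] by (simp add: ab(3) algebra_simps power2_eq_square)
  then have "a ^ 2 - 2 * b ^ 2 \<in> OL" using OL_mult[OF x(2) sO] by simp
  moreover have "a ^ 2 - 2 * b ^ 2 \<in> \<rat>" using ab by simp
  ultimately have "a ^ 2 - 2 * b ^ 2 \<in> \<int>" using algebraic_int_rat unfolding OL_def by blast
  then obtain M where M: "a ^ 2 - 2 * b ^ 2 = of_int M" by (rule Ints_cases)
  have b4: "(4 * b) ^ 2 = of_int (2 * A ^ 2 - 8 * M)"
  proof -
    have "(4 * b) ^ 2 = 2 * (2 * a) ^ 2 - 8 * (a ^ 2 - 2 * b ^ 2)" by (simp add: power2_eq_square algebra_simps)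
    then show ?thesis unfolding A M by simp
  qed
  have "algebraic_int (of_int (2 * A ^ 2 - 8 * M) :: complex)" by (rule algebraic_int_of_int)
  then have "algebraic_int ((4 * b) ^ 2)" unfolding b4 .
  then have "algebraic_int (4 * b)" by (rule algebraic_int_power_root) simp
  moreover have "4 * b \<in> \<rat>" using ab by simp
  ultimately have "4 * b \<in> \<int>" using algebraic_int_rat by blast
  then obtain C where C: "4 * b = of_int C" by (rule Ints_cases)
  have "of_int (C ^ 2) = (of_int (2 * A ^ 2 - 8 * M) :: complex)" using b4 C by simp
  then have C2: "C ^ 2 = 2 * A ^ 2 - 8 * M" by (simp only: of_int_eq_iff)
  then have "even (C ^ 2)" by simp
  then obtain D where D: "C = 2 * D" by auto
  then have A2: "A ^ 2 = 2 * D ^ 2 + 4 * M" using C2 by simp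
  then have "even (A ^ 2)" by simp
  then obtain E where E: "A = 2 * E" by auto
  then have "D ^ 2 = 2 * (E ^ 2 - M)" using A2 by simp
  then have "even (D ^ 2)" by simp
  then obtain F where F: "D = 2 * F" by auto
  have "a = of_int E" using A E by simp
  moreover have "b = of_int F" using C D F by simp
  ultimately show thesis using that ab(3) by blast
qed

lemma z_OL: "z \<in> OL"
proof -
  have "algebraic_int (of_int 2 :: complex)" by (rule algebraic_int_of_int)
  then have "algebraic_int (z ^ 2)" unfolding z2 by simp
  then have "algebraic_int z" by (rule algebraic_int_power_root) simp
  then show ?thesis unfolding OL_def using z_L by simp
qed

lemma r_OL: "r \<in> OL"
proof -
  have "algebraic_int (of_int 2 :: complex)" by (rule algebraic_int_of_int)
  then have "algebraic_int (r ^ 4)" unfolding r4 by simp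
  then have "algebraic_int r" by (rule algebraic_int_power_root) simp
  then show ?thesis unfolding OL_def using r_L by simp
qed

lemma s_pow_z: "(s [^]\<^bsub>G\<^esub> (b::nat)) z = (-1) ^ b * z"
  by (rule pow_apply_neg[OF s z_L s_z_neg])

end

locale two_at = two_quartic + prime_above
begin

sublocale quartic_at L r z t s e 2 K B P l
  by unfold_locales

lemma B_cong:
  assumes \<sigma>: "\<sigma> \<in> carrier G" and m: "m = 1 \<or> m = l" and z: "\<sigma> z \<doteq> z ^ m" and x: "x \<in> B" "x \<in> OL"
  shows "\<sigma> x \<doteq> x ^ m"
proof -
  obtain a b :: int where ab: "x = of_int a + of_int b * z" using integral_basis_two[OF x] by blast
  have "x = (\<Sum>k\<in>{0, 1}. of_int (if k = 0 then a else b) * z ^ k)" unfolding ab by simp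
  then show ?thesis using cg_zpoly[OF \<sigma> m z_OL z, of "\<lambda>k. if k = 0 then a else b" "{0, 1}"] by (simp only:)
qed

lemma r_notin_P: "odd l \<Longrightarrow> r \<notin> P" and z_notin_P: "odd l \<Longrightarrow> z \<notin> P"
proof -
  assume l: "odd l"
  show r: "r \<notin> P"
  proof
    assume "r \<in> P"
    then have "r * r ^ 3 \<in> P" by (intro P_mult2 OL_power r_OL)
    moreover have "r * r ^ 3 = 2" using r4 by (simp add: numeral_eq_Suc)
    ultimately show False using two_notin_P[OF l] by simp
  qed
  show "z \<notin> P" using P_prime_power[OF r_OL, of 2] r unfolding z_r by blast
qed

lemma z_pow_l:
  assumes l: "odd l"
  shows "z ^ l \<doteq> (-1) ^ (if l mod 8 \<in> {1, 7} then 0 else 1) * z"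
proof -
  have l2: "2 < l" using l prime_ge_2_nat[OF prime_l] by (cases "l = 2") auto
  have "l = 2 * ((l - 1) div 2) + 1" using l by presburger
  then have "z ^ l = (z ^ 2) ^ ((l - 1) div 2) * z" by (metis power_add power_mult power_one_right)
  also have "(z ^ 2) ^ ((l - 1) div 2) = of_int (2 ^ ((l - 1) div 2))" unfolding z2 by simp
  also have "of_int (2 ^ ((l - 1) div 2)) * z \<doteq> of_int (Legendre 2 (int l)) * z"
    by (intro cg_mult cg_refl OL_of_int z_OL)
      (simp only: cg_of_int cong_sym[OF euler_criterion[OF prime_l l2]])
  also have "of_int (Legendre 2 (int l)) = (-1 :: complex) ^ (if l mod 8 \<in> {1, 7} then 0 else 1)"
    unfolding Legendre_two[OF prime_l l2] chi8_def by simp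
  finally show ?thesis .
qed

lemma frobenius_nonempty: "frobenius_elements L P l \<noteq> {}"
proof (cases "odd l")
  case True
  let ?\<sigma> = "s [^]\<^bsub>G\<^esub> (if l mod 8 \<in> {1, 7} then 0 else 1 :: nat)"
  have \<sigma>: "?\<sigma> \<in> carrier G" using s by simp
  have "?\<sigma> z \<doteq> z ^ l" unfolding s_pow_z by (rule cg_sym[OF z_pow_l[OF True]])
  then show ?thesis using frobenius_exists[OF \<sigma>] B_cong[OF \<sigma>] by blast
next
  case False
  then have l: "l = 2" using prime_l primes_dvd_imp_eq two_is_prime_nat by blast
  have "z ^ 2 \<in> P" using P_l l unfolding z2 by simp
  then have zP: "z \<in> P" by (rule P_prime_power[OF z_OL])
  have "\<one>\<^bsub>G\<^esub> z \<doteq> z ^ l"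
    unfolding Gal_one_apply[OF z_L] cg_def l using zP \<open>z ^ 2 \<in> P\<close> by (rule P_diff)
  then show ?thesis using frobenius_exists[OF G.one_closed] B_cong[OF G.one_closed] by blast
qed

lemma inertia_good: "odd l \<Longrightarrow> inertia_group L P = {\<one>\<^bsub>G\<^esub>}"
proof -
  assume l: "odd l"
  show ?thesis
  proof (rule inertia_trivial)
    fix \<sigma> assume \<sigma>: "\<sigma> \<in> carrier G" "\<sigma> z \<doteq> z"
    obtain b :: nat where b: "\<sigma> z = (s [^]\<^bsub>G\<^esub> b) z" using z_conj[OF \<sigma>(1)] by blast
    have "(-1) ^ b * z \<doteq> (-1) ^ 0 * z" using \<sigma>(2) unfolding b s_pow_z by simp
    then have "even b \<longleftrightarrow> even (0::nat)" by (rule neg_not_cg[OF two_notin_P[OF l] z_OL z_notin_P[OF l]])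
    then show "\<sigma> z = z" unfolding b s_pow_z by simp
  qed (use two_notin_P[OF l] r_OL r_notin_P[OF l] z_OL in auto)
qed

lemma frobenius_b:
  assumes l: "odd l" and F: "word b a k \<in> frobenius_elements L P l"
  shows "even b \<longleftrightarrow> l mod 8 \<in> {1, 7}"
proof -
  let ?n = "if l mod 8 \<in> {1, 7} then 0 else 1 :: nat"
  have "(-1) ^ b * z \<doteq> z ^ l" using F z_OL word_z[of b a k] unfolding frobenius_iff s_pow_z by metis
  also have "\<dots> \<doteq> (-1) ^ ?n * z" by (rule z_pow_l[OF l])
  finally have "even b \<longleftrightarrow> even ?n" by (rule neg_not_cg[OF two_notin_P[OF l] z_OL z_notin_P[OF l]])
  then show ?thesis by simp
qed

lemma frobenius_sign:
  assumes l: "l mod 8 = 1" and F: "word b 0 k \<in> frobenius_elements L P l"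
  shows "(-1) ^ k * (-1) ^ (b div 2) = (if l \<in> P0 then 1 else -1 :: complex)"
proof -
  have odd: "odd l" using l by presburger
  have b: "even b" using frobenius_b[OF odd F] l by simp
  define n where "n = (l - 1) div 4"
  have n: "l = 4 * n + 1" using l unfolding n_def by presburger
  define \<epsilon> :: int where "\<epsilon> = (-1) ^ k * (-1) ^ (b div 2)"
  have \<epsilon>: "\<epsilon> = 1 \<or> \<epsilon> = -1" unfolding \<epsilon>_def by (cases "even k"; cases "even (b div 2)") auto
  have \<epsilon>c: "of_int \<epsilon> = ((-1) ^ k * (-1) ^ (b div 2) :: complex)" unfolding \<epsilon>_def by simp
  have "of_int \<epsilon> * r \<doteq> r ^ l" using F r_OL word_r_even[OF b, of k] unfolding frobenius_iff \<epsilon>c by metis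
  also have "r ^ l = of_int (2 ^ n) * r" unfolding n using r4 by (simp add: power_mult)
  finally have "(of_int \<epsilon> - of_int (2 ^ n)) * r \<in> P" unfolding cg_def by (simp add: algebra_simps)
  then have "of_int (\<epsilon> - 2 ^ n) \<in> P"
    using P_prime[OF OL_of_int r_OL, of "\<epsilon> - 2 ^ n"] r_notin_P[OF odd] by simp
  then have c: "[2 ^ n = \<epsilon>] (mod int l)" unfolding P_of_int by (simp add: cong_iff_dvd_diff dvd_diff_commute)
  have "\<not> int l dvd 2"
  proof
    assume "int l dvd 2"
    then have "int l \<le> 2" by (intro zdvd_imp_le) auto
    then show False using odd prime_ge_2_nat[OF prime_l] by (cases "l = 2") auto
  qed
  then have "\<not> [(-1::int) = 1] (mod int l)" by (simp add: cong_iff_dvd_diff)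
  then have "[\<epsilon> = 1] (mod int l) \<longleftrightarrow> \<epsilon> = 1" using \<epsilon> by auto
  then have "[2 ^ n = 1] (mod int l) \<longleftrightarrow> \<epsilon> = 1" using c unfolding cong_def by simp
  then have "l \<in> P0 \<longleftrightarrow> \<epsilon> = 1" using P0_iff_biquadratic[OF prime_l l] unfolding n_def by simp
  then show ?thesis using \<epsilon> unfolding \<epsilon>c[symmetric] by auto
qed

lemma local_det_odd:
  assumes l: "odd l" and F: "word b a k \<in> frobenius_elements L P l"
  shows "local_det (-1) b a k x = (if l mod 8 \<in> {3, 7} then 1 - x ^ 2 else if l mod 8 = 5 then 1 + x ^ 2
     else if l \<in> P0 then (1 - x) ^ 2 else (1 + x) ^ 2)"
proof -
  have a: "even a \<longleftrightarrow> l mod 4 = 1" by (rule frobenius_inertia_i[OF F two_notin_P[OF l] l])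
  have b: "even b \<longleftrightarrow> l mod 8 \<in> {1, 7}" by (rule frobenius_b[OF l F])
  have "l mod 8 = 1 \<or> l mod 8 = 3 \<or> l mod 8 = 5 \<or> l mod 8 = 7" using l by presburger
  then consider "l mod 8 = 3" "l mod 4 = 3" | "l mod 8 = 7" "l mod 4 = 3" | "l mod 8 = 5" "l mod 4 = 1"
    | "l mod 8 = 1" "l mod 4 = 1"
    using mod_mod_cancel[of 4 8 l] by fastforce
  then show ?thesis
  proof cases
    case 4
    have ev: "even a" "even b" using a b 4 by auto
    then have "word b 0 k \<in> frobenius_elements L P l" using F unfolding word_def by (simp add: t_pow_even)
    from frobenius_sign[OF 4(1) this] show ?thesis using 4 ev unfolding local_det_def by simp
  qed (use a b in \<open>auto simp: local_det_def\<close>)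
qed

text \<open>Write x = a + b \<i>, 2a = p + p' z and 2b = m + m' z. Integrality of a^2 + b^2 yields
  two equations that force m to be even. Then t x - x = -(m + m' z) \<i> and s x - x = -(p' + m'
  \<i>) z lie in P together with 2 and z.\<close>

lemma two_cg_K:
  assumes l: "l = 2" and x: "x \<in> K" "x \<in> OL"
  shows "t x \<doteq> x" "s x \<doteq> x"
proof -
  have "z ^ 2 \<in> P" using P_l l unfolding z2 by simp
  then have zP: "z \<in> P" by (rule P_prime_power[OF z_OL])
  obtain a b where ab: "a \<in> B" "b \<in> B" "x = a + b * \<i>" using K_elim[OF x(1)] by blast
  have tx: "t x = a - b * \<i>" unfolding ab(3) by (rule t_K_apply[OF ab(1,2)])
  have txO: "t x \<in> OL" by (rule Gal_OL[OF t x(2)])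
  have "(2::complex) = of_nat 2" by simp
  then have twoB: "2 \<in> B" using csubfield_of_nat[OF B_field, of 2] by simp
  have "2 * a = x + t x" unfolding tx by (simp add: ab(3))
  then have "2 * a \<in> OL" using OL_add[OF x(2) txO] by simp
  then obtain p p' :: int where p: "2 * a = of_int p + of_int p' * z"
    using integral_basis_two[OF csubfield_mult[OF B_field twoB ab(1)]] by blast
  have "2 * b = - \<i> * (x - t x)" unfolding tx by (simp add: ab(3))
  then have "2 * b \<in> OL" using OL_mult[OF OL_uminus[OF i_OL] OL_diff[OF x(2) txO]] by simp
  then obtain m m' :: int where m: "2 * b = of_int m + of_int m' * z"
    using integral_basis_two[OF csubfield_mult[OF B_field twoB ab(2)]] by blast
  have nu: "a * a + b * b = x * t x" unfolding tx by (simp add: ab(3) algebra_simps)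
  have "a * a + b * b \<in> B" by (intro csubfield_add[OF B_field] csubfield_mult[OF B_field] ab)
  moreover have "a * a + b * b \<in> OL" using OL_mult[OF x(2) txO] unfolding nu .
  ultimately obtain n n' :: int where n: "a * a + b * b = of_int n + of_int n' * z"
    using integral_basis_two by blast
  have "of_int (p ^ 2 + 2 * p' ^ 2 + m ^ 2 + 2 * m' ^ 2) + of_int (2 * (p * p' + m * m')) * z
      = (2 * a) ^ 2 + (2 * b) ^ 2"
  proof -
    have "(2 * a) ^ 2 + (2 * b) ^ 2 = of_int (p ^ 2 + m ^ 2) + of_int (p' ^ 2 + m' ^ 2) * z ^ 2
        + of_int (2 * (p * p' + m * m')) * z"
      unfolding p m by (simp add: algebra_simps power2_eq_square)
    then show ?thesis unfolding z2 by (simp add: algebra_simps)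
  qed
  also have "\<dots> = 4 * (a * a + b * b)" by (simp add: algebra_simps power2_eq_square)
  also have "\<dots> = of_int (4 * n) + of_int (4 * n') * z" unfolding n by (simp add: algebra_simps)
  finally have "of_int (p ^ 2 + 2 * p' ^ 2 + m ^ 2 + 2 * m' ^ 2) = (of_int (4 * n) :: complex) \<and>
      of_int (2 * (p * p' + m * m')) = (of_int (4 * n') :: complex)"
    by (rule B_unique[rotated 4]) simp_all
  then have eq1: "p ^ 2 + 2 * p' ^ 2 + m ^ 2 + 2 * m' ^ 2 = 4 * n" and eq2: "2 * (p * p' + m * m') = 4 * n'"
    unfolding of_int_eq_iff by auto
  \<comment> \<open>If m were odd, so would be p. As odd squares are 1 modulo 4, the first equation
    makes p' + m' odd, whereas the second makes it even.\<close>
  have "even m"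
  proof (rule ccontr)
    assume odd: "odd m"
    have "p ^ 2 + m ^ 2 = 2 * (2 * n - p' ^ 2 - m' ^ 2)" using eq1 by (simp add: algebra_simps)
    then have "even (p ^ 2 + m ^ 2)" by simp
    then have "odd p" using odd by simp
    then obtain i j where ij: "p = 2 * i + 1" "m = 2 * j + 1" using odd oddE by metis
    have "2 * (p' ^ 2 + m' ^ 2 + 1) = 2 * (2 * (n - i ^ 2 - i - j ^ 2 - j))"
      using eq1 unfolding ij by (simp add: algebra_simps power2_eq_square)
    then have "p' ^ 2 + m' ^ 2 + 1 = 2 * (n - i ^ 2 - i - j ^ 2 - j)" by simp
    then have "even (p' ^ 2 + m' ^ 2 + 1)" by simp
    then have "odd (p' + m')" by simp
    moreover have "p * p' + m * m' = 2 * n'" using eq2 by simp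
    then have "even (p * p' + m * m')" by simp
    then have "even (p' + m')" using \<open>odd p\<close> odd by simp
    ultimately show False by simp
  qed
  then have "of_int m \<in> P" unfolding P_of_int l by simp
  then have "2 * b \<in> P" unfolding m by (intro P_add P_mult OL_of_int zP)
  then have "- (2 * b * \<i>) \<in> P" by (rule P_uminus[OF P_mult2[OF _ i_OL]])
  moreover have "t x - x = - (2 * b * \<i>)" unfolding tx by (simp add: ab(3))
  ultimately show "t x \<doteq> x" unfolding cg_def by simp
  have "s (2 * x) = 2 * x - 2 * ((of_int p' + of_int m' * \<i>) * z)"
  proof -
    have x2: "2 * x = (of_int p + of_int p' * z) + (of_int m + of_int m' * z) * \<i>"
      unfolding p[symmetric] m[symmetric] ab(3) by (simp add: algebra_simps)
    have "s (2 * x) = s (of_int p + of_int p' * z) + s (of_int m + of_int m' * z) * s \<i>"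
      unfolding x2 using rat_L z_L i_L L_closed by (simp add: Gal_add[OF s] Gal_mul[OF s])
    also have "s (of_int p + of_int p' * z) = of_int p - of_int p' * z" by (rule s_B_apply) simp_all
    also have "s (of_int m + of_int m' * z) = of_int m - of_int m' * z" by (rule s_B_apply) simp_all
    finally have sx2: "s (2 * x) = of_int p - of_int p' * z + (of_int m - of_int m' * z) * \<i>" unfolding s_i .
    show ?thesis unfolding sx2 unfolding x2 by (simp add: algebra_simps)
  qed
  moreover have "s (2 * x) = 2 * s x"
    using Gal_mul[OF s rat_L[of 2] OL_L[OF x(2)]] Gal_rat[OF s, of 2] by simp
  ultimately have "2 * (s x - x) = 2 * - ((of_int p' + of_int m' * \<i>) * z)" by (simp add: algebra_simps)
  then have "s x - x = - ((of_int p' + of_int m' * \<i>) * z)" by (simp only: mult_cancel_left) simp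
  also have "\<dots> \<in> P" by (intro P_uminus P_mult OL_add OL_mult OL_of_int i_OL zP)
  finally show "s x \<doteq> x" unfolding cg_def .
qed

lemma fixed_space_two:
  assumes l: "l = 2" and \<rho>: "standard_rep (-1) \<rho>"
  shows "fixed_space 2 \<rho> (inertia_group L P) = {0\<^sub>v 2}"
proof -
  have rep: "representation G 2 \<rho>" using \<rho> unfolding standard_rep_def by simp
  obtain k :: nat where "t \<otimes>\<^bsub>G\<^esub> e [^]\<^bsub>G\<^esub> k \<in> inertia_group L P" by (rule inertia_lift[OF t two_cg_K(1)[OF l]])
  moreover have "t \<otimes>\<^bsub>G\<^esub> e [^]\<^bsub>G\<^esub> k = word 0 1 k" unfolding word_def using t e by simp
  ultimately have k: "word 0 1 k \<in> inertia_group L P" by simp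
  obtain k' :: nat where "s \<otimes>\<^bsub>G\<^esub> e [^]\<^bsub>G\<^esub> k' \<in> inertia_group L P" by (rule inertia_lift[OF s two_cg_K(2)[OF l]])
  moreover have "s \<otimes>\<^bsub>G\<^esub> e [^]\<^bsub>G\<^esub> k' = word 1 0 k'" unfolding word_def using s e by simp
  ultimately have k': "word 1 0 k' \<in> inertia_group L P" by simp
  show ?thesis
  proof (rule fixed_space_zeroI[OF rep inertia_carrier])
    fix v :: "complex vec" assume v: "v \<in> carrier_vec 2" and fx: "\<And>h. h \<in> inertia_group L P \<Longrightarrow> \<rho> h *\<^sub>v v = v"
    obtain a b where ab: "v = v2 a b" using v2_exhaust[OF v] by blast
    have "word_mat (-1) 0 1 k *\<^sub>v v2 a b = v2 a b" "word_mat (-1) 1 0 k' *\<^sub>v v2 a b = v2 a b"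
      using fx[OF k] fx[OF k'] unfolding ab standard_rep_word[OF \<rho>] by simp_all
    then have "a = 0 \<and> b = 0"
      unfolding word_mat_def by (cases "even k"; cases "even k'") (auto simp: m2_smult m2_mult_vec v2_eq_iff)
    then show "v = 0\<^sub>v 2" unfolding ab v2_zero by simp
  qed
qed

end

context two_quartic
begin

lemma two_atI:
  assumes "prime l" "P \<in> primes_above L l"
  shows "two_at L r z t s e K B P l"
proof (rule two_at.intro[OF two_quartic_axioms])
  show "prime_above L P l"
    by (rule prime_above.intro[OF number_field_axioms]) (rule prime_above_axioms.intro[OF assms(2,1)])
qed

text \<open>For \<open>N = 2\<close> and \<open>h = 1\<close> the relation on the parameter reads c
  = -1, so there is just one standard representation.\<close>

lemma irreducible_unique:
  obtains \<rho> where "standard_rep (-1) \<rho>" "irreducible_rep G 2 \<rho>"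
    "\<And>n \<phi>. irreducible_rep G n \<phi> \<Longrightarrow> n > 1 \<Longrightarrow> rep_iso G n \<phi> 2 \<rho>"
proof -
  obtain \<rho> where \<rho>: "standard_rep (-1) \<rho>" by (rule standard_rep_exists[of "-1"]) simp
  show thesis
  proof (rule that[OF \<rho> standard_rep_irreducible[OF \<rho>]])
    fix n \<phi> assume irr: "irreducible_rep G n \<phi>" "n > 1"
    obtain c \<rho>' where c: "n = 2" "c ^ (2 div 2) = (-1) ^ (2 div 2 :: nat)" "standard_rep c \<rho>'" "rep_iso G n \<phi> 2 \<rho>'"
      by (rule irreducible_classification[OF irr])
    have c1: "c = -1" using c(2) by simp
    show "rep_iso G n \<phi> 2 \<rho>"
      using c(4) standard_rep_unique[OF c(3)[unfolded c1] \<rho>] unfolding rep_iso_def by simp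
  qed simp
qed

lemma artin_factor_irreducible:
  assumes irr: "irreducible_rep G 2 \<phi>" and l: "prime l"
  shows "artin_factor L 2 \<phi> l w = inverse (let x = of_nat l powr (- w) in
    if l = 2 then 1 else if l mod 8 \<in> {3, 7} then 1 - x ^ 2 else if l mod 8 = 5 then 1 + x ^ 2
     else if l \<in> P0 then (1 - x) ^ 2 else (1 + x) ^ 2)"
proof (rule artin_factor_eqI[OF subfield l])
  let ?x = "of_nat l powr (- w) :: complex"
  obtain \<rho> where \<rho>: "standard_rep (-1) \<rho>" "irreducible_rep G 2 \<rho>" "rep_iso G 2 \<phi> 2 \<rho>"
    using irreducible_unique irr by (metis one_less_numeral_iff semiring_norm(76))
  have rep: "representation G 2 \<phi>" "representation G 2 \<rho>" using irr \<rho>(2) unfolding irreducible_rep_def by auto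
  fix P assume P: "P \<in> primes_above L l"
  interpret A: two_at L r z t s e K B P l by (rule two_atI[OF l P])
  show "frobenius_elements L P l \<noteq> {}" by (rule A.frobenius_nonempty)
  fix F assume F: "F \<in> frobenius_elements L P l"
  then have FG: "F \<in> carrier G" unfolding A.frobenius_iff by blast
  have C: "1\<^sub>m 2 - ?x \<cdot>\<^sub>m \<phi> F \<in> carrier_mat 2 2"
    by (intro minus_carrier_mat smult_carrier_mat rep_closed[OF rep(1) FG])
  show "det_on 2 (fixed_space 2 \<phi> (inertia_group L P)) (1\<^sub>m 2 - ?x \<cdot>\<^sub>m \<phi> F) = (let x = ?x in
    if l = 2 then 1 else if l mod 8 \<in> {3, 7} then 1 - x ^ 2 else if l mod 8 = 5 then 1 + x ^ 2
     else if l \<in> P0 then (1 - x) ^ 2 else (1 + x) ^ 2)"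
  proof (cases "l = 2")
    case True
    have "fixed_space 2 \<phi> (inertia_group L P) = {0\<^sub>v 2}"
      by (rule rep_iso_fixed_space_zero[OF rep(1) \<rho>(3) A.inertia_carrier rep(2) A.fixed_space_two[OF True \<rho>(1)]])
    then show ?thesis using det_on_zero[OF C] True by simp
  next
    case False
    then have l': "odd l" using l primes_dvd_imp_eq two_is_prime_nat by blast
    obtain b a k where Fw: "F = word b a k" using word_exhaust[OF FG] by blast
    have "fixed_space 2 \<phi> (inertia_group L P) = carrier_vec 2"
      unfolding A.inertia_good[OF l'] by (rule fixed_space_singleton_one[OF rep(1) G.group_axioms])
    then have "det_on 2 (fixed_space 2 \<phi> (inertia_group L P)) (1\<^sub>m 2 - ?x \<cdot>\<^sub>m \<phi> F) = det (1\<^sub>m 2 - ?x \<cdot>\<^sub>m \<phi> F)"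
      using det_on_full[OF C] by simp
    also have "\<dots> = det (1\<^sub>m 2 - ?x \<cdot>\<^sub>m \<rho> F)" by (rule rep_iso_det[OF rep \<rho>(3) FG])
    also have "\<dots> = local_det (-1) b a k ?x" unfolding Fw standard_rep_word[OF \<rho>(1)] det_word_mat ..
    finally show ?thesis using A.local_det_odd[OF l' F[unfolded Fw], of ?x] False by (simp add: Let_def)
  qed
qed

theorem artin_L_irreducible:
  assumes irr: "irreducible_rep G 2 \<phi>" and w: "Re w > 1"
  defines "A1 \<equiv> {l. prime l \<and> l mod 8 \<in> {3, 7}}"
    and "f1 \<equiv> \<lambda>l. inverse (1 - of_nat l powr (- 2 * w))"
    and "A2 \<equiv> {l. prime l \<and> l mod 8 = 5}"
    and "f2 \<equiv> \<lambda>l. inverse (1 + of_nat l powr (- 2 * w))"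
    and "A3 \<equiv> P0"
    and "f3 \<equiv> \<lambda>l. inverse ((1 - of_nat l powr (- w)) ^ 2)"
    and "A4 \<equiv> {l. prime l \<and> l mod 8 = 1 \<and> l \<notin> P0}"
    and "f4 \<equiv> \<lambda>l. inverse ((1 + of_nat l powr (- w)) ^ 2)"
  shows "artin_L_converges L 2 \<phi> w \<and> prime_prod_converges A1 f1 \<and> prime_prod_converges A2 f2 \<and>
    prime_prod_converges A3 f3 \<and> prime_prod_converges A4 f4 \<and> artin_L L 2 \<phi> w =
      prime_prod A1 f1 * prime_prod A2 f2 * prime_prod A3 f3 * prime_prod A4 f4"
proof -
  define f where "f l = artin_factor L 2 \<phi> l w" for l
  have sq: "(of_nat l powr (- w :: complex)) ^ 2 = of_nat l powr (- 2 * w)" for l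
    unfolding power2_eq_square by (simp flip: powr_add)
  have P0: "prime l" "l mod 8 = 1" if "l \<in> P0" for l
    using P0_mod_8[OF that] that unfolding P0_def by auto
  have eq: "f l = f1 l" if "l \<in> A1" for l
    using that artin_factor_irreducible[OF irr, of l w] unfolding A1_def f_def f1_def by (auto simp: Let_def sq)
  have eq2: "f l = f2 l" if "l \<in> A2" for l
    using that artin_factor_irreducible[OF irr, of l w] unfolding A2_def f_def f2_def by (auto simp: Let_def sq)
  have eq3: "f l = f3 l" if "l \<in> A3" for l
    using that P0[of l] artin_factor_irreducible[OF irr, of l w] unfolding A3_def f_def f3_def by (auto simp: Let_def)
  have eq4: "f l = f4 l" if "l \<in> A4" for l
    using that artin_factor_irreducible[OF irr, of l w] unfolding A4_def f_def f4_def by (auto simp: Let_def)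
  have f2: "f 2 = 1" unfolding f_def using artin_factor_irreducible[OF irr, of 2 w] by simp
  have w2: "Re (2 * w) > 1" using w by simp
  have c1: "prime_prod_converges A1 f1"
    unfolding f1_def using prime_prod_converges_euler[OF _ _ w2, of A1 "\<lambda>l. 1"]
    by (simp add: A1_def prime_ge_2_nat)
  have c2: "prime_prod_converges A2 f2"
    unfolding f2_def using prime_prod_converges_euler[OF _ _ w2, of A2 "\<lambda>l. -1"]
    by (simp add: A2_def prime_ge_2_nat)
  have "prime_prod_converges A3 (\<lambda>l. inverse (1 - 1 * of_nat l powr (- w)))"
    by (rule prime_prod_converges_euler[OF _ _ w]) (use P0 prime_ge_2_nat in \<open>auto simp: A3_def\<close>)
  from prime_prod_converges_mult[OF this this] have c3: "prime_prod_converges A3 f3"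
    unfolding f3_def by (simp add: power2_eq_square inverse_mult_distrib)
  have "prime_prod_converges A4 (\<lambda>l. inverse (1 - (-1) * of_nat l powr (- w)))"
    by (rule prime_prod_converges_euler[OF _ _ w]) (use prime_ge_2_nat in \<open>auto simp: A4_def\<close>)
  from prime_prod_converges_mult[OF this this] have c4: "prime_prod_converges A4 f4"
    unfolding f4_def by (simp add: power2_eq_square inverse_mult_distrib)
  have split: "{l. prime l} = ((({2} \<union> A1) \<union> A2) \<union> A3) \<union> A4"
  proof (rule Set.set_eqI)
    fix l :: nat
    have "l mod 8 = 1 \<or> l mod 8 = 3 \<or> l mod 8 = 5 \<or> l mod 8 = 7" if "odd l" using that by presburger
    moreover have "prime l \<Longrightarrow> even l \<Longrightarrow> l = 2" using primes_dvd_imp_eq two_is_prime_nat by blast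
    ultimately show "l \<in> {l. prime l} \<longleftrightarrow> l \<in> ((({2} \<union> A1) \<union> A2) \<union> A3) \<union> A4"
      unfolding A1_def A2_def A3_def A4_def using P0 two_is_prime_nat by auto
  qed
  have f': "prime_prod_converges A1 f" "prime_prod_converges A2 f" "prime_prod_converges A3 f" "prime_prod_converges A4 f"
    "prime_prod A1 f = prime_prod A1 f1" "prime_prod A2 f = prime_prod A2 f2" "prime_prod A3 f = prime_prod A3 f3"
    "prime_prod A4 f = prime_prod A4 f4"
    using c1 c2 c3 c4 prime_prod_converges_cong[OF eq] prime_prod_converges_cong[OF eq2]
      prime_prod_converges_cong[OF eq3] prime_prod_converges_cong[OF eq4]
      prime_prod_cong[OF eq] prime_prod_cong[OF eq2] prime_prod_cong[OF eq3] prime_prod_cong[OF eq4] by simp_all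
  have "{2} \<inter> A1 = {}" unfolding A1_def by auto
  note u1 = prime_prod_converges_union[OF this _ f'(1)]
  have "({2} \<union> A1) \<inter> A2 = {}" unfolding A1_def A2_def by auto
  note u2 = prime_prod_converges_union[OF this _ f'(2)]
  have "2 \<notin> P0" using P0(2)[of 2] by auto
  then have "(({2} \<union> A1) \<union> A2) \<inter> A3 = {}" unfolding A1_def A2_def A3_def using P0 by auto
  note u3 = prime_prod_converges_union[OF this _ f'(3)]
  have "((({2} \<union> A1) \<union> A2) \<union> A3) \<inter> A4 = {}" unfolding A1_def A2_def A3_def A4_def by auto
  note u4 = prime_prod_converges_union[OF this _ f'(4)]
  have "prime_prod_converges {2} f" by (rule prime_prod_converges_finite) simp
  note v1 = u1[OF this]
  note v2 = u2[OF v1(1)]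
  note v3 = u3[OF v2(1)]
  note v4 = u4[OF v3(1)]
  have "artin_L_converges L 2 \<phi> w" unfolding artin_L_converges_def split using v4(1) unfolding f_def .
  moreover have "artin_L L 2 \<phi> w = prime_prod A1 f1 * prime_prod A2 f2 * prime_prod A3 f3 * prime_prod A4 f4"
    unfolding artin_L_def split using v4(2) v3(2) v2(2) v1(2) prime_prod_singleton[of 2 f] f'(5-8) f2
    unfolding f_def[symmetric, abs_def] by simp
  ultimately show ?thesis using c1 c2 c3 c4 by blast
qed

end

subsection \<open>The fields at hand\<close>

lemma zeta_4: "zeta 4 = \<i>"
proof -
  have "zeta 4 = exp (\<i> * of_real (pi / 2))" unfolding zeta_def by (simp add: field_simps)
  then show ?thesis by (simp only: cis_conv_exp[symmetric] cis_pi_half)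
qed

lemma zeta_power_div: "k > 0 \<Longrightarrow> zeta (k * n) ^ k = zeta n"
  using zeta_power[of "k * n" k] zeta_power[of n 1] by (simp add: field_simps)

lemma gen_insert_gen: "gen (insert x (gen H)) = gen (insert x H)"
proof (rule gen_eqI)
  have "gen H \<subseteq> gen (insert x H)" by (rule gen_mono) (auto intro: gen_incl)
  then show "insert x (gen H) \<subseteq> gen (insert x H)" by (auto intro: gen_incl)
qed (auto intro: gen_incl)

lemma gen_empty: "gen {} = \<rat>"
proof
  show "gen {} \<subseteq> \<rat>" by (rule gen_least) (auto simp: csubfield_def)
  show "\<rat> \<subseteq> gen {}" by (rule csubfield_Rats[OF csubfield_gen])
qed

lemma K_field_odd:
  assumes q: "odd q"
  shows "K_field q = gen {\<i>, zeta q}"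
  unfolding K_field_def
proof (rule gen_eqI)
  have q0: "q > 0" using q by (cases q) auto
  have "zeta (4 * q) ^ q = \<i>" using zeta_power_div[OF q0, of 4] zeta_4 by (simp add: mult.commute)
  moreover have "zeta (4 * q) ^ 4 = zeta q" using zeta_power_div[of 4 q] by simp
  moreover have "zeta (4 * q) ^ k \<in> gen {zeta (4 * q)}" for k
    by (intro csubfield_power[OF csubfield_gen] gen_incl) simp
  ultimately show "{\<i>, zeta q} \<subseteq> gen {zeta (4 * q)}" by (metis empty_subsetI insert_subset)
  obtain m where m: "q = 2 * m + 1" using q oddE by blast
  \<comment> \<open>This is u = (1 + 3q^2)/4, the coefficient in q * q + 4 u = 1 modulo 4q; it
    recovers \<open>zeta (4 * q)\<close> from its powers \<i> and \<open>zeta q\<close>.\<close>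
  define u where "u = 3 * m ^ 2 + 3 * m + 1"
  have "q * q + 4 * u = 1 + 4 * q * q" unfolding m u_def by (simp add: algebra_simps power2_eq_square)
  then have "(q * q + 4 * u) mod (4 * q) = 1 mod (4 * q)" by (simp only: mod_mult_self2)
  moreover have "1 \<le> 4 * q" using q0 by simp
  ultimately have "zeta (4 * q) ^ (q * q + 4 * u) = zeta (4 * q) ^ 1" by (simp only: zeta_power_eq)
  then have "zeta (4 * q) = (zeta (4 * q) ^ q) ^ q * (zeta (4 * q) ^ 4) ^ u" by (simp add: power_add power_mult)
  then have "zeta (4 * q) = \<i> ^ q * zeta q ^ u"
    using \<open>zeta (4 * q) ^ q = \<i>\<close> \<open>zeta (4 * q) ^ 4 = zeta q\<close> by simp
  moreover have "\<i> ^ q * zeta q ^ u \<in> gen {\<i>, zeta q}"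
    by (intro csubfield_mult[OF csubfield_gen] csubfield_power[OF csubfield_gen] gen_incl) auto
  ultimately show "{zeta (4 * q)} \<subseteq> gen {\<i>, zeta q}" by simp
qed

lemma Kt_field_odd: "odd q \<Longrightarrow> Kt_field q r = gen {\<i>, zeta q, r}"
  unfolding Kt_field_def K_field_odd gen_insert_gen by (simp add: insert_commute)

text \<open>The Gauss sum shows that r^2 lies in \<open>K_field q\<close>. Hence \<epsilon> maps r
  to r or -r, and the former is excluded because \<epsilon> is not the identity.\<close>

lemma odd_quartic_Kt_field:
  assumes q: "prime q" "odd q" and r: "r ^ 4 = of_int (qstar q)" and g: "residue_primroot q g"
    and \<epsilon>: "\<epsilon> \<in> carrier (Gal (Kt_field q r) (K_field q))" "\<epsilon> \<noteq> one (Gal (Kt_field q r) (K_field q))"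
    and \<sigma>1: "\<sigma>\<^sub>1 (zeta 4) = inverse (zeta 4)" "\<sigma>\<^sub>1 (zeta q) = zeta q"
    and \<sigma>q: "\<sigma>\<^sub>q (zeta 4) = zeta 4" "\<sigma>\<^sub>q (zeta q) = zeta q ^ g"
    and t1: "t\<^sub>1 \<in> carrier (Gt q r)" "\<And>x. x \<in> K_field q \<Longrightarrow> t\<^sub>1 x = \<sigma>\<^sub>1 x"
    and tq: "t\<^sub>q \<in> carrier (Gt q r)" "\<And>x. x \<in> K_field q \<Longrightarrow> t\<^sub>q x = \<sigma>\<^sub>q x"
  shows "odd_quartic (Kt_field q r) q g t\<^sub>q r t\<^sub>1 \<epsilon> (K_field q) (gen {zeta q})"
proof -
  let ?L = "Kt_field q r" and ?K = "K_field q"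
  note L = Kt_field_odd[OF q(2), of r] and K = K_field_odd[OF q(2)]
  have KL: "?K \<subseteq> ?L" unfolding L K by (rule gen_mono) (auto intro: gen_incl)
  have iK: "\<i> \<in> ?K" and zK: "zeta q \<in> ?K" unfolding K by (auto intro: gen_incl)
  have rL: "r \<in> ?L" unfolding L by (auto intro: gen_incl)
  have QK: "\<rat> \<subseteq> ?K" unfolding K by (rule csubfield_Rats[OF csubfield_gen])
  interpret number_field ?L by unfold_locales (simp only: L csubfield_gen)
  interpret cyclotomic ?L q g t\<^sub>q
    by unfold_locales (use q g tq zK KL \<sigma>q in auto)
  have \<epsilon>G: "\<epsilon> \<in> carrier G" by (rule Gal_mono[OF \<epsilon>(1) QK])
  have \<epsilon>K: "\<epsilon> x = x" if "x \<in> ?K" for x using \<epsilon>(1) that unfolding mem_Gal_iff by blast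
  have "(r ^ 2) ^ 2 = gauss_sum ^ 2" unfolding gauss_sum_square r[symmetric] by (simp flip: power_mult)
  then have "r ^ 2 = gauss_sum \<or> r ^ 2 = - gauss_sum" by (simp only: power2_eq_iff)
  moreover have "gauss_sum \<in> gen {zeta q}" using gauss_sum_Rz gen_zeta by simp
  moreover have "gen {zeta q} \<subseteq> ?K" unfolding K by (rule gen_mono) (auto intro: gen_incl)
  ultimately have "r ^ 2 \<in> ?K" using csubfield_uminus[OF csubfield_gen] K by auto
  then have "(\<epsilon> r) ^ 2 = r ^ 2" using \<epsilon>K Gal_pow[OF \<epsilon>G rL, of 2] by simp
  then have er: "\<epsilon> r = r \<or> \<epsilon> r = - r" by (simp only: power2_eq_iff)
  have "\<epsilon> r \<noteq> r"
  proof
    assume rr: "\<epsilon> r = r"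
    have "\<epsilon> = \<one>\<^bsub>G\<^esub>"
    proof (rule Gal_eqI[OF L \<epsilon>G G.one_closed])
      fix x assume "x \<in> {\<i>, zeta q, r}"
      then show "\<epsilon> x = \<one>\<^bsub>G\<^esub> x" using rr \<epsilon>K[OF iK] \<epsilon>K[OF zK] Gal_one_apply rL iK zK KL by auto
    qed
    then show False using \<epsilon>(2) unfolding Gal_one by simp
  qed
  then have er: "\<epsilon> r = - r" using er by blast
  show ?thesis
  proof (rule odd_quartic.intro[OF cyclotomic_axioms], unfold_locales)
    show "?L = gen {\<i>, zeta q, r}" "?K = gen {\<i>, zeta q}" by (fact L K)+
    show "r ^ 4 = of_int (qstar q)" "t\<^sub>1 \<in> carrier G" "\<epsilon> \<in> carrier G" "\<epsilon> r = - r" by (fact r t1 \<epsilon>G er)+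
    show "t\<^sub>1 \<i> = - \<i>" using t1(2)[OF iK] \<sigma>1(1) unfolding zeta_4 by simp
    show "t\<^sub>1 (zeta q) = zeta q" using t1(2)[OF zK] \<sigma>1(2) by simp
    show "t\<^sub>q \<i> = \<i>" using tq(2)[OF iK] \<sigma>q(1) unfolding zeta_4 by simp
    show "\<epsilon> \<i> = \<i>" "\<epsilon> (zeta q) = zeta q" by (rule \<epsilon>K[OF iK], rule \<epsilon>K[OF zK])
  qed (rule refl)
qed

text \<open>For q = 2 the theorem supplies no automorphisms, so they are built by successive
  quadratic extensions. The image of w can be any square root of \<sigma>(w^2) in the larger
  field.\<close>

lemma Gal_extend_quadratic:
  assumes \<sigma>: "\<sigma> \<in> carrier (Gal (gen H) \<rat>)" and w: "w ^ 2 \<in> gen H" "w \<notin> gen H"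
    and w': "w' \<in> gen (insert w H)" "w' ^ 2 = \<sigma> (w ^ 2)"
  obtains \<tau> where "\<tau> \<in> carrier (Gal (gen (insert w H)) \<rat>)" "\<tau> w = w'" "\<And>x. x \<in> gen H \<Longrightarrow> \<tau> x = \<sigma> x"
proof -
  let ?F = "gen H" and ?E = "gen (insert w H)"
  interpret F: number_field ?F by unfold_locales (rule csubfield_gen)
  note Fc = F.L_closed
  have FE: "?F \<subseteq> ?E" by (rule gen_mono) (auto intro: gen_incl)
  have wE: "w \<in> ?E" by (rule gen_incl) simp
  have EI: "x + y * w \<in> ?E" if "x \<in> ?F" "y \<in> ?F" for x y
    using that FE wE by (intro csubfield_add[OF csubfield_gen] csubfield_mult[OF csubfield_gen]) auto
  have elim: "\<exists>p. fst p \<in> ?F \<and> snd p \<in> ?F \<and> u = fst p + snd p * w" if u: "u \<in> ?E" for u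
  proof -
    have "H \<subseteq> {x + y * w | x y. x \<in> ?F \<and> y \<in> ?F}"
    proof
      fix x assume "x \<in> H"
      then have "x = x + 0 * w" "x \<in> ?F" by (auto intro: gen_incl)
      then show "x \<in> {x + y * w | x y. x \<in> ?F \<and> y \<in> ?F}" using Fc(2) by blast
    qed
    moreover have "w = 0 + 1 * w" by simp
    then have "w \<in> {x + y * w | x y. x \<in> ?F \<and> y \<in> ?F}" using Fc(1,2) by blast
    ultimately have "?E \<subseteq> {x + y * w | x y. x \<in> ?F \<and> y \<in> ?F}"
      by (intro gen_least csubfield_quadratic[OF csubfield_gen w]) auto
    then obtain x y where "u = x + y * w" "x \<in> ?F" "y \<in> ?F" using u by blast
    then show ?thesis by (intro exI[of _ "(x, y)"]) simp
  qed
  then obtain p where p: "\<And>u. u \<in> ?E \<Longrightarrow> fst (p u) \<in> ?F \<and> snd (p u) \<in> ?F \<and> u = fst (p u) + snd (p u) * w"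
    by metis
  have uniq: "x = x' \<and> y = y'" if "x \<in> ?F" "y \<in> ?F" "x' \<in> ?F" "y' \<in> ?F" "x + y * v = x' + y' * v" "v \<notin> ?F" for x y x' y' v
  proof -
    have "y = y'"
    proof (rule ccontr)
      assume "y \<noteq> y'"
      then have "v = (x' - x) / (y - y')" using that(5) by (simp add: field_simps)
      also have "\<dots> \<in> ?F" using that(1-4) by (intro csubfield_divide[OF csubfield_gen] csubfield_diff[OF csubfield_gen])
      finally show False using that(6) by simp
    qed
    then show ?thesis using that(5) by simp
  qed
  have bij: "bij_betw \<sigma> ?F ?F" using \<sigma> unfolding mem_Gal_iff by (elim conjE)
  have im: "\<sigma> ` ?F = ?F" by (rule bij_betw_imp_surj_on[OF bij])
  \<comment> \<open>If w' were in the small field, it would be \<sigma> v with v^2 = w^2, and w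
    would be v or -v.\<close>
  have w'F: "w' \<notin> ?F"
  proof
    assume "w' \<in> ?F"
    then have "w' \<in> \<sigma> ` ?F" unfolding im .
    then obtain v where "w' = \<sigma> v" and v: "v \<in> ?F" by (rule imageE)
    then have v: "v \<in> ?F" "\<sigma> v = w'" by simp_all
    have "\<sigma> (v ^ 2) = \<sigma> (w ^ 2)" using F.Gal_pow[OF \<sigma> v(1)] v(2) w'(2) by simp
    then have "v ^ 2 = w ^ 2" using F.Gal_inj[OF \<sigma> _ w(1)] csubfield_power[OF csubfield_gen v(1)] by blast
    then have "w = v \<or> w = - v" by (metis power2_eq_iff minus_minus)
    then show False using v(1) w(2) Fc by auto
  qed
  \<comment> \<open>\<open>p\<close> chooses coordinates with respect to 1 and w; they are unique
    since w lies outside the small field.\<close>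
  define \<tau> where "\<tau> = (\<lambda>u\<in>?E. \<sigma> (fst (p u)) + \<sigma> (snd (p u)) * w')"
  have ap: "\<tau> (x + y * w) = \<sigma> x + \<sigma> y * w'" if xy: "x \<in> ?F" "y \<in> ?F" for x y
  proof -
    have "fst (p (x + y * w)) = x \<and> snd (p (x + y * w)) = y"
      using p[OF EI[OF xy]] uniq[OF _ _ xy _ w(2)] by metis
    then show ?thesis unfolding \<tau>_def using EI[OF xy] by simp
  qed
  have apF: "\<tau> x = \<sigma> x" if "x \<in> ?F" for x using ap[OF that Fc(2)] F.Gal_0[OF \<sigma>] by simp
  have apw: "\<tau> w = w'" using ap[OF Fc(2) Fc(1)] F.Gal_0[OF \<sigma>] F.Gal_1[OF \<sigma>] by simp
  have sF: "\<sigma> x \<in> ?F" if "x \<in> ?F" for x by (rule F.Gal_closed[OF \<sigma> that])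
  have hom: "\<tau> (u + v) = \<tau> u + \<tau> v \<and> \<tau> (u * v) = \<tau> u * \<tau> v" if uv: "u \<in> ?E" "v \<in> ?E" for u v
  proof -
    obtain x y where u: "u = x + y * w" "x \<in> ?F" "y \<in> ?F" using elim[OF uv(1)] by blast
    obtain x' y' where v: "v = x' + y' * w" "x' \<in> ?F" "y' \<in> ?F" using elim[OF uv(2)] by blast
    have s: "u + v = (x + x') + (y + y') * w" unfolding u v by (simp add: algebra_simps)
    have m: "u * v = (x * x' + y * y' * w ^ 2) + (x * y' + y * x') * w"
      unfolding u v by (simp add: algebra_simps power2_eq_square)
    have "\<tau> (u + v) = \<tau> u + \<tau> v"
      unfolding s ap[OF Fc(3)[OF u(2) v(2)] Fc(3)[OF u(3) v(3)]] unfolding u(1) v(1) ap[OF u(2,3)] ap[OF v(2,3)]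
      using u v by (simp add: F.Gal_add[OF \<sigma>] algebra_simps)
    moreover have "\<tau> (u * v) = \<tau> u * \<tau> v"
    proof -
      have c: "x * x' + y * y' * w ^ 2 \<in> ?F" "x * y' + y * x' \<in> ?F" using u v w Fc by simp_all
      have "\<tau> (u * v) = (\<sigma> x * \<sigma> x' + \<sigma> y * \<sigma> y' * w' ^ 2) + (\<sigma> x * \<sigma> y' + \<sigma> y * \<sigma> x') * w'"
        unfolding m ap[OF c] w'(2) using u v w Fc by (simp add: F.Gal_add[OF \<sigma>] F.Gal_mul[OF \<sigma>])
      then show ?thesis unfolding u(1) v(1) ap[OF u(2,3)] ap[OF v(2,3)]
        by (simp add: algebra_simps power2_eq_square)
    qed
    ultimately show ?thesis ..
  qed
  have cl: "\<tau> u \<in> ?E" if uE: "u \<in> ?E" for u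
  proof -
    obtain x y where u: "u = x + y * w" "x \<in> ?F" "y \<in> ?F" using elim[OF uE] by blast
    show ?thesis unfolding u(1) ap[OF u(2,3)] using sF u w'(1) FE
      by (intro csubfield_add[OF csubfield_gen] csubfield_mult[OF csubfield_gen]) auto
  qed
  have inj: "inj_on \<tau> ?E"
  proof (rule inj_onI)
    fix u v assume uv: "u \<in> ?E" "v \<in> ?E" "\<tau> u = \<tau> v"
    obtain x y where u: "u = x + y * w" "x \<in> ?F" "y \<in> ?F" using elim[OF uv(1)] by blast
    obtain x' y' where v: "v = x' + y' * w" "x' \<in> ?F" "y' \<in> ?F" using elim[OF uv(2)] by blast
    have "\<sigma> x + \<sigma> y * w' = \<sigma> x' + \<sigma> y' * w'" using uv(3) unfolding u(1) v(1) ap[OF u(2,3)] ap[OF v(2,3)] .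
    then have "\<sigma> x = \<sigma> x' \<and> \<sigma> y = \<sigma> y'" using uniq[OF sF sF sF sF _ w'F] u v by blast
    then have "x = x' \<and> y = y'" using F.Gal_inj[OF \<sigma>] u v by blast
    then show "u = v" unfolding u(1) v(1) by simp
  qed
  have surj: "\<exists>v\<in>?E. \<tau> v = u" if uE: "u \<in> ?E" for u
  proof -
    obtain x y where u: "u = x + y * w" "x \<in> ?F" "y \<in> ?F" using elim[OF uE] by blast
    obtain c d where cd: "w' = c + d * w" "c \<in> ?F" "d \<in> ?F" using elim[OF w'(1)] by blast
    have d: "d \<noteq> 0" using cd w'F by auto
    \<comment> \<open>u is rewritten in the basis 1, w', where d is nonzero because w' lies outside
      the small field; the two coefficients have preimages under \<sigma>.\<close>
    have eq: "u = (x - y / d * c) + (y / d) * w'" unfolding u(1) cd(1) using d by (simp add: field_simps)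
    have "x - y / d * c \<in> ?F" "y / d \<in> ?F"
      using u cd by (auto intro!: csubfield_diff[OF csubfield_gen] csubfield_mult[OF csubfield_gen] csubfield_divide[OF csubfield_gen])
    then have ims: "x - y / d * c \<in> \<sigma> ` ?F" "y / d \<in> \<sigma> ` ?F" unfolding im .
    obtain X where X: "x - y / d * c = \<sigma> X" "X \<in> ?F" by (rule imageE[OF ims(1)])
    obtain Y where Y: "y / d = \<sigma> Y" "Y \<in> ?F" by (rule imageE[OF ims(2)])
    have "\<tau> (X + Y * w) = u" unfolding ap[OF X(2) Y(2)] X(1)[symmetric] Y(1)[symmetric] by (rule eq[symmetric])
    then show ?thesis using EI[OF X(2) Y(2)] by (rule bexI)
  qed
  have "\<tau> \<in> carrier (Gal ?E \<rat>)"
    unfolding mem_Gal_iff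
  proof (intro conjI ballI)
    show "\<tau> \<in> extensional ?E" unfolding \<tau>_def by simp
    show "bij_betw \<tau> ?E ?E" unfolding bij_betw_def using inj cl surj by blast
    show "\<tau> 1 = 1" using apF[OF Fc(1)] F.Gal_1[OF \<sigma>] by simp
    fix x :: complex assume x: "x \<in> \<rat>"
    have "x \<in> ?F" by (rule subsetD[OF csubfield_Rats[OF csubfield_gen] x])
    then show "\<tau> x = x" using apF F.Gal_rat[OF \<sigma> x] by simp
  qed (use hom in auto)
  then show thesis using that apw apF by blast
qed

lemma sqrt_2_irrational:
  assumes z: "(z::complex) ^ 2 = 2"
  shows "z \<notin> \<rat>"
proof
  assume zQ: "z \<in> \<rat>"
  have "algebraic_int (of_int 2 :: complex)" by (rule algebraic_int_of_int)
  then have "algebraic_int (z ^ 2)" unfolding z by simp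
  then have "algebraic_int z" by (rule algebraic_int_power_root) simp
  then have "z \<in> \<int>" using zQ algebraic_int_rat by blast
  then obtain k where "z = of_int k" by (rule Ints_cases)
  then have "of_int (k ^ 2) = (of_int 2 :: complex)" using z by simp
  then have k: "k ^ 2 = 2" by (simp only: of_int_eq_iff)
  then have "even (k ^ 2)" by simp
  then obtain m where "k = 2 * m" by auto
  then have "2 * m ^ 2 = 1" using k by simp
  then have "even (1::int)" by (metis dvd_triv_left)
  then show False by simp
qed

lemma i_notin_real_gen:
  assumes z: "(z::complex) ^ 2 = 2"
  shows "\<i> \<notin> gen {z}"
proof
  have "z ^ 2 = (of_real (sqrt 2)) ^ 2" using z by (simp flip: of_real_power)
  then have "z = of_real (sqrt 2) \<or> z = - of_real (sqrt 2)" by (simp only: power2_eq_iff)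
  then have "z \<in> \<real>" by auto
  then have "gen {z} \<subseteq> \<real>" by (intro gen_least) (auto simp: csubfield_def)
  moreover assume "\<i> \<in> gen {z}"
  ultimately have "\<i> \<in> \<real>" by blast
  then show False by (simp add: complex_is_Real_iff)
qed

text \<open>\<open>s\<close> and \<open>t\<close> commute on this field, since they do so at \<i>
  and z. If r belonged to it, s r would be \<i> r up to sign and t r would be r up to sign, and t
  \<i> = - \<i> would make t(s r) the negative of s(t r).\<close>

lemma r_notin_gen:
  assumes z: "z = r ^ 2" "z ^ 2 = 2" and t: "t \<in> carrier (Gal (gen {\<i>, z}) \<rat>)" "t \<i> = - \<i>" "t z = z"
    and s: "s \<in> carrier (Gal (gen {\<i>, z}) \<rat>)" "s \<i> = \<i>" "s z = - z"
  shows "r \<notin> gen {\<i>, z}"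
proof
  assume r: "r \<in> gen {\<i>, z}"
  interpret F: number_field "gen {\<i>, z}" by unfold_locales (rule csubfield_gen)
  have mem: "\<i> \<in> gen {\<i>, z}" "z \<in> gen {\<i>, z}" by (auto intro: gen_incl)
  have ir: "\<i> * r \<in> gen {\<i>, z}" by (rule F.L_closed(4)[OF mem(1) r])
  have "(t r) ^ 2 = r ^ 2" using F.Gal_pow[OF t(1) r, of 2] t(3) unfolding z(1) by simp
  then have tr: "t r = r \<or> t r = - r" by (simp only: power2_eq_iff)
  have "(s r) ^ 2 = (\<i> * r) ^ 2" using F.Gal_pow[OF s(1) r, of 2] s(3) unfolding z(1) by (simp add: power_mult_distrib)
  then have sr: "s r = \<i> * r \<or> s r = - (\<i> * r)" by (simp only: power2_eq_iff)
  have "s \<otimes>\<^bsub>F.G\<^esub> t = t \<otimes>\<^bsub>F.G\<^esub> s"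
  proof (rule F.Gal_eqI[OF refl])
    show "s \<otimes>\<^bsub>F.G\<^esub> t \<in> carrier F.G" "t \<otimes>\<^bsub>F.G\<^esub> s \<in> carrier F.G" using s t by simp_all
    show "(s \<otimes>\<^bsub>F.G\<^esub> t) x = (t \<otimes>\<^bsub>F.G\<^esub> s) x" if "x \<in> {\<i>, z}" for x
      using that s t mem by (auto simp: F.Gal_comp F.Gal_uminus)
  qed
  then have "s (t r) = t (s r)" using F.Gal_comp[OF s(1) t(1) r] F.Gal_comp[OF t(1) s(1) r] by metis
  moreover have "t (\<i> * r) = - (\<i> * t r)" using F.Gal_mul[OF t(1) mem(1) r] t(2) by simp
  ultimately have "\<i> * r = - (\<i> * r)"
    using tr sr F.Gal_uminus[OF s(1) r] F.Gal_uminus[OF t(1) ir] by auto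
  then have "2 * (\<i> * r) = 0" by (simp only: eq_neg_iff_add_eq_0 mult_2)
  then have "r = 0" by simp
  then show False using z by simp
qed

lemma K_field_two:
  assumes "z ^ 2 = 2"
  shows "K_field 2 = gen {\<i>, z}"
proof -
  let ?w = "zeta 8"
  have w2: "?w ^ 2 = \<i>" using zeta_power_div[of 2 4] zeta_4 by simp
  have w0: "?w \<noteq> 0" by (rule zeta_nz)
  have z0: "z \<noteq> 0" using assms by auto
  have "(?w + inverse ?w) ^ 2 = ?w ^ 2 + 2 + inverse (?w ^ 2)"
    using w0 by (simp add: power2_eq_square field_simps)
  also have "\<dots> = z ^ 2" unfolding w2 assms by simp
  \<comment> \<open>z may be either square root of 2, so the sum of \<open>zeta 8\<close> and its
    inverse equals z only up to a sign.\<close>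
  finally obtain \<epsilon> where \<epsilon>: "\<epsilon> = 1 \<or> \<epsilon> = -1" "?w + inverse ?w = \<epsilon> * z"
    by (metis power2_eq_iff mult_1 mult_minus1)
  have "(?w + inverse ?w) * ?w = \<i> + 1" using w0 w2 by (simp add: algebra_simps power2_eq_square)
  then have "\<epsilon> * (z * ?w) = \<i> + 1" unfolding \<epsilon>(2) by (simp add: mult.assoc)
  then have "(\<epsilon> * \<epsilon>) * (z * ?w) = \<epsilon> * (\<i> + 1)" by (simp only: mult.assoc)
  moreover have "\<epsilon> * \<epsilon> = 1" using \<epsilon>(1) by auto
  ultimately have "z * ?w = \<epsilon> * (\<i> + 1)" by simp
  then have w: "?w = \<epsilon> * (\<i> + 1) / z" using z0 by (simp add: eq_divide_eq mult.commute)
  have z: "z = \<epsilon> * (?w + inverse ?w)" using \<epsilon> by auto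
  have \<epsilon>g: "\<epsilon> \<in> gen H" for H using \<epsilon>(1) csubfieldD[OF csubfield_gen[of H]] by auto
  have "gen {zeta 8} = gen {\<i>, z}"
  proof (rule gen_eqI)
    have wg: "?w \<in> gen {zeta 8}" by (rule gen_incl) simp
    have "\<i> \<in> gen {zeta 8}" unfolding w2[symmetric] by (intro csubfield_power[OF csubfield_gen] wg)
    moreover have "\<epsilon> * (?w + inverse ?w) \<in> gen {zeta 8}"
      using wg \<epsilon>g csubfieldD[OF csubfield_gen[of "{zeta 8}"]] by simp
    ultimately show "{\<i>, z} \<subseteq> gen {zeta 8}" unfolding z[symmetric] by simp
    have "\<i> \<in> gen {\<i>, z}" "z \<in> gen {\<i>, z}" by (auto intro: gen_incl)
    then have "\<epsilon> * (\<i> + 1) / z \<in> gen {\<i>, z}"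
      using \<epsilon>g[of "{\<i>, z}"] csubfieldD[OF csubfield_gen[of "{\<i>, z}"]] csubfield_divide[OF csubfield_gen] by simp
    then show "{zeta 8} \<subseteq> gen {\<i>, z}" unfolding w[symmetric] by simp
  qed
  then show ?thesis unfolding K_field_def by simp
qed

text \<open>The automorphisms are extended along Q, Q(z), Q(\<i>, z) and L. The last step needs that
  r is not in Q(\<i>, z), which is derived from the automorphisms already built on that
  field.\<close>

lemma two_quartic_Kt_field:
  assumes r: "r ^ 4 = 2"
  obtains t s e where "two_quartic (Kt_field 2 r) r (r ^ 2) t s e (K_field 2) (gen {r ^ 2})"
proof -
  define z where "z = r ^ 2"
  have z2: "z ^ 2 = 2" unfolding z_def r[symmetric] by (simp flip: power_mult)
  have z0: "z \<noteq> 0" and r0: "r \<noteq> 0" using z2 z_def by auto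
  note K = K_field_two[OF z2]
  have L: "Kt_field 2 r = gen {r, \<i>, z}" unfolding Kt_field_def K gen_insert_gen ..
  have one: "\<one>\<^bsub>Gal (gen H) \<rat>\<^esub> \<in> carrier (Gal (gen H) \<rat>)" for H
    using group.is_monoid[OF Gal_group[OF csubfield_gen csubfield_Rats[OF csubfield_gen]]] by (rule monoid.one_closed)
  have one_ap: "\<one>\<^bsub>Gal (gen H) \<rat>\<^esub> x = x" if "x \<in> gen H" for H x
    using that unfolding Gal_one by simp
  have mono: "x \<in> gen H \<Longrightarrow> x \<in> gen (insert y H)" for x y H
    by (rule subsetD[OF gen_mono]) (auto intro: gen_incl)
  have incl: "x \<in> gen (insert x H)" for x H by (rule gen_incl) simp
  have neg: "- x \<in> gen H" if "x \<in> gen H" for x H by (rule csubfield_uminus[OF csubfield_gen that])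
  have rat: "x \<in> gen H" if "x \<in> \<rat>" for x H using csubfield_Rats[OF csubfield_gen] that by blast
  have zQ: "z \<notin> gen {}" unfolding gen_empty by (rule sqrt_2_irrational[OF z2])
  have iF: "\<i> \<notin> gen {z}" by (rule i_notin_real_gen[OF z2])
  have two: "(2::complex) \<in> gen H" for H by (rule rat) simp
  obtain s1 where s1: "s1 \<in> carrier (Gal (gen {z}) \<rat>)" "s1 z = - z"
    by (rule Gal_extend_quadratic[OF one[of "{}"], of z "- z"])
      (use zQ two neg[OF incl] one_ap in \<open>auto simp: z2\<close>)
  have m1: "-1 \<in> gen {z}" by (rule rat) simp
  obtain s2 where s2: "s2 \<in> carrier (Gal (gen {\<i>, z}) \<rat>)" "s2 \<i> = \<i>" "\<And>x. x \<in> gen {z} \<Longrightarrow> s2 x = s1 x"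
  proof (rule Gal_extend_quadratic[OF s1(1), of \<i> \<i>])
    have "s1 (-1) = -1" using s1(1) unfolding mem_Gal_iff by simp
    then show "\<i> ^ 2 = s1 (\<i> ^ 2)" by simp
  qed (use iF m1 incl in auto)
  obtain t2 where t2: "t2 \<in> carrier (Gal (gen {\<i>, z}) \<rat>)" "t2 \<i> = - \<i>" "\<And>x. x \<in> gen {z} \<Longrightarrow> t2 x = x"
  proof (rule Gal_extend_quadratic[OF one[of "{z}"], of \<i> "- \<i>"])
    show "(- \<i>) ^ 2 = \<one>\<^bsub>Gal (gen {z}) \<rat>\<^esub> (\<i> ^ 2)" using one_ap[OF m1] by simp
  qed (use iF m1 neg[OF incl] one_ap in auto)
  have s2z: "s2 z = - z" using s2(3)[OF incl] s1(2) by simp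
  have t2z: "t2 z = z" using t2(3)[OF incl] by simp
  have rF: "r \<notin> gen {\<i>, z}" by (rule r_notin_gen[OF z_def z2 t2(1,2) t2z s2(1,2) s2z])
  have zF: "z \<in> gen {\<i>, z}" by (rule mono[OF incl])
  have r2F: "r ^ 2 \<in> gen {\<i>, z}" using zF z_def by simp
  have iE: "\<i> \<in> gen {r, \<i>, z}" and rE: "r \<in> gen {r, \<i>, z}" by (auto intro: gen_incl)
  have irE: "\<i> * r \<in> gen {r, \<i>, z}" by (rule csubfield_mult[OF csubfield_gen iE rE])
  have iF2: "\<i> \<in> gen {\<i>, z}" by (rule incl)
  obtain t where t: "t \<in> carrier (Gal (gen {r, \<i>, z}) \<rat>)" "t r = r" "\<And>x. x \<in> gen {\<i>, z} \<Longrightarrow> t x = t2 x"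
    by (rule Gal_extend_quadratic[OF t2(1) r2F rF, of r]) (use rE t2z z_def in auto)
  \<comment> \<open>The image is admissible because (\<i> r)^2 = -z is the image of r^2 = z.\<close>
  obtain s where s: "s \<in> carrier (Gal (gen {r, \<i>, z}) \<rat>)" "s r = \<i> * r" "\<And>x. x \<in> gen {\<i>, z} \<Longrightarrow> s x = s2 x"
    by (rule Gal_extend_quadratic[OF s2(1) r2F rF, of "\<i> * r"])
      (use irE s2z z_def in \<open>auto simp: power_mult_distrib\<close>)
  obtain e where e: "e \<in> carrier (Gal (gen {r, \<i>, z}) \<rat>)" "e r = - r" "\<And>x. x \<in> gen {\<i>, z} \<Longrightarrow> e x = x"
    by (rule Gal_extend_quadratic[OF one r2F rF, of "- r"])
      (use neg[OF rE] one_ap r2F in auto)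
  interpret number_field "gen {r, \<i>, z}" by unfold_locales (rule csubfield_gen)
  have zL: "z \<in> gen {r, \<i>, z}" by (rule mono[OF zF])
  have sz: "s z = - z" using s(3)[OF zF] s2z by simp
  have s_pow: "(s [^]\<^bsub>G\<^esub> (b::nat)) z = (-1) ^ b * z" for b by (rule pow_apply_neg[OF s(1) zL sz])
  have "two_quartic (gen {r, \<i>, z}) r z t s e (gen {\<i>, z}) (gen {z})"
  proof unfold_locales
    show "gen {r, \<i>, z} = gen {\<i>, z, r}" by (simp add: insert_commute)
    show "t \<in> carrier G" "s \<in> carrier G" "e \<in> carrier G" by (fact t s e)+
    show "t \<i> = - \<i>" "t z = z" using t(3)[OF iF2] t(3)[OF zF] t2 t2z by simp_all
    show "s \<i> = \<i>" using s(3)[OF iF2] s2 by simp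
    show "s z \<in> gen {z}" unfolding sz by (rule neg[OF incl])
    show "e \<i> = \<i>" "e z = z" "e r = - r" using e iF2 zF by simp_all
    show "r ^ 2 \<in> gen {z}" unfolding z_def[symmetric] by (rule incl)
    show "s (r ^ 2) = - (r ^ 2)" using sz unfolding z_def .
    show "(s [^]\<^bsub>G\<^esub> (2::nat)) z = z" unfolding s_pow by simp
    show "\<exists>b::nat. \<sigma> z = (s [^]\<^bsub>G\<^esub> b) z" if "\<sigma> \<in> carrier G" for \<sigma>
    proof -
      have "(\<sigma> z) ^ 2 = z ^ 2" using Gal_pow[OF that zL, of 2] Gal_rat[OF that, of 2] z2 by simp
      then have "\<sigma> z = z \<or> \<sigma> z = - z" by (simp only: power2_eq_iff)
      then show ?thesis unfolding s_pow by (metis power_0 power_one_right mult_1 mult_minus1)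
    qed
    show "2 dvd b" if "(s [^]\<^bsub>G\<^esub> (b::nat)) z = z" for b
      using that z0 unfolding s_pow by (cases "even b") auto
    show "r \<noteq> 0" "z = r ^ 2" "r ^ 4 = 2" by (fact r0 z_def r)+
  qed (auto)
  then show thesis using that unfolding L K z_def by blast
qed

theorem theorem5p1:
  fixes q :: nat and r :: complex
  assumes q: "prime q" and r: "r ^ 4 = of_int (qstar q)"
  shows
    "(q = 2 \<longrightarrow>
       (\<exists>\<rho>. irreducible_rep (Gt q r) 2 \<rho> \<and>
         (\<forall>n \<phi>. irreducible_rep (Gt q r) n \<phi> \<and> n > 1 \<longrightarrow> rep_iso (Gt q r) n \<phi> 2 \<rho>)) \<and>
       (\<forall>\<rho> s. irreducible_rep (Gt q r) 2 \<rho> \<and> Re s > 1 \<longrightarrow>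
         (let A\<^sub>1 = {l. prime l \<and> l mod 8 \<in> {3, 7}};
              f\<^sub>1 = (\<lambda>l. inverse (1 - of_nat l powr (- 2 * s)));
              A\<^sub>2 = {l. prime l \<and> l mod 8 = 5};
              f\<^sub>2 = (\<lambda>l. inverse (1 + of_nat l powr (- 2 * s)));
              A\<^sub>3 = P0;
              f\<^sub>3 = (\<lambda>l. inverse ((1 - of_nat l powr (- s)) ^ 2));
              A\<^sub>4 = {l. prime l \<and> l mod 8 = 1 \<and> l \<notin> P0};
              f\<^sub>4 = (\<lambda>l. inverse ((1 + of_nat l powr (- s)) ^ 2))
          in artin_L_converges (Kt_field q r) 2 \<rho> s \<and>
             prime_prod_converges A\<^sub>1 f\<^sub>1 \<and> prime_prod_converges A\<^sub>2 f\<^sub>2 \<and>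
             prime_prod_converges A\<^sub>3 f\<^sub>3 \<and> prime_prod_converges A\<^sub>4 f\<^sub>4 \<and>
             artin_L (Kt_field q r) 2 \<rho> s =
               prime_prod A\<^sub>1 f\<^sub>1 * prime_prod A\<^sub>2 f\<^sub>2 * prime_prod A\<^sub>3 f\<^sub>3 * prime_prod A\<^sub>4 f\<^sub>4))) \<and>
     (odd q \<longrightarrow>
       (\<forall>g \<epsilon> \<sigma>\<^sub>1 \<sigma>\<^sub>q t\<^sub>1 t\<^sub>q b \<alpha>.
         residue_primroot q g \<and>
         \<epsilon> \<in> carrier (Gal (Kt_field q r) (K_field q)) \<and> \<epsilon> \<noteq> one (Gal (Kt_field q r) (K_field q)) \<and>
         \<sigma>\<^sub>1 \<in> carrier (Gal (K_field q) \<rat>) \<and> \<sigma>\<^sub>1 (zeta 4) = inverse (zeta 4) \<and> \<sigma>\<^sub>1 (zeta q) = zeta q \<and>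
         \<sigma>\<^sub>q \<in> carrier (Gal (K_field q) \<rat>) \<and> \<sigma>\<^sub>q (zeta 4) = zeta 4 \<and> \<sigma>\<^sub>q (zeta q) = zeta q ^ g \<and>
         t\<^sub>1 \<in> carrier (Gt q r) \<and> (\<forall>x\<in>K_field q. t\<^sub>1 x = \<sigma>\<^sub>1 x) \<and>
         t\<^sub>q \<in> carrier (Gt q r) \<and> (\<forall>x\<in>K_field q. t\<^sub>q x = \<sigma>\<^sub>q x) \<and>
         (\<forall>l. prime l \<and> l \<noteq> q \<longrightarrow> is_index q g l (b l)) \<and>
         (Legendre 2 (int q) = 1 \<and> q mod 4 = 3 \<longrightarrow> b 2 mod 4 = 2) \<and>
         (\<forall>l. prime l \<and> l \<noteq> q \<and> l mod 4 = 1 \<and> even (b l) \<longrightarrow>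
            [\<alpha> l ^ 2 = qstar q] (mod int l)) \<longrightarrow>
         (\<forall>j\<in>J_set q.
            (\<exists>\<rho>. is_rho (Gt q r) q t\<^sub>1 t\<^sub>q \<epsilon> j \<rho>) \<and>
            (\<forall>\<rho> \<rho>'. is_rho (Gt q r) q t\<^sub>1 t\<^sub>q \<epsilon> j \<rho> \<and> is_rho (Gt q r) q t\<^sub>1 t\<^sub>q \<epsilon> j \<rho>' \<longrightarrow>
               (\<forall>x\<in>carrier (Gt q r). \<rho> x = \<rho>' x))) \<and>
         (\<forall>n \<phi>. irreducible_rep (Gt q r) n \<phi> \<and> n > 1 \<longrightarrow>
            (\<exists>j\<in>J_set q. \<exists>\<rho>. is_rho (Gt q r) q t\<^sub>1 t\<^sub>q \<epsilon> j \<rho> \<and> rep_iso (Gt q r) n \<phi> 2 \<rho>)) \<and>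
         (\<forall>j\<in>J_set q. \<forall>\<rho> s. is_rho (Gt q r) q t\<^sub>1 t\<^sub>q \<epsilon> j \<rho> \<and> Re s > 1 \<longrightarrow>
           (let A\<^sub>1 = {l. prime l \<and> odd l \<and> l \<noteq> q \<and>
                       (l mod 4 = 1 \<and> odd (b l) \<or> l mod 4 = 3 \<and> even (b l))};
                f\<^sub>1 = (\<lambda>l. inverse (1 - zeta (q - 1) powi (int j * b l) * of_nat l powr (- 2 * s)));
                A\<^sub>2 = {l. prime l \<and> odd l \<and> l \<noteq> q \<and> l mod 4 = 3 \<and> odd (b l)};
                f\<^sub>2 = (\<lambda>l. inverse (1 + zeta (q - 1) powi (int j * b l) * of_nat l powr (- 2 * s)));
                A\<^sub>3 = {l. prime l \<and> odd l \<and> l \<noteq> q \<and> l mod 4 = 1 \<and> even (b l)};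
                f\<^sub>3 = (\<lambda>l. inverse ((1 - u_sign \<alpha> b l * zeta (2 * (q - 1)) powi (int j * b l)
                                    * of_nat l powr (- s)) ^ 2))
            in artin_L_converges (Kt_field q r) 2 \<rho> s \<and>
               prime_prod_converges A\<^sub>1 f\<^sub>1 \<and> prime_prod_converges A\<^sub>2 f\<^sub>2 \<and>
               prime_prod_converges A\<^sub>3 f\<^sub>3 \<and>
               artin_L (Kt_field q r) 2 \<rho> s = E_2 q j b s * E_q q j s *
                 prime_prod A\<^sub>1 f\<^sub>1 * prime_prod A\<^sub>2 f\<^sub>2 * prime_prod A\<^sub>3 f\<^sub>3))))"
proof (intro conjI impI)
  assume q2: "q = 2"
  have r4: "r ^ 4 = 2" using r q2 unfolding qstar_def by simp
  obtain t s e where "two_quartic (Kt_field 2 r) r (r ^ 2) t s e (K_field 2) (gen {r ^ 2})"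
    by (rule two_quartic_Kt_field[OF r4])
  then interpret two_quartic "Kt_field 2 r" r "r ^ 2" t s e "K_field 2" "gen {r ^ 2}" .
  show "\<exists>\<rho>. irreducible_rep (Gt q r) 2 \<rho> \<and>
      (\<forall>n \<phi>. irreducible_rep (Gt q r) n \<phi> \<and> n > 1 \<longrightarrow> rep_iso (Gt q r) n \<phi> 2 \<rho>)"
    unfolding q2 using irreducible_unique by metis
  show "\<forall>\<rho> s. irreducible_rep (Gt q r) 2 \<rho> \<and> Re s > 1 \<longrightarrow>
    (let A\<^sub>1 = {l. prime l \<and> l mod 8 \<in> {3, 7}};
              f\<^sub>1 = (\<lambda>l. inverse (1 - of_nat l powr (- 2 * s)));
              A\<^sub>2 = {l. prime l \<and> l mod 8 = 5};
              f\<^sub>2 = (\<lambda>l. inverse (1 + of_nat l powr (- 2 * s)));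
              A\<^sub>3 = P0;
              f\<^sub>3 = (\<lambda>l. inverse ((1 - of_nat l powr (- s)) ^ 2));
              A\<^sub>4 = {l. prime l \<and> l mod 8 = 1 \<and> l \<notin> P0};
              f\<^sub>4 = (\<lambda>l. inverse ((1 + of_nat l powr (- s)) ^ 2))
          in artin_L_converges (Kt_field q r) 2 \<rho> s \<and>
             prime_prod_converges A\<^sub>1 f\<^sub>1 \<and> prime_prod_converges A\<^sub>2 f\<^sub>2 \<and>
             prime_prod_converges A\<^sub>3 f\<^sub>3 \<and> prime_prod_converges A\<^sub>4 f\<^sub>4 \<and>
             artin_L (Kt_field q r) 2 \<rho> s =
               prime_prod A\<^sub>1 f\<^sub>1 * prime_prod A\<^sub>2 f\<^sub>2 * prime_prod A\<^sub>3 f\<^sub>3 * prime_prod A\<^sub>4 f\<^sub>4)"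
    unfolding q2 Let_def by (intro allI impI, elim conjE) (rule artin_L_irreducible)
next
  assume q2: "odd q"
  show "(\<forall>g \<epsilon> \<sigma>\<^sub>1 \<sigma>\<^sub>q t\<^sub>1 t\<^sub>q b \<alpha>.
         residue_primroot q g \<and>
         \<epsilon> \<in> carrier (Gal (Kt_field q r) (K_field q)) \<and> \<epsilon> \<noteq> one (Gal (Kt_field q r) (K_field q)) \<and>
         \<sigma>\<^sub>1 \<in> carrier (Gal (K_field q) \<rat>) \<and> \<sigma>\<^sub>1 (zeta 4) = inverse (zeta 4) \<and> \<sigma>\<^sub>1 (zeta q) = zeta q \<and>
         \<sigma>\<^sub>q \<in> carrier (Gal (K_field q) \<rat>) \<and> \<sigma>\<^sub>q (zeta 4) = zeta 4 \<and> \<sigma>\<^sub>q (zeta q) = zeta q ^ g \<and>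
         t\<^sub>1 \<in> carrier (Gt q r) \<and> (\<forall>x\<in>K_field q. t\<^sub>1 x = \<sigma>\<^sub>1 x) \<and>
         t\<^sub>q \<in> carrier (Gt q r) \<and> (\<forall>x\<in>K_field q. t\<^sub>q x = \<sigma>\<^sub>q x) \<and>
         (\<forall>l. prime l \<and> l \<noteq> q \<longrightarrow> is_index q g l (b l)) \<and>
         (Legendre 2 (int q) = 1 \<and> q mod 4 = 3 \<longrightarrow> b 2 mod 4 = 2) \<and>
         (\<forall>l. prime l \<and> l \<noteq> q \<and> l mod 4 = 1 \<and> even (b l) \<longrightarrow>
            [\<alpha> l ^ 2 = qstar q] (mod int l)) \<longrightarrow>
         (\<forall>j\<in>J_set q.
            (\<exists>\<rho>. is_rho (Gt q r) q t\<^sub>1 t\<^sub>q \<epsilon> j \<rho>) \<and>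
            (\<forall>\<rho> \<rho>'. is_rho (Gt q r) q t\<^sub>1 t\<^sub>q \<epsilon> j \<rho> \<and> is_rho (Gt q r) q t\<^sub>1 t\<^sub>q \<epsilon> j \<rho>' \<longrightarrow>
               (\<forall>x\<in>carrier (Gt q r). \<rho> x = \<rho>' x))) \<and>
         (\<forall>n \<phi>. irreducible_rep (Gt q r) n \<phi> \<and> n > 1 \<longrightarrow>
            (\<exists>j\<in>J_set q. \<exists>\<rho>. is_rho (Gt q r) q t\<^sub>1 t\<^sub>q \<epsilon> j \<rho> \<and> rep_iso (Gt q r) n \<phi> 2 \<rho>)) \<and>
         (\<forall>j\<in>J_set q. \<forall>\<rho> s. is_rho (Gt q r) q t\<^sub>1 t\<^sub>q \<epsilon> j \<rho> \<and> Re s > 1 \<longrightarrow>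
           (let A\<^sub>1 = {l. prime l \<and> odd l \<and> l \<noteq> q \<and>
                       (l mod 4 = 1 \<and> odd (b l) \<or> l mod 4 = 3 \<and> even (b l))};
                f\<^sub>1 = (\<lambda>l. inverse (1 - zeta (q - 1) powi (int j * b l) * of_nat l powr (- 2 * s)));
                A\<^sub>2 = {l. prime l \<and> odd l \<and> l \<noteq> q \<and> l mod 4 = 3 \<and> odd (b l)};
                f\<^sub>2 = (\<lambda>l. inverse (1 + zeta (q - 1) powi (int j * b l) * of_nat l powr (- 2 * s)));
                A\<^sub>3 = {l. prime l \<and> odd l \<and> l \<noteq> q \<and> l mod 4 = 1 \<and> even (b l)};
                f\<^sub>3 = (\<lambda>l. inverse ((1 - u_sign \<alpha> b l * zeta (2 * (q - 1)) powi (int j * b l)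
                                    * of_nat l powr (- s)) ^ 2))
            in artin_L_converges (Kt_field q r) 2 \<rho> s \<and>
               prime_prod_converges A\<^sub>1 f\<^sub>1 \<and> prime_prod_converges A\<^sub>2 f\<^sub>2 \<and>
               prime_prod_converges A\<^sub>3 f\<^sub>3 \<and>
               artin_L (Kt_field q r) 2 \<rho> s = E_2 q j b s * E_q q j s *
                 prime_prod A\<^sub>1 f\<^sub>1 * prime_prod A\<^sub>2 f\<^sub>2 * prime_prod A\<^sub>3 f\<^sub>3)))"
  proof (intro allI impI, elim conjE, goal_cases)
    case (1 g \<epsilon> \<sigma>\<^sub>1 \<sigma>\<^sub>q t\<^sub>1 t\<^sub>q b \<alpha>)
    interpret odd_quartic "Kt_field q r" q g t\<^sub>q r t\<^sub>1 \<epsilon> "K_field q" "gen {zeta q}"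
      by (rule odd_quartic_Kt_field[of q r g \<epsilon> \<sigma>\<^sub>1 \<sigma>\<^sub>q]) (use 1 q q2 r in auto)
    have bl: "is_index q g l (b l)" if "prime l" "l \<noteq> q" for l using 1 that by blast
    have b4: "Legendre 2 (int q) = 1 \<and> q mod 4 = 3 \<longrightarrow> b 2 mod 4 = 2" by (rule 1)
    have al: "[\<alpha> l ^ 2 = qstar q] (mod int l)" if "prime l" "l \<noteq> q" "l mod 4 = 1" "even (b l)" for l
      using 1 that by blast
    show ?case
    proof (intro conjI ballI)
      fix j assume j: "j \<in> J_set q"
      obtain \<rho> where "standard_rep (zeta (q - 1) ^ j) \<rho>"
        by (rule standard_rep_exists[of "zeta (q - 1) ^ j"]) (use j zeta_pow_half J_set_iff in simp)
      then show "\<exists>\<rho>. is_rho (Gt q r) q t\<^sub>1 t\<^sub>q \<epsilon> j \<rho>" unfolding is_rho_iff by blast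
      show "\<forall>\<rho> \<rho>'. is_rho (Gt q r) q t\<^sub>1 t\<^sub>q \<epsilon> j \<rho> \<and> is_rho (Gt q r) q t\<^sub>1 t\<^sub>q \<epsilon> j \<rho>' \<longrightarrow>
          (\<forall>x\<in>carrier (Gt q r). \<rho> x = \<rho>' x)"
        unfolding is_rho_iff by (intro allI impI, elim conjE) (rule standard_rep_unique)
      show "\<forall>\<rho> s. is_rho (Gt q r) q t\<^sub>1 t\<^sub>q \<epsilon> j \<rho> \<and> Re s > 1 \<longrightarrow>
          (let A\<^sub>1 = {l. prime l \<and> odd l \<and> l \<noteq> q \<and>
                       (l mod 4 = 1 \<and> odd (b l) \<or> l mod 4 = 3 \<and> even (b l))};
                f\<^sub>1 = (\<lambda>l. inverse (1 - zeta (q - 1) powi (int j * b l) * of_nat l powr (- 2 * s)));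
                A\<^sub>2 = {l. prime l \<and> odd l \<and> l \<noteq> q \<and> l mod 4 = 3 \<and> odd (b l)};
                f\<^sub>2 = (\<lambda>l. inverse (1 + zeta (q - 1) powi (int j * b l) * of_nat l powr (- 2 * s)));
                A\<^sub>3 = {l. prime l \<and> odd l \<and> l \<noteq> q \<and> l mod 4 = 1 \<and> even (b l)};
                f\<^sub>3 = (\<lambda>l. inverse ((1 - u_sign \<alpha> b l * zeta (2 * (q - 1)) powi (int j * b l)
                                    * of_nat l powr (- s)) ^ 2))
            in artin_L_converges (Kt_field q r) 2 \<rho> s \<and>
               prime_prod_converges A\<^sub>1 f\<^sub>1 \<and> prime_prod_converges A\<^sub>2 f\<^sub>2 \<and>
               prime_prod_converges A\<^sub>3 f\<^sub>3 \<and>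
               artin_L (Kt_field q r) 2 \<rho> s = E_2 q j b s * E_q q j s *
                 prime_prod A\<^sub>1 f\<^sub>1 * prime_prod A\<^sub>2 f\<^sub>2 * prime_prod A\<^sub>3 f\<^sub>3)"
      proof (intro allI impI)
        fix \<rho> w assume "is_rho (Gt q r) q t\<^sub>1 t\<^sub>q \<epsilon> j \<rho> \<and> Re w > 1"
        then have \<rho>: "standard_rep (zeta (q - 1) ^ j) \<rho>" and w: "Re w > 1" unfolding is_rho_iff by auto
        show "(let A\<^sub>1 = {l. prime l \<and> odd l \<and> l \<noteq> q \<and>
                       (l mod 4 = 1 \<and> odd (b l) \<or> l mod 4 = 3 \<and> even (b l))};
                f\<^sub>1 = (\<lambda>l. inverse (1 - zeta (q - 1) powi (int j * b l) * of_nat l powr (- 2 * w)));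
                A\<^sub>2 = {l. prime l \<and> odd l \<and> l \<noteq> q \<and> l mod 4 = 3 \<and> odd (b l)};
                f\<^sub>2 = (\<lambda>l. inverse (1 + zeta (q - 1) powi (int j * b l) * of_nat l powr (- 2 * w)));
                A\<^sub>3 = {l. prime l \<and> odd l \<and> l \<noteq> q \<and> l mod 4 = 1 \<and> even (b l)};
                f\<^sub>3 = (\<lambda>l. inverse ((1 - u_sign \<alpha> b l * zeta (2 * (q - 1)) powi (int j * b l)
                                    * of_nat l powr (- w)) ^ 2))
            in artin_L_converges (Kt_field q r) 2 \<rho> w \<and>
               prime_prod_converges A\<^sub>1 f\<^sub>1 \<and> prime_prod_converges A\<^sub>2 f\<^sub>2 \<and>
               prime_prod_converges A\<^sub>3 f\<^sub>3 \<and>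
               artin_L (Kt_field q r) 2 \<rho> w = E_2 q j b w * E_q q j w *
                 prime_prod A\<^sub>1 f\<^sub>1 * prime_prod A\<^sub>2 f\<^sub>2 * prime_prod A\<^sub>3 f\<^sub>3)"
          unfolding Let_def by (rule artin_L_standard_rep[where b = b and \<alpha> = \<alpha>, OF j \<rho> w bl b4 al])
      qed
    next
      show "\<forall>n \<phi>. irreducible_rep (Gt q r) n \<phi> \<and> n > 1 \<longrightarrow>
          (\<exists>j\<in>J_set q. \<exists>\<rho>. is_rho (Gt q r) q t\<^sub>1 t\<^sub>q \<epsilon> j \<rho> \<and> rep_iso (Gt q r) n \<phi> 2 \<rho>)"
      proof (intro allI impI)
        fix n \<phi> assume irr: "irreducible_rep (Gt q r) n \<phi> \<and> n > 1"
        obtain c \<rho> where "n = 2" and c: "c ^ ((q - 1) div 2) = (-1) ^ ((q - 1) div 2)" "standard_rep c \<rho>"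
            "rep_iso (Gt q r) n \<phi> 2 \<rho>"
          by (rule irreducible_classification[OF conjunct1[OF irr] conjunct2[OF irr]])
        obtain j where "j \<in> J_set q" "c = zeta (q - 1) ^ j" by (rule J_set_exists[OF c(1)])
        then show "\<exists>j\<in>J_set q. \<exists>\<rho>. is_rho (Gt q r) q t\<^sub>1 t\<^sub>q \<epsilon> j \<rho> \<and> rep_iso (Gt q r) n \<phi> 2 \<rho>"
          using c unfolding is_rho_iff by blast
      qed
    qed
  qed
qed

end
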